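(* Let $M\cong\mathbb{Z}^n$, let $N=\operatorname{Hom}_{\mathbb{Z}}(M,\mathbb{Z})$, let $\sigma\subset M_{\mathbb{R}}=M\otimes_{\mathbb{Z}}\mathbb{R}$ be a strictly convex rational polyhedral cone with dual cone $\check\sigma\subset N_{\mathbb{R}}=N\otimes_{\mathbb{Z}}\mathbb{R}$, and let $X=\operatorname{Spec}\mathbb{C}[\check\sigma\cap N]$ be the associated affine toric variety, regarded as a complex analytic space. Let $D\subset X$ be the toric boundary divisor and endow $X$ with the divisorial log structure $\mathcal{M}_{(X,D)}$. Then there is a homeomorphism $$X^{KN}\cong \check\sigma\times T^n,$$ where $X^{KN}$ is the Kato--Nakayama space of $(X,\mathcal{M}_{(X,D)})$ and $T^n=(S^1)^n$ denotes the compact $n$-torus.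
   Context: All monoids are commutative. The dual cone is $\check\sigma=\{u\in N_{\mathbb{R}} : \langle u,m\rangle\ge0\text{ for all } m\in\sigma\}$. The toric boundary divisor $D$ is the complement of the big torus in $X$. Log structures. A log structure on an analytic space $X$ is a sheaf of monoids $\mathcal{M}_X$ with a homomorphism of sheaves of monoids $\alpha\colon\mathcal{M}_X\to(\mathcal{O}_X,\cdot)$ inducing an isomorphism $\alpha^{-1}(\mathcal{O}_X^\times)\to\mathcal{O}_X^\times$; via this isomorphism $\mathcal{O}_X^\times$ is regarded as a subsheaf of $\mathcal{M}_X$. The divisorial log structure of a pair $(X,D)$, with $j\colon X\setminus D\to X$ the inclusion, is $\mathcal{M}_{(X,D)}=j_*(\mathcal{O}_{X\setminus D}^\times)\cap\mathcal{O}_X$, the sheaf of functions on $X$ that are invertible on $X\setminus D$, with $\alpha$ the inclusion into $\mathcal{O}_X$. Kato--Nakayama space. For a log analytic space $(X,\mathcal{M}_X)$, with $\mathcal{M}^{gp}_{X,x}$ the Grothendieck group of the stalk $\mathcal{M}_{X,x}$ and $S^1=\{z\in\mathbb{C}:|z|=1\}$, $$X^{KN}=\Big\{(x,\phi)\ \Big|\ x\in X,\ \phi\in\operatorname{Hom}(\mathcal{M}^{gp}_{X,x},S^1),\ \phi(h)=\tfrac{h(x)}{|h(x)|}\text{ for all } h\in\mathcal{O}_{X,x}^\times\Big\}.$$ It carries the weakest topology making continuous the projection $\tau_X\colon X^{KN}\to X$, $(x,\phi)\mapsto x$, and, for every open $U\subset X$ and every section $m$ of $\mathcal{M}_X$ over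 $U$, the function $\arg(m)\colon\tau_X^{-1}(U)\to S^1$, $(x,\phi)\mapsto\phi(m_x)$. *)

theory Defs
  imports
    "HOL-Analysis.Analysis"
    "HOL-Algebra.Group"
    "HOL-Library.Poly_Mapping"
begin

section \<open>Cones and lattices\<close>

text \<open>
  A basis of \<open>M\<close> identifies \<open>M\<close> with \<open>int ^ 'n\<close> and \<open>M \<otimes> \<real>\<close> with \<open>real ^ 'n\<close>.
  The dual lattice \<open>N\<close> and \<open>N \<otimes> \<real>\<close> are written in the dual basis, so that they are again
  \<open>int ^ 'n\<close> and \<open>real ^ 'n\<close>, and the pairing of \<open>N \<otimes> \<real>\<close> with \<open>M \<otimes> \<real>\<close> is \<open>(\<bullet>)\<close>.
\<close>

definition real_vec :: "int ^ 'n \<Rightarrow> real ^ 'n" where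
  "real_vec m = (\<chi> i. real_of_int (m $ i))"

definition rational_polyhedral_cone :: "(real ^ 'n::finite) set \<Rightarrow> bool" where
  "rational_polyhedral_cone \<sigma> \<longleftrightarrow>
     (\<exists>G :: (int ^ 'n) set. finite G \<and> \<sigma> = convex_cone hull (real_vec ` G))"

definition strictly_convex :: "(real ^ 'n::finite) set \<Rightarrow> bool" where
  "strictly_convex \<sigma> \<longleftrightarrow> \<sigma> \<inter> uminus ` \<sigma> = {0}"

definition dual_cone :: "(real ^ 'n::finite) set \<Rightarrow> (real ^ 'n) set" where
  "dual_cone \<sigma> = {u. \<forall>m\<in>\<sigma>. u \<bullet> m \<ge> 0}"

definition dual_monoid :: "(real ^ 'n::finite) set \<Rightarrow> (int ^ 'n) set" where
  "dual_monoid \<sigma> = {u. real_vec u \<in> dual_cone \<sigma>}"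

section \<open>The affine toric variety as a complex analytic space\<close>

text \<open>
  \<open>(int ^ 'n) \<Rightarrow>\<^sub>0 complex\<close> with convolution product is the group algebra of \<open>N\<close>;
  \<open>Poly_Mapping.single u 1\<close> is the monomial with exponent \<open>u\<close>.
\<close>

definition monoid_algebra :: "(int ^ 'n::finite) set \<Rightarrow> ((int ^ 'n) \<Rightarrow>\<^sub>0 complex) set" where
  "monoid_algebra S = {f. Poly_Mapping.keys f \<subseteq> S}"

type_synonym 'n point = "((int ^ 'n) \<Rightarrow>\<^sub>0 complex) \<Rightarrow> complex"

text \<open>
  The complex points of \<open>Spec A\<close>: the \<open>\<complex>\<close>-algebra homomorphisms \<open>A \<rightarrow> \<complex>\<close>, made
  \<^const>\<open>undefined\<close> outside \<open>A\<close> so that they are determined by their values on \<open>A\<close>.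
\<close>

definition complex_points :: "((int ^ 'n::finite) \<Rightarrow>\<^sub>0 complex) set \<Rightarrow> 'n point set" where
  "complex_points A = {x \<in> extensional A.
     (\<forall>f\<in>A. \<forall>g\<in>A. x (f + g) = x f + x g \<and> x (f * g) = x f * x g) \<and>
     (\<forall>c. x (Poly_Mapping.single 0 c) = c)}"

text \<open>
  The classical topology is the weakest one for which all regular functions are continuous;
  on families \<open>(x f)\<close> indexed by \<open>f \<in> A\<close> this is the topology induced by the product topology.
\<close>

definition toric_space :: "(real ^ 'n::finite) set \<Rightarrow> 'n point topology" where
  "toric_space \<sigma> =
     (let A = monoid_algebra (dual_monoid \<sigma>)
      in subtopology (product_topology (\<lambda>_. euclidean) A) (complex_points A))"

definition toric_boundary :: "(real ^ 'n::finite) set \<Rightarrow> 'n point set" where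
  "toric_boundary \<sigma> = topspace (toric_space \<sigma>) -
     (\<lambda>x. restrict x (monoid_algebra (dual_monoid \<sigma>))) ` complex_points (monoid_algebra UNIV)"

text \<open>
  Holomorphy of \<open>F\<close> on a neighbourhood of the point \<open>a\<close> of \<open>\<complex>\<^sup>k\<close>: expansion in a power
  series that converges (absolutely) on a polydisc. Points of \<open>\<complex>\<^sup>k\<close> are functions on the
  naturals of which only the values at \<open>i < k\<close> matter.
\<close>

definition holomorphic_near :: "nat \<Rightarrow> ((nat \<Rightarrow> complex) \<Rightarrow> complex) \<Rightarrow> (nat \<Rightarrow> complex) \<Rightarrow> bool" where
  "holomorphic_near k F a \<longleftrightarrow>
     (\<exists>r>0. \<exists>c :: (nat \<Rightarrow> nat) \<Rightarrow> complex. \<forall>z. (\<forall>i<k. cmod (z i - a i) < r) \<longrightarrow>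
        ((\<lambda>\<alpha>. c \<alpha> * (\<Prod>i<k. (z i - a i) ^ \<alpha> i)) has_sum F z) {\<alpha>. \<forall>i\<ge>k. \<alpha> i = 0})"

definition generates_monoid :: "nat \<Rightarrow> (nat \<Rightarrow> int ^ 'n) \<Rightarrow> (int ^ 'n::finite) set \<Rightarrow> bool" where
  "generates_monoid k h S \<longleftrightarrow> S = range (\<lambda>a :: nat \<Rightarrow> nat. \<Sum>i<k. int (a i) *s h i)"

text \<open>
  Generators \<open>h\<^sub>0, \<dots>, h\<^sub>k\<^sub>-\<^sub>1\<close> of the monoid give a closed embedding into \<open>\<complex>\<^sup>k\<close>. As the
  toric variety is reduced, the sections of the structure sheaf of the analytic space are
  the functions that are locally restrictions of holomorphic functions along such an embedding;
  the resulting sheaf does not depend on the choice of generators.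
\<close>

definition toric_sheaf :: "(real ^ 'n::finite) set \<Rightarrow> 'n point set \<Rightarrow> ('n point \<Rightarrow> complex) set" where
  "toric_sheaf \<sigma> U = {f \<in> extensional U. \<forall>x\<in>U. \<exists>k h F.
     generates_monoid k h (dual_monoid \<sigma>) \<and>
     holomorphic_near k F (\<lambda>i. x (Poly_Mapping.single (h i) 1)) \<and>
     (\<exists>W. openin (toric_space \<sigma>) W \<and> x \<in> W \<and> W \<subseteq> U \<and>
        (\<forall>y\<in>W. f y = F (\<lambda>i. y (Poly_Mapping.single (h i) 1))))}"

section \<open>Divisorial log structures and Kato--Nakayama spaces\<close>

text \<open>
  A reduced analytic space is given by a topology \<open>X\<close> and a sheaf of functions \<open>\<O>\<close>.
  Divisorial log structures are sheaves of submonoids of \<open>\<O>\<close> with \<open>\<alpha>\<close> the inclusion, so a log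
  structure is represented by a sheaf of functions \<open>\<M>\<close> with \<open>\<M> U \<subseteq> \<O> U\<close>, containing the units.
  The values of \<open>\<O>\<close> and \<open>\<M>\<close> are relevant on open sets only.
\<close>

type_synonym 'a fun_sheaf = "'a set \<Rightarrow> ('a \<Rightarrow> complex) set"

definition unit_sections :: "'a fun_sheaf \<Rightarrow> 'a fun_sheaf" where
  "unit_sections \<O> U = {f \<in> \<O> U. \<exists>g\<in>\<O> U. \<forall>x\<in>U. f x * g x = 1}"

definition divisorial_log :: "'a fun_sheaf \<Rightarrow> 'a set \<Rightarrow> 'a fun_sheaf" where
  "divisorial_log \<O> D U = {f \<in> \<O> U. restrict f (U - D) \<in> unit_sections \<O> (U - D)}"

text \<open>
  The germ of \<open>f\<close> at \<open>x\<close> is the class of all functions that agree with \<open>f\<close> near \<open>x\<close>.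
\<close>

definition germ :: "'a topology \<Rightarrow> 'a \<Rightarrow> ('a \<Rightarrow> complex) \<Rightarrow> ('a \<Rightarrow> complex) set" where
  "germ X x f = {g. \<forall>\<^sub>F y in nhdsin X x. g y = f y}"

definition stalk :: "'a topology \<Rightarrow> 'a fun_sheaf \<Rightarrow> 'a \<Rightarrow> ('a \<Rightarrow> complex) set monoid" where
  "stalk X \<M> x =
     \<lparr>carrier = {germ X x f | f U. openin X U \<and> x \<in> U \<and> f \<in> \<M> U},
      mult = (\<lambda>A B. {h. \<exists>f\<in>A. \<exists>g\<in>B. \<forall>\<^sub>F y in nhdsin X x. h y = f y * g y}),
      one = germ X x (\<lambda>_. 1)\<rparr>"

text \<open>Grothendieck group of a commutative monoid; the pair \<open>(a, b)\<close> stands for \<open>a / b\<close>.\<close>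

definition groth_rel :: "('m, 'r) monoid_scheme \<Rightarrow> (('m \<times> 'm) \<times> ('m \<times> 'm)) set" where
  "groth_rel G = {((a, b), (c, d)). a \<in> carrier G \<and> b \<in> carrier G \<and> c \<in> carrier G \<and> d \<in> carrier G \<and>
     (\<exists>k\<in>carrier G. a \<otimes>\<^bsub>G\<^esub> d \<otimes>\<^bsub>G\<^esub> k = c \<otimes>\<^bsub>G\<^esub> b \<otimes>\<^bsub>G\<^esub> k)}"

definition grothendieck_group :: "('m, 'r) monoid_scheme \<Rightarrow> ('m \<times> 'm) set monoid" where
  "grothendieck_group G =
     \<lparr>carrier = (carrier G \<times> carrier G) // groth_rel G,
      mult = (\<lambda>A B. \<Union>(a, b)\<in>A. \<Union>(c, d)\<in>B. groth_rel G `` {(a \<otimes>\<^bsub>G\<^esub> c, b \<otimes>\<^bsub>G\<^esub> d)}),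
      one = groth_rel G `` {(\<one>\<^bsub>G\<^esub>, \<one>\<^bsub>G\<^esub>)}\<rparr>"

definition groth_of :: "('m, 'r) monoid_scheme \<Rightarrow> 'm \<Rightarrow> ('m \<times> 'm) set" where
  "groth_of G a = groth_rel G `` {(a, \<one>\<^bsub>G\<^esub>)}"

definition circle_group :: "complex monoid" where
  "circle_group = \<lparr>carrier = sphere 0 1, mult = (*), one = 1\<rparr>"

type_synonym 'a kn_point = "'a \<times> ((('a \<Rightarrow> complex) set \<times> ('a \<Rightarrow> complex) set) set \<Rightarrow> complex)"

text \<open>
  Homomorphisms are taken in \<^const>\<open>extensional\<close> so that each one is represented once.
\<close>

definition kn_points :: "'a topology \<Rightarrow> 'a fun_sheaf \<Rightarrow> 'a fun_sheaf \<Rightarrow> 'a kn_point set" where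
  "kn_points X \<O> \<M> = {(x, \<phi>). x \<in> topspace X \<and>
     \<phi> \<in> hom (grothendieck_group (stalk X \<M> x)) circle_group \<and>
     \<phi> \<in> extensional (carrier (grothendieck_group (stalk X \<M> x))) \<and>
     (\<forall>U h. openin X U \<and> x \<in> U \<and> h \<in> unit_sections \<O> U \<longrightarrow>
        \<phi> (groth_of (stalk X \<M> x) (germ X x h)) = h x / cmod (h x))}"

definition kato_nakayama :: "'a topology \<Rightarrow> 'a fun_sheaf \<Rightarrow> 'a fun_sheaf \<Rightarrow> 'a kn_point topology" where
  "kato_nakayama X \<O> \<M> = topology_generated_by
     ({{(x, \<phi>) \<in> kn_points X \<O> \<M>. x \<in> U} | U. openin X U} \<union>
      {{(x, \<phi>) \<in> kn_points X \<O> \<M>. x \<in> U \<and> \<phi> (groth_of (stalk X \<M> x) (germ X x m)) \<in> V} | U m V.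
         openin X U \<and> m \<in> \<M> U \<and> openin (top_of_set (sphere 0 1)) V})"

definition compact_torus :: "('n::finite \<Rightarrow> complex) topology" where
  "compact_torus = product_topology (\<lambda>_. top_of_set (sphere 0 1)) UNIV"

end

theory Submission
  imports Defs "HOL-Complex_Analysis.Complex_Analysis"
begin

text \<open>
  Write \<open>S\<close> for the monoid \<open>dual_monoid \<sigma>\<close>. A point \<open>x\<close> of the toric variety is a monoid
  homomorphism from \<open>S\<close> to \<open>(\<complex>, \<cdot>)\<close>, \<open>u \<mapsto> monomial_value x u\<close>, and the boundary consists of the
  points where some monomial vanishes. The homeomorphism is a form of polar coordinates: it splits
  such a homomorphism into absolute value and phase, where the Kato--Nakayama space remembers the
  phases of the monomials that vanish.

  The first ingredient describes the log structure (\<open>local_factorization\<close>): near any point \<open>x\<close>, a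
  holomorphic function without zeros off the boundary is a monomial times a unit. As \<open>X\<close> is
  singular, prime factorization of germs is not at hand. Instead, a power series in the generating
  monomials is pulled back along the exponential map to a set of logarithms of torus points near
  \<open>x\<close>. Moving a logarithm in the direction of a normal \<open>g\<close> of the cone multiplies each term of the
  series by a power of \<open>exp \<zeta>\<close>, whose exponent is the weight of the term; so every normal gives a
  one-variable power series without zeros in the punctured disc. Hurwitz' theorem shows that the
  terms whose weights are minimal for all normals at once have a sum without zeros
  (\<open>leading_weight\<close>). In particular such terms exist; the exponent of one of them is the required
  monomial, and by Dickson's lemma the whole series can be divided by it (\<open>divide_series\<close>).

  Consequently a homomorphism on the stalk with prescribed values on units is determined by its
  values on monomials. These are the values of a character \<open>phase \<theta>\<close> of the whole lattice with a
  unique \<open>\<theta>\<close> in the torus \<open>T\<^sup>n\<close>, because \<open>S\<close> generates the lattice when \<open>\<sigma>\<close> is strictly convex.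
  The condition on units becomes \<open>monomial_value x u = \<bar>monomial_value x u\<bar> * phase \<theta> u\<close>
  (\<open>compatible\<close>). Conversely, a compatible \<open>\<theta>\<close> defines a homomorphism: the limit of \<open>f / \<bar>f\<bar>\<close>
  along a path in the torus that has constant phase \<open>\<theta>\<close> and leads to \<open>x\<close> (\<open>phase_hom\<close>). This is
  multiplicative for trivial reasons, and the factorization shows that the limit exists.

  So a point of the Kato--Nakayama space amounts to a homomorphism \<open>\<eta>\<close> from \<open>S\<close> to the nonnegative
  reals, the absolute value of \<open>x\<close>, together with an arbitrary \<open>\<theta>\<close>. The last ingredient is the
  moment map \<open>\<eta> \<mapsto> \<Sum>\<^sub>i \<eta> (h i) h i\<close> for generators \<open>h i\<close> of \<open>S\<close>, which identifies the space of
  these \<open>\<eta>\<close> with the dual cone (\<open>moment_homeomorphism\<close>). On the torus it is the gradient of the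
  convex function \<open>\<Sum>\<^sub>i exp (a \<bullet> h i)\<close>, which yields injectivity by monotonicity and surjectivity
  by minimization; the inverse is continuous because the map is proper. Both directions of the
  homeomorphism are then checked on the generators of the topologies, where the factorization
  appears once more: locally the argument of a section of the log structure is \<open>phase \<theta> u\<close> times
  the phase of a unit.
\<close>

section \<open>Lattice cones\<close>

definition pairing :: "int ^ 'n::finite \<Rightarrow> int ^ 'n \<Rightarrow> int" where
  "pairing g u = (\<Sum>i\<in>UNIV. g $ i * u $ i)"

lemma pairing_add_right: "pairing g (u + v) = pairing g u + pairing g v"
  by (simp add: pairing_def distrib_left sum.distrib)

lemma pairing_diff_right: "pairing g (u - v) = pairing g u - pairing g v"
  by (simp add: pairing_def right_diff_distrib sum_subtractf)

lemma pairing_add_left: "pairing (g + h) u = pairing g u + pairing h u"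
  by (simp add: pairing_def distrib_right sum.distrib)

lemma pairing_zero [simp]: "pairing g 0 = 0" "pairing 0 u = 0"
  by (simp_all add: pairing_def)

lemma pairing_minus_right: "pairing g (- u) = - pairing g u"
  by (simp add: pairing_def sum_negf)

lemma pairing_scale_right: "pairing g (c *s u) = c * pairing g u"
  by (simp add: pairing_def sum_distrib_left mult.left_commute)

lemma pairing_scale_left: "pairing (c *s g) u = c * pairing g u"
  by (simp add: pairing_def sum_distrib_left mult.assoc)

lemma pairing_sum_right: "pairing g (\<Sum>a\<in>A. f a) = (\<Sum>a\<in>A. pairing g (f a))"
  by (induction A rule: infinite_finite_induct) (auto simp: pairing_add_right)

lemma pairing_sum_left: "pairing (\<Sum>a\<in>A. f a) u = (\<Sum>a\<in>A. pairing (f a) u)"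
  by (induction A rule: infinite_finite_induct) (auto simp: pairing_add_left)

lemma pairing_axis [simp]: "pairing g (axis j 1) = g $ j" "pairing (axis j 1) u = u $ j"
  by (simp_all add: pairing_def axis_def if_distrib if_distribR cong: if_cong)

lemma real_vec_add: "real_vec (u + v) = real_vec u + real_vec v"
  by (simp add: real_vec_def vec_eq_iff)

lemma real_vec_zero [simp]: "real_vec 0 = 0"
  by (simp add: real_vec_def vec_eq_iff)

lemma real_vec_scale: "real_vec (c *s u) = of_int c *\<^sub>R real_vec u"
  by (simp add: real_vec_def vec_eq_iff)

lemma real_vec_sum: "real_vec (\<Sum>a\<in>A. f a) = (\<Sum>a\<in>A. real_vec (f a))"
  by (induction A rule: infinite_finite_induct) (auto simp: real_vec_add)

lemma real_vec_eq_zero_iff: "real_vec u = 0 \<longleftrightarrow> u = 0"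
  by (simp add: real_vec_def vec_eq_iff)

lemma real_vec_inner: "real_vec g \<bullet> real_vec u = of_int (pairing g u)"
  by (simp add: real_vec_def inner_vec_def pairing_def)

subsection \<open>Dickson's lemma and Gordan's lemma\<close>

lemma nat_incseq_subseq:
  fixes a :: "nat \<Rightarrow> nat"
  obtains r :: "nat \<Rightarrow> nat" where "strict_mono r" "incseq (\<lambda>n. a (r n))"
proof -
  obtain r :: "nat \<Rightarrow> nat" where r: "strict_mono r" "monoseq (\<lambda>n. a (r n))"
    using seq_monosub by blast
  show ?thesis
  proof (cases "incseq (\<lambda>n. a (r n))")
    case True
    then show ?thesis using r that by blast
  next
    case False
    then have dec: "decseq (\<lambda>n. a (r n))"
      using r(2) by (simp add: monoseq_iff)
    obtain N where N: "\<And>n. a (r N) \<le> a (r n)"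
      using ex_has_least_nat[of "\<lambda>_. True" 0 "\<lambda>n. a (r n)"] by auto
    have "a (r (N + n)) = a (r N)" for n
      using N[of "N + n"] dec by (simp add: decseq_def le_antisym)
    then show ?thesis
      using that[of "\<lambda>n. r (N + n)"] r(1) by (simp add: strict_mono_def)
  qed
qed

lemma incseq_subseq_finite:
  fixes f :: "nat \<Rightarrow> 'j \<Rightarrow> nat"
  assumes "finite J"
  shows "\<exists>r. strict_mono (r :: nat \<Rightarrow> nat) \<and> (\<forall>j\<in>J. incseq (\<lambda>n. f (r n) j))"
  using assms
proof (induction J)
  case empty
  show ?case using strict_mono_id by blast
next
  case (insert i J)
  then obtain r where r: "strict_mono (r :: nat \<Rightarrow> nat)" "\<forall>j\<in>J. incseq (\<lambda>n. f (r n) j)"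
    by blast
  obtain q where q: "strict_mono (q :: nat \<Rightarrow> nat)" "incseq (\<lambda>n. f (r (q n)) i)"
    using nat_incseq_subseq[of "\<lambda>n. f (r n) i"] by auto
  have "incseq (\<lambda>n. f (r (q n)) j)" if "j \<in> J" for j
    using r(2) that q(1) by (simp add: incseq_def strict_mono_less_eq)
  then show ?case
    using q strict_mono_o[OF r(1) q(1)] by (intro exI[of _ "r \<circ> q"]) (simp add: o_def)
qed

text \<open>
  A counterexample would yield an infinite sequence in which no term lies above an earlier one,
  but every sequence in a finite power of the naturals has a weakly increasing subsequence.
\<close>

lemma Dickson:
  fixes w :: "'a \<Rightarrow> 'j \<Rightarrow> nat"
  assumes "finite J"
  shows "\<exists>B. finite B \<and> B \<subseteq> A \<and> (\<forall>a\<in>A. \<exists>b\<in>B. \<forall>j\<in>J. w b j \<le> w a j)"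
proof (rule ccontr)
  assume neg: "\<not> ?thesis"
  have "\<exists>a\<in>A. \<forall>b\<in>B. \<not> (\<forall>j\<in>J. w b j \<le> w a j)" if "finite B" "B \<subseteq> A" for B
  proof (rule ccontr)
    assume "\<not> ?thesis"
    then have "\<forall>a\<in>A. \<exists>b\<in>B. \<forall>j\<in>J. w b j \<le> w a j" by blast
    then show False using neg that by blast
  qed
  then obtain pick where pick: "\<And>B. finite B \<Longrightarrow> B \<subseteq> A \<Longrightarrow>
      pick B \<in> A \<and> (\<forall>b\<in>B. \<not> (\<forall>j\<in>J. w b j \<le> w (pick B) j))"
    by metis
  define L where "L = rec_nat [] (\<lambda>_ l. l @ [pick (set l)])"
  have L: "L 0 = []" "L (Suc n) = L n @ [pick (set (L n))]" for n
    by (simp_all add: L_def)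
  define s where "s n = pick (set (L n))" for n
  have set_L: "set (L n) = s ` {..<n}" for n
    by (induction n) (auto simp: L s_def lessThan_Suc)
  have sub: "set (L n) \<subseteq> A" for n
  proof (induction n)
    case (Suc n)
    then show ?case using pick[of "set (L n)"] by (simp add: L)
  qed (simp add: L)
  have bad: "\<not> (\<forall>j\<in>J. w (s m) j \<le> w (s n) j)" if "m < n" for m n
  proof -
    have "s m \<in> set (L n)" using that by (auto simp: set_L)
    then show ?thesis using pick[OF finite_set sub, of n] unfolding s_def[of n] by blast
  qed
  obtain r where r: "strict_mono (r :: nat \<Rightarrow> nat)" "\<forall>j\<in>J. incseq (\<lambda>n. w (s (r n)) j)"
    using incseq_subseq_finite[OF assms, of "\<lambda>n. w (s n)"] by blast
  have "r 0 < r 1" using r(1) by (simp add: strict_mono_def)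
  then show False using bad[of "r 0" "r 1"] r(2) by (auto simp: incseq_def)
qed

definition lattice_cone :: "(int ^ 'n::finite) set \<Rightarrow> (int ^ 'n) set" where
  "lattice_cone G = {u. \<forall>g\<in>G. 0 \<le> pairing g u}"

lemma lattice_cone_zero [simp]: "0 \<in> lattice_cone G"
  by (simp add: lattice_cone_def)

lemma lattice_cone_add: "u \<in> lattice_cone G \<Longrightarrow> v \<in> lattice_cone G \<Longrightarrow> u + v \<in> lattice_cone G"
  by (simp add: lattice_cone_def pairing_add_right)

lemma lattice_cone_scale: "u \<in> lattice_cone G \<Longrightarrow> int n *s u \<in> lattice_cone G"
  by (simp add: lattice_cone_def pairing_scale_right)

lemma lattice_cone_sum: "(\<And>a. a \<in> A \<Longrightarrow> f a \<in> lattice_cone G) \<Longrightarrow> (\<Sum>a\<in>A. f a) \<in> lattice_cone G"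
  by (induction A rule: infinite_finite_induct) (auto intro: lattice_cone_add)

text \<open>
  Every lattice point is compared by the sizes of its coordinates and by its pairings with \<open>G\<close>.
  Then the minimal nonzero elements generate: subtracting a smaller element \<open>h\<close> from \<open>u\<close> stays in
  the cone and, since coordinates of \<open>h\<close> have the same signs as those of \<open>u\<close>, decreases the sum of
  absolute values.
\<close>

lemma Gordan:
  fixes G :: "(int ^ 'n::finite) set"
  assumes "finite G"
  obtains H where "finite H" "H \<subseteq> lattice_cone G"
    "\<And>u. u \<in> lattice_cone G \<Longrightarrow> \<exists>n. u = (\<Sum>h\<in>H. int (n h) *s h)"
proof -
  let ?S = "lattice_cone G"
  define J :: "('n + 'n + int ^ 'n) set" where "J = UNIV <+> UNIV <+> G"
  \<comment> \<open>Positive and negative parts of the coordinates are recorded separately, so that \<open>w h \<le> w u\<close> forces equal signs.\<close>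
  define w :: "int ^ 'n \<Rightarrow> 'n + 'n + int ^ 'n \<Rightarrow> nat" where
    "w u = case_sum (\<lambda>i. nat (u $ i)) (case_sum (\<lambda>i. nat (- (u $ i))) (\<lambda>g. nat (pairing g u)))" for u
  have "finite J" using assms by (simp add: J_def)
  from Dickson[OF this, of "?S - {0}" w] obtain H where H: "finite H" "H \<subseteq> ?S - {0}"
    and min: "\<forall>u \<in> ?S - {0}. \<exists>h\<in>H. \<forall>j\<in>J. w h j \<le> w u j"
    by (elim exE conjE)
  define N where "N u = nat (\<Sum>i\<in>UNIV. \<bar>u $ i\<bar>)" for u :: "int ^ 'n"
  have "\<exists>n. u = (\<Sum>h\<in>H. int (n h) *s h)" if "u \<in> ?S" for u
    using that
  proof (induction "N u" arbitrary: u rule: less_induct)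
    case less
    show ?case
    proof (cases "u = 0")
      case True
      then show ?thesis by (intro exI[of _ "\<lambda>_. 0"]) simp
    next
      case False
      then obtain h where h: "h \<in> H" "\<forall>j\<in>J. w h j \<le> w u j"
        using bspec[OF min, of u] less.prems by auto
      have h0: "h \<in> ?S" "h \<noteq> 0" using H h by auto
      have pos: "nat (h $ i) \<le> nat (u $ i)" for i
        using h(2)[rule_format, of "Inl i"] by (auto simp: w_def J_def)
      have neg: "nat (- (h $ i)) \<le> nat (- (u $ i))" for i
        using h(2)[rule_format, of "Inr (Inl i)"] by (auto simp: w_def J_def)
      have prs: "nat (pairing g h) \<le> nat (pairing g u)" if "g \<in> G" for g
        using h(2)[rule_format, of "Inr (Inr g)"] that by (auto simp: w_def J_def)
      have "u - h \<in> ?S"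
        using prs h0 less.prems by (fastforce simp: lattice_cone_def pairing_diff_right)
      have eq: "\<bar>(u - h) $ i\<bar> = \<bar>u $ i\<bar> - \<bar>h $ i\<bar>" for i
        using pos[of i] neg[of i] by auto
      obtain i where "h $ i \<noteq> 0" using h0 by (auto simp: vec_eq_iff)
      then have "0 < (\<Sum>i\<in>UNIV. \<bar>h $ i\<bar>)"
        by (intro sum_pos2[of UNIV i]) auto
      moreover have "(\<Sum>i\<in>UNIV. \<bar>(u - h) $ i\<bar>) = (\<Sum>i\<in>UNIV. \<bar>u $ i\<bar>) - (\<Sum>i\<in>UNIV. \<bar>h $ i\<bar>)"
        by (simp only: eq sum_subtractf)
      moreover have "0 \<le> (\<Sum>i\<in>UNIV. \<bar>(u - h) $ i\<bar>)" by (intro sum_nonneg) auto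
      ultimately have "N (u - h) < N u" unfolding N_def by linarith
      from less.hyps[OF this \<open>u - h \<in> ?S\<close>] obtain n
        where n: "u - h = (\<Sum>h\<in>H. int (n h) *s h)" by blast
      have "(\<Sum>h'\<in>H. int ((n(h := Suc (n h))) h') *s h') =
            (\<Sum>h'\<in>H. int (n h') *s h' + (if h' = h then h else 0))"
      proof (intro sum.cong refl)
        fix h' show "int ((n(h := Suc (n h))) h') *s h' = int (n h') *s h' + (if h' = h then h else 0)"
        proof (cases "h' = h")
          case True
          have "int (Suc (n h)) *s h = int (n h) *s h + h" by (simp add: vec_eq_iff algebra_simps)
          then show ?thesis unfolding True fun_upd_same by simp
        qed simp
      qed
      also have "\<dots> = u" using n h(1) H(1)
        by (simp add: sum.distrib) (metis diff_add_cancel)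
      finally show ?thesis by metis
    qed
  qed
  with H show ?thesis by (intro that[of H]) auto
qed

lemma lattice_cone_generators:
  assumes "finite G"
  obtains k h where "generates_monoid k h (lattice_cone G)"
proof -
  from Gordan[OF assms] obtain H where H: "finite H" "H \<subseteq> lattice_cone G"
    "\<And>u. u \<in> lattice_cone G \<Longrightarrow> \<exists>n. u = (\<Sum>h\<in>H. int (n h) *s h)" by blast
  obtain h where h: "bij_betw h {0..<card H} H"
    using ex_bij_betw_nat_finite[OF H(1)] by blast
  then have h: "bij_betw h {..<card H} H" by (simp add: atLeast0LessThan)
  have "lattice_cone G = range (\<lambda>a :: nat \<Rightarrow> nat. \<Sum>i<card H. int (a i) *s h i)"
  proof (intro equalityI subsetI)
    fix u assume "u \<in> lattice_cone G"
    then obtain n where "u = (\<Sum>x\<in>H. int (n x) *s x)" using H by blast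
    also have "\<dots> = (\<Sum>i<card H. int (n (h i)) *s h i)"
      by (simp add: sum.reindex_bij_betw[OF h, of "\<lambda>x. int (n x) *s x"])
    finally have "u = (\<Sum>i<card H. int (n (h i)) *s h i)" .
    then show "u \<in> range (\<lambda>a :: nat \<Rightarrow> nat. \<Sum>i<card H. int (a i) *s h i)"
      by (intro range_eqI[of _ _ "\<lambda>i. n (h i)"])
  next
    fix u assume "u \<in> range (\<lambda>a :: nat \<Rightarrow> nat. \<Sum>i<card H. int (a i) *s h i)"
    then show "u \<in> lattice_cone G"
      using H(2) bij_betwE[OF h] by (auto intro!: lattice_cone_sum lattice_cone_scale)
  qed
  then show ?thesis using that[of "card H" h] by (simp add: generates_monoid_def)
qed

lemma generates_monoid_mem:
  assumes "generates_monoid k h S"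
  shows "(\<Sum>i<k. int (a i) *s h i) \<in> S"
  using assms by (auto simp: generates_monoid_def)

lemma generates_monoid_generator:
  assumes "generates_monoid k h S" "i < k"
  shows "h i \<in> S"
proof -
  have "(\<Sum>l<k. int (if l = i then 1 else 0) *s h l) = (\<Sum>l<k. if l = i then h l else 0)"
    by (intro sum.cong) auto
  also have "\<dots> = h i" using assms(2) by simp
  finally show ?thesis using generates_monoid_mem[OF assms(1)] by metis
qed

lemma generates_monoid_rep:
  assumes "generates_monoid k h S" "u \<in> S"
  obtains a :: "nat \<Rightarrow> nat" where "u = (\<Sum>i<k. int (a i) *s h i)" "\<And>i. i \<ge> k \<Longrightarrow> a i = 0"
proof -
  obtain a :: "nat \<Rightarrow> nat" where "u = (\<Sum>i<k. int (a i) *s h i)"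
    using assms by (auto simp: generates_monoid_def)
  then show ?thesis using that[of "\<lambda>i. if i < k then a i else 0"] by simp
qed

subsection \<open>Dual cones\<close>

lemma dual_cone_hull:
  "dual_cone (convex_cone hull (real_vec ` G)) = {p. \<forall>g\<in>G. 0 \<le> real_vec g \<bullet> p}"
proof (intro equalityI subsetI)
  fix p assume "p \<in> dual_cone (convex_cone hull (real_vec ` G))"
  then show "p \<in> {p. \<forall>g\<in>G. 0 \<le> real_vec g \<bullet> p}"
    by (auto simp: dual_cone_def inner_commute hull_inc)
next
  fix p assume p: "p \<in> {p. \<forall>g\<in>G. 0 \<le> real_vec g \<bullet> p}"
  have cc: "convex_cone {m. 0 \<le> p \<bullet> m}"
    by (auto simp: convex_cone_def convex_def conic_def inner_add_right intro!: exI[of _ 0] add_nonneg_nonneg mult_nonneg_nonneg)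
  have "convex_cone hull (real_vec ` G) \<subseteq> {m. 0 \<le> p \<bullet> m}"
    by (rule hull_minimal) (use p cc in \<open>auto simp: inner_commute\<close>)
  then show "p \<in> dual_cone (convex_cone hull (real_vec ` G))"
    by (auto simp: dual_cone_def)
qed

lemma sum_in_convex_cone:
  assumes "convex_cone C" "\<And>a. a \<in> A \<Longrightarrow> f a \<in> C"
  shows "(\<Sum>a\<in>A. f a) \<in> C"
  using assms(2)
proof (induction A rule: infinite_finite_induct)
  case (insert a A)
  then show ?case using convex_cone_add[OF assms(1)] by simp
qed (use convex_cone_contains_0 assms(1) in auto)

lemma dual_monoid_hull: "dual_monoid (convex_cone hull (real_vec ` G)) = lattice_cone G"
  by (auto simp: dual_monoid_def dual_cone_hull lattice_cone_def real_vec_inner)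

text \<open>
  If \<open>0\<close> were a convex combination of nonzero generators, then one of them would have its negative
  in the cone, against strict convexity. So \<open>0\<close> can be separated from the generators by a
  hyperplane, and rounding a large multiple of its normal vector gives the lattice point.
\<close>

lemma strictly_convex_interior_lattice_point:
  fixes G :: "(int ^ 'n::finite) set"
  assumes "finite G" and sc: "strictly_convex (convex_cone hull (real_vec ` G))"
  obtains u where "\<And>g. g \<in> G \<Longrightarrow> g \<noteq> 0 \<Longrightarrow> 0 < pairing g u"
proof (cases "G - {0} = {}")
  case True
  show ?thesis by (rule that[of 0]) (use True in auto)
next
  case False
  define P where "P = real_vec ` (G - {0})"
  let ?C = "convex_cone hull (real_vec ` G)"
  have cc: "convex_cone ?C" by (rule convex_cone_convex_cone_hull)
  have finP: "finite P" using assms by (simp add: P_def)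
  have P0: "0 \<notin> P" by (auto simp: P_def real_vec_eq_zero_iff)
  have PC: "P \<subseteq> ?C" by (auto simp: P_def intro: hull_inc)
  have "0 \<notin> convex hull P"
  proof
    assume "0 \<in> convex hull P"
    then obtain c where c: "\<And>x. x \<in> P \<Longrightarrow> 0 \<le> c x" "sum c P = 1" "(\<Sum>x\<in>P. c x *\<^sub>R x) = 0"
      unfolding convex_hull_finite[OF finP] by auto
    then obtain x where x: "x \<in> P" "c x > 0"
      using sum_nonpos[of P c] by (metis linorder_not_le zero_less_one)
    have "(\<Sum>y\<in>P - {x}. c y *\<^sub>R y) \<in> ?C"
    proof (rule sum_in_convex_cone[OF cc])
      fix y assume "y \<in> P - {x}"
      then show "c y *\<^sub>R y \<in> ?C"
        using convex_cone_scaleR[OF cc, of "c y" y] c(1) PC by blast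
    qed
    moreover have "c x *\<^sub>R x + (\<Sum>y\<in>P - {x}. c y *\<^sub>R y) = 0"
      using c(3) x(1) by (simp add: sum.remove[OF finP])
    ultimately have "- (c x *\<^sub>R x) \<in> ?C" by (simp only: minus_unique)
    moreover have "c x *\<^sub>R x \<in> ?C"
      using convex_cone_scaleR[OF cc, of "c x" x] x PC by auto
    moreover have "c x *\<^sub>R x = - (- (c x *\<^sub>R x))" by simp
    ultimately have "c x *\<^sub>R x \<in> ?C \<inter> uminus ` ?C" by (intro IntI image_eqI)
    then have "c x *\<^sub>R x = 0" using sc unfolding strictly_convex_def by blast
    then show False using x P0 by simp
  qed
  then obtain a b where ab: "b > 0" "\<And>x. x \<in> convex hull P \<Longrightarrow> b < a \<bullet> x"
    using separating_hyperplane_closed_0[of "convex hull P"] finP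
    by (metis convex_convex_hull compact_imp_closed finite_imp_compact_convex_hull)
  then have a: "b < a \<bullet> real_vec g" if "g \<in> G" "g \<noteq> 0" for g
    using that by (auto simp: P_def intro!: ab hull_inc)
  define M where "M = Max ((\<lambda>g. norm (real_vec g)) ` G)"
  have M: "norm (real_vec g) \<le> M" if "g \<in> G" for g
    using assms that by (auto simp: M_def)
  obtain N :: nat where N: "real N * b > M * real CARD('n)"
    using ab(1) reals_Archimedean3 by blast
  define u :: "int ^ 'n" where "u = (\<chi> i. \<lfloor>real N * a $ i\<rfloor>)"
  have "0 < pairing g u" if g: "g \<in> G" "g \<noteq> 0" for g
  proof -
    have "norm (real_vec u - real N *\<^sub>R a) \<le> (\<Sum>i\<in>UNIV. \<bar>(real_vec u - real N *\<^sub>R a) $ i\<bar>)"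
      by (rule norm_le_l1_cart)
    also have "\<dots> \<le> (\<Sum>i\<in>(UNIV::'n set). 1)"
    proof (rule sum_mono)
      fix i
      have "(real_vec u - real N *\<^sub>R a) $ i = real_of_int \<lfloor>real N * a $ i\<rfloor> - real N * a $ i"
        by (simp add: real_vec_def u_def)
      then show "\<bar>(real_vec u - real N *\<^sub>R a) $ i\<bar> \<le> 1" by linarith
    qed
    finally have "norm (real_vec u - real N *\<^sub>R a) \<le> real CARD('n)" by simp
    then have "norm (real_vec g) * norm (real_vec u - real N *\<^sub>R a) \<le> M * real CARD('n)"
      using M[OF g(1)] by (intro mult_mono) (auto intro: order_trans[OF norm_ge_zero])
    then have "\<bar>real_vec g \<bullet> (real_vec u - real N *\<^sub>R a)\<bar> \<le> M * real CARD('n)"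
      using Cauchy_Schwarz_ineq2 order_trans by blast
    moreover have "real N * b \<le> real N * (a \<bullet> real_vec g)"
      using a[OF g] by (intro mult_left_mono) auto
    ultimately have "0 < real_vec g \<bullet> real_vec u"
      using N by (simp add: inner_diff_right inner_commute)
    then show ?thesis by (simp add: real_vec_inner)
  qed
  then show ?thesis by (rule that)
qed

subsection \<open>Lattice bases adapted to a subspace\<close>

text \<open>
  A lattice basis \<open>e\<close> together with its dual basis \<open>d\<close>; carrying both along avoids inverting
  matrices.
\<close>

definition lattice_basis :: "('n \<Rightarrow> int ^ 'n::finite) \<Rightarrow> ('n \<Rightarrow> int ^ 'n) \<Rightarrow> bool" where
  "lattice_basis e d \<longleftrightarrow> (\<forall>u. (\<Sum>i\<in>UNIV. pairing (d i) u *s e i) = u) \<and>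
     (\<forall>i j. pairing (d i) (e j) = (if i = j then 1 else 0))"

lemma lattice_basis_standard: "lattice_basis (\<lambda>i. axis i 1) (\<lambda>i. axis i (1::int))"
proof -
  have "(\<Sum>i\<in>UNIV. u $ i *s axis i (1::int)) = u" for u :: "int ^ 'n"
    by (simp add: vec_eq_iff axis_def if_distrib cong: if_cong)
  then show ?thesis by (auto simp: lattice_basis_def) (auto simp: axis_def)
qed

lemma lattice_basis_shear:
  assumes b: "lattice_basis e d" and ij: "i \<noteq> j"
  shows "lattice_basis (e(i := e i - s *s e j)) (d(j := d j + s *s d i))"
    (is "lattice_basis ?e ?d")
proof -
  have "(\<Sum>k\<in>UNIV. pairing (?d k) u *s ?e k) = u" for u
  proof -
    have "pairing (?d k) u *s ?e k = pairing (d k) u *s e k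
        + ((if k = j then (s * pairing (d i) u) *s e j else 0)
           - (if k = i then (s * pairing (d i) u) *s e j else 0))" for k
      using ij by (auto simp: vec_eq_iff pairing_add_left pairing_scale_left algebra_simps)
    then show ?thesis
      using b by (simp add: sum.distrib sum_subtractf lattice_basis_def)
  qed
  moreover have "pairing (?d k) (?e l) = (if k = l then 1 else 0)" for k l
    using b ij by (auto simp: lattice_basis_def pairing_add_left pairing_scale_left
      pairing_diff_right pairing_scale_right)
  ultimately show ?thesis by (simp add: lattice_basis_def)
qed

lemma lattice_basis_expand:
  assumes "lattice_basis e d"
  shows "(\<Sum>i\<in>UNIV. (real_vec (d i) \<bullet> p) *\<^sub>R real_vec (e i)) = p"
proof -
  have delta: "(\<Sum>i\<in>UNIV. d i $ l * e i $ k) = (if l = k then 1 else 0)" for k l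
  proof -
    have "(\<Sum>i\<in>UNIV. pairing (d i) (axis l 1) *s e i) = axis l 1"
      using assms by (simp only: lattice_basis_def)
    then have "(\<Sum>i\<in>UNIV. d i $ l *s e i) $ k = (axis l 1 :: int ^ 'a) $ k" by simp
    then show ?thesis by (simp add: axis_def)
  qed
  have "(\<Sum>i\<in>UNIV. (real_vec (d i) \<bullet> p) *\<^sub>R real_vec (e i)) $ k = p $ k" for k
  proof -
    have "(\<Sum>i\<in>UNIV. (real_vec (d i) \<bullet> p) *\<^sub>R real_vec (e i)) $ k
        = (\<Sum>i\<in>UNIV. \<Sum>l\<in>UNIV. p $ l * of_int (d i $ l * e i $ k))"
      by (simp add: real_vec_def inner_vec_def sum_distrib_left sum_distrib_right mult_ac)
    also have "\<dots> = (\<Sum>l\<in>UNIV. p $ l * of_int (\<Sum>i\<in>UNIV. d i $ l * e i $ k))"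
      by (subst sum.swap) (simp add: sum_distrib_left)
    also have "\<dots> = p $ k" by (simp add: delta if_distrib cong: if_cong)
    finally show ?thesis .
  qed
  then show ?thesis by (simp add: vec_eq_iff)
qed

text \<open>
  Euclid's algorithm on the values of \<open>g\<close> on the basis vectors indexed by \<open>D\<close>: as long as two of
  them are nonzero, a shear lowers the larger absolute value. Shears within \<open>D\<close> leave the dual
  vectors outside \<open>D\<close> unchanged.
\<close>

lemma lattice_basis_Euclid:
  assumes "lattice_basis e d"
  shows "\<exists>e' d'. lattice_basis e' d' \<and> (\<forall>i. i \<notin> D \<longrightarrow> d' i = d i) \<and>
     (\<forall>i\<in>D. \<forall>j\<in>D. pairing g (e' i) \<noteq> 0 \<longrightarrow> pairing g (e' j) \<noteq> 0 \<longrightarrow> i = j)"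
  using assms
proof (induction "nat (\<Sum>i\<in>D. \<bar>pairing g (e i)\<bar>)" arbitrary: e d rule: less_induct)
  case less
  show ?case
  proof (cases "\<forall>i\<in>D. \<forall>j\<in>D. pairing g (e i) \<noteq> 0 \<longrightarrow> pairing g (e j) \<noteq> 0 \<longrightarrow> i = j")
    case True
    then show ?thesis using less.prems by blast
  next
    case False
    then obtain i j where ij: "i \<in> D" "j \<in> D" "i \<noteq> j" "pairing g (e i) \<noteq> 0" "pairing g (e j) \<noteq> 0"
      "\<bar>pairing g (e j)\<bar> \<le> \<bar>pairing g (e i)\<bar>"
      by (metis linorder_le_cases)
    define s where "s = sgn (pairing g (e i)) * sgn (pairing g (e j))"
    let ?e = "e(i := e i - s *s e j)" and ?d = "d(j := d j + s *s d i)"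
    have b: "lattice_basis ?e ?d" using lattice_basis_shear[OF less.prems ij(3)] .
    have lt: "\<bar>pairing g (?e i)\<bar> < \<bar>pairing g (e i)\<bar>"
      using ij(4-6) by (auto simp: s_def pairing_diff_right pairing_scale_right sgn_if)
    have "(\<Sum>k\<in>D. \<bar>pairing g (?e k)\<bar>) < (\<Sum>k\<in>D. \<bar>pairing g (e k)\<bar>)"
    proof (intro sum_strict_mono_ex1 finite ballI bexI[of _ i])
      show "\<bar>pairing g (?e k)\<bar> \<le> \<bar>pairing g (e k)\<bar>" for k
        using lt by (cases "k = i") simp_all
    qed (use lt ij(1) in simp_all)
    moreover have "0 \<le> (\<Sum>k\<in>D. \<bar>pairing g (?e k)\<bar>)" by (intro sum_nonneg) auto
    ultimately have "nat (\<Sum>k\<in>D. \<bar>pairing g (?e k)\<bar>) < nat (\<Sum>k\<in>D. \<bar>pairing g (e k)\<bar>)" by linarith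
    from less.hyps[OF this b] obtain e' d' where "lattice_basis e' d'" "\<forall>i. i \<notin> D \<longrightarrow> d' i = ?d i"
     "\<forall>i\<in>D. \<forall>j\<in>D. pairing g (e' i) \<noteq> 0 \<longrightarrow> pairing g (e' j) \<noteq> 0 \<longrightarrow> i = j"
      by (elim exE conjE)
    then show ?thesis using ij(2) by (intro exI[of _ e'] exI[of _ d']) auto
  qed
qed

text \<open>
  The subspace cut out by finitely many integral forms is spanned by part of a lattice basis,
  namely by the vectors indexed by \<open>D\<close>. Each new form is first brought into a shape where at most
  one basis vector in \<open>D\<close> has a nonzero value; this vector is then removed from \<open>D\<close>.
\<close>

lemma lattice_basis_adapted:
  fixes F :: "(int ^ 'n::finite) set"
  assumes "finite F"
  shows "\<exists>e d D. lattice_basis e d \<and>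
     (\<forall>p. (\<forall>g\<in>F. real_vec g \<bullet> p = 0) \<longleftrightarrow> (\<forall>i. i \<notin> D \<longrightarrow> real_vec (d i) \<bullet> p = 0))"
  using assms
proof (induction F)
  case empty
  show ?case
    using lattice_basis_standard
    by (intro exI[of _ "\<lambda>i. axis i 1"] exI[of _ UNIV] conjI) simp_all
next
  case (insert g F)
  then obtain e0 d0 D where 0: "lattice_basis e0 d0"
    "\<forall>p. (\<forall>g\<in>F. real_vec g \<bullet> p = 0) \<longleftrightarrow> (\<forall>i. i \<notin> D \<longrightarrow> real_vec (d0 i) \<bullet> p = 0)"
    by (elim exE conjE)
  obtain e d where b: "lattice_basis e d" and out: "\<forall>i. i \<notin> D \<longrightarrow> d i = d0 i"
    and one: "\<forall>i\<in>D. \<forall>j\<in>D. pairing g (e i) \<noteq> 0 \<longrightarrow> pairing g (e j) \<noteq> 0 \<longrightarrow> i = j"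
    using lattice_basis_Euclid[OF 0(1), of D g] by (elim exE conjE)
  have F: "(\<forall>g\<in>F. real_vec g \<bullet> p = 0) \<longleftrightarrow> (\<forall>i. i \<notin> D \<longrightarrow> real_vec (d i) \<bullet> p = 0)" for p
    using 0(2) out by simp
  have g: "real_vec g \<bullet> p = (\<Sum>i\<in>D. (real_vec (d i) \<bullet> p) * of_int (pairing g (e i)))"
    if "\<forall>i. i \<notin> D \<longrightarrow> real_vec (d i) \<bullet> p = 0" for p
  proof -
    have "real_vec g \<bullet> p = real_vec g \<bullet> (\<Sum>i\<in>UNIV. (real_vec (d i) \<bullet> p) *\<^sub>R real_vec (e i))"
      by (simp only: lattice_basis_expand[OF b])
    also have "\<dots> = (\<Sum>i\<in>UNIV. (real_vec (d i) \<bullet> p) * of_int (pairing g (e i)))"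
      by (simp add: inner_sum_right real_vec_inner)
    also have "\<dots> = (\<Sum>i\<in>D. (real_vec (d i) \<bullet> p) * of_int (pairing g (e i)))"
      using that by (intro sum.mono_neutral_right) auto
    finally show ?thesis .
  qed
  show ?case
  proof (cases "\<exists>i\<in>D. pairing g (e i) \<noteq> 0")
    case False
    then show ?thesis
      using b F g by (intro exI[of _ e] exI[of _ d] exI[of _ D] conjI allI) auto
  next
    case True
    then obtain i where i: "i \<in> D" "pairing g (e i) \<noteq> 0" by blast
    have gi: "real_vec g \<bullet> p = (real_vec (d i) \<bullet> p) * of_int (pairing g (e i))"
      if "\<forall>i. i \<notin> D \<longrightarrow> real_vec (d i) \<bullet> p = 0" for p
    proof -
      have "real_vec g \<bullet> p = (\<Sum>j\<in>{i}. (real_vec (d j) \<bullet> p) * of_int (pairing g (e j)))"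
        unfolding g[OF that] using i one by (intro sum.mono_neutral_right) auto
      then show ?thesis by simp
    qed
    have "(\<forall>h\<in>insert g F. real_vec h \<bullet> p = 0) \<longleftrightarrow> (\<forall>j. j \<notin> D - {i} \<longrightarrow> real_vec (d j) \<bullet> p = 0)" for p
      using F[of p] gi[of p] i by auto
    then show ?thesis
      using b by (intro exI[of _ e] exI[of _ d] exI[of _ "D - {i}"] conjI allI)
  qed
qed

section \<open>Convergent power series in several variables\<close>

definition multi_indices :: "nat \<Rightarrow> (nat \<Rightarrow> nat) set" where
  "multi_indices k = {\<alpha>. \<forall>i\<ge>k. \<alpha> i = 0}"

definition monom_eval :: "nat \<Rightarrow> (nat \<Rightarrow> 'a::comm_monoid_mult) \<Rightarrow> (nat \<Rightarrow> nat) \<Rightarrow> 'a" where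
  "monom_eval k z \<alpha> = (\<Prod>i<k. z i ^ \<alpha> i)"

lemma multi_indices_zero [simp]: "(\<lambda>_. 0) \<in> multi_indices k"
  by (simp add: multi_indices_def)

lemma monom_eval_zero [simp]: "monom_eval k z (\<lambda>_. 0) = 1"
  by (simp add: monom_eval_def)

lemma monom_eval_add: "monom_eval k z (\<lambda>i. \<alpha> i + \<beta> i) = monom_eval k z \<alpha> * monom_eval k z \<beta>"
  by (simp add: monom_eval_def power_add prod.distrib)

lemma monom_eval_pos: "0 < \<rho> \<Longrightarrow> 0 < monom_eval k (\<lambda>_. \<rho>::real) \<alpha>"
  by (simp add: monom_eval_def prod_pos)

lemma norm_monom_eval_le:
  fixes z :: "nat \<Rightarrow> complex"
  assumes "\<And>i. i < k \<Longrightarrow> norm (z i) \<le> N i"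
  shows "norm (monom_eval k z \<alpha>) \<le> monom_eval k N \<alpha>"
  unfolding monom_eval_def prod_norm[symmetric]
  by (intro prod_mono) (auto simp: norm_power intro!: power_mono assms)

lemma monom_eval_cong: "(\<And>i. i < k \<Longrightarrow> z i = z' i) \<Longrightarrow> monom_eval k z \<alpha> = monom_eval k z' \<alpha>"
  by (simp add: monom_eval_def)

text \<open>
  Power series at \<open>a\<close> that converge absolutely on the closed polydisc of radius \<open>\<rho>\<close>, with norm at
  most \<open>N\<close>. This is a Banach algebra norm, so that sums, products, inverses and compositions can
  be obtained by summing numerical series of bounds (\<open>abs_series_infsum\<close>).
\<close>

definition abs_series ::
  "nat \<Rightarrow> (nat \<Rightarrow> complex) \<Rightarrow> real \<Rightarrow> ((nat \<Rightarrow> complex) \<Rightarrow> complex) \<Rightarrow> real \<Rightarrow> bool" where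
  "abs_series k a \<rho> P N \<longleftrightarrow> (\<exists>c.
     (\<lambda>\<alpha>. norm (c \<alpha>) * monom_eval k (\<lambda>_. \<rho>) \<alpha>) summable_on multi_indices k \<and>
     (\<Sum>\<^sub>\<infinity>\<alpha>\<in>multi_indices k. norm (c \<alpha>) * monom_eval k (\<lambda>_. \<rho>) \<alpha>) \<le> N \<and>
     (\<forall>z. (\<forall>i<k. norm (z i - a i) \<le> \<rho>) \<longrightarrow>
        ((\<lambda>\<alpha>. c \<alpha> * monom_eval k (\<lambda>i. z i - a i) \<alpha>) has_sum P z) (multi_indices k)))"

text \<open>
  Terms with equal exponents may occur repeatedly and in any order; absolute convergence permits
  collecting them into a power series.
\<close>

lemma abs_series_collect:
  assumes rho: "0 < \<rho>"
    and e: "\<And>i. i \<in> I \<Longrightarrow> e i \<in> multi_indices k"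
    and sm: "(\<lambda>i. norm (c i) * monom_eval k (\<lambda>_. \<rho>) (e i)) summable_on I"
    and N: "(\<Sum>\<^sub>\<infinity>i\<in>I. norm (c i) * monom_eval k (\<lambda>_. \<rho>) (e i)) \<le> N"
    and P: "\<And>z. (\<And>i. i < k \<Longrightarrow> norm (z i - a i) \<le> \<rho>) \<Longrightarrow>
      ((\<lambda>i. c i * monom_eval k (\<lambda>l. z l - a l) (e i)) has_sum P z) I"
  shows "abs_series k a \<rho> P N"
proof -
  define fib where "fib \<alpha> = {i \<in> I. e i = \<alpha>}" for \<alpha>
  define c' where "c' \<alpha> = infsum c (fib \<alpha>)" for \<alpha>
  let ?M = "multi_indices k" and ?r = "monom_eval k (\<lambda>_. \<rho>)"
  have bij: "bij_betw snd (Sigma ?M fib) I"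
    by (rule bij_betwI[where g = "\<lambda>i. (e i, i)"]) (auto simp: fib_def e)
  have S0: "((\<lambda>p. norm (c (snd p)) * ?r (e (snd p))) has_sum
      (\<Sum>\<^sub>\<infinity>i\<in>I. norm (c i) * ?r (e i))) (Sigma ?M fib)"
    using has_sum_reindex_bij_betw[OF bij, of "\<lambda>i. norm (c i) * ?r (e i)"] sm by simp
  have fib_norm: "(\<lambda>i. norm (c i)) summable_on fib \<alpha>" for \<alpha>
  proof -
    have "(\<lambda>i. norm (c i) * ?r (e i)) summable_on fib \<alpha>"
      using sm by (rule summable_on_subset_banach) (auto simp: fib_def)
    then have "(\<lambda>i. norm (c i) * ?r \<alpha>) summable_on fib \<alpha>"
      by (rule summable_on_cong[THEN iffD1, rotated]) (auto simp: fib_def)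
    then show ?thesis
      using monom_eval_pos[OF rho, of k \<alpha>] by (simp add: summable_on_cmult_left')
  qed
  have fib_c: "c summable_on fib \<alpha>" for \<alpha>
    by (rule abs_summable_summable) (rule fib_norm)
  have c'_le: "norm (c' \<alpha>) \<le> (\<Sum>\<^sub>\<infinity>i\<in>fib \<alpha>. norm (c i))" for \<alpha>
    unfolding c'_def by (rule norm_infsum_bound) (rule fib_norm)
  have S1: "((\<lambda>\<alpha>. (\<Sum>\<^sub>\<infinity>i\<in>fib \<alpha>. norm (c i)) * ?r \<alpha>) has_sum (\<Sum>\<^sub>\<infinity>i\<in>I. norm (c i) * ?r (e i))) ?M"
  proof (rule has_sum_SigmaD[OF S0])
    fix \<alpha>
    have "((\<lambda>i. norm (c i) * ?r \<alpha>) has_sum (\<Sum>\<^sub>\<infinity>i\<in>fib \<alpha>. norm (c i)) * ?r \<alpha>) (fib \<alpha>)"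
      using has_sum_cmult_left[OF has_sum_infsum[OF fib_norm]] .
    then show "((\<lambda>i. norm (c (snd (\<alpha>, i))) * ?r (e (snd (\<alpha>, i)))) has_sum
        (\<Sum>\<^sub>\<infinity>i\<in>fib \<alpha>. norm (c i)) * ?r \<alpha>) (fib \<alpha>)"
      by (rule has_sum_cong[THEN iffD1, rotated]) (auto simp: fib_def)
  qed
  have le: "norm (c' \<alpha>) * ?r \<alpha> \<le> (\<Sum>\<^sub>\<infinity>i\<in>fib \<alpha>. norm (c i)) * ?r \<alpha>" for \<alpha>
    using c'_le monom_eval_pos[OF rho, of k \<alpha>] by (intro mult_right_mono) auto
  have sm': "(\<lambda>\<alpha>. norm (c' \<alpha>) * ?r \<alpha>) summable_on ?M"
  proof -
    have "(\<lambda>\<alpha>. norm (norm (c' \<alpha>) * ?r \<alpha>)) summable_on ?M"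
      using le monom_eval_pos[OF rho]
      by (intro Infinite_Sum.abs_summable_on_comparison_test'[OF has_sum_imp_summable[OF S1]])
        (simp add: abs_mult less_imp_le)
    then show ?thesis by (rule abs_summable_summable)
  qed
  have "(\<Sum>\<^sub>\<infinity>\<alpha>\<in>?M. norm (c' \<alpha>) * ?r \<alpha>) \<le> (\<Sum>\<^sub>\<infinity>\<alpha>\<in>?M. (\<Sum>\<^sub>\<infinity>i\<in>fib \<alpha>. norm (c i)) * ?r \<alpha>)"
    using has_sum_imp_summable[OF S1] by (intro infsum_mono sm' le)
  also have "\<dots> \<le> N" using infsumI[OF S1] N by simp
  finally have bound: "(\<Sum>\<^sub>\<infinity>\<alpha>\<in>?M. norm (c' \<alpha>) * ?r \<alpha>) \<le> N" .
  have "((\<lambda>\<alpha>. c' \<alpha> * monom_eval k (\<lambda>l. z l - a l) \<alpha>) has_sum P z) ?M"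
    if z: "\<forall>i<k. norm (z i - a i) \<le> \<rho>" for z
  proof -
    let ?m = "monom_eval k (\<lambda>l. z l - a l)"
    have "((\<lambda>p. c (snd p) * ?m (e (snd p))) has_sum P z) (Sigma ?M fib)"
      using has_sum_reindex_bij_betw[OF bij, of "\<lambda>i. c i * ?m (e i)"] P z by simp
    then show ?thesis
    proof (rule has_sum_SigmaD)
      fix \<alpha>
      have "((\<lambda>i. c i * ?m \<alpha>) has_sum c' \<alpha> * ?m \<alpha>) (fib \<alpha>)"
        unfolding c'_def using has_sum_cmult_left[OF has_sum_infsum[OF fib_c]] .
      then show "((\<lambda>i. c (snd (\<alpha>, i)) * ?m (e (snd (\<alpha>, i)))) has_sum c' \<alpha> * ?m \<alpha>) (fib \<alpha>)"
        by (rule has_sum_cong[THEN iffD1, rotated]) (auto simp: fib_def)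
    qed
  qed
  then show ?thesis
    unfolding abs_series_def using sm' bound by blast
qed

lemma abs_series_mono: "abs_series k a \<rho> P N \<Longrightarrow> N \<le> N' \<Longrightarrow> abs_series k a \<rho> P N'"
  unfolding abs_series_def by (meson order_trans)

lemma abs_series_const:
  assumes "0 < \<rho>"
  shows "abs_series k a \<rho> (\<lambda>_. c) (norm c)"
  by (rule abs_series_collect[where I = "{()}" and e = "\<lambda>_ _. 0" and c = "\<lambda>_. c"])
    (use assms in \<open>auto intro!: has_sum_finiteI\<close>)

lemma abs_series_shift:
  assumes rho: "0 < \<rho>" and P: "abs_series k a \<rho> P N" and \<beta>: "\<beta> \<in> multi_indices k"
  shows "abs_series k a \<rho> (\<lambda>z. monom_eval k (\<lambda>i. z i - a i) \<beta> * P z) (monom_eval k (\<lambda>_. \<rho>) \<beta> * N)"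
proof -
  from P obtain c where c: "(\<lambda>\<alpha>. norm (c \<alpha>) * monom_eval k (\<lambda>_. \<rho>) \<alpha>) summable_on multi_indices k"
     "(\<Sum>\<^sub>\<infinity>\<alpha>\<in>multi_indices k. norm (c \<alpha>) * monom_eval k (\<lambda>_. \<rho>) \<alpha>) \<le> N"
     "\<And>z. (\<forall>i<k. norm (z i - a i) \<le> \<rho>) \<Longrightarrow>
        ((\<lambda>\<alpha>. c \<alpha> * monom_eval k (\<lambda>i. z i - a i) \<alpha>) has_sum P z) (multi_indices k)"
    unfolding abs_series_def by auto
  have eq: "c \<alpha> * monom_eval k z (\<lambda>i. \<beta> i + \<alpha> i) = monom_eval k z \<beta> * (c \<alpha> * monom_eval k z \<alpha>)" for z \<alpha>
    by (simp add: monom_eval_add mult_ac)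
  have eq': "norm (c \<alpha>) * monom_eval k z (\<lambda>i. \<beta> i + \<alpha> i) = monom_eval k z \<beta> * (norm (c \<alpha>) * monom_eval k z \<alpha>)" for z \<alpha>
    by (simp add: monom_eval_add mult_ac)
  show ?thesis
  proof (rule abs_series_collect[where I = "multi_indices k" and e = "\<lambda>\<alpha> i. \<beta> i + \<alpha> i" and c = c])
    show "(\<lambda>i. \<beta> i + \<alpha> i) \<in> multi_indices k" if "\<alpha> \<in> multi_indices k" for \<alpha>
      using that \<beta> by (simp add: multi_indices_def)
    show "(\<lambda>\<alpha>. norm (c \<alpha>) * monom_eval k (\<lambda>_. \<rho>) (\<lambda>i. \<beta> i + \<alpha> i)) summable_on multi_indices k"
      unfolding eq' by (rule summable_on_cmult_right) (rule c)
    show "(\<Sum>\<^sub>\<infinity>\<alpha>\<in>multi_indices k. norm (c \<alpha>) * monom_eval k (\<lambda>_. \<rho>) (\<lambda>i. \<beta> i + \<alpha> i))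
        \<le> monom_eval k (\<lambda>_. \<rho>) \<beta> * N"
      unfolding eq' infsum_cmult_right'
      using c(2) monom_eval_pos[OF rho, of k \<beta>] by (intro mult_left_mono) auto
  qed (use rho c(3) in \<open>auto simp: eq intro!: has_sum_cmult_right\<close>)
qed

lemma abs_series_coordinate:
  assumes "0 < \<rho>" "j < k"
  shows "abs_series k a \<rho> (\<lambda>z. z j - a j) \<rho>"
proof -
  have m: "monom_eval k z (\<lambda>i. if i = j then 1 else 0) = z j" for z :: "nat \<Rightarrow> 'b::comm_monoid_mult"
  proof -
    have "monom_eval k z (\<lambda>i. if i = j then 1 else 0) = (\<Prod>i<k. if i = j then z i else 1)"
      unfolding monom_eval_def by (intro prod.cong) auto
    then show ?thesis using assms(2) by simp
  qed
  show ?thesis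
    using abs_series_shift[OF assms(1) abs_series_const[OF assms(1), of k a 1], of "\<lambda>i. if i = j then 1 else 0"] assms(2)
    by (simp add: m multi_indices_def)
qed

lemma abs_series_infsum:
  assumes rho: "0 < \<rho>" and P: "\<And>j. j \<in> J \<Longrightarrow> abs_series k a \<rho> (P j) (N j)"
    and sm: "(\<lambda>j. norm (b j) * N j) summable_on J" and M: "(\<Sum>\<^sub>\<infinity>j\<in>J. norm (b j) * N j) \<le> M"
    and Q: "\<And>z. (\<And>i. i < k \<Longrightarrow> norm (z i - a i) \<le> \<rho>) \<Longrightarrow> ((\<lambda>j. b j * P j z) has_sum Q z) J"
  shows "abs_series k a \<rho> Q M"
proof -
  let ?M = "multi_indices k" and ?r = "monom_eval k (\<lambda>_. \<rho>)"
  have "\<forall>j\<in>J. \<exists>c. (\<lambda>\<alpha>. norm (c \<alpha>) * ?r \<alpha>) summable_on ?M \<and>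
     (\<Sum>\<^sub>\<infinity>\<alpha>\<in>?M. norm (c \<alpha>) * ?r \<alpha>) \<le> N j \<and>
     (\<forall>z. (\<forall>i<k. norm (z i - a i) \<le> \<rho>) \<longrightarrow>
        ((\<lambda>\<alpha>. c \<alpha> * monom_eval k (\<lambda>i. z i - a i) \<alpha>) has_sum P j z) ?M)"
    using P unfolding abs_series_def by blast
  then obtain c where c: "\<And>j. j \<in> J \<Longrightarrow> (\<lambda>\<alpha>. norm (c j \<alpha>) * ?r \<alpha>) summable_on ?M"
     "\<And>j. j \<in> J \<Longrightarrow> (\<Sum>\<^sub>\<infinity>\<alpha>\<in>?M. norm (c j \<alpha>) * ?r \<alpha>) \<le> N j"
     "\<And>j z. j \<in> J \<Longrightarrow> (\<forall>i<k. norm (z i - a i) \<le> \<rho>) \<Longrightarrow>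
        ((\<lambda>\<alpha>. c j \<alpha> * monom_eval k (\<lambda>i. z i - a i) \<alpha>) has_sum P j z) ?M"
    by (auto dest!: bchoice)
  define C where "C = (\<lambda>(j, \<alpha>). b j * c j \<alpha>)"
  define n where "n j = (\<Sum>\<^sub>\<infinity>\<alpha>\<in>?M. norm (c j \<alpha>) * ?r \<alpha>)" for j
  have n0: "0 \<le> n j" for j
    unfolding n_def using monom_eval_pos[OF rho] by (intro infsum_nonneg) (simp add: less_imp_le)
  have in1: "((\<lambda>\<alpha>. norm (C (j, \<alpha>)) * ?r \<alpha>) has_sum norm (b j) * n j) ?M" if "j \<in> J" for j
    using has_sum_cmult_right[OF has_sum_infsum[OF c(1)[OF that]], of "norm (b j)"]
    by (simp add: C_def n_def norm_mult mult_ac)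
  have le: "norm (b j) * n j \<le> norm (b j) * N j" if "j \<in> J" for j
    using c(2)[OF that] by (intro mult_left_mono) (auto simp: n_def)
  have sm_n: "(\<lambda>j. norm (b j) * n j) summable_on J"
  proof -
    have "(\<lambda>j. norm (norm (b j) * n j)) summable_on J"
      using le n0 by (intro Infinite_Sum.abs_summable_on_comparison_test'[OF sm]) (simp add: abs_mult)
    then show ?thesis by (rule abs_summable_summable)
  qed
  have smS: "(\<lambda>p. norm (C p) * ?r (snd p)) summable_on Sigma J (\<lambda>_. ?M)"
  proof (rule summable_on_SigmaI)
    show "((\<lambda>\<alpha>. norm (C (j, \<alpha>)) * ?r (snd (j, \<alpha>))) has_sum norm (b j) * n j) ?M" if "j \<in> J" for j
      using in1[OF that] by simp
  qed (use sm_n monom_eval_pos[OF rho] in \<open>auto simp: less_imp_le\<close>)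
  show ?thesis
  proof (rule abs_series_collect[where I = "Sigma J (\<lambda>_. ?M)" and e = snd and c = C])
    have "((\<lambda>j. norm (b j) * n j) has_sum (\<Sum>\<^sub>\<infinity>p\<in>Sigma J (\<lambda>_. ?M). norm (C p) * ?r (snd p))) J"
      by (rule has_sum_SigmaD[OF has_sum_infsum[OF smS]]) (use in1 in auto)
    then have "(\<Sum>\<^sub>\<infinity>p\<in>Sigma J (\<lambda>_. ?M). norm (C p) * ?r (snd p)) = (\<Sum>\<^sub>\<infinity>j\<in>J. norm (b j) * n j)"
      by (simp add: infsumI)
    also have "\<dots> \<le> (\<Sum>\<^sub>\<infinity>j\<in>J. norm (b j) * N j)" by (intro infsum_mono sm_n sm le)
    finally show "(\<Sum>\<^sub>\<infinity>p\<in>Sigma J (\<lambda>_. ?M). norm (C p) * ?r (snd p)) \<le> M" using M by linarith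
  next
    fix z assume z: "\<And>i. i < k \<Longrightarrow> norm (z i - a i) \<le> \<rho>"
    let ?m = "monom_eval k (\<lambda>i. z i - a i)"
    show "((\<lambda>p. C p * ?m (snd p)) has_sum Q z) (Sigma J (\<lambda>_. ?M))"
    proof (rule has_sum_SigmaI)
      show "((\<lambda>j. b j * P j z) has_sum Q z) J" using Q z by blast
      show "((\<lambda>\<alpha>. C (j, \<alpha>) * ?m (snd (j, \<alpha>))) has_sum b j * P j z) ?M" if "j \<in> J" for j
        using has_sum_cmult_right[OF c(3)[OF that], of z "b j"] z by (simp add: C_def mult.assoc)
      have "norm (C p * ?m (snd p)) \<le> norm (C p) * ?r (snd p)" for p
        unfolding norm_mult by (intro mult_left_mono norm_monom_eval_le z) auto
      then have "(\<lambda>p. norm (C p * ?m (snd p))) summable_on Sigma J (\<lambda>_. ?M)"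
        by (intro Infinite_Sum.abs_summable_on_comparison_test'[OF smS]) auto
      then show "(\<lambda>p. C p * ?m (snd p)) summable_on Sigma J (\<lambda>_. ?M)"
        by (rule abs_summable_summable)
    qed
  qed (use rho smS in auto)
qed

lemma abs_series_norm_le:
  assumes "abs_series k a \<rho> P N" "\<And>i. i < k \<Longrightarrow> norm (z i - a i) \<le> \<rho>"
  shows "norm (P z) \<le> N"
proof -
  let ?M = "multi_indices k" and ?r = "monom_eval k (\<lambda>_. \<rho>)" and ?m = "monom_eval k (\<lambda>i. z i - a i)"
  from assms obtain c where c: "(\<lambda>\<alpha>. norm (c \<alpha>) * ?r \<alpha>) summable_on ?M"
     "(\<Sum>\<^sub>\<infinity>\<alpha>\<in>?M. norm (c \<alpha>) * ?r \<alpha>) \<le> N" "((\<lambda>\<alpha>. c \<alpha> * ?m \<alpha>) has_sum P z) ?M"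
    unfolding abs_series_def by blast
  have le: "norm (c \<alpha> * ?m \<alpha>) \<le> norm (c \<alpha>) * ?r \<alpha>" for \<alpha>
    unfolding norm_mult by (intro mult_left_mono norm_monom_eval_le assms) auto
  have sm: "(\<lambda>\<alpha>. norm (c \<alpha> * ?m \<alpha>)) summable_on ?M"
    using le by (intro Infinite_Sum.abs_summable_on_comparison_test'[OF c(1)])
  have "norm (P z) \<le> (\<Sum>\<^sub>\<infinity>\<alpha>\<in>?M. norm (c \<alpha> * ?m \<alpha>))"
    using norm_infsum_bound[OF sm] infsumI[OF c(3)] by simp
  also have "\<dots> \<le> (\<Sum>\<^sub>\<infinity>\<alpha>\<in>?M. norm (c \<alpha>) * ?r \<alpha>)"
    by (intro infsum_mono sm c(1) le)
  finally show ?thesis using c(2) by linarith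
qed

lemma abs_series_nonneg: "abs_series k a \<rho> P N \<Longrightarrow> 0 < \<rho> \<Longrightarrow> 0 \<le> N"
  by (rule order_trans[OF norm_ge_zero abs_series_norm_le[of k a \<rho> P N a]]) auto

lemma abs_series_mult:
  assumes rho: "0 < \<rho>" and P: "abs_series k a \<rho> P N" and Q: "abs_series k a \<rho> Q M"
  shows "abs_series k a \<rho> (\<lambda>z. P z * Q z) (N * M)"
proof -
  let ?M = "multi_indices k" and ?r = "monom_eval k (\<lambda>_. \<rho>)"
  from P obtain c where c: "(\<lambda>\<alpha>. norm (c \<alpha>) * ?r \<alpha>) summable_on ?M"
     "(\<Sum>\<^sub>\<infinity>\<alpha>\<in>?M. norm (c \<alpha>) * ?r \<alpha>) \<le> N"
     "\<And>z. (\<forall>i<k. norm (z i - a i) \<le> \<rho>) \<Longrightarrow>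
        ((\<lambda>\<alpha>. c \<alpha> * monom_eval k (\<lambda>i. z i - a i) \<alpha>) has_sum P z) ?M"
    unfolding abs_series_def by auto
  show ?thesis
  proof (rule abs_series_infsum[OF rho, of ?M])
    show "abs_series k a \<rho> (\<lambda>z. monom_eval k (\<lambda>i. z i - a i) \<beta> * Q z) (?r \<beta> * M)" if "\<beta> \<in> ?M" for \<beta>
      using abs_series_shift[OF rho Q that] .
    show "(\<lambda>\<beta>. norm (c \<beta>) * (?r \<beta> * M)) summable_on ?M"
      using summable_on_cmult_left[OF c(1), of M] by (simp add: mult.assoc)
    have "(\<Sum>\<^sub>\<infinity>\<beta>\<in>?M. norm (c \<beta>) * (?r \<beta> * M)) = (\<Sum>\<^sub>\<infinity>\<beta>\<in>?M. norm (c \<beta>) * ?r \<beta>) * M"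
      by (simp add: infsum_cmult_left' flip: mult.assoc)
    also have "\<dots> \<le> N * M" using c(2) abs_series_nonneg[OF Q rho] by (intro mult_right_mono) auto
    finally show "(\<Sum>\<^sub>\<infinity>\<beta>\<in>?M. norm (c \<beta>) * (?r \<beta> * M)) \<le> N * M" .
    show "((\<lambda>\<beta>. c \<beta> * (monom_eval k (\<lambda>i. z i - a i) \<beta> * Q z)) has_sum P z * Q z) ?M"
      if "\<And>i. i < k \<Longrightarrow> norm (z i - a i) \<le> \<rho>" for z
      using has_sum_cmult_left[OF c(3), of z "Q z"] that by (simp add: mult.assoc)
  qed
qed

lemma abs_series_add:
  assumes rho: "0 < \<rho>" and P: "abs_series k a \<rho> P N" and Q: "abs_series k a \<rho> Q M"
  shows "abs_series k a \<rho> (\<lambda>z. P z + Q z) (N + M)"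
  by (rule abs_series_infsum[OF rho, of "UNIV :: bool set" _ _ "\<lambda>b. if b then P else Q" "\<lambda>b. if b then N else M" "\<lambda>_. 1"])
    (use P Q in \<open>auto simp: UNIV_bool intro!: has_sum_finiteI\<close>)

lemma abs_series_monom:
  assumes rho: "0 < \<rho>" and P: "\<And>j. j < l \<Longrightarrow> abs_series k a \<rho> (P j) (N j)"
  shows "abs_series k a \<rho> (\<lambda>z. monom_eval l (\<lambda>j. P j z) \<alpha>) (monom_eval l N \<alpha>)"
proof -
  have pow: "abs_series k a \<rho> (\<lambda>z. P j z ^ n) (N j ^ n)" if "j < l" for j n
  proof (induction n)
    case 0
    then show ?case using abs_series_const[OF rho, of k a 1] by simp
  next
    case (Suc n)
    then show ?case using abs_series_mult[OF rho P[OF that] Suc] by simp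
  qed
  have "abs_series k a \<rho> (\<lambda>z. \<Prod>j<m. P j z ^ \<alpha> j) (\<Prod>j<m. N j ^ \<alpha> j)" if "m \<le> l" for m
    using that
  proof (induction m)
    case 0
    then show ?case using abs_series_const[OF rho, of k a 1] by simp
  next
    case (Suc m)
    then show ?case using abs_series_mult[OF rho Suc.IH pow[of m]] by simp
  qed
  then show ?thesis by (simp add: monom_eval_def)
qed

text \<open>
  Unconditional convergence in the open polydisc, evaluated at the positive point with all
  coordinates \<open>\<rho>\<close>, is absolute convergence.
\<close>

lemma has_sum_polydisc_abs:
  fixes c :: "(nat \<Rightarrow> nat) \<Rightarrow> complex"
  assumes F: "\<And>z. (\<And>i. i < k \<Longrightarrow> norm (z i - a i) < r) \<Longrightarrow>
      ((\<lambda>\<alpha>. c \<alpha> * monom_eval k (\<lambda>i. z i - a i) \<alpha>) has_sum F z) (multi_indices k)"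
    and "0 \<le> \<rho>" "\<rho> < r"
  shows "(\<lambda>\<alpha>. norm (c \<alpha>) * monom_eval k (\<lambda>_. \<rho>) \<alpha>) summable_on multi_indices k"
proof -
  have "(\<lambda>\<alpha>. c \<alpha> * monom_eval k (\<lambda>i. (a i + of_real \<rho>) - a i) \<alpha>) summable_on multi_indices k"
    using F[of "\<lambda>i. a i + of_real \<rho>"] assms(2,3) by (auto intro: has_sum_imp_summable)
  then have "(\<lambda>\<alpha>. norm (c \<alpha> * monom_eval k (\<lambda>i. of_real \<rho>) \<alpha>)) summable_on multi_indices k"
    by (subst (asm) summable_on_iff_abs_summable_on_complex) simp
  moreover have "norm (monom_eval k (\<lambda>i. of_real \<rho> :: complex) \<alpha>) = monom_eval k (\<lambda>_. \<rho>) \<alpha>" for \<alpha>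
    using assms(2) by (simp add: monom_eval_def norm_power flip: prod_norm)
  ultimately show ?thesis by (simp add: norm_mult)
qed

lemma holomorphic_near_iff_series:
  "holomorphic_near k F a \<longleftrightarrow> (\<exists>r>0. \<exists>c. \<forall>z. (\<forall>i<k. norm (z i - a i) < r) \<longrightarrow>
     ((\<lambda>\<alpha>. c \<alpha> * monom_eval k (\<lambda>i. z i - a i) \<alpha>) has_sum F z) (multi_indices k))"
  by (simp add: holomorphic_near_def monom_eval_def multi_indices_def)

lemma abs_series_imp_holomorphic_near:
  assumes "0 < \<rho>" "abs_series k a \<rho> F N"
  shows "holomorphic_near k F a"
  using assms unfolding abs_series_def holomorphic_near_iff_series by (meson less_imp_le)

lemma holomorphic_near_imp_abs_series:
  assumes "holomorphic_near k F a"
  obtains \<rho> N where "0 < \<rho>" "abs_series k a \<rho> F N"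
proof -
  from assms obtain r c where r: "0 < r" and F: "\<And>z. (\<And>i. i < k \<Longrightarrow> norm (z i - a i) < r) \<Longrightarrow>
      ((\<lambda>\<alpha>. c \<alpha> * monom_eval k (\<lambda>i. z i - a i) \<alpha>) has_sum F z) (multi_indices k)"
    unfolding holomorphic_near_iff_series by metis
  have "abs_series k a (r / 2) F (\<Sum>\<^sub>\<infinity>\<alpha>\<in>multi_indices k. norm (c \<alpha>) * monom_eval k (\<lambda>_. r / 2) \<alpha>)"
    unfolding abs_series_def
  proof (intro exI[of _ c] conjI allI impI order_refl)
    show "(\<lambda>\<alpha>. norm (c \<alpha>) * monom_eval k (\<lambda>_. r / 2) \<alpha>) summable_on multi_indices k"
      using has_sum_polydisc_abs[OF F, of r "r / 2"] r by auto
    show "((\<lambda>\<alpha>. c \<alpha> * monom_eval k (\<lambda>i. z i - a i) \<alpha>) has_sum F z) (multi_indices k)"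
      if z: "\<forall>i<k. norm (z i - a i) \<le> r / 2" for z
    proof (rule F)
      fix i assume "i < k"
      then have "norm (z i - a i) \<le> r / 2" using z by blast
      then show "norm (z i - a i) < r" using r by linarith
    qed
  qed
  then show ?thesis using that[of "r / 2"] r by simp
qed

text \<open>
  Every term except the constant one contains at least one factor of the radius, so that its bound
  shrinks at least linearly with the radius.
\<close>

lemma abs_series_shrink:
  assumes rho: "0 < \<rho>" and P: "abs_series k a \<rho> P N" and eps: "0 < \<epsilon>"
  shows "\<forall>\<^sub>F \<rho>' in at_right 0. abs_series k a \<rho>' (\<lambda>z. P z - P a) \<epsilon>"
proof -
  let ?M = "multi_indices k" and ?z = "\<lambda>_. 0 :: nat"
  from P obtain c where c: "(\<lambda>\<alpha>. norm (c \<alpha>) * monom_eval k (\<lambda>_. \<rho>) \<alpha>) summable_on ?M"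
     "(\<Sum>\<^sub>\<infinity>\<alpha>\<in>?M. norm (c \<alpha>) * monom_eval k (\<lambda>_. \<rho>) \<alpha>) \<le> N"
     "\<And>z. (\<forall>i<k. norm (z i - a i) \<le> \<rho>) \<Longrightarrow>
        ((\<lambda>\<alpha>. c \<alpha> * monom_eval k (\<lambda>i. z i - a i) \<alpha>) has_sum P z) ?M"
    unfolding abs_series_def by auto
  have nz: "\<exists>i<k. \<alpha> i \<noteq> 0" if M: "\<alpha> \<in> ?M" and N: "\<alpha> \<noteq> ?z" for \<alpha>
  proof -
    obtain i where i: "\<alpha> i \<noteq> 0" using N by (auto simp: fun_eq_iff)
    have "i < k"
    proof (rule ccontr)
      assume "\<not> i < k"
      then have "\<alpha> i = 0" using M by (simp add: multi_indices_def)
      then show False using i by contradiction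
    qed
    then show ?thesis using i by blast
  qed
  have "c \<alpha> * monom_eval k (\<lambda>i. a i - a i) \<alpha> = 0" if "\<alpha> \<in> ?M" "\<alpha> \<noteq> ?z" for \<alpha>
    using nz[OF that] by (auto simp: monom_eval_def intro!: prod_zero)
  then have "((\<lambda>\<alpha>. c \<alpha> * monom_eval k (\<lambda>i. a i - a i) \<alpha>) has_sum c ?z) ?M"
    by (intro has_sum_finite_neutralI[of "{?z}"]) auto
  moreover have "((\<lambda>\<alpha>. c \<alpha> * monom_eval k (\<lambda>i. a i - a i) \<alpha>) has_sum P a) ?M"
    using c(3)[of a] rho by simp
  ultimately have Pa: "P a = c ?z" using has_sum_unique by blast
  define c' where "c' = c(?z := 0)"
  have main: "abs_series k a \<rho>' (\<lambda>z. P z - P a) \<epsilon>" if r': "0 < \<rho>'" "\<rho>' \<le> \<rho>" "\<rho>' * N \<le> \<rho> * \<epsilon>" for \<rho>'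
  proof -
    have le: "norm (c' \<alpha>) * monom_eval k (\<lambda>_. \<rho>') \<alpha> \<le> (\<rho>' / \<rho>) * (norm (c \<alpha>) * monom_eval k (\<lambda>_. \<rho>) \<alpha>)"
      if a: "\<alpha> \<in> ?M" for \<alpha>
    proof (cases "\<alpha> = ?z")
      case True
      then show ?thesis using rho r' by (simp add: c'_def)
    next
      case False
      obtain i where i: "i < k" "\<alpha> i \<noteq> 0" using nz[OF a False] by blast
      have r1: "0 \<le> \<rho>' / \<rho>" "\<rho>' / \<rho> \<le> 1" using r' rho by auto
      have "monom_eval k (\<lambda>_. \<rho>') \<alpha> = monom_eval k (\<lambda>_. \<rho>) \<alpha> * (\<Prod>i<k. (\<rho>' / \<rho>) ^ \<alpha> i)"
        using rho by (simp add: monom_eval_def power_divide flip: prod.distrib)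
      also have "(\<Prod>i<k. (\<rho>' / \<rho>) ^ \<alpha> i) = (\<rho>' / \<rho>) ^ (\<Sum>i<k. \<alpha> i)" by (simp add: power_sum)
      also have "\<dots> \<le> (\<rho>' / \<rho>) ^ 1"
        using i member_le_sum[of i "{..<k}" \<alpha>] by (intro power_decreasing r1) auto
      finally have "monom_eval k (\<lambda>_. \<rho>') \<alpha> \<le> monom_eval k (\<lambda>_. \<rho>) \<alpha> * (\<rho>' / \<rho>)"
        using monom_eval_pos[OF rho, of k \<alpha>] by (simp add: mult_left_mono)
      then have "norm (c' \<alpha>) * monom_eval k (\<lambda>_. \<rho>') \<alpha> \<le> norm (c' \<alpha>) * (monom_eval k (\<lambda>_. \<rho>) \<alpha> * (\<rho>' / \<rho>))"
        by (intro mult_left_mono) auto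
      then show ?thesis using False by (simp add: c'_def mult_ac)
    qed
    have sm: "(\<lambda>\<alpha>. (\<rho>' / \<rho>) * (norm (c \<alpha>) * monom_eval k (\<lambda>_. \<rho>) \<alpha>)) summable_on ?M"
      by (rule summable_on_cmult_right) (rule c)
    have sm': "(\<lambda>\<alpha>. norm (c' \<alpha>) * monom_eval k (\<lambda>_. \<rho>') \<alpha>) summable_on ?M"
    proof -
      have "(\<lambda>\<alpha>. norm (norm (c' \<alpha>) * monom_eval k (\<lambda>_. \<rho>') \<alpha>)) summable_on ?M"
        using le monom_eval_pos[OF r'(1)] by (intro Infinite_Sum.abs_summable_on_comparison_test'[OF sm]) (simp add: abs_mult less_imp_le)
      then show ?thesis by (rule abs_summable_summable)
    qed
    have "(\<Sum>\<^sub>\<infinity>\<alpha>\<in>?M. norm (c' \<alpha>) * monom_eval k (\<lambda>_. \<rho>') \<alpha>)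
        \<le> (\<Sum>\<^sub>\<infinity>\<alpha>\<in>?M. (\<rho>' / \<rho>) * (norm (c \<alpha>) * monom_eval k (\<lambda>_. \<rho>) \<alpha>))"
      by (intro infsum_mono sm sm' le)
    also have "\<dots> \<le> (\<rho>' / \<rho>) * N"
      unfolding infsum_cmult_right' using c(2) rho r' by (intro mult_left_mono) auto
    also have "\<dots> \<le> \<epsilon>" using r'(3) rho by (simp add: field_simps)
    finally have "(\<Sum>\<^sub>\<infinity>\<alpha>\<in>?M. norm (c' \<alpha>) * monom_eval k (\<lambda>_. \<rho>') \<alpha>) \<le> \<epsilon>" .
    moreover have "((\<lambda>\<alpha>. c' \<alpha> * monom_eval k (\<lambda>i. z i - a i) \<alpha>) has_sum P z - P a) ?M"
      if z: "\<forall>i<k. norm (z i - a i) \<le> \<rho>'" for z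
    proof -
      have "((\<lambda>\<alpha>. c \<alpha> * monom_eval k (\<lambda>i. z i - a i) \<alpha>) has_sum P z) ?M"
        using c(3) z r'(2) by force
      moreover have "((\<lambda>\<alpha>. if \<alpha> = ?z then - c ?z else 0) has_sum - c ?z) ?M"
        by (intro has_sum_finite_neutralI[of "{?z}"]) auto
      ultimately have "((\<lambda>\<alpha>. c \<alpha> * monom_eval k (\<lambda>i. z i - a i) \<alpha> + (if \<alpha> = ?z then - c ?z else 0))
          has_sum P z + - c ?z) ?M" by (rule has_sum_add)
      moreover have "(\<lambda>\<alpha>. c \<alpha> * monom_eval k (\<lambda>i. z i - a i) \<alpha> + (if \<alpha> = ?z then - c ?z else 0))
          = (\<lambda>\<alpha>. c' \<alpha> * monom_eval k (\<lambda>i. z i - a i) \<alpha>)"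
        by (rule ext) (simp add: c'_def)
      ultimately show ?thesis by (simp add: Pa)
    qed
    ultimately show ?thesis unfolding abs_series_def using sm' by blast
  qed
  have N0: "0 \<le> N" using abs_series_nonneg[OF P rho] .
  define \<delta> where "\<delta> = min \<rho> (\<rho> * \<epsilon> / (N + 1))"
  have "0 < \<delta>" using rho eps N0 by (simp add: \<delta>_def)
  moreover have "abs_series k a \<rho>' (\<lambda>z. P z - P a) \<epsilon>" if "0 < \<rho>'" "\<rho>' < \<delta>" for \<rho>'
  proof (rule main)
    have "\<rho>' * (N + 1) \<le> \<rho> * \<epsilon>" using that N0 by (simp add: \<delta>_def field_simps)
    then show "\<rho>' * N \<le> \<rho> * \<epsilon>" using that by (simp add: algebra_simps)
  qed (use that in \<open>auto simp: \<delta>_def\<close>)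
  ultimately show ?thesis unfolding eventually_at_right_field by blast
qed

subsection \<open>Holomorphic functions near a point\<close>

lemma holomorphic_near_eventually:
  assumes "holomorphic_near k P a"
  shows "\<forall>\<^sub>F \<rho> in at_right 0. abs_series k a \<rho> P (norm (P a) + 1)"
proof -
  obtain \<rho>0 N where "0 < \<rho>0" "abs_series k a \<rho>0 P N"
    using holomorphic_near_imp_abs_series[OF assms] .
  from abs_series_shrink[OF this zero_less_one]
  have "\<forall>\<^sub>F \<rho> in at_right 0. abs_series k a \<rho> (\<lambda>z. P z - P a) 1" .
  with eventually_at_right_less show ?thesis
  proof eventually_elim
    case (elim \<rho>)
    then show ?case
      using abs_series_add[OF elim(1) abs_series_const[OF elim(1)] elim(2), of "P a"] by simp
  qed
qed

lemma eventually_at_right_0_witness: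
  assumes "\<forall>\<^sub>F \<rho> in at_right (0::real). Q \<rho>"
  obtains \<rho> where "0 < \<rho>" "Q \<rho>"
proof -
  from assms eventually_at_right_less have "\<forall>\<^sub>F \<rho> in at_right (0::real). 0 < \<rho> \<and> Q \<rho>"
    by eventually_elim simp
  then have "\<exists>\<rho>. 0 < \<rho> \<and> Q \<rho>" by (rule eventually_happens'[rotated]) simp
  then show ?thesis using that by blast
qed

lemma holomorphic_near_shrink:
  assumes "holomorphic_near k P a" "0 < \<epsilon>"
  shows "\<forall>\<^sub>F \<rho> in at_right 0. abs_series k a \<rho> (\<lambda>z. P z - P a) \<epsilon>"
proof -
  obtain \<rho>0 N where "0 < \<rho>0" "abs_series k a \<rho>0 P N"
    using holomorphic_near_imp_abs_series[OF assms(1)] .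
  from abs_series_shrink[OF this assms(2)] show ?thesis .
qed

lemma holomorphic_near_const [intro]: "holomorphic_near k (\<lambda>_. c) a"
  using abs_series_imp_holomorphic_near[OF zero_less_one abs_series_const] by simp

lemma holomorphic_near_mult [intro]:
  assumes "holomorphic_near k P a" "holomorphic_near k Q a"
  shows "holomorphic_near k (\<lambda>z. P z * Q z) a"
proof -
  from holomorphic_near_eventually[OF assms(1)] holomorphic_near_eventually[OF assms(2)]
  have "\<forall>\<^sub>F \<rho> in at_right 0. abs_series k a \<rho> P (norm (P a) + 1) \<and> abs_series k a \<rho> Q (norm (Q a) + 1)"
    by eventually_elim simp
  then obtain \<rho> where \<rho>: "0 < \<rho>" "abs_series k a \<rho> P (norm (P a) + 1) \<and> abs_series k a \<rho> Q (norm (Q a) + 1)"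
    by (rule eventually_at_right_0_witness)
  then show ?thesis
    by (intro abs_series_imp_holomorphic_near[OF \<rho>(1) abs_series_mult[OF \<rho>(1)]]) auto
qed

lemma holomorphic_near_add [intro]:
  assumes "holomorphic_near k P a" "holomorphic_near k Q a"
  shows "holomorphic_near k (\<lambda>z. P z + Q z) a"
proof -
  from holomorphic_near_eventually[OF assms(1)] holomorphic_near_eventually[OF assms(2)]
  have "\<forall>\<^sub>F \<rho> in at_right 0. abs_series k a \<rho> P (norm (P a) + 1) \<and> abs_series k a \<rho> Q (norm (Q a) + 1)"
    by eventually_elim simp
  then obtain \<rho> where \<rho>: "0 < \<rho>" "abs_series k a \<rho> P (norm (P a) + 1) \<and> abs_series k a \<rho> Q (norm (Q a) + 1)"
    by (rule eventually_at_right_0_witness)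
  then show ?thesis
    by (intro abs_series_imp_holomorphic_near[OF \<rho>(1) abs_series_add[OF \<rho>(1)]]) auto
qed

lemma holomorphic_near_coordinate:
  assumes "j < k"
  shows "holomorphic_near k (\<lambda>z. z j) a"
proof -
  have "holomorphic_near k (\<lambda>z. z j - a j) a"
    using abs_series_imp_holomorphic_near[OF zero_less_one abs_series_coordinate] assms by simp
  from holomorphic_near_add[OF this holomorphic_near_const[of k "a j"]] show ?thesis by simp
qed

lemma holomorphic_near_power: "holomorphic_near k P a \<Longrightarrow> holomorphic_near k (\<lambda>z. P z ^ n) a"
  by (induction n) auto

lemma holomorphic_near_prod:
  "(\<And>j. j \<in> J \<Longrightarrow> holomorphic_near k (P j) a) \<Longrightarrow> holomorphic_near k (\<lambda>z. \<Prod>j\<in>J. P j z) a"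
  by (induction J rule: infinite_finite_induct) auto

lemma holomorphic_near_sum:
  "(\<And>j. j \<in> J \<Longrightarrow> holomorphic_near k (P j) a) \<Longrightarrow> holomorphic_near k (\<lambda>z. \<Sum>j\<in>J. P j z) a"
  by (induction J rule: infinite_finite_induct) auto

lemma holomorphic_near_monom_eval:
  assumes "\<And>j. j < l \<Longrightarrow> holomorphic_near k (P j) a"
  shows "holomorphic_near k (\<lambda>z. monom_eval l (\<lambda>j. P j z) \<alpha>) a"
  unfolding monom_eval_def using assms by (intro holomorphic_near_prod holomorphic_near_power) auto

text \<open>
  A geometric series in \<open>1 - P / P a\<close>, which has small norm on a small polydisc.
\<close>

lemma holomorphic_near_inverse:
  assumes P: "holomorphic_near k P a" and nz: "P a \<noteq> 0"
  shows "holomorphic_near k (\<lambda>z. inverse (P z)) a"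
proof -
  have "0 < norm (P a) / 2" using nz by simp
  from holomorphic_near_shrink[OF P this] obtain \<rho>
    where \<rho>: "0 < \<rho>" and Q: "abs_series k a \<rho> (\<lambda>z. P z - P a) (norm (P a) / 2)"
    by (rule eventually_at_right_0_witness)
  define g where "g z = - inverse (P a) * (P z - P a)" for z
  have g: "abs_series k a \<rho> g (1 / 2)"
    using abs_series_mult[OF \<rho> abs_series_const[OF \<rho>, of _ _ "- inverse (P a)"] Q] nz
    by (simp add: g_def[abs_def] norm_inverse)
  have gn: "abs_series k a \<rho> (\<lambda>z. g z ^ n) ((1 / 2) ^ n)" for n
    using abs_series_monom[OF \<rho>, of 1 k a "\<lambda>_. g" "\<lambda>_. 1 / 2" "\<lambda>_. n"] g
    by (simp add: monom_eval_def lessThan_Suc)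
  have half: "((\<lambda>n. (1 / 2 :: real) ^ n) has_sum 2) UNIV"
    using geometric_sums[of "1 / 2 :: real"] summable_geometric[of "1 / 2 :: real"]
    by (intro norm_summable_imp_has_sum) (simp_all add: power_divide norm_power)
  have "abs_series k a \<rho> (\<lambda>z. inverse (P z)) (norm (inverse (P a)) * 2)"
  proof (rule abs_series_infsum[OF \<rho> gn, where J = UNIV and b = "\<lambda>_. inverse (P a)"])
    show "(\<lambda>n. norm (inverse (P a)) * (1 / 2) ^ n) summable_on UNIV"
      using half by (intro summable_on_cmult_right) (rule has_sum_imp_summable)
    show "(\<Sum>\<^sub>\<infinity>n. norm (inverse (P a)) * (1 / 2) ^ n) \<le> norm (inverse (P a)) * 2"
      unfolding infsum_cmult_right' infsumI[OF half] ..
  next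
    fix z assume "\<And>i. i < k \<Longrightarrow> norm (z i - a i) \<le> \<rho>"
    then have gz: "norm (g z) \<le> 1 / 2" by (rule abs_series_norm_le[OF g])
    then have "norm (g z) < 1" by simp
    then have "((\<lambda>n. g z ^ n) has_sum (1 / (1 - g z))) UNIV"
      using geometric_sums[of "g z"] summable_geometric[of "norm (g z)"]
      by (intro norm_summable_imp_has_sum) (simp_all add: norm_power)
    moreover have "1 - g z = P z / P a" using nz by (simp add: g_def field_simps)
    ultimately have "((\<lambda>n. g z ^ n) has_sum (P a / P z)) UNIV" by simp
    from has_sum_cmult_right[OF this, of "inverse (P a)"] nz
    show "((\<lambda>n. inverse (P a) * g z ^ n) has_sum inverse (P z)) UNIV"
      by (simp add: field_simps)
  qed
  then show ?thesis using abs_series_imp_holomorphic_near[OF \<rho>] by blast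
qed

text \<open>
  Substituting series of norm at most \<open>r'\<close> into an expansion that converges absolutely at radius
  \<open>r'\<close>.
\<close>

lemma abs_series_compose:
  assumes rho: "0 < \<rho>" and r: "0 \<le> r'" "r' < r"
    and F: "\<And>w. (\<And>j. j < l \<Longrightarrow> norm (w j - w0 j) < r) \<Longrightarrow>
      ((\<lambda>\<alpha>. c \<alpha> * monom_eval l (\<lambda>j. w j - w0 j) \<alpha>) has_sum F w) (multi_indices l)"
    and P: "\<And>j. j < l \<Longrightarrow> abs_series k a \<rho> (\<lambda>z. P j z - w0 j) r'"
  shows "\<exists>N. abs_series k a \<rho> (\<lambda>z. F (\<lambda>j. P j z)) N"
proof
  show "abs_series k a \<rho> (\<lambda>z. F (\<lambda>j. P j z))
    (\<Sum>\<^sub>\<infinity>\<alpha>\<in>multi_indices l. norm (c \<alpha>) * monom_eval l (\<lambda>_. r') \<alpha>)"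
  proof (rule abs_series_infsum[OF rho abs_series_monom[OF rho, where l = l and P = "\<lambda>j z. P j z - w0 j" and N = "\<lambda>_. r'"]])
    show "abs_series k a \<rho> (\<lambda>z. P j z - w0 j) r'" if "j < l" for j using P[OF that] .
    show "(\<lambda>\<alpha>. norm (c \<alpha>) * monom_eval l (\<lambda>_. r') \<alpha>) summable_on multi_indices l"
      by (rule has_sum_polydisc_abs[OF F r])
    show "((\<lambda>\<alpha>. c \<alpha> * monom_eval l (\<lambda>j. P j z - w0 j) \<alpha>) has_sum F (\<lambda>j. P j z)) (multi_indices l)"
      if z: "\<And>i. i < k \<Longrightarrow> norm (z i - a i) \<le> \<rho>" for z
    proof (rule F)
      fix j assume "j < l"
      then have "norm (P j z - w0 j) \<le> r'" using abs_series_norm_le[OF P] z by blast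
      then show "norm (P j z - w0 j) < r" using r by linarith
    qed
  qed auto
qed

lemma holomorphic_near_compose:
  assumes F: "holomorphic_near l F (\<lambda>j. P j a)"
    and P: "\<And>j. j < l \<Longrightarrow> holomorphic_near k (P j) a"
  shows "holomorphic_near k (\<lambda>z. F (\<lambda>j. P j z)) a"
proof -
  from F obtain r c where r: "0 < r" and c: "\<And>w. (\<And>j. j < l \<Longrightarrow> norm (w j - P j a) < r) \<Longrightarrow>
      ((\<lambda>\<alpha>. c \<alpha> * monom_eval l (\<lambda>j. w j - P j a) \<alpha>) has_sum F w) (multi_indices l)"
    unfolding holomorphic_near_iff_series by metis
  have "\<forall>\<^sub>F \<rho> in at_right 0. \<forall>j\<in>{..<l}. abs_series k a \<rho> (\<lambda>z. P j z - P j a) (r / 2)"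
    using holomorphic_near_shrink[OF P] r by (intro eventually_ball_finite) auto
  then obtain \<rho> where \<rho>: "0 < \<rho>" "\<forall>j\<in>{..<l}. abs_series k a \<rho> (\<lambda>z. P j z - P j a) (r / 2)"
    by (rule eventually_at_right_0_witness)
  have "\<exists>N. abs_series k a \<rho> (\<lambda>z. F (\<lambda>j. P j z)) N"
    by (rule abs_series_compose[OF \<rho>(1) _ _ c, of "r / 2"]) (use r \<rho>(2) in auto)
  then show ?thesis using abs_series_imp_holomorphic_near[OF \<rho>(1)] by blast
qed

text \<open>
  Re-expansion at a nearby centre is the composition with a translation.
\<close>

lemma holomorphic_near_nearby:
  assumes "holomorphic_near k F a"
  obtains \<delta> where "0 < \<delta>" "\<And>b. (\<And>i. i < k \<Longrightarrow> norm (b i - a i) < \<delta>) \<Longrightarrow> holomorphic_near k F b"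
proof -
  from assms obtain r c where r: "0 < r" and c: "\<And>w. (\<And>j. j < k \<Longrightarrow> norm (w j - a j) < r) \<Longrightarrow>
      ((\<lambda>\<alpha>. c \<alpha> * monom_eval k (\<lambda>j. w j - a j) \<alpha>) has_sum F w) (multi_indices k)"
    unfolding holomorphic_near_iff_series by metis
  have r4: "0 < r / 4" using r by simp
  have "holomorphic_near k F b" if b: "\<And>i. i < k \<Longrightarrow> norm (b i - a i) < r / 4" for b
  proof -
    have "abs_series k b (r / 4) (\<lambda>z. z j - a j) (r / 2)" if "j < k" for j
    proof -
      have "abs_series k b (r / 4) (\<lambda>z. (z j - b j) + (b j - a j)) (r / 4 + norm (b j - a j))"
        by (rule abs_series_add[OF r4 abs_series_coordinate[OF r4 that] abs_series_const[OF r4]])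
      then have "abs_series k b (r / 4) (\<lambda>z. z j - a j) (r / 4 + norm (b j - a j))" by simp
      then show ?thesis by (rule abs_series_mono) (use b[OF that] in simp)
    qed
    then have "\<exists>N. abs_series k b (r / 4) (\<lambda>z. F (\<lambda>j. z j)) N"
      by (intro abs_series_compose[OF r4 _ _ c, of "r / 2"]) (use r in auto)
    then show ?thesis using abs_series_imp_holomorphic_near[OF r4] by auto
  qed
  with r4 show ?thesis by (rule that)
qed

lemma holomorphic_near_continuous:
  assumes "holomorphic_near k F a" "0 < \<epsilon>"
  obtains \<delta> where "0 < \<delta>" "\<And>z. (\<And>i. i < k \<Longrightarrow> norm (z i - a i) < \<delta>) \<Longrightarrow> norm (F z - F a) < \<epsilon>"
proof -
  have "0 < \<epsilon> / 2" using assms by simp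
  from holomorphic_near_shrink[OF assms(1) this] obtain \<rho>
    where \<rho>: "0 < \<rho>" and Q: "abs_series k a \<rho> (\<lambda>z. F z - F a) (\<epsilon> / 2)"
    by (rule eventually_at_right_0_witness)
  have "norm (F z - F a) < \<epsilon>" if "\<And>i. i < k \<Longrightarrow> norm (z i - a i) < \<rho>" for z
  proof -
    have "norm (F z - F a) \<le> \<epsilon> / 2"
      by (rule abs_series_norm_le[OF Q]) (use that in \<open>simp add: less_imp_le\<close>)
    then show ?thesis using assms(2) by linarith
  qed
  with \<rho> show ?thesis by (rule that)
qed

text \<open>A subseries whose exponents are all at least \<open>\<beta>\<close> may be divided by the monomial \<open>\<beta>\<close>.\<close>

lemma holomorphic_near_subseries:
  assumes F: "\<And>z. (\<And>i. i < k \<Longrightarrow> norm (z i - a i) < r) \<Longrightarrow>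
      ((\<lambda>\<alpha>. c \<alpha> * monom_eval k (\<lambda>i. z i - a i) \<alpha>) has_sum F z) (multi_indices k)"
    and r: "0 < r" and A: "A \<subseteq> multi_indices k" "\<And>\<alpha> i. \<alpha> \<in> A \<Longrightarrow> i < k \<Longrightarrow> \<beta> i \<le> \<alpha> i"
  shows "holomorphic_near k (\<lambda>z. \<Sum>\<^sub>\<infinity>\<alpha>\<in>A. c \<alpha> * monom_eval k (\<lambda>i. z i - a i) (\<lambda>i. \<alpha> i - \<beta> i)) a"
proof -
  let ?\<rho> = "r / 2" and ?e = "\<lambda>\<alpha> i. \<alpha> i - \<beta> i :: nat"
  let ?r = "monom_eval k (\<lambda>_. ?\<rho>)"
  have \<rho>: "0 < ?\<rho>" using r by simp
  have eq: "monom_eval k z (?e \<alpha>) * monom_eval k z \<beta> = monom_eval k z \<alpha>"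
    if "\<alpha> \<in> A" for \<alpha> and z :: "nat \<Rightarrow> real"
    unfolding monom_eval_def prod.distrib[symmetric] power_add[symmetric]
    using A(2)[OF that] by (intro prod.cong) auto
  have "(\<lambda>\<alpha>. norm (c \<alpha>) * ?r \<alpha>) summable_on A"
    by (rule summable_on_subset_banach[OF has_sum_polydisc_abs[OF F]]) (use r A in auto)
  then have "(\<lambda>\<alpha>. norm (c \<alpha>) * ?r (?e \<alpha>) * ?r \<beta>) summable_on A"
    by (rule summable_on_cong[THEN iffD1, rotated]) (simp add: eq mult.assoc)
  then have sm: "(\<lambda>\<alpha>. norm (c \<alpha>) * ?r (?e \<alpha>)) summable_on A"
    using monom_eval_pos[OF \<rho>, of k \<beta>] by (simp add: summable_on_cmult_left')
  show ?thesis
  proof (rule abs_series_imp_holomorphic_near[OF \<rho> abs_series_collect[OF \<rho> _ sm order_refl]])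
    show "?e \<alpha> \<in> multi_indices k" if "\<alpha> \<in> A" for \<alpha>
      using that A(1) by (auto simp: multi_indices_def)
    show "((\<lambda>\<alpha>. c \<alpha> * monom_eval k (\<lambda>i. z i - a i) (?e \<alpha>)) has_sum
       (\<Sum>\<^sub>\<infinity>\<alpha>\<in>A. c \<alpha> * monom_eval k (\<lambda>i. z i - a i) (?e \<alpha>))) A"
      if z: "\<And>i. i < k \<Longrightarrow> norm (z i - a i) \<le> ?\<rho>" for z
    proof (rule has_sum_infsum)
      have "norm (c \<alpha> * monom_eval k (\<lambda>i. z i - a i) (?e \<alpha>)) \<le> norm (c \<alpha>) * ?r (?e \<alpha>)" for \<alpha>
        unfolding norm_mult by (intro mult_left_mono norm_monom_eval_le z) auto
      then have "(\<lambda>\<alpha>. norm (c \<alpha> * monom_eval k (\<lambda>i. z i - a i) (?e \<alpha>))) summable_on A"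
        by (intro Infinite_Sum.abs_summable_on_comparison_test'[OF sm]) auto
      then show "(\<lambda>\<alpha>. c \<alpha> * monom_eval k (\<lambda>i. z i - a i) (?e \<alpha>)) summable_on A"
        by (rule abs_summable_summable)
    qed
  qed
qed

section \<open>Nowhere vanishing series with weights\<close>

lemma summable_on_comparison:
  fixes f :: "'a \<Rightarrow> complex"
  assumes "M summable_on A" "\<And>x. x \<in> A \<Longrightarrow> norm (f x) \<le> M x"
  shows "f summable_on A"
  by (rule abs_summable_summable, rule Infinite_Sum.abs_summable_on_comparison_test'[OF assms])

lemma infsum_power_series_unit_disc:
  fixes b :: "'a \<Rightarrow> complex" and n :: "'a \<Rightarrow> nat"
  assumes b: "(\<lambda>\<alpha>. norm (b \<alpha>)) summable_on J"
  defines "f \<equiv> \<lambda>s. \<Sum>\<^sub>\<infinity>\<alpha>\<in>J. b \<alpha> * s ^ n \<alpha>"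
  shows "continuous_on (cball 0 1) f" "f holomorphic_on ball 0 1"
    "f 0 = (\<Sum>\<^sub>\<infinity>\<alpha>\<in>{\<alpha>\<in>J. n \<alpha> = 0}. b \<alpha>)"
proof -
  have lim: "uniform_limit (cball 0 1) (\<lambda>F s. \<Sum>\<alpha>\<in>F. b \<alpha> * s ^ n \<alpha>) f (finite_subsets_at_top J)"
    unfolding f_def
    by (rule Weierstrass_m_test_general[OF _ b])
      (auto simp: norm_mult norm_power intro!: mult_left_le power_le_one)
  have "\<forall>\<^sub>F F in finite_subsets_at_top J. continuous_on (cball 0 1) (\<lambda>s. \<Sum>\<alpha>\<in>F. b \<alpha> * s ^ n \<alpha>) \<and>
      (\<lambda>s. \<Sum>\<alpha>\<in>F. b \<alpha> * s ^ n \<alpha>) holomorphic_on ball 0 1"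
    by (intro always_eventually allI conjI continuous_intros holomorphic_intros)
  from holomorphic_uniform_limit[OF this lim]
  show "continuous_on (cball 0 1) f" "f holomorphic_on ball 0 1" by auto
  have "f 0 = (\<Sum>\<^sub>\<infinity>\<alpha>\<in>J. if n \<alpha> = 0 then b \<alpha> else 0)"
    unfolding f_def by (intro infsum_cong) auto
  also have "\<dots> = (\<Sum>\<^sub>\<infinity>\<alpha>\<in>{\<alpha>\<in>J. n \<alpha> = 0}. b \<alpha>)"
    by (rule infsum_cong_neutral) auto
  finally show "f 0 = (\<Sum>\<^sub>\<infinity>\<alpha>\<in>{\<alpha>\<in>J. n \<alpha> = 0}. b \<alpha>)" .
qed

text \<open>
  The disc is arranged so that only its centre is in question: elsewhere the limit is known to
  have no zeros.
\<close>

lemma Hurwitz_at_0: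
  assumes hol: "\<And>n::nat. \<psi> n holomorphic_on ball 0 1" "\<phi> holomorphic_on ball 0 1"
    and lim: "uniform_limit (ball 0 1) \<psi> \<phi> sequentially"
    and nz: "\<And>n s. s \<in> ball 0 1 \<Longrightarrow> \<psi> n s \<noteq> 0" "\<And>s. s \<in> ball 0 1 \<Longrightarrow> s \<noteq> 0 \<Longrightarrow> \<phi> s \<noteq> 0"
  shows "\<phi> (0::complex) \<noteq> 0"
proof (cases "\<phi> constant_on ball 0 1")
  case True
  then have "\<phi> 0 = \<phi> (1 / 2)" unfolding constant_on_def by force
  then show ?thesis using nz(2)[of "1 / 2"] by simp
next
  case False
  show ?thesis
    by (rule Hurwitz_no_zeros[of "ball 0 1" \<psi> \<phi>])
      (use hol nz(1) False in \<open>auto intro: uniform_limit_on_subset[OF lim]\<close>)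
qed

lemma has_sum_diff:
  fixes f g :: "'a \<Rightarrow> complex"
  assumes "(f has_sum a) A" "(g has_sum b) A"
  shows "((\<lambda>x. f x - g x) has_sum a - b) A"
  using has_sum_add[OF assms(1), of "\<lambda>x. - g x" "- b"] assms(2) by (simp add: has_sum_uminus)

lemma exp_minus_nat_tendsto: "(\<lambda>n. exp (- real n) * B) \<longlonglongrightarrow> 0"
proof -
  have "(\<lambda>n. exp (- 1 :: real) ^ n) \<longlonglongrightarrow> 0" by (rule LIMSEQ_realpow_zero) auto
  then have "(\<lambda>n. exp (- real n)) \<longlonglongrightarrow> 0" by (simp flip: exp_of_nat_mult)
  from tendsto_mult_left_zero[OF this] show ?thesis .
qed

text \<open>
  The \<open>T \<alpha>\<close> are the terms of a normally convergent series on a connected set \<open>\<Omega>\<close> of logarithms.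
  Moving by \<open>\<zeta> *s dir g\<close> with \<open>Re \<zeta> \<le> 0\<close> keeps \<open>\<Omega>\<close> invariant and multiplies \<open>T \<alpha>\<close> by
  \<open>exp \<zeta> ^ w \<alpha> g\<close>; hence the sum is, along each direction, a power series in \<open>s = exp \<zeta>\<close> on the
  punctured unit disc. The model case is a power series in monomials on a toric variety, written
  in logarithmic coordinates.
\<close>

locale weighted_series =
  fixes \<Omega> :: "(complex ^ 'n::finite) set" and G :: "'g set" and dir :: "'g \<Rightarrow> complex ^ 'n"
    and I :: "'a set" and T :: "'a \<Rightarrow> complex ^ 'n \<Rightarrow> complex" and w :: "'a \<Rightarrow> 'g \<Rightarrow> nat" and M :: "'a \<Rightarrow> real"
  assumes finite_G: "finite G"
    and connected_\<Omega>: "connected \<Omega>"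
    and nonempty_\<Omega>: "\<Omega> \<noteq> {}"
    and dir_\<Omega>: "g \<in> G \<Longrightarrow> c \<in> \<Omega> \<Longrightarrow> Re \<zeta> \<le> 0 \<Longrightarrow> c + \<zeta> *s dir g \<in> \<Omega>"
    and T_dir: "\<alpha> \<in> I \<Longrightarrow> g \<in> G \<Longrightarrow> c \<in> \<Omega> \<Longrightarrow> Re \<zeta> \<le> 0 \<Longrightarrow>
      T \<alpha> (c + \<zeta> *s dir g) = exp (\<zeta> * of_nat (w \<alpha> g)) * T \<alpha> c"
    and T_cont: "\<alpha> \<in> I \<Longrightarrow> continuous_on \<Omega> (T \<alpha>)"
    and T_le: "\<alpha> \<in> I \<Longrightarrow> c \<in> \<Omega> \<Longrightarrow> norm (T \<alpha> c) \<le> M \<alpha>"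
    and M_summable: "M summable_on I"
    and nonzero: "c \<in> \<Omega> \<Longrightarrow> (\<Sum>\<^sub>\<infinity>\<alpha>\<in>I. T \<alpha> c) \<noteq> 0"
begin

definition part :: "'a set \<Rightarrow> complex ^ 'n \<Rightarrow> complex" where
  "part Q c = (\<Sum>\<^sub>\<infinity>\<alpha>\<in>I \<inter> Q. T \<alpha> c)"

definition null_part :: "'a set \<Rightarrow> bool" where
  "null_part Q \<longleftrightarrow> (\<forall>c\<in>\<Omega>. part Q c = 0)"

lemma M_summable_part: "M summable_on (I \<inter> Q)"
  by (rule summable_on_subset_banach[OF M_summable]) auto

lemma T_abs_summable: "c \<in> \<Omega> \<Longrightarrow> (\<lambda>\<alpha>. norm (T \<alpha> c)) summable_on (I \<inter> Q)"
  by (rule Infinite_Sum.abs_summable_on_comparison_test'[OF M_summable_part]) (use T_le in auto)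

lemma T_summable: "c \<in> \<Omega> \<Longrightarrow> (\<lambda>\<alpha>. T \<alpha> c) summable_on (I \<inter> Q)"
  by (rule abs_summable_summable) (rule T_abs_summable)

lemma part_cont: "continuous_on \<Omega> (part Q)"
proof (rule uniform_limit_theorem)
  show "uniform_limit \<Omega> (\<lambda>F c. \<Sum>\<alpha>\<in>F. T \<alpha> c) (part Q) (finite_subsets_at_top (I \<inter> Q))"
    unfolding part_def
    by (rule Weierstrass_m_test_general[OF _ M_summable_part]) (use T_le in auto)
  show "\<forall>\<^sub>F F in finite_subsets_at_top (I \<inter> Q). continuous_on \<Omega> (\<lambda>c. \<Sum>\<alpha>\<in>F. T \<alpha> c)"
    by (rule eventually_finite_subsets_at_top_weakI) (auto intro!: continuous_on_sum T_cont)
qed simp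

lemma part_Un: "c \<in> \<Omega> \<Longrightarrow> Q \<inter> R = {} \<Longrightarrow> part (Q \<union> R) c = part Q c + part R c"
  unfolding part_def Int_Un_distrib by (intro infsum_Un_disjoint T_summable) auto

lemma part_UNIV_nonzero: "c \<in> \<Omega> \<Longrightarrow> part UNIV c \<noteq> 0"
  using nonzero by (simp add: part_def)

text \<open>
  For \<open>s = exp \<zeta>\<close> this is \<open>s\<close> to the power \<open>-j\<close> times \<open>part Q (c + \<zeta> *s dir g)\<close>, provided that all
  weights in \<open>Q\<close> are at least \<open>j\<close>. Unlike that expression it makes sense for \<open>s = 0\<close>, where it
  picks out the terms of weight exactly \<open>j\<close>.
\<close>

definition slice :: "'a set \<Rightarrow> 'g \<Rightarrow> nat \<Rightarrow> complex ^ 'n \<Rightarrow> complex \<Rightarrow> complex" where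
  "slice Q g j c s = (\<Sum>\<^sub>\<infinity>\<alpha>\<in>I \<inter> Q. T \<alpha> c * s ^ (w \<alpha> g - j))"

lemma slice_cont: "c \<in> \<Omega> \<Longrightarrow> continuous_on (cball 0 1) (slice Q g j c)"
  and slice_holomorphic: "c \<in> \<Omega> \<Longrightarrow> slice Q g j c holomorphic_on ball 0 1"
  using infsum_power_series_unit_disc(1,2)[OF T_abs_summable[of c Q], where n = "\<lambda>\<alpha>. w \<alpha> g - j"]
  by (simp_all add: slice_def[abs_def])

lemma slice_0:
  assumes "c \<in> \<Omega>" "\<And>\<alpha>. \<alpha> \<in> Q \<Longrightarrow> j \<le> w \<alpha> g"
  shows "slice Q g j c 0 = part {\<alpha>\<in>Q. w \<alpha> g = j} c"
proof -
  have "{\<alpha> \<in> I \<inter> Q. w \<alpha> g - j = 0} = I \<inter> {\<alpha>\<in>Q. w \<alpha> g = j}" using assms(2) by force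
  then show ?thesis
    using infsum_power_series_unit_disc(3)[OF T_abs_summable[of c Q], where n = "\<lambda>\<alpha>. w \<alpha> g - j"] assms(1)
    by (simp add: slice_def part_def)
qed

lemma slice_nonzero_arg:
  assumes "c \<in> \<Omega>" "g \<in> G" "\<And>\<alpha>. \<alpha> \<in> Q \<Longrightarrow> j \<le> w \<alpha> g" "s \<noteq> 0" "norm s \<le> 1"
  shows "c + Ln s *s dir g \<in> \<Omega>" "s ^ j * slice Q g j c s = part Q (c + Ln s *s dir g)"
proof -
  have Re: "Re (Ln s) \<le> 0" using assms(4,5) by (simp add: Re_Ln)
  then show "c + Ln s *s dir g \<in> \<Omega>" using dir_\<Omega> assms by blast
  have "exp (Ln s * of_nat (w \<alpha> g)) = s ^ j * s ^ (w \<alpha> g - j)" if "\<alpha> \<in> Q" for \<alpha>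
    using assms(3)[OF that] assms(4) by (simp add: mult.commute[of "Ln s"] exp_of_nat_mult flip: power_add)
  then have "part Q (c + Ln s *s dir g) = (\<Sum>\<^sub>\<infinity>\<alpha>\<in>I \<inter> Q. s ^ j * (T \<alpha> c * s ^ (w \<alpha> g - j)))"
    unfolding part_def by (intro infsum_cong) (use T_dir[OF _ assms(2,1) Re] in auto)
  then show "s ^ j * slice Q g j c s = part Q (c + Ln s *s dir g)"
    by (simp add: slice_def infsum_cmult_right')
qed

text \<open>
  A power series that vanishes on the punctured disc has only zero coefficients; the coefficients
  are split off one after another as values at the centre.
\<close>

lemma null_part_level:
  assumes null: "null_part Q" and g: "g \<in> G"
  shows "null_part {\<alpha>\<in>Q. w \<alpha> g = j}"
proof -
  have step: "null_part {\<alpha>\<in>Q. w \<alpha> g = j}" if le: "null_part {\<alpha>\<in>Q. j \<le> w \<alpha> g}" for j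
    unfolding null_part_def
  proof
    fix c assume c: "c \<in> \<Omega>"
    let ?f = "slice {\<alpha>\<in>Q. j \<le> w \<alpha> g} g j c"
    have "?f s = 0" if "s \<in> cball 0 1 - {0}" for s
      using slice_nonzero_arg[OF c g, of "{\<alpha>\<in>Q. j \<le> w \<alpha> g}" j s] le that by (auto simp: null_part_def)
    moreover have "closure (ball 0 1 - {0::complex}) \<subseteq> cball 0 1"
      by (rule closure_minimal) auto
    moreover have "0 \<in> closure (ball 0 1 - {0::complex})"
      unfolding islimpt_in_closure[symmetric] by (simp add: islimpt_ball)
    ultimately have "?f 0 = 0"
      using continuous_constant_on_closure[of "ball 0 1 - {0}" ?f 0 0]
        continuous_on_subset[OF slice_cont[OF c]] by auto
    moreover have "{\<alpha> \<in> {\<alpha>\<in>Q. j \<le> w \<alpha> g}. w \<alpha> g = j} = {\<alpha>\<in>Q. w \<alpha> g = j}" by auto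
    ultimately show "part {\<alpha>\<in>Q. w \<alpha> g = j} c = 0"
      using slice_0[OF c, of "{\<alpha>\<in>Q. j \<le> w \<alpha> g}" j g] by simp
  qed
  have "null_part {\<alpha>\<in>Q. j \<le> w \<alpha> g}" for j
  proof (induction j)
    case 0
    then show ?case using null by simp
  next
    case (Suc j)
    have "{\<alpha>\<in>Q. j \<le> w \<alpha> g} = {\<alpha>\<in>Q. Suc j \<le> w \<alpha> g} \<union> {\<alpha>\<in>Q. w \<alpha> g = j}" by auto
    then have "part {\<alpha>\<in>Q. j \<le> w \<alpha> g} c = part {\<alpha>\<in>Q. Suc j \<le> w \<alpha> g} c + part {\<alpha>\<in>Q. w \<alpha> g = j} c"
      if "c \<in> \<Omega>" for c
      using part_Un[OF that, of "{\<alpha>\<in>Q. Suc j \<le> w \<alpha> g}" "{\<alpha>\<in>Q. w \<alpha> g = j}"] by force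
    then show ?case using Suc step[OF Suc] by (simp add: null_part_def)
  qed
  then show ?thesis by (rule step)
qed

definition same_weight :: "'a \<Rightarrow> 'a set" where
  "same_weight \<beta> = {\<alpha>. \<forall>g\<in>G. w \<alpha> g = w \<beta> g}"

definition support :: "'a set" where
  "support = {\<beta>\<in>I. \<not> null_part (same_weight \<beta>)}"

definition saturated :: "'a set \<Rightarrow> bool" where
  "saturated Q \<longleftrightarrow> (\<forall>\<alpha>\<in>Q. same_weight \<alpha> \<subseteq> Q)"

lemma null_part_same_weight:
  assumes "null_part Q" "saturated Q" "\<beta> \<in> Q"
  shows "null_part (same_weight \<beta>)"
proof -
  have "null_part {\<alpha>\<in>Q. \<forall>g\<in>F. w \<alpha> g = w \<beta> g}" if "finite F" "F \<subseteq> G" for F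
    using that
  proof (induction F)
    case empty
    then show ?case using assms(1) by simp
  next
    case (insert g F)
    then have "null_part {\<alpha> \<in> {\<alpha>\<in>Q. \<forall>g\<in>F. w \<alpha> g = w \<beta> g}. w \<alpha> g = w \<beta> g}"
      by (intro null_part_level) auto
    moreover have "{\<alpha> \<in> {\<alpha>\<in>Q. \<forall>g\<in>F. w \<alpha> g = w \<beta> g}. w \<alpha> g = w \<beta> g}
        = {\<alpha>\<in>Q. \<forall>g\<in>insert g F. w \<alpha> g = w \<beta> g}" by auto
    ultimately show ?case by simp
  qed
  from this[OF finite_G] have "null_part {\<alpha>\<in>Q. \<forall>g\<in>G. w \<alpha> g = w \<beta> g}" by blast
  moreover have "{\<alpha>\<in>Q. \<forall>g\<in>G. w \<alpha> g = w \<beta> g} = same_weight \<beta>"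
    using assms(2,3) by (auto simp: saturated_def same_weight_def)
  ultimately show ?thesis by simp
qed

text \<open>
  Grouping the terms by their weight vectors, the classes outside the support contribute nothing.
\<close>

lemma part_support:
  assumes c: "c \<in> \<Omega>" and sat: "saturated Q"
  shows "part Q c = part (Q \<inter> support) c"
proof -
  define J where "J = I \<inter> (Q - support)"
  define cls where "cls \<alpha> = restrict (w \<alpha>) G" for \<alpha>
  define fib where "fib v = {\<alpha>\<in>J. cls \<alpha> = v}" for v
  have bij: "bij_betw snd (Sigma (cls ` J) fib) J"
    by (rule bij_betwI[where g = "\<lambda>\<alpha>. (cls \<alpha>, \<alpha>)"]) (auto simp: fib_def)
  have "((\<lambda>\<alpha>. T \<alpha> c) has_sum part (Q - support) c) J"
    unfolding J_def part_def by (rule has_sum_infsum[OF T_summable[OF c]])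
  then have "((\<lambda>p. T (snd p) c) has_sum part (Q - support) c) (Sigma (cls ` J) fib)"
    using has_sum_reindex_bij_betw[OF bij, of "\<lambda>\<alpha>. T \<alpha> c"] by simp
  then have "((\<lambda>_. 0) has_sum part (Q - support) c) (cls ` J)"
  proof (rule has_sum_SigmaD)
    fix v assume "v \<in> cls ` J"
    then obtain \<beta> where \<beta>: "\<beta> \<in> J" "v = cls \<beta>" by blast
    have cls_eq: "cls \<alpha> = cls \<beta> \<longleftrightarrow> \<alpha> \<in> same_weight \<beta>" for \<alpha>
      by (auto simp: cls_def same_weight_def restrict_def fun_eq_iff)
    have sw: "same_weight \<alpha> = same_weight \<beta>" if "\<alpha> \<in> same_weight \<beta>" for \<alpha>
      using that by (auto simp: same_weight_def)
    have "fib v = I \<inter> same_weight \<beta>"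
    proof (intro equalityI subsetI)
      fix \<alpha> assume "\<alpha> \<in> fib v"
      then show "\<alpha> \<in> I \<inter> same_weight \<beta>"
        unfolding fib_def \<beta>(2) using cls_eq[of \<alpha>] by (simp add: J_def)
    next
      fix \<alpha> assume \<alpha>: "\<alpha> \<in> I \<inter> same_weight \<beta>"
      have "\<alpha> \<in> Q" using \<alpha> \<beta>(1) sat unfolding saturated_def J_def by blast
      moreover have "\<alpha> \<notin> support" using \<beta>(1) sw[of \<alpha>] \<alpha> unfolding J_def support_def by simp
      ultimately show "\<alpha> \<in> fib v"
        unfolding fib_def \<beta>(2) using cls_eq[of \<alpha>] \<alpha> by (simp add: J_def)
    qed
    then show "((\<lambda>\<alpha>. T (snd (v, \<alpha>)) c) has_sum 0) (fib v)"
      using has_sum_infsum[OF T_summable[OF c, of "same_weight \<beta>"]] \<beta>(1) c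
      by (simp add: J_def support_def null_part_def part_def)
  qed
  then have "infsum (\<lambda>_. 0) (cls ` J) = part (Q - support) c" by (rule infsumI)
  then have "part (Q - support) c = 0" by simp
  moreover have "part ((Q \<inter> support) \<union> (Q - support)) c = part (Q \<inter> support) c + part (Q - support) c"
    by (rule part_Un[OF c]) auto
  moreover have "(Q \<inter> support) \<union> (Q - support) = Q" by auto
  ultimately show ?thesis by simp
qed

lemma support_nonempty: "support \<noteq> {}"
proof
  assume "support = {}"
  moreover obtain c where c: "c \<in> \<Omega>" using nonempty_\<Omega> by blast
  ultimately show False
    using part_support[OF c, of UNIV] part_UNIV_nonzero[OF c] by (simp add: saturated_def part_def)
qed

text \<open>
  The minima for the individual directions need not be attained by a common term a priori; that
  they are is the point of \<open>part_at_min_nonzero\<close>.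
\<close>

definition min_weight :: "'g \<Rightarrow> nat" where
  "min_weight g = (LEAST j. j \<in> (\<lambda>\<alpha>. w \<alpha> g) ` support)"

definition at_least :: "'a set" where
  "at_least = {\<alpha>. \<forall>g\<in>G. min_weight g \<le> w \<alpha> g}"

definition at_min :: "'g set \<Rightarrow> 'a set" where
  "at_min F = {\<alpha>. \<forall>g\<in>F. w \<alpha> g = min_weight g}"

lemma support_at_least: "support \<subseteq> at_least"
  by (auto simp: at_least_def min_weight_def intro!: Least_le)

lemma saturated_at_least: "saturated at_least"
  and saturated_at_min: "F \<subseteq> G \<Longrightarrow> saturated (at_min F)"
  by (auto simp: saturated_def same_weight_def at_least_def at_min_def)

lemma saturated_Int: "saturated Q \<Longrightarrow> saturated R \<Longrightarrow> saturated (Q \<inter> R)"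
  by (auto simp: saturated_def)

lemma part_at_least: "c \<in> \<Omega> \<Longrightarrow> saturated Q \<Longrightarrow> part (at_least \<inter> Q) c = part Q c"
  using part_support[of c Q] part_support[of c "at_least \<inter> Q"] support_at_least
  by (simp add: saturated_Int saturated_at_least Int_absorb1 Int_assoc inf.absorb2 inf_commute inf_left_commute)

lemma not_null_at_min:
  assumes g: "g \<in> G"
  shows "\<not> null_part (at_min {g})"
proof
  assume null: "null_part (at_min {g})"
  have "min_weight g \<in> (\<lambda>\<alpha>. w \<alpha> g) ` support"
  proof -
    obtain \<beta>0 where "\<beta>0 \<in> support" using support_nonempty by blast
    then show ?thesis
      unfolding min_weight_def by (intro LeastI[of "\<lambda>j. j \<in> (\<lambda>\<alpha>. w \<alpha> g) ` support" "w \<beta>0 g"] imageI)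
  qed
  then obtain \<beta> where \<beta>: "\<beta> \<in> support" "w \<beta> g = min_weight g" by (elim imageE) simp
  then have "null_part (same_weight \<beta>)"
    using g by (intro null_part_same_weight[OF null] saturated_at_min) (auto simp: at_min_def)
  then show False using \<beta> by (simp add: support_def)
qed

lemma slice_at_least_nonzero:
  assumes "c \<in> \<Omega>" "g \<in> G" "s \<noteq> 0" "norm s \<le> 1" "F \<subseteq> G"
    and "\<And>c. c \<in> \<Omega> \<Longrightarrow> part (at_min F) c \<noteq> 0"
  shows "slice (at_least \<inter> at_min F) g (min_weight g) c s \<noteq> 0"
  using slice_nonzero_arg[OF assms(1,2), of "at_least \<inter> at_min F" "min_weight g" s] assms
    part_at_least[OF _ saturated_at_min[OF assms(5)]]
  by (auto simp: at_least_def)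

lemma slice_at_least_0:
  assumes "c \<in> \<Omega>" "g \<in> G" "F \<subseteq> G"
  shows "slice (at_least \<inter> at_min F) g (min_weight g) c 0 = part (at_min (insert g F)) c"
proof -
  have "slice (at_least \<inter> at_min F) g (min_weight g) c 0
      = part {\<alpha>\<in>at_least \<inter> at_min F. w \<alpha> g = min_weight g} c"
    using assms by (intro slice_0) (auto simp: at_least_def)
  also have "{\<alpha>\<in>at_least \<inter> at_min F. w \<alpha> g = min_weight g} = at_least \<inter> at_min (insert g F)"
    by (auto simp: at_min_def)
  finally show ?thesis using assms by (simp add: part_at_least saturated_at_min)
qed

lemma T_distance_tendsto:
  assumes c: "c \<in> \<Omega>" and cn: "\<And>n. cn n \<in> \<Omega>" "cn \<longlonglongrightarrow> c"
  shows "(\<lambda>n. \<Sum>\<^sub>\<infinity>\<alpha>\<in>I. norm (T \<alpha> (cn n) - T \<alpha> c)) \<longlonglongrightarrow> 0"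
proof -
  have le: "norm (norm (T \<alpha> c' - T \<alpha> c)) \<le> 2 * M \<alpha>" if "\<alpha> \<in> I" "c' \<in> \<Omega>" for \<alpha> c'
    using T_le[OF that(1,2)] T_le[OF that(1) c] norm_triangle_ineq4[of "T \<alpha> c'" "T \<alpha> c"] by simp
  have "continuous_on \<Omega> (\<lambda>c'. \<Sum>\<^sub>\<infinity>\<alpha>\<in>I. norm (T \<alpha> c' - T \<alpha> c))"
  proof (rule uniform_limit_theorem)
    show "uniform_limit \<Omega> (\<lambda>F c'. \<Sum>\<alpha>\<in>F. norm (T \<alpha> c' - T \<alpha> c))
      (\<lambda>c'. \<Sum>\<^sub>\<infinity>\<alpha>\<in>I. norm (T \<alpha> c' - T \<alpha> c)) (finite_subsets_at_top I)"
      by (rule Weierstrass_m_test_general[OF le summable_on_cmult_right[OF M_summable]])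
    show "\<forall>\<^sub>F F in finite_subsets_at_top I. continuous_on \<Omega> (\<lambda>c'. \<Sum>\<alpha>\<in>F. norm (T \<alpha> c' - T \<alpha> c))"
      by (rule eventually_finite_subsets_at_top_weakI) (auto intro!: continuous_intros T_cont)
  qed simp
  then have "(\<lambda>n. \<Sum>\<^sub>\<infinity>\<alpha>\<in>I. norm (T \<alpha> (cn n) - T \<alpha> c)) \<longlonglongrightarrow> (\<Sum>\<^sub>\<infinity>\<alpha>\<in>I. norm (T \<alpha> c - T \<alpha> c))"
    by (rule continuous_on_tendsto_compose[OF _ cn(2) c]) (simp add: cn)
  then show ?thesis by simp
qed

lemma slice_diff_le:
  assumes c: "c \<in> \<Omega>" "c' \<in> \<Omega>" and s: "norm s \<le> 1"
  shows "norm (slice Q g j c' s - slice Q g j c s) \<le> (\<Sum>\<^sub>\<infinity>\<alpha>\<in>I. norm (T \<alpha> c' - T \<alpha> c))"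
proof -
  have M': "norm (T \<alpha> c * s ^ n) \<le> M \<alpha>" if "\<alpha> \<in> I" "c \<in> \<Omega>" for \<alpha> c n
  proof -
    have "norm (T \<alpha> c) * norm s ^ n \<le> norm (T \<alpha> c) * 1"
      using s by (intro mult_left_mono power_le_one) auto
    then show ?thesis using T_le[OF that] by (simp add: norm_mult norm_power)
  qed
  have hs: "((\<lambda>\<alpha>. T \<alpha> c * s ^ (w \<alpha> g - j)) has_sum slice Q g j c s) (I \<inter> Q)" if "c \<in> \<Omega>" for c
    unfolding slice_def
    by (rule has_sum_infsum[OF summable_on_comparison[OF M_summable_part]]) (use M' that in auto)
  have "((\<lambda>\<alpha>. T \<alpha> c' * s ^ (w \<alpha> g - j) - T \<alpha> c * s ^ (w \<alpha> g - j)) has_sum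
      slice Q g j c' s - slice Q g j c s) (I \<inter> Q)"
    using hs[OF c(1)] hs[OF c(2)] by (intro has_sum_diff)
  moreover have sm: "(\<lambda>\<alpha>. norm (T \<alpha> c' - T \<alpha> c)) summable_on I \<inter> Q" for Q
  proof -
    have "(\<lambda>\<alpha>. norm (T \<alpha> c' - T \<alpha> c)) summable_on I"
    proof (rule Infinite_Sum.abs_summable_on_comparison_test'[OF summable_on_cmult_right[OF M_summable, of 2]])
      fix \<alpha> assume "\<alpha> \<in> I"
      then show "norm (T \<alpha> c' - T \<alpha> c) \<le> 2 * M \<alpha>"
        using T_le[of \<alpha> c] T_le[of \<alpha> c'] c norm_triangle_ineq4[of "T \<alpha> c'" "T \<alpha> c"] by simp
    qed
    then show ?thesis by (rule summable_on_subset_banach) auto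
  qed
  ultimately have "norm (slice Q g j c' s - slice Q g j c s) \<le> (\<Sum>\<^sub>\<infinity>\<alpha>\<in>I \<inter> Q. norm (T \<alpha> c' - T \<alpha> c))"
  proof (rule norm_infsum_le[OF _ has_sum_infsum])
    fix \<alpha>
    have "norm (T \<alpha> c' - T \<alpha> c) * norm s ^ (w \<alpha> g - j) \<le> norm (T \<alpha> c' - T \<alpha> c) * 1"
      using s by (intro mult_left_mono power_le_one) auto
    then show "norm (T \<alpha> c' * s ^ (w \<alpha> g - j) - T \<alpha> c * s ^ (w \<alpha> g - j)) \<le> norm (T \<alpha> c' - T \<alpha> c)"
      by (simp add: norm_mult norm_power flip: left_diff_distrib)
  qed
  also have "\<dots> \<le> (\<Sum>\<^sub>\<infinity>\<alpha>\<in>I. norm (T \<alpha> c' - T \<alpha> c))"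
    using sm[of Q] sm[of UNIV] by (intro infsum_mono2) auto
  finally show ?thesis .
qed

lemma at_min_empty [simp]: "at_min {} = UNIV"
  by (simp add: at_min_def)

text \<open>
  The part of minimal weight is the value at the centre of slices without zeros elsewhere in the
  disc. That it be nonzero is an open condition on \<open>c\<close> by continuity, and a closed one by Hurwitz'
  theorem. Since it does not vanish identically and \<open>\<Omega>\<close> is connected, it vanishes nowhere.
\<close>

lemma part_at_min_single:
  assumes g: "g \<in> G" and c: "c \<in> \<Omega>"
  shows "part (at_min {g}) c \<noteq> 0"
proof -
  define Z where "Z = \<Omega> \<inter> part (at_min {g}) -` (- {0})"
  let ?\<psi> = "\<lambda>c. slice (at_least \<inter> at_min {}) g (min_weight g) c"
  have "openin (top_of_set \<Omega>) Z"
    unfolding Z_def by (rule continuous_openin_preimage_gen[OF part_cont]) auto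
  moreover have "closedin (top_of_set \<Omega>) Z"
    unfolding closedin_limpt
  proof (intro conjI allI impI)
    show "Z \<subseteq> \<Omega>" by (auto simp: Z_def)
  next
    fix x assume "x islimpt Z \<and> x \<in> \<Omega>"
    then have x: "x \<in> \<Omega>" and "x islimpt Z" by auto
    then obtain f where f: "\<And>n. f n \<in> Z" "f \<longlonglongrightarrow> x"
      unfolding islimpt_sequential by auto
    have f\<Omega>: "f n \<in> \<Omega>" for n using f(1)[of n] by (simp add: Z_def)
    have "?\<psi> x 0 \<noteq> 0"
    proof (rule Hurwitz_at_0[of "\<lambda>n. ?\<psi> (f n)" "?\<psi> x"])
      show "uniform_limit (ball 0 1) (\<lambda>n. ?\<psi> (f n)) (?\<psi> x) sequentially"
      proof (rule uniform_limitI)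
        fix e :: real assume "e > 0"
        then have "\<forall>\<^sub>F n in sequentially. (\<Sum>\<^sub>\<infinity>\<alpha>\<in>I. norm (T \<alpha> (f n) - T \<alpha> x)) < e"
          using order_tendstoD(2)[OF T_distance_tendsto[OF x f\<Omega> f(2)]] by blast
        then show "\<forall>\<^sub>F n in sequentially. \<forall>s\<in>ball 0 1. dist (?\<psi> (f n) s) (?\<psi> x s) < e"
        proof eventually_elim
          case (elim n)
          show ?case
          proof
            fix s :: complex assume "s \<in> ball 0 1"
            then have "norm s \<le> 1" by simp
            from slice_diff_le[OF x f\<Omega>[of n] this] elim
            show "dist (?\<psi> (f n) s) (?\<psi> x s) < e" unfolding dist_norm by (rule le_less_trans)
          qed
        qed
      qed
      show "?\<psi> (f n) s \<noteq> 0" if "s \<in> ball 0 1" for n s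
      proof (cases "s = 0")
        case True
        then show ?thesis using slice_at_least_0[OF f\<Omega> g, of "{}"] f(1)[of n] by (simp add: Z_def)
      next
        case False
        then show ?thesis
          using that part_UNIV_nonzero by (intro slice_at_least_nonzero[OF f\<Omega> g]) auto
      qed
      show "?\<psi> x s \<noteq> 0" if "s \<in> ball 0 1" "s \<noteq> 0" for s
        using that part_UNIV_nonzero by (intro slice_at_least_nonzero[OF x g]) auto
    qed (use slice_holomorphic f\<Omega> x in auto)
    then show "x \<in> Z" using slice_at_least_0[OF x g, of "{}"] x by (simp add: Z_def)
  qed
  moreover have "Z \<noteq> {}" using not_null_at_min[OF g] by (auto simp: null_part_def Z_def)
  ultimately have "Z = \<Omega>" using connected_\<Omega> unfolding connected_clopen by blast
  then show ?thesis using c by (auto simp: Z_def)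
qed

definition shift :: "'g set \<Rightarrow> complex ^ 'n \<Rightarrow> nat \<Rightarrow> complex ^ 'n" where
  "shift F c n = c + (- of_nat n) *s (\<Sum>g\<in>F. dir g)"

lemma shift:
  assumes "F \<subseteq> G" "c \<in> \<Omega>"
  shows "shift F c n \<in> \<Omega>"
    and "\<alpha> \<in> I \<Longrightarrow> T \<alpha> (shift F c n) = exp (- of_nat n * of_nat (\<Sum>g\<in>F. w \<alpha> g)) * T \<alpha> c"
proof -
  have "finite F" using assms(1) finite_G finite_subset by blast
  then have "shift F c n \<in> \<Omega> \<and>
      (\<alpha> \<in> I \<longrightarrow> T \<alpha> (shift F c n) = exp (- of_nat n * of_nat (\<Sum>g\<in>F. w \<alpha> g)) * T \<alpha> c)"
    using assms(1)
  proof (induction F)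
    case empty
    then show ?case using assms(2) by (simp add: shift_def)
  next
    case (insert g F)
    have eq: "shift (insert g F) c n = shift F c n + (- of_nat n) *s dir g"
      using insert.hyps by (simp add: shift_def vector_add_ldistrib add_ac)
    have IH: "shift F c n \<in> \<Omega>"
      "\<alpha> \<in> I \<Longrightarrow> T \<alpha> (shift F c n) = exp (- of_nat n * of_nat (\<Sum>g\<in>F. w \<alpha> g)) * T \<alpha> c"
      using insert by auto
    show ?case
      using dir_\<Omega>[OF _ IH(1), of g "- of_nat n"] T_dir[OF _ _ IH(1), of \<alpha> g "- of_nat n"] IH(2) insert.prems insert.hyps
      unfolding eq by (auto simp: exp_add[symmetric] algebra_simps)
  qed
  then show "shift F c n \<in> \<Omega>"
    and "\<alpha> \<in> I \<Longrightarrow> T \<alpha> (shift F c n) = exp (- of_nat n * of_nat (\<Sum>g\<in>F. w \<alpha> g)) * T \<alpha> c"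
    by auto
qed

text \<open>
  Along the shift, the terms of minimal total weight in the directions \<open>F\<close> dominate all others by
  a factor of at least \<open>exp n\<close>, because weights are integers.
\<close>

lemma slice_shift_le:
  assumes F: "F \<subseteq> G" and c: "c \<in> \<Omega>" and s: "norm s \<le> 1"
  shows "norm (exp (of_nat n * of_nat (\<Sum>g\<in>F. min_weight g)) * slice at_least g j (shift F c n) s
    - slice (at_least \<inter> at_min F) g j c s) \<le> exp (- real n) * (\<Sum>\<^sub>\<infinity>\<alpha>\<in>I. M \<alpha>)"
proof -
  have fin: "finite F" using F finite_G finite_subset by blast
  define \<kappa> where "\<kappa> = (\<Sum>g\<in>F. min_weight g)"
  define q where "q \<alpha> = exp (of_nat n * of_nat \<kappa> - of_nat n * of_nat (\<Sum>g\<in>F. w \<alpha> g) :: complex)" for \<alpha>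
  define b where "b \<alpha> = (if \<alpha> \<in> at_min F then 1 else 0 :: complex)" for \<alpha>
  have qb: "norm (q \<alpha> - b \<alpha>) \<le> exp (- real n)" if "\<alpha> \<in> at_least" for \<alpha>
  proof (cases "\<alpha> \<in> at_min F")
    case True
    then have "(\<Sum>g\<in>F. w \<alpha> g) = \<kappa>" by (simp add: \<kappa>_def at_min_def)
    then show ?thesis using True by (simp add: q_def b_def)
  next
    case False
    have le: "\<forall>g\<in>F. min_weight g \<le> w \<alpha> g" using that F by (auto simp: at_least_def)
    obtain g0 where g0: "g0 \<in> F" "w \<alpha> g0 \<noteq> min_weight g0" using False by (auto simp: at_min_def)
    have "\<kappa> < (\<Sum>g\<in>F. w \<alpha> g)"
      unfolding \<kappa>_def using le g0 by (intro sum_strict_mono_ex1 fin) (auto intro!: bexI[of _ g0])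
    then have "real (\<kappa> + 1) \<le> real (\<Sum>g\<in>F. w \<alpha> g)" by (simp only: of_nat_le_iff)
    then have "real n * real (\<kappa> + 1) \<le> real n * real (\<Sum>g\<in>F. w \<alpha> g)"
      by (rule mult_left_mono) simp
    then have "real n * real \<kappa> - real n * real (\<Sum>g\<in>F. w \<alpha> g) \<le> - real n"
      by (simp add: algebra_simps)
    moreover have "norm (q \<alpha>) = exp (real n * real \<kappa> - real n * real (\<Sum>g\<in>F. w \<alpha> g))"
      unfolding q_def by (simp flip: of_nat_mult)
    ultimately show ?thesis using False by (simp add: b_def)
  qed
  have T: "T \<alpha> (shift F c n) * exp (of_nat n * of_nat \<kappa>) = q \<alpha> * T \<alpha> c" if "\<alpha> \<in> I" for \<alpha>
    using shift(2)[OF F c that, of n] by (simp add: q_def exp_diff exp_minus field_simps)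
  let ?p = "\<lambda>\<alpha>. s ^ (w \<alpha> g - j)"
  have p1: "norm (?p \<alpha>) \<le> 1" for \<alpha> using s by (simp add: norm_power power_le_one)
  have smq: "(\<lambda>\<alpha>. a \<alpha> * T \<alpha> c * ?p \<alpha>) summable_on I \<inter> at_least"
    if "\<And>\<alpha>. \<alpha> \<in> at_least \<Longrightarrow> norm (a \<alpha>) \<le> 2" for a
  proof (rule summable_on_comparison[OF summable_on_cmult_right[OF M_summable_part, of 2]])
    fix \<alpha> assume \<alpha>: "\<alpha> \<in> I \<inter> at_least"
    have "norm (a \<alpha>) * norm (T \<alpha> c) * norm (?p \<alpha>) \<le> 2 * M \<alpha> * 1"
      using that \<alpha> T_le[of \<alpha> c] c p1 by (intro mult_mono) (auto intro: order_trans[OF norm_ge_zero])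
    then show "norm (a \<alpha> * T \<alpha> c * ?p \<alpha>) \<le> 2 * M \<alpha>" by (simp add: norm_mult)
  qed
  have b2: "norm (b \<alpha>) \<le> 1" for \<alpha> by (simp add: b_def)
  have q2: "norm (q \<alpha>) \<le> 2" if "\<alpha> \<in> at_least" for \<alpha>
    using qb[OF that] b2[of \<alpha>] norm_triangle_sub[of "q \<alpha>" "b \<alpha>"] by (smt (verit) exp_le_one_iff of_nat_0_le_iff)
  have "exp (of_nat n * of_nat \<kappa>) * slice at_least g j (shift F c n) s
      = (\<Sum>\<^sub>\<infinity>\<alpha>\<in>I \<inter> at_least. q \<alpha> * T \<alpha> c * ?p \<alpha>)"
    unfolding slice_def infsum_cmult_right'[symmetric] using T
    by (intro infsum_cong) (simp add: mult_ac)
  moreover have "slice (at_least \<inter> at_min F) g j c s = (\<Sum>\<^sub>\<infinity>\<alpha>\<in>I \<inter> at_least. b \<alpha> * T \<alpha> c * ?p \<alpha>)"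
    unfolding slice_def by (rule infsum_cong_neutral) (auto simp: b_def)
  moreover have "((\<lambda>\<alpha>. q \<alpha> * T \<alpha> c * ?p \<alpha> - b \<alpha> * T \<alpha> c * ?p \<alpha>) has_sum
      ((\<Sum>\<^sub>\<infinity>\<alpha>\<in>I \<inter> at_least. q \<alpha> * T \<alpha> c * ?p \<alpha>) - (\<Sum>\<^sub>\<infinity>\<alpha>\<in>I \<inter> at_least. b \<alpha> * T \<alpha> c * ?p \<alpha>)))
      (I \<inter> at_least)"
    by (intro has_sum_diff has_sum_infsum smq q2 order_trans[OF b2]) auto
  ultimately have hs: "((\<lambda>\<alpha>. q \<alpha> * T \<alpha> c * ?p \<alpha> - b \<alpha> * T \<alpha> c * ?p \<alpha>) has_sum
      (exp (of_nat n * of_nat \<kappa>) * slice at_least g j (shift F c n) s - slice (at_least \<inter> at_min F) g j c s))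
      (I \<inter> at_least)" by simp
  have "norm (exp (of_nat n * of_nat \<kappa>) * slice at_least g j (shift F c n) s - slice (at_least \<inter> at_min F) g j c s)
     \<le> (\<Sum>\<^sub>\<infinity>\<alpha>\<in>I \<inter> at_least. exp (- real n) * M \<alpha>)"
  proof (rule norm_infsum_le[OF hs has_sum_infsum[OF summable_on_cmult_right[OF M_summable_part]]])
    fix \<alpha> assume \<alpha>: "\<alpha> \<in> I \<inter> at_least"
    have "norm (q \<alpha> - b \<alpha>) * norm (T \<alpha> c) * norm (?p \<alpha>) \<le> exp (- real n) * M \<alpha> * 1"
      using qb \<alpha> T_le[of \<alpha> c] c p1 order_trans[OF norm_ge_zero T_le[of \<alpha> c]]
      by (intro mult_mono mult_nonneg_nonneg) auto
    then show "norm (q \<alpha> * T \<alpha> c * ?p \<alpha> - b \<alpha> * T \<alpha> c * ?p \<alpha>) \<le> exp (- real n) * M \<alpha>"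
      by (simp add: norm_mult flip: left_diff_distrib)
  qed
  also have "\<dots> \<le> (\<Sum>\<^sub>\<infinity>\<alpha>\<in>I. exp (- real n) * M \<alpha>)"
    using order_trans[OF norm_ge_zero T_le[OF _ c]]
    by (intro infsum_mono2 summable_on_cmult_right M_summable M_summable_part mult_nonneg_nonneg) auto
  finally show ?thesis by (simp add: \<kappa>_def infsum_cmult_right')
qed

text \<open>
  Induction over the directions. The slice in direction \<open>g\<close> of the part that is minimal for \<open>F\<close> is
  the uniform limit of rescaled slices of the full series at points shifted along \<open>F\<close>. Those have
  no zeros in the whole disc, at the centre by \<open>part_at_min_single\<close>, so the limit has none by
  Hurwitz' theorem.
\<close>

lemma part_at_min_nonzero:
  assumes "F \<subseteq> G" "c \<in> \<Omega>"
  shows "part (at_min F) c \<noteq> 0"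
proof -
  have "finite F" using assms(1) finite_G finite_subset by blast
  then have "\<forall>c\<in>\<Omega>. part (at_min F) c \<noteq> 0" using assms(1)
  proof (induction F)
    case empty
    then show ?case using part_UNIV_nonzero by simp
  next
    case (insert g F)
    then have g: "g \<in> G" and F: "F \<subseteq> G" and IH: "\<And>c. c \<in> \<Omega> \<Longrightarrow> part (at_min F) c \<noteq> 0" by auto
    show ?case
    proof
      fix c assume c: "c \<in> \<Omega>"
      let ?\<phi> = "slice (at_least \<inter> at_min F) g (min_weight g) c"
      let ?\<psi> = "\<lambda>n s. exp (of_nat n * of_nat (\<Sum>g\<in>F. min_weight g)) * slice at_least g (min_weight g) (shift F c n) s"
      have "?\<phi> 0 \<noteq> 0"
      proof (rule Hurwitz_at_0[of ?\<psi> ?\<phi>])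
        show "uniform_limit (ball 0 1) ?\<psi> ?\<phi> sequentially"
        proof (rule uniform_limitI)
          fix e :: real assume "e > 0"
          then have "\<forall>\<^sub>F n in sequentially. exp (- real n) * (\<Sum>\<^sub>\<infinity>\<alpha>\<in>I. M \<alpha>) < e"
            using order_tendstoD(2)[OF exp_minus_nat_tendsto] by blast
          then show "\<forall>\<^sub>F n in sequentially. \<forall>s\<in>ball 0 1. dist (?\<psi> n s) (?\<phi> s) < e"
          proof eventually_elim
            case (elim n)
            show ?case
            proof
              fix s :: complex assume "s \<in> ball 0 1"
              then have "norm s \<le> 1" by simp
              from slice_shift_le[OF F c this] elim
              show "dist (?\<psi> n s) (?\<phi> s) < e" unfolding dist_norm by (rule le_less_trans)
            qed
          qed
        qed
        show "?\<psi> n s \<noteq> 0" if "s \<in> ball 0 1" for n s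
        proof (cases "s = 0")
          case True
          then show ?thesis
            using slice_at_least_0[OF shift(1)[OF F c] g, of "{}" n] part_at_min_single[OF g shift(1)[OF F c]] by simp
        next
          case False
          then show ?thesis
            using that part_UNIV_nonzero slice_at_least_nonzero[OF shift(1)[OF F c] g, of s "{}" n] by simp
        qed
        show "?\<phi> s \<noteq> 0" if "s \<in> ball 0 1" "s \<noteq> 0" for s
          using that IH by (intro slice_at_least_nonzero[OF c g _ _ F]) auto
        show "?\<psi> n holomorphic_on ball 0 1" for n
          by (intro holomorphic_intros slice_holomorphic shift F c)
      qed (use slice_holomorphic c in auto)
      then show "part (at_min (insert g F)) c \<noteq> 0" using slice_at_least_0[OF c g F] by simp
    qed
  qed
  then show ?thesis using assms(2) by blast
qed

text \<open>
  The first claim discards the terms below the minimal weights, which cancel; the second provides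
  a term that attains all minima; the third says that the series decays along the diagonal
  direction exactly as fast as this term, which later shows that the quotient by it does not
  vanish.
\<close>

theorem leading_weight:
  "\<exists>\<kappa>. (\<forall>c\<in>\<Omega>. (\<Sum>\<^sub>\<infinity>\<alpha>\<in>I. T \<alpha> c) = (\<Sum>\<^sub>\<infinity>\<alpha>\<in>{\<alpha>\<in>I. \<forall>g\<in>G. \<kappa> g \<le> w \<alpha> g}. T \<alpha> c)) \<and>
    (\<exists>\<alpha>\<in>I. \<forall>g\<in>G. w \<alpha> g = \<kappa> g) \<and>
    (\<forall>c\<in>\<Omega>. \<exists>L. L \<noteq> 0 \<and>
      (\<lambda>n. exp (of_nat n * of_nat (\<Sum>g\<in>G. \<kappa> g)) * (\<Sum>\<^sub>\<infinity>\<alpha>\<in>I. T \<alpha> (c + (- of_nat n) *s (\<Sum>g\<in>G. dir g)))) \<longlonglongrightarrow> L)"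
proof (intro exI[of _ min_weight] conjI ballI)
  have sat: "saturated UNIV" by (simp add: saturated_def)
  have I: "(\<Sum>\<^sub>\<infinity>\<alpha>\<in>I. T \<alpha> c) = part at_least c" if "c \<in> \<Omega>" for c
    using part_at_least[OF that sat] by (simp add: part_def)
  have "I \<inter> at_least = {\<alpha>\<in>I. \<forall>g\<in>G. min_weight g \<le> w \<alpha> g}" by (auto simp: at_least_def)
  then show "(\<Sum>\<^sub>\<infinity>\<alpha>\<in>I. T \<alpha> c) = (\<Sum>\<^sub>\<infinity>\<alpha>\<in>{\<alpha>\<in>I. \<forall>g\<in>G. min_weight g \<le> w \<alpha> g}. T \<alpha> c)"
    if "c \<in> \<Omega>" for c
    using I[OF that] by (simp add: part_def)
  obtain c where "c \<in> \<Omega>" using nonempty_\<Omega> by blast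
  then have "part (at_min G) c \<noteq> 0" by (intro part_at_min_nonzero) auto
  then have "I \<inter> at_min G \<noteq> {}" unfolding part_def by (metis infsum_empty)
  then show "\<exists>\<alpha>\<in>I. \<forall>g\<in>G. w \<alpha> g = min_weight g" by (auto simp: at_min_def)
  fix c assume c: "c \<in> \<Omega>"
  show "\<exists>L. L \<noteq> 0 \<and> (\<lambda>n. exp (of_nat n * of_nat (\<Sum>g\<in>G. min_weight g)) *
      (\<Sum>\<^sub>\<infinity>\<alpha>\<in>I. T \<alpha> (c + (- of_nat n) *s (\<Sum>g\<in>G. dir g)))) \<longlonglongrightarrow> L"
  proof (intro exI conjI)
    show "part (at_min G) c \<noteq> 0" using c by (intro part_at_min_nonzero) auto
    \<comment> \<open>At \<open>s = 1\<close> the power of \<open>s\<close> disappears, so the direction and exponent of the slice are irrelevant.\<close>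
    have s1: "slice Q undefined 0 c 1 = part Q c" for Q c by (simp add: slice_def part_def)
    let ?f = "\<lambda>n. exp (of_nat n * of_nat (\<Sum>g\<in>G. min_weight g)) *
      (\<Sum>\<^sub>\<infinity>\<alpha>\<in>I. T \<alpha> (c + (- of_nat n) *s (\<Sum>g\<in>G. dir g)))"
    have bound: "norm (?f n - part (at_min G) c) \<le> exp (- real n) * (\<Sum>\<^sub>\<infinity>\<alpha>\<in>I. M \<alpha>)" for n
    proof -
      have "(\<Sum>\<^sub>\<infinity>\<alpha>\<in>I. T \<alpha> (c + (- of_nat n) *s (\<Sum>g\<in>G. dir g))) = part at_least (shift G c n)"
        using I[OF shift(1)[OF order_refl c]] by (simp add: shift_def)
      then show ?thesis
        using slice_shift_le[OF order_refl c, of 1 n undefined 0] part_at_least[OF c saturated_at_min[OF order_refl]]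
        by (simp add: s1)
    qed
    have "(\<lambda>n. ?f n - part (at_min G) c) \<longlonglongrightarrow> 0"
      by (rule Lim_null_comparison[OF always_eventually exp_minus_nat_tendsto]) (rule allI[OF bound])
    then show "?f \<longlonglongrightarrow> part (at_min G) c" using LIM_zero_iff by blast
  qed
qed

end

section \<open>Faces and characters of a lattice cone\<close>

subsection \<open>Characters\<close>

text \<open>
  Vectors in \<open>complex ^ 'n\<close> serve as logarithms of points of the complex torus.
\<close>

definition complex_pairing :: "complex ^ 'n::finite \<Rightarrow> int ^ 'n \<Rightarrow> complex" where
  "complex_pairing c u = (\<Sum>i\<in>UNIV. c $ i * of_int (u $ i))"

definition complex_vec :: "int ^ 'n \<Rightarrow> complex ^ 'n" where
  "complex_vec g = (\<chi> i. of_int (g $ i))"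

lemma complex_pairing_add_right: "complex_pairing c (u + v) = complex_pairing c u + complex_pairing c v"
  by (simp add: complex_pairing_def distrib_left sum.distrib)

lemma complex_pairing_add_left: "complex_pairing (c + d) u = complex_pairing c u + complex_pairing d u"
  by (simp add: complex_pairing_def distrib_right sum.distrib)

lemma complex_pairing_diff_left: "complex_pairing (c - d) u = complex_pairing c u - complex_pairing d u"
  by (simp add: complex_pairing_def left_diff_distrib sum_subtractf)

lemma complex_pairing_zero [simp]: "complex_pairing c 0 = 0" "complex_pairing 0 u = 0"
  by (simp_all add: complex_pairing_def)

lemma complex_pairing_scale_left: "complex_pairing (\<zeta> *s c) u = \<zeta> * complex_pairing c u"
  by (simp add: complex_pairing_def sum_distrib_left mult.assoc)

lemma complex_pairing_scale_right: "complex_pairing c (n *s u) = of_int n * complex_pairing c u"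
  by (simp add: complex_pairing_def sum_distrib_left mult_ac)

lemma complex_pairing_sum_left: "complex_pairing (\<Sum>a\<in>A. f a) u = (\<Sum>a\<in>A. complex_pairing (f a) u)"
  by (induction A rule: infinite_finite_induct) (auto simp: complex_pairing_add_left)

lemma complex_pairing_sum_right: "complex_pairing c (\<Sum>a\<in>A. f a) = (\<Sum>a\<in>A. complex_pairing c (f a))"
  by (induction A rule: infinite_finite_induct) (auto simp: complex_pairing_add_right)

lemma complex_pairing_complex_vec: "complex_pairing (complex_vec g) u = of_int (pairing g u)"
  by (simp add: complex_pairing_def complex_vec_def pairing_def)

lemma complex_vec_sum:
  fixes f :: "'a \<Rightarrow> int ^ 'n::finite"
  shows "complex_vec (\<Sum>a\<in>A. f a) = (\<Sum>a\<in>A. complex_vec (f a))"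
proof -
  have "complex_vec (0 :: int ^ 'n) = 0" "complex_vec (u + v) = complex_vec u + complex_vec v"
    for u v :: "int ^ 'n"
    by (simp_all add: complex_vec_def vec_eq_iff)
  then show ?thesis by (induction A rule: infinite_finite_induct) auto
qed

lemma complex_pairing_cont: "continuous_on A (\<lambda>c. complex_pairing c u)"
  unfolding complex_pairing_def by (intro continuous_intros)

definition character :: "complex ^ 'n::finite \<Rightarrow> int ^ 'n \<Rightarrow> complex" where
  "character c u = exp (complex_pairing c u)"

lemma character_add: "character c (u + v) = character c u * character c v"
  by (simp add: character_def complex_pairing_add_right exp_add)

lemma character_zero [simp]: "character c 0 = 1"
  by (simp add: character_def)

lemma character_nonzero [simp]: "character c u \<noteq> 0"
  by (simp add: character_def)

lemma hom_eq_exp: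
  fixes \<psi> :: "int ^ 'n \<Rightarrow> complex"
  assumes K: "0 \<in> K" "\<And>u v. u \<in> K \<Longrightarrow> v \<in> K \<Longrightarrow> u + v \<in> K" "\<And>u. u \<in> K \<Longrightarrow> - u \<in> K"
    and hom: "\<And>u v. u \<in> K \<Longrightarrow> v \<in> K \<Longrightarrow> \<psi> (u + v) = \<psi> u * \<psi> v" and nz: "\<And>u. u \<in> K \<Longrightarrow> \<psi> u \<noteq> 0"
    and D: "finite D" and e: "\<And>i. i \<in> D \<Longrightarrow> e i \<in> K \<and> \<psi> (e i) = exp (l i)"
  shows "(\<Sum>i\<in>D. n i *s e i) \<in> K \<and> \<psi> (\<Sum>i\<in>D. n i *s e i) = exp (\<Sum>i\<in>D. of_int (n i) * l i)"
proof -
  have "\<psi> 0 * \<psi> 0 = \<psi> 0 * 1" using hom[OF K(1) K(1)] by simp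
  then have 0: "\<psi> 0 = 1" using nz[OF K(1)] by (simp only: mult_cancel_left) auto
  have minus: "\<psi> (- u) = inverse (\<psi> u)" if "u \<in> K" for u
    using hom[OF that K(3)[OF that]] 0 nz[OF that] by (simp add: field_simps)
  have nat: "int m *s e i \<in> K \<and> \<psi> (int m *s e i) = exp (of_nat m * l i)" if i: "e i \<in> K \<and> \<psi> (e i) = exp (l i)" for i m
  proof (induction m)
    case 0
    then show ?case using K(1) \<open>\<psi> 0 = 1\<close> by simp
  next
    case (Suc m)
    have "int (Suc m) *s e i = int m *s e i + e i" by (simp add: vec_eq_iff algebra_simps)
    then show ?case
      using Suc i hom[of "int m *s e i" "e i"] K(2)[of "int m *s e i" "e i"]
      by (simp add: exp_add algebra_simps)
  qed
  have int: "m *s e i \<in> K \<and> \<psi> (m *s e i) = exp (of_int m * l i)" if i: "e i \<in> K \<and> \<psi> (e i) = exp (l i)" for i m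
  proof (cases "0 \<le> m")
    case True
    then show ?thesis using nat[OF i, of "nat m"] by simp
  next
    case False
    then have "m *s e i = - (int (nat (- m)) *s e i)" by (simp add: vec_eq_iff)
    then show ?thesis
      using False nat[OF i, of "nat (- m)"] minus[of "int (nat (- m)) *s e i"] K(3)[of "int (nat (- m)) *s e i"]
      by (simp add: exp_minus)
  qed
  show ?thesis using D e
  proof (induction D)
    case empty
    then show ?case using K(1) 0 by simp
  next
    case (insert i D)
    then have D: "i \<in> insert i D" by simp
    from insert have IH: "(\<Sum>i\<in>D. n i *s e i) \<in> K"
        "\<psi> (\<Sum>i\<in>D. n i *s e i) = exp (\<Sum>i\<in>D. of_int (n i) * l i)" by auto
    from insert.prems[OF D] have i: "n i *s e i \<in> K" "\<psi> (n i *s e i) = exp (of_int (n i) * l i)"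
      by (simp_all add: int)
    show ?case using K(2)[OF i(1) IH(1)] hom[OF i(1) IH(1)] i(2) IH(2) insert.hyps by (simp add: exp_add)
  qed
qed

subsection \<open>Faces\<close>

text \<open>
  The elements of \<open>G\<close> are the inner normals of the cone of lattice points \<open>S\<close>.
\<close>

locale rational_lattice_cone =
  fixes G :: "(int ^ 'n::finite) set"
  assumes finite_G: "finite G"
begin

abbreviation S :: "(int ^ 'n) set" where "S \<equiv> lattice_cone G"

definition face :: "(int ^ 'n) set \<Rightarrow> bool" where
  "face T \<longleftrightarrow> 0 \<in> T \<and> T \<subseteq> S \<and> (\<forall>u\<in>S. \<forall>v\<in>S. u + v \<in> T \<longleftrightarrow> u \<in> T \<and> v \<in> T)"

definition annihilator :: "(int ^ 'n) set \<Rightarrow> (int ^ 'n) set" where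
  "annihilator T = {g\<in>G. \<forall>u\<in>T. pairing g u = 0}"

lemma finite_annihilator: "finite (annihilator T)"
  using finite_G by (simp add: annihilator_def)

lemma face_subset: "face T \<Longrightarrow> u \<in> T \<Longrightarrow> u \<in> S"
  by (auto simp: face_def)

lemma face_add: "face T \<Longrightarrow> u \<in> T \<Longrightarrow> v \<in> T \<Longrightarrow> u + v \<in> T"
  by (auto simp: face_def)

lemma face_addD: "face T \<Longrightarrow> u \<in> S \<Longrightarrow> v \<in> S \<Longrightarrow> u + v \<in> T \<Longrightarrow> u \<in> T"
  by (auto simp: face_def)

lemma face_sum: "face T \<Longrightarrow> (\<And>a. a \<in> A \<Longrightarrow> f a \<in> T) \<Longrightarrow> (\<Sum>a\<in>A. f a) \<in> T"
  by (induction A rule: infinite_finite_induct) (auto intro: face_add simp: face_def)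

lemma face_scale:
  assumes "face T" "u \<in> T"
  shows "int m *s u \<in> T"
proof (induction m)
  case 0
  then show ?case using assms(1) by (simp add: face_def)
next
  case (Suc m)
  have "int (Suc m) *s u = int m *s u + u" by (simp add: vec_eq_iff algebra_simps)
  then show ?case using face_add[OF assms(1) Suc assms(2)] by (simp only:)
qed

text \<open>
  Add up, for each normal that is not zero on the face, an element of the face at which it is
  positive.
\<close>

lemma face_relative_interior:
  assumes T: "face T"
  obtains v where "v \<in> T" "\<And>g. g \<in> G \<Longrightarrow> g \<notin> annihilator T \<Longrightarrow> 0 < pairing g v"
proof -
  have "\<forall>g\<in>G - annihilator T. \<exists>u\<in>T. 0 < pairing g u"
  proof
    fix g assume g: "g \<in> G - annihilator T"
    then obtain u where u: "u \<in> T" "pairing g u \<noteq> 0" by (auto simp: annihilator_def)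
    then have "0 \<le> pairing g u" using face_subset[OF T] g by (auto simp: lattice_cone_def)
    then show "\<exists>u\<in>T. 0 < pairing g u" using u by force
  qed
  then obtain p where p: "\<forall>g\<in>G - annihilator T. p g \<in> T \<and> 0 < pairing g (p g)" by metis
  define v where "v = (\<Sum>g\<in>G - annihilator T. p g)"
  have "v \<in> T" unfolding v_def using p by (intro face_sum[OF T]) auto
  moreover have "0 < pairing g v" if g: "g \<in> G" "g \<notin> annihilator T" for g
    unfolding v_def pairing_sum_right
  proof (rule sum_pos2[of _ g])
    show "0 \<le> pairing g (p i)" if "i \<in> G - annihilator T" for i
      using p that face_subset[OF T] g(1) by (auto simp: lattice_cone_def)
  qed (use p g finite_G in auto)
  ultimately show ?thesis by (rule that)
qed

text \<open>
  A large multiple of a relatively interior element of the face makes all other normals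
  nonnegative. In other words, inverting the elements of the face turns the cone into the
  intersection of the half-spaces containing the face in their boundary.
\<close>

lemma face_lift:
  assumes T: "face T" and u: "\<And>g. g \<in> annihilator T \<Longrightarrow> 0 \<le> pairing g u"
  obtains q where "q \<in> T" "u + q \<in> S"
proof -
  obtain v where v: "v \<in> T" "\<And>g. g \<in> G \<Longrightarrow> g \<notin> annihilator T \<Longrightarrow> 0 < pairing g v"
    using face_relative_interior[OF T] by metis
  define m where "m = nat (\<Sum>g\<in>G. \<bar>pairing g u\<bar>)"
  have "u + int m *s v \<in> S"
    unfolding lattice_cone_def
  proof (intro CollectI ballI)
    fix g assume g: "g \<in> G"
    show "0 \<le> pairing g (u + int m *s v)"
    proof (cases "g \<in> annihilator T")
      case True
      then show ?thesis using u v(1) by (simp add: pairing_add_right pairing_scale_right annihilator_def)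
    next
      case False
      have "\<bar>pairing g u\<bar> \<le> (\<Sum>g\<in>G. \<bar>pairing g u\<bar>)"
        using g finite_G by (intro member_le_sum) auto
      then have "\<bar>pairing g u\<bar> \<le> int m" by (simp add: m_def)
      also have "int m * 1 \<le> int m * pairing g v"
        using v(2)[OF g False] by (intro mult_left_mono) auto
      finally show ?thesis by (simp add: pairing_add_right pairing_scale_right)
    qed
  qed
  then show ?thesis using that[of "int m *s v"] face_scale[OF T v(1)] by blast
qed

lemma face_iff:
  assumes T: "face T" and u: "u \<in> S"
  shows "u \<in> T \<longleftrightarrow> (\<forall>g\<in>annihilator T. pairing g u = 0)"
proof
  assume "\<forall>g\<in>annihilator T. pairing g u = 0"
  then have "\<And>g. g \<in> annihilator T \<Longrightarrow> 0 \<le> pairing g (- u)" by (simp add: pairing_minus_right)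
  from face_lift[OF T this] obtain q where "q \<in> T" "- u + q \<in> S" by metis
  then show "u \<in> T" using face_addD[OF T u, of "- u + q"] by simp
qed (auto simp: annihilator_def)

text \<open>
  An element of the cone \<open>\<sigma>\<close> that vanishes on \<open>T\<close> and is positive on the rest of \<open>S\<close>.
\<close>

definition face_normal :: "(int ^ 'n) set \<Rightarrow> int ^ 'n" where
  "face_normal T = (\<Sum>g\<in>annihilator T. g)"

lemma face_normal_nonneg: "u \<in> S \<Longrightarrow> 0 \<le> pairing (face_normal T) u"
  unfolding face_normal_def pairing_sum_left annihilator_def lattice_cone_def
  by (intro sum_nonneg) auto

lemma face_normal_zero_iff:
  assumes T: "face T" and u: "u \<in> S"
  shows "pairing (face_normal T) u = 0 \<longleftrightarrow> u \<in> T"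
proof -
  have "pairing (face_normal T) u = 0 \<longleftrightarrow> (\<forall>g\<in>annihilator T. pairing g u = 0)"
    unfolding face_normal_def pairing_sum_left using u
    by (intro sum_nonneg_eq_0_iff finite_annihilator) (auto simp: annihilator_def lattice_cone_def)
  then show ?thesis using face_iff[OF T u] by simp
qed

subsection \<open>Monoid homomorphisms to the complex numbers\<close>

definition monoid_hom :: "(int ^ 'n \<Rightarrow> complex) \<Rightarrow> bool" where
  "monoid_hom \<eta> \<longleftrightarrow> \<eta> 0 = 1 \<and> (\<forall>u\<in>S. \<forall>v\<in>S. \<eta> (u + v) = \<eta> u * \<eta> v)"

definition hom_face :: "(int ^ 'n \<Rightarrow> complex) \<Rightarrow> (int ^ 'n) set" where
  "hom_face \<eta> = {u\<in>S. \<eta> u \<noteq> 0}"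

lemma face_hom_face: "monoid_hom \<eta> \<Longrightarrow> face (hom_face \<eta>)"
  by (auto simp: face_def hom_face_def monoid_hom_def lattice_cone_add)

lemma monoid_hom_mult: "monoid_hom \<eta> \<Longrightarrow> u \<in> S \<Longrightarrow> v \<in> S \<Longrightarrow> \<eta> (u + v) = \<eta> u * \<eta> v"
  by (simp add: monoid_hom_def)

lemma monoid_hom_scale:
  assumes "monoid_hom \<eta>" "u \<in> S"
  shows "\<eta> (int m *s u) = \<eta> u ^ m"
proof (induction m)
  case 0
  then show ?case using assms(1) by (simp add: monoid_hom_def)
next
  case (Suc m)
  have "int (Suc m) *s u = int m *s u + u" by (simp add: vec_eq_iff algebra_simps)
  then show ?case
    using monoid_hom_mult[OF assms(1) lattice_cone_scale[OF assms(2)] assms(2), of m] Suc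
    by (simp only: power_Suc2)
qed

lemma monoid_hom_sum:
  assumes "monoid_hom \<eta>" "\<And>a. a \<in> A \<Longrightarrow> f a \<in> S"
  shows "\<eta> (\<Sum>a\<in>A. f a) = (\<Prod>a\<in>A. \<eta> (f a))"
  using assms(2)
proof (induction A rule: infinite_finite_induct)
  case (insert a A)
  then show ?case using monoid_hom_mult[OF assms(1), of "f a" "sum f A"] lattice_cone_sum[of A f G] by simp
qed (use assms(1) in \<open>auto simp: monoid_hom_def\<close>)

lemma monoid_hom_character: "monoid_hom (character c)"
  by (simp add: monoid_hom_def character_add)

text \<open>
  On the face where it does not vanish, a homomorphism is the restriction of a character of the
  whole lattice, because the lattice points in the linear span of a face are a direct summand.
\<close>

lemma hom_face_eq_character:
  assumes \<eta>: "monoid_hom \<eta>"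
  obtains c where "\<And>u. u \<in> hom_face \<eta> \<Longrightarrow> \<eta> u = character c u"
proof -
  define T where "T = hom_face \<eta>"
  have T: "face T" using face_hom_face[OF \<eta>] by (simp add: T_def)
  have TS: "u \<in> S" and Tnz: "\<eta> u \<noteq> 0" if "u \<in> T" for u using that by (auto simp: T_def hom_face_def)
  define K where "K = {u. \<forall>g\<in>annihilator T. pairing g u = 0}"
  obtain e d :: "'n \<Rightarrow> int ^ 'n" and D where b: "lattice_basis e d"
    and D: "\<forall>p. (\<forall>g\<in>annihilator T. real_vec g \<bullet> p = 0) \<longleftrightarrow> (\<forall>i. i \<notin> D \<longrightarrow> real_vec (d i) \<bullet> p = 0)"
    using lattice_basis_adapted[OF finite_annihilator, of T] by (elim exE conjE)
  have K_iff: "u \<in> K \<longleftrightarrow> (\<forall>i. i \<notin> D \<longrightarrow> pairing (d i) u = 0)" for u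
    using D[rule_format, of "real_vec u"] by (simp add: K_def real_vec_inner)
  have lift: "\<exists>q\<in>T. u + q \<in> T" if "u \<in> K" for u
  proof -
    have "\<And>g. g \<in> annihilator T \<Longrightarrow> 0 \<le> pairing g u" using that by (simp add: K_def)
    from face_lift[OF T this] obtain q where q: "q \<in> T" "u + q \<in> S" by metis
    moreover have "\<forall>g\<in>annihilator T. pairing g (u + q) = 0"
      using that q(1) by (simp add: K_def pairing_add_right annihilator_def)
    ultimately show ?thesis using face_iff[OF T] by blast
  qed
  then obtain Q where Q: "\<And>u. u \<in> K \<Longrightarrow> Q u \<in> T \<and> u + Q u \<in> T" by metis
  \<comment> \<open>\<open>\<psi>\<close> extends \<open>\<eta>\<close> to the group \<open>K\<close> of differences of elements of the face.\<close>
  define \<psi> where "\<psi> u = \<eta> (u + Q u) / \<eta> (Q u)" for u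
  have \<psi>_eq: "\<psi> u = \<eta> (u + q) / \<eta> q" if "u \<in> K" "q \<in> T" "u + q \<in> T" for u q
  proof -
    have "\<eta> ((u + Q u) + q) = \<eta> (u + Q u) * \<eta> q" "\<eta> ((u + q) + Q u) = \<eta> (u + q) * \<eta> (Q u)"
      using Q[OF that(1)] that TS by (intro monoid_hom_mult[OF \<eta>]; blast)+
    then have "\<eta> (u + Q u) * \<eta> q = \<eta> (u + q) * \<eta> (Q u)" by (simp add: add_ac)
    then show ?thesis using Q[OF that(1)] that Tnz unfolding \<psi>_def by (simp add: field_simps)
  qed
  define l where "l i = Ln (\<psi> (e i))" for i
  define c where "c = (\<Sum>i\<in>D. l i *s complex_vec (d i))"
  have K0: "0 \<in> K" "\<And>u v. u \<in> K \<Longrightarrow> v \<in> K \<Longrightarrow> u + v \<in> K" "\<And>u. u \<in> K \<Longrightarrow> - u \<in> K"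
    by (auto simp: K_def pairing_add_right pairing_minus_right)
  have \<psi>nz: "\<psi> u \<noteq> 0" if "u \<in> K" for u using Q[OF that] Tnz by (simp add: \<psi>_def)
  have \<psi>hom: "\<psi> (u + v) = \<psi> u * \<psi> v" if "u \<in> K" "v \<in> K" for u v
  proof -
    have QQ: "Q u + Q v \<in> T" "(u + v) + (Q u + Q v) \<in> T"
      using face_add[OF T, of "Q u" "Q v"] face_add[OF T, of "u + Q u" "v + Q v"] Q[OF that(1)] Q[OF that(2)]
      by (simp_all add: add_ac)
    have "\<psi> (u + v) = \<eta> ((u + Q u) + (v + Q v)) / \<eta> (Q u + Q v)"
      using \<psi>_eq[OF K0(2)[OF that] QQ] by (simp add: add_ac)
    also have "\<dots> = (\<eta> (u + Q u) * \<eta> (v + Q v)) / (\<eta> (Q u) * \<eta> (Q v))"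
      using Q[OF that(1)] Q[OF that(2)] TS by (simp add: monoid_hom_mult[OF \<eta>])
    finally show ?thesis by (simp add: \<psi>_def)
  qed
  have eK: "e i \<in> K" if "i \<in> D" for i
    unfolding K_iff using b that by (auto simp: lattice_basis_def)
  have "\<eta> u = character c u" if u: "u \<in> T" for u
  proof -
    have uK: "u \<in> K" using face_iff[OF T TS[OF u]] u by (simp add: K_def)
    have "u = (\<Sum>i\<in>UNIV. pairing (d i) u *s e i)" using b by (simp add: lattice_basis_def)
    also have "\<dots> = (\<Sum>i\<in>D. pairing (d i) u *s e i)"
      using uK by (intro sum.mono_neutral_right) (auto simp: K_iff)
    finally have eq: "u = (\<Sum>i\<in>D. pairing (d i) u *s e i)" .
    have "\<psi> (\<Sum>i\<in>D. pairing (d i) u *s e i) = exp (\<Sum>i\<in>D. of_int (pairing (d i) u) * l i)"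
      by (rule hom_eq_exp[THEN conjunct2, OF K0 \<psi>hom \<psi>nz])
        (use eK \<psi>nz in \<open>auto simp: l_def\<close>)
    then have "\<psi> u = character c u"
      unfolding eq[symmetric]
      by (simp add: character_def c_def complex_pairing_sum_left complex_pairing_scale_left
        complex_pairing_complex_vec mult.commute)
    moreover have "\<psi> u = \<eta> u"
      using \<psi>_eq[OF uK, of 0] u T \<eta> by (simp add: face_def monoid_hom_def)
    ultimately show ?thesis by simp
  qed
  then show ?thesis using that[of c] by (simp add: T_def)
qed

end

section \<open>Points and holomorphic functions of an affine toric variety\<close>

lemma continuous_map_euclidean_mult:
  fixes f g :: "'a \<Rightarrow> 'b::real_normed_algebra"
  shows "continuous_map Z euclidean f \<Longrightarrow> continuous_map Z euclidean g \<Longrightarrow>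
    continuous_map Z euclidean (\<lambda>z. f z * g z)"
  by (simp add: continuous_map_atin tendsto_mult)

lemma continuous_map_euclidean_sum:
  fixes f :: "'i \<Rightarrow> 'a \<Rightarrow> 'b::real_normed_vector"
  shows "(\<And>i. i \<in> I \<Longrightarrow> continuous_map Z euclidean (f i)) \<Longrightarrow>
    continuous_map Z euclidean (\<lambda>z. \<Sum>i\<in>I. f i z)"
  by (simp add: continuous_map_atin tendsto_sum)

lemma continuous_map_euclidean_divide:
  fixes f g :: "'a \<Rightarrow> 'b::real_normed_field"
  shows "continuous_map Z euclidean f \<Longrightarrow> continuous_map Z euclidean g \<Longrightarrow>
    (\<And>z. z \<in> topspace Z \<Longrightarrow> g z \<noteq> 0) \<Longrightarrow> continuous_map Z euclidean (\<lambda>z. f z / g z)"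
  by (simp add: continuous_map_atin tendsto_divide)

lemma continuous_map_euclidean_sgn:
  fixes f :: "'a \<Rightarrow> 'b::real_normed_vector"
  shows "continuous_map Z euclidean f \<Longrightarrow> (\<And>z. z \<in> topspace Z \<Longrightarrow> f z \<noteq> 0) \<Longrightarrow>
    continuous_map Z euclidean (\<lambda>z. sgn (f z))"
  by (simp add: continuous_map_atin tendsto_sgn)

lemma continuous_map_euclidean_of_real:
  shows "continuous_map Z euclidean f \<Longrightarrow> continuous_map Z euclidean (\<lambda>z. complex_of_real (f z))"
  by (simp add: continuous_map_atin tendsto_of_real)

lemma continuous_map_euclidean_norm:
  fixes f :: "'a \<Rightarrow> 'b::real_normed_vector"
  shows "continuous_map Z euclidean f \<Longrightarrow> continuous_map Z euclidean (\<lambda>z. norm (f z))"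
  by (simp add: continuous_map_atin tendsto_norm)

lemma continuous_map_euclidean_scaleR:
  fixes f :: "'a \<Rightarrow> real" and v :: "'b::real_normed_vector"
  shows "continuous_map Z euclidean f \<Longrightarrow> continuous_map Z euclidean (\<lambda>z. f z *\<^sub>R v)"
  by (simp add: continuous_map_atin tendsto_scaleR)

subsection \<open>Points as monoid homomorphisms\<close>

definition monomial_value :: "'n::finite point \<Rightarrow> int ^ 'n \<Rightarrow> complex" where
  "monomial_value x u = x (Poly_Mapping.single u 1)"

text \<open>
  The linear extension of a function on monomials to the group algebra.
\<close>

definition evaluate :: "(int ^ 'n::finite \<Rightarrow> complex) \<Rightarrow> 'n point" where
  "evaluate \<eta> f = (\<Sum>u\<in>Poly_Mapping.keys f. Poly_Mapping.lookup f u * \<eta> u)"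

lemma evaluate_superset:
  assumes "finite A" "Poly_Mapping.keys f \<subseteq> A"
  shows "evaluate \<eta> f = (\<Sum>u\<in>A. Poly_Mapping.lookup f u * \<eta> u)"
  unfolding evaluate_def using assms by (intro sum.mono_neutral_left) (auto simp: in_keys_iff)

lemma evaluate_add: "evaluate \<eta> (f + g) = evaluate \<eta> f + evaluate \<eta> g"
proof -
  let ?A = "Poly_Mapping.keys f \<union> Poly_Mapping.keys g"
  have "evaluate \<eta> (f + g) = (\<Sum>u\<in>?A. Poly_Mapping.lookup (f + g) u * \<eta> u)"
    by (rule evaluate_superset) (use keys_add[of f g] in auto)
  also have "\<dots> = (\<Sum>u\<in>?A. Poly_Mapping.lookup f u * \<eta> u) + (\<Sum>u\<in>?A. Poly_Mapping.lookup g u * \<eta> u)"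
    by (simp add: lookup_add distrib_right sum.distrib)
  also have "\<dots> = evaluate \<eta> f + evaluate \<eta> g"
    by (simp add: evaluate_superset[of ?A f] evaluate_superset[of ?A g])
  finally show ?thesis .
qed

lemma evaluate_single: "evaluate \<eta> (Poly_Mapping.single u c) = c * \<eta> u"
  by (cases "c = 0") (simp_all add: evaluate_def)

lemma evaluate_zero: "evaluate \<eta> 0 = 0"
  by (simp add: evaluate_def)

lemma evaluate_sum: "evaluate \<eta> (\<Sum>a\<in>A. f a) = (\<Sum>a\<in>A. evaluate \<eta> (f a))"
  by (induction A rule: infinite_finite_induct) (auto simp: evaluate_add evaluate_zero)

lemma sum_of_monomials:
  "f = (\<Sum>u\<in>Poly_Mapping.keys f. Poly_Mapping.single u (Poly_Mapping.lookup f u))"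
proof (rule poly_mapping_eqI)
  fix v
  show "Poly_Mapping.lookup f v =
    Poly_Mapping.lookup (\<Sum>u\<in>Poly_Mapping.keys f. Poly_Mapping.single u (Poly_Mapping.lookup f u)) v"
    by (auto simp: lookup_sum lookup_single when_def in_keys_iff sum.delta)
qed

lemma evaluate_mult:
  assumes hom: "\<And>u v. u \<in> U \<Longrightarrow> v \<in> U \<Longrightarrow> \<eta> (u + v) = \<eta> u * \<eta> v"
    and f: "f \<in> monoid_algebra U" and g: "g \<in> monoid_algebra U"
  shows "evaluate \<eta> (f * g) = evaluate \<eta> f * evaluate \<eta> g"
proof -
  let ?l = Poly_Mapping.lookup and ?s = Poly_Mapping.single and ?k = Poly_Mapping.keys
  have "f * g = (\<Sum>u\<in>?k f. ?s u (?l f u)) * (\<Sum>v\<in>?k g. ?s v (?l g v))"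
    by (simp only: sum_of_monomials[symmetric])
  also have "\<dots> = (\<Sum>u\<in>?k f. \<Sum>v\<in>?k g. ?s (u + v) (?l f u * ?l g v))"
    by (simp add: sum_product mult_single)
  finally have "evaluate \<eta> (f * g) = (\<Sum>u\<in>?k f. \<Sum>v\<in>?k g. (?l f u * ?l g v) * \<eta> (u + v))"
    by (simp only: evaluate_sum evaluate_single)
  also have "\<dots> = (\<Sum>u\<in>?k f. \<Sum>v\<in>?k g. (?l f u * \<eta> u) * (?l g v * \<eta> v))"
    using f g by (intro sum.cong refl) (auto simp: monoid_algebra_def subset_iff hom mult_ac)
  finally show ?thesis by (simp add: evaluate_def sum_product)
qed

lemma evaluate_in_complex_points:
  assumes U: "0 \<in> U" "\<And>u v. u \<in> U \<Longrightarrow> v \<in> U \<Longrightarrow> u + v \<in> U"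
    and hom: "\<eta> 0 = 1" "\<And>u v. u \<in> U \<Longrightarrow> v \<in> U \<Longrightarrow> \<eta> (u + v) = \<eta> u * \<eta> v"
  shows "restrict (evaluate \<eta>) (monoid_algebra U) \<in> complex_points (monoid_algebra U)"
proof -
  have "f + g \<in> monoid_algebra U \<and> f * g \<in> monoid_algebra U"
    if "f \<in> monoid_algebra U" "g \<in> monoid_algebra U" for f g
  proof
    show "f + g \<in> monoid_algebra U" using that keys_add[of f g] unfolding monoid_algebra_def by blast
    show "f * g \<in> monoid_algebra U"
      unfolding monoid_algebra_def
    proof (intro CollectI subsetI)
      fix w assume "w \<in> Poly_Mapping.keys (f * g)"
      then obtain u v where "w = u + v" "u \<in> Poly_Mapping.keys f" "v \<in> Poly_Mapping.keys g"
        using keys_mult[of f g] by auto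
      then show "w \<in> U" using that U(2)[of u v] unfolding monoid_algebra_def by blast
    qed
  qed
  moreover have "Poly_Mapping.single 0 c \<in> monoid_algebra U" for c
    using U by (simp add: monoid_algebra_def)
  ultimately show ?thesis
    using hom by (auto simp: complex_points_def evaluate_add evaluate_single evaluate_mult[where U = U])
qed

lemma single_in_monoid_algebra: "u \<in> U \<Longrightarrow> Poly_Mapping.single u c \<in> monoid_algebra U"
  by (simp add: monoid_algebra_def)

lemma complex_points_eq_evaluate:
  assumes U: "0 \<in> U" "\<And>u v. u \<in> U \<Longrightarrow> v \<in> U \<Longrightarrow> u + v \<in> U"
    and x: "x \<in> complex_points (monoid_algebra U)" and f: "f \<in> monoid_algebra U"
  shows "x f = evaluate (monomial_value x) f"
proof -
  have add: "x (f + g) = x f + x g" and mult: "x (f * g) = x f * x g"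
    if "f \<in> monoid_algebra U" "g \<in> monoid_algebra U" for f g
    using x that by (simp_all add: complex_points_def)
  have const: "x (Poly_Mapping.single 0 c) = c" for c using x by (simp add: complex_points_def)
  have single: "x (Poly_Mapping.single u c) = c * monomial_value x u" if "u \<in> U" for u c
    using mult[OF single_in_monoid_algebra[OF U(1), of c] single_in_monoid_algebra[OF that, of 1]]
    by (simp add: mult_single const monomial_value_def)
  have "x (\<Sum>u\<in>A. Poly_Mapping.single u (c u)) = (\<Sum>u\<in>A. c u * monomial_value x u)
      \<and> (\<Sum>u\<in>A. Poly_Mapping.single u (c u)) \<in> monoid_algebra U"
    if "finite A" "A \<subseteq> U" for A c
    using that
  proof (induction A)
    case empty
    then show ?case using const[of 0] by (simp add: monoid_algebra_def)
  next
    case (insert u A)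
    have "Poly_Mapping.single u (c u) + (\<Sum>u\<in>A. Poly_Mapping.single u (c u)) \<in> monoid_algebra U"
      using insert keys_add[of "Poly_Mapping.single u (c u)" "\<Sum>u\<in>A. Poly_Mapping.single u (c u)"]
        keys_single[of u "c u"]
      by (auto simp: monoid_algebra_def split: if_splits)
    then show ?case
      using insert add[of "Poly_Mapping.single u (c u)" "\<Sum>u\<in>A. Poly_Mapping.single u (c u)"]
      by (simp add: single single_in_monoid_algebra)
  qed
  from this[of "Poly_Mapping.keys f" "Poly_Mapping.lookup f"] f
  show ?thesis
    by (simp add: evaluate_def monoid_algebra_def flip: sum_of_monomials)
qed

text \<open>
  The generators \<open>h\<close> of \<open>S\<close> embed the toric variety into \<open>\<complex>\<^sup>k\<close>; the point \<open>u0\<close> is interior to the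
  dual cone and exists by strict convexity.
\<close>

locale affine_toric = rational_lattice_cone G for G :: "(int ^ 'n::finite) set" +
  fixes \<sigma> :: "(real ^ 'n) set" and k :: nat and h :: "nat \<Rightarrow> int ^ 'n" and u0 :: "int ^ 'n"
  assumes \<sigma>_eq: "\<sigma> = convex_cone hull (real_vec ` G)"
    and generators: "generates_monoid k h (lattice_cone G)"
    and interior: "\<And>g. g \<in> G \<Longrightarrow> g \<noteq> 0 \<Longrightarrow> 0 < pairing g u0"
begin

lemma dual_monoid_eq [simp]: "dual_monoid \<sigma> = S"
  by (simp add: \<sigma>_eq dual_monoid_hull)

lemma u0_in_S: "u0 \<in> S"
  using interior by (force simp: lattice_cone_def)

lemma h_in_S: "i < k \<Longrightarrow> h i \<in> S"
  using generates_monoid_generator[OF generators] .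

abbreviation X :: "'n point topology" where "X \<equiv> toric_space \<sigma>"

abbreviation points :: "'n point set" where "points \<equiv> complex_points (monoid_algebra S)"

abbreviation D :: "'n point set" where "D \<equiv> toric_boundary \<sigma>"

abbreviation structure_sheaf :: "'n point fun_sheaf" where "structure_sheaf \<equiv> toric_sheaf \<sigma>"

lemma topspace_X [simp]: "topspace X = points"
  by (auto simp: toric_space_def Let_def complex_points_def extensional_def PiE_def)

lemma monoid_hom_monomial_value:
  assumes "x \<in> points"
  shows "monoid_hom (monomial_value x)"
proof -
  have "monomial_value x (u + v) = monomial_value x u * monomial_value x v" if "u \<in> S" "v \<in> S" for u v
  proof -
    have "\<forall>f\<in>monoid_algebra S. \<forall>g\<in>monoid_algebra S. x (f + g) = x f + x g \<and> x (f * g) = x f * x g"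
      using assms by (simp add: complex_points_def)
    from this[rule_format, OF single_in_monoid_algebra[OF that(1), of 1] single_in_monoid_algebra[OF that(2), of 1]]
    show ?thesis by (simp add: monomial_value_def mult_single)
  qed
  moreover have "monomial_value x 0 = 1"
    using assms unfolding complex_points_def monomial_value_def by blast
  ultimately show ?thesis unfolding monoid_hom_def by blast
qed

lemma monomial_value_mult:
  "x \<in> points \<Longrightarrow> u \<in> S \<Longrightarrow> v \<in> S \<Longrightarrow> monomial_value x (u + v) = monomial_value x u * monomial_value x v"
  using monoid_hom_mult[OF monoid_hom_monomial_value] .

lemma monomial_value_zero [simp]: "x \<in> points \<Longrightarrow> monomial_value x 0 = 1"
  using monoid_hom_monomial_value by (simp add: monoid_hom_def)

lemma point_eq_evaluate: "x \<in> points \<Longrightarrow> f \<in> monoid_algebra S \<Longrightarrow> x f = evaluate (monomial_value x) f"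
  by (rule complex_points_eq_evaluate[of S]) (auto intro: lattice_cone_add)

lemma points_eqI:
  assumes "x \<in> points" "y \<in> points" "\<And>u. u \<in> S \<Longrightarrow> monomial_value x u = monomial_value y u"
  shows "x = y"
proof (rule extensionalityI[of x "monoid_algebra S"])
  fix f :: "(int ^ 'n) \<Rightarrow>\<^sub>0 complex" assume f: "f \<in> monoid_algebra S"
  have "evaluate (monomial_value x) f = evaluate (monomial_value y) f"
    unfolding evaluate_def using f assms(3) by (intro sum.cong) (auto simp: monoid_algebra_def)
  then show "x f = y f" using point_eq_evaluate f assms by simp
qed (use assms in \<open>auto simp: complex_points_def\<close>)

definition point_of :: "(int ^ 'n \<Rightarrow> complex) \<Rightarrow> 'n point" where
  "point_of \<eta> = restrict (evaluate \<eta>) (monoid_algebra S)"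

lemma point_of_in_points: "monoid_hom \<eta> \<Longrightarrow> point_of \<eta> \<in> points"
  unfolding point_of_def
  by (rule evaluate_in_complex_points) (auto simp: monoid_hom_def lattice_cone_add)

lemma monomial_value_point_of: "u \<in> S \<Longrightarrow> monomial_value (point_of \<eta>) u = \<eta> u"
  by (simp add: monomial_value_def point_of_def single_in_monoid_algebra evaluate_single)

abbreviation torus_point :: "complex ^ 'n \<Rightarrow> 'n point" where
  "torus_point c \<equiv> point_of (character c)"

lemma torus_point_in_points: "torus_point c \<in> points"
  by (rule point_of_in_points[OF monoid_hom_character])

text \<open>
  A point of the torus inverts all monomials. Conversely, a homomorphism without zeros is a
  character by \<open>hom_face_eq_character\<close>, hence extends to the whole lattice.
\<close>

lemma boundary_iff:
  assumes x: "x \<in> points"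
  shows "x \<notin> D \<longleftrightarrow> (\<forall>u\<in>S. monomial_value x u \<noteq> 0)"
proof
  assume "x \<notin> D"
  then obtain y where y: "y \<in> complex_points (monoid_algebra UNIV)" and xy: "x = restrict y (monoid_algebra S)"
    using x by (auto simp: toric_boundary_def)
  show "\<forall>u\<in>S. monomial_value x u \<noteq> 0"
  proof
    fix u assume u: "u \<in> S"
    have "y (f * g) = y f * y g" for f g
      using y by (simp add: complex_points_def monoid_algebra_def)
    moreover have "y (Poly_Mapping.single 0 1) = 1" using y unfolding complex_points_def by blast
    moreover have "Poly_Mapping.single u (1::complex) * Poly_Mapping.single (- u) 1 = Poly_Mapping.single 0 1"
      by (simp only: mult_single) simp
    ultimately have "y (Poly_Mapping.single u 1) * y (Poly_Mapping.single (- u) 1) = 1" by metis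
    then show "monomial_value x u \<noteq> 0"
      using u by (auto simp: monomial_value_def xy single_in_monoid_algebra)
  qed
next
  assume nz: "\<forall>u\<in>S. monomial_value x u \<noteq> 0"
  obtain c where c: "\<And>u. u \<in> hom_face (monomial_value x) \<Longrightarrow> monomial_value x u = character c u"
    using hom_face_eq_character[OF monoid_hom_monomial_value[OF x]] by metis
  define y where "y = restrict (evaluate (character c)) (monoid_algebra UNIV)"
  have y: "y \<in> complex_points (monoid_algebra UNIV)"
    unfolding y_def by (rule evaluate_in_complex_points) (auto simp: character_add)
  have "restrict y (monoid_algebra S) = torus_point c"
    by (auto simp: y_def point_of_def restrict_def fun_eq_iff monoid_algebra_def)
  moreover have "torus_point c = x"
    using c nz by (intro points_eqI torus_point_in_points x) (simp add: monomial_value_point_of hom_face_def)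
  ultimately show "x \<notin> D" using y by (auto simp: toric_boundary_def)
qed

subsection \<open>Coordinates and the classical topology\<close>

definition coords :: "'n point \<Rightarrow> nat \<Rightarrow> complex" where
  "coords x = (\<lambda>i. monomial_value x (h i))"

text \<open>
  Some expression of \<open>u\<close> in terms of the generators; it is not unique.
\<close>

definition rep :: "int ^ 'n \<Rightarrow> nat \<Rightarrow> nat" where
  "rep u = (SOME a. u = (\<Sum>i<k. int (a i) *s h i))"

lemma rep:
  assumes "u \<in> S"
  shows "u = (\<Sum>i<k. int (rep u i) *s h i)"
proof -
  obtain a :: "nat \<Rightarrow> nat" where a: "u = (\<Sum>i<k. int (a i) *s h i)"
    by (rule generates_monoid_rep[OF generators assms])
  show ?thesis
    unfolding rep_def by (rule someI[where P = "\<lambda>a. u = (\<Sum>i<k. int (a i) *s h i)", OF a])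
qed

lemma hom_generators:
  assumes "monoid_hom \<eta>"
  shows "\<eta> (\<Sum>i<k. int (a i) *s h i) = monom_eval k (\<lambda>i. \<eta> (h i)) a"
proof -
  have "\<eta> (\<Sum>i<k. int (a i) *s h i) = (\<Prod>i<k. \<eta> (int (a i) *s h i))"
    by (rule monoid_hom_sum[OF assms]) (auto intro: lattice_cone_scale h_in_S)
  also have "\<dots> = (\<Prod>i<k. \<eta> (h i) ^ a i)"
    by (intro prod.cong refl monoid_hom_scale[OF assms] h_in_S) auto
  finally show ?thesis by (simp add: monom_eval_def)
qed

lemma monomial_value_eq:
  assumes "x \<in> points" "u \<in> S"
  shows "monomial_value x u = monom_eval k (coords x) (rep u)"
  unfolding coords_def
  using hom_generators[OF monoid_hom_monomial_value[OF assms(1)], of "rep u"] rep[OF assms(2)] by simp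

lemma continuous_map_monomial_value:
  assumes "u \<in> S"
  shows "continuous_map X euclidean (\<lambda>x. monomial_value x u)"
  unfolding monomial_value_def toric_space_def Let_def
  by (intro continuous_map_from_subtopology continuous_map_product_projection)
    (simp add: single_in_monoid_algebra assms)

lemma continuous_map_into_X:
  assumes "\<And>z. z \<in> topspace Z \<Longrightarrow> f z \<in> points"
    and "\<And>u. u \<in> S \<Longrightarrow> continuous_map Z euclidean (\<lambda>z. monomial_value (f z) u)"
  shows "continuous_map Z X f"
  unfolding toric_space_def Let_def dual_monoid_eq
proof (rule continuous_map_into_subtopology)
  show "f \<in> topspace Z \<rightarrow> points" using assms(1) by auto
  have "continuous_map Z euclidean (\<lambda>z. f z g)" if g: "g \<in> monoid_algebra S" for g
  proof -
    have "continuous_map Z euclidean (\<lambda>z. evaluate (monomial_value (f z)) g)"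
      unfolding evaluate_def using g
      by (intro continuous_map_euclidean_sum continuous_map_euclidean_mult assms(2))
        (auto simp: monoid_algebra_def)
    then show ?thesis
      by (rule continuous_map_eq) (use point_eq_evaluate g assms(1) in auto)
  qed
  then show "continuous_map Z (product_topology (\<lambda>_. euclidean) (monoid_algebra S)) f"
    unfolding continuous_map_componentwise using assms(1) by (auto simp: complex_points_def)
qed

definition box :: "'n point \<Rightarrow> real \<Rightarrow> 'n point set" where
  "box x \<delta> = {y\<in>points. \<forall>i<k. norm (coords y i - coords x i) < \<delta>}"

lemma openin_box: "openin X (box x \<delta>)"
proof -
  have eq: "{y \<in> topspace X. monomial_value y (h i) \<in> ball (coords x i) \<delta>}
      = {y\<in>points. norm (coords y i - coords x i) < \<delta>}" for i
    by (auto simp: coords_def dist_norm norm_minus_commute)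
  have "openin X {y \<in> topspace X. monomial_value y (h i) \<in> ball (coords x i) \<delta>}" if "i < k" for i
    using openin_continuous_map_preimage[OF continuous_map_monomial_value[OF h_in_S[OF that]], of "ball (coords x i) \<delta>"]
    by simp
  then have i: "openin X {y\<in>points. norm (coords y i - coords x i) < \<delta>}" if "i < k" for i
    using that by (simp only: eq)
  have "openin X {y\<in>points. \<forall>i<m. norm (coords y i - coords x i) < \<delta>}" if "m \<le> k" for m
    using that
  proof (induction m)
    case 0
    then show ?case using openin_topspace[of X] by simp
  next
    case (Suc m)
    have "{y\<in>points. \<forall>i<Suc m. norm (coords y i - coords x i) < \<delta>}
        = {y\<in>points. norm (coords y m - coords x m) < \<delta>} \<inter> {y\<in>points. \<forall>i<m. norm (coords y i - coords x i) < \<delta>}"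
      by (auto simp: less_Suc_eq)
    moreover have "openin X \<dots>" using Suc i[of m] by (intro openin_Int) auto
    ultimately show ?case by simp
  qed
  then show ?thesis by (simp add: box_def)
qed

lemma center_in_box: "x \<in> points \<Longrightarrow> 0 < \<delta> \<Longrightarrow> x \<in> box x \<delta>"
  by (simp add: box_def)

lemma box_mono: "\<delta> \<le> \<delta>' \<Longrightarrow> box x \<delta> \<subseteq> box x \<delta>'"
  by (auto simp: box_def)

text \<open>
  The boxes in the coordinates form a basis of neighbourhoods, because every regular function is a
  polynomial in the coordinates.
\<close>

lemma openin_contains_box:
  assumes "openin X U" "x \<in> U"
  obtains \<delta> where "0 < \<delta>" "box x \<delta> \<subseteq> U"
proof -
  let ?A = "monoid_algebra S"
  obtain V where V: "openin (product_topology (\<lambda>_. euclidean) ?A) V" and U: "U = V \<inter> points"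
    using assms(1) unfolding toric_space_def Let_def openin_subtopology by auto
  have x: "x \<in> V" "x \<in> points" using assms(2) U by auto
  have "\<exists>B. finite {f \<in> ?A. B f \<noteq> topspace euclidean} \<and> (\<forall>f\<in>?A. openin euclidean (B f)) \<and>
      x \<in> Pi\<^sub>E ?A B \<and> Pi\<^sub>E ?A B \<subseteq> V"
    using V x(1) unfolding openin_product_topology_alt by (rule bspec)
  then obtain B where fin: "finite {f \<in> ?A. B f \<noteq> UNIV}" and B: "\<forall>f\<in>?A. open (B f)"
    and xB: "x \<in> Pi\<^sub>E ?A B" and BV: "Pi\<^sub>E ?A B \<subseteq> V"
    unfolding topspace_euclidean open_openin[symmetric] by (elim exE conjE)
  have "\<exists>\<delta>>0. \<forall>y\<in>box x \<delta>. y f \<in> B f" if f: "f \<in> ?A" for f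
  proof -
    define P where "P z = (\<Sum>u\<in>Poly_Mapping.keys f. Poly_Mapping.lookup f u * monom_eval k z (rep u))" for z
    have P: "y f = P (coords y)" if "y \<in> points" for y
      unfolding P_def point_eq_evaluate[OF that f] evaluate_def
      using f monomial_value_eq[OF that] by (intro sum.cong) (auto simp: monoid_algebra_def)
    have Phol: "holomorphic_near k P (coords x)"
      unfolding P_def
      by (intro holomorphic_near_sum holomorphic_near_mult holomorphic_near_const
          holomorphic_near_monom_eval holomorphic_near_coordinate)
    obtain \<epsilon> where \<epsilon>: "0 < \<epsilon>" "ball (x f) \<epsilon> \<subseteq> B f"
    proof -
      have "x f \<in> B f" using PiE_mem[OF xB f] .
      then show ?thesis using openE[of "B f" "x f"] B f that by blast
    qed
    obtain \<delta> where \<delta>: "0 < \<delta>"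
      "\<And>z. (\<And>i. i < k \<Longrightarrow> norm (z i - coords x i) < \<delta>) \<Longrightarrow> norm (P z - P (coords x)) < \<epsilon>"
      using holomorphic_near_continuous[OF Phol \<epsilon>(1)] by metis
    have "y f \<in> B f" if y: "y \<in> box x \<delta>" for y
    proof -
      have "norm (P (coords y) - P (coords x)) < \<epsilon>" using y by (intro \<delta>(2)) (simp add: box_def)
      moreover have "y \<in> points" using y by (simp add: box_def)
      ultimately have "y f \<in> ball (x f) \<epsilon>" by (simp add: P x(2) dist_norm norm_minus_commute)
      then show ?thesis using \<epsilon>(2) by blast
    qed
    then show ?thesis using \<delta>(1) by blast
  qed
  then obtain d where d: "\<And>f. f \<in> ?A \<Longrightarrow> 0 < d f" "\<And>f y. f \<in> ?A \<Longrightarrow> y \<in> box x (d f) \<Longrightarrow> y f \<in> B f"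
    by metis
  define \<delta> where "\<delta> = Min (insert 1 (d ` {f \<in> ?A. B f \<noteq> UNIV}))"
  have "0 < \<delta>" unfolding \<delta>_def using fin d(1) by (subst Min_gr_iff) auto
  moreover have "box x \<delta> \<subseteq> U"
  proof
    fix y assume y: "y \<in> box x \<delta>"
    have "y f \<in> B f" if f: "f \<in> ?A" for f
    proof (cases "B f = UNIV")
      case False
      then have "\<delta> \<le> d f" unfolding \<delta>_def using fin f by (intro Min_le) auto
      then have "y \<in> box x (d f)" using y box_mono by blast
      then show ?thesis using d(2)[OF f] by blast
    qed simp
    moreover have "y \<in> points" using y by (simp add: box_def)
    ultimately have "y \<in> Pi\<^sub>E ?A B" by (auto simp: complex_points_def PiE_def)
    then show "y \<in> U" using BV U \<open>y \<in> points\<close> by blast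
  qed
  ultimately show ?thesis by (rule that)
qed

end

lemma holomorphic_near_cong:
  assumes "\<And>i. i < k \<Longrightarrow> a i = b i"
  shows "holomorphic_near k F a \<longleftrightarrow> holomorphic_near k F b"
proof -
  have "(\<forall>i<k. cmod (z i - a i) < r) \<longleftrightarrow> (\<forall>i<k. cmod (z i - b i) < r)"
    "(\<Prod>i<k. (z i - a i) ^ \<alpha> i) = (\<Prod>i<k. (z i - b i) ^ \<alpha> i)" for z r \<alpha>
    using assms by simp_all
  then show ?thesis unfolding holomorphic_near_def by simp
qed

lemma holomorphic_near_local:
  assumes "holomorphic_near k F a"
  shows "\<exists>r>0. \<forall>z z'. (\<forall>i<k. norm (z i - a i) < r \<and> z' i = z i) \<longrightarrow> F z = F z'"
proof -
  from assms obtain r c where r: "0 < r" and c: "\<And>w. (\<And>j. j < k \<Longrightarrow> norm (w j - a j) < r) \<Longrightarrow>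
      ((\<lambda>\<alpha>. c \<alpha> * monom_eval k (\<lambda>j. w j - a j) \<alpha>) has_sum F w) (multi_indices k)"
    unfolding holomorphic_near_iff_series by metis
  have "F z = F z'" if *: "\<forall>i<k. norm (z i - a i) < r \<and> z' i = z i" for z z'
  proof -
    have "monom_eval k (\<lambda>j. z' j - a j) = monom_eval k (\<lambda>j. z j - a j)"
      using * by (intro ext monom_eval_cong) simp
    then have "((\<lambda>\<alpha>. c \<alpha> * monom_eval k (\<lambda>j. z j - a j) \<alpha>) has_sum F z') (multi_indices k)"
      using c[of z'] * by simp
    moreover have "((\<lambda>\<alpha>. c \<alpha> * monom_eval k (\<lambda>j. z j - a j) \<alpha>) has_sum F z) (multi_indices k)"
      using c[of z] * by simp
    ultimately show ?thesis using has_sum_unique by metis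
  qed
  then show ?thesis using r by blast
qed

context affine_toric
begin

subsection \<open>Germs of holomorphic functions\<close>

text \<open>
  In contrast to \<^const>\<open>toric_sheaf\<close>, one fixed system of generators is used throughout;
  \<open>structure_sheaf_iff\<close> shows that this gives the same functions.
\<close>

definition hol_at :: "'n point \<Rightarrow> ('n point \<Rightarrow> complex) \<Rightarrow> bool" where
  "hol_at x f \<longleftrightarrow> (\<exists>F W. holomorphic_near k F (coords x) \<and> openin X W \<and> x \<in> W \<and>
     (\<forall>y\<in>W. f y = F (coords y)))"

lemma hol_atI:
  "holomorphic_near k F (coords x) \<Longrightarrow> openin X W \<Longrightarrow> x \<in> W \<Longrightarrow> (\<And>y. y \<in> W \<Longrightarrow> f y = F (coords y)) \<Longrightarrow>
    hol_at x f"
  unfolding hol_at_def by blast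

lemma hol_atE:
  assumes "hol_at x f"
  obtains F W where "holomorphic_near k F (coords x)" "openin X W" "x \<in> W" "\<And>y. y \<in> W \<Longrightarrow> f y = F (coords y)"
  using assms unfolding hol_at_def by blast

lemma openin_points: "openin X points"
  using openin_topspace[of X] by simp

lemma openin_subset_points: "openin X W \<Longrightarrow> W \<subseteq> points"
  using openin_subset[of X W] by simp

lemma openin_finite_all:
  assumes "\<And>i. i < m \<Longrightarrow> openin X {y\<in>points. Q i y}"
  shows "openin X {y\<in>points. \<forall>i<m::nat. Q i y}"
  using assms
proof (induction m)
  case 0
  then show ?case using openin_points by simp
next
  case (Suc m)
  have "{y\<in>points. \<forall>i<Suc m. Q i y} = {y\<in>points. Q m y} \<inter> {y\<in>points. \<forall>i<m. Q i y}"
    by (auto simp: less_Suc_eq)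
  moreover have "openin X \<dots>" using Suc by (intro openin_Int) auto
  ultimately show ?case by simp
qed

lemma openin_monomial_value:
  assumes "u \<in> S" "open V"
  shows "openin X {y\<in>points. monomial_value y u \<in> V}"
  using openin_continuous_map_preimage[OF continuous_map_monomial_value[OF assms(1)], of V] assms(2)
  by simp

lemma hol_at_cong:
  assumes "hol_at x f" "openin X W" "x \<in> W" "\<And>y. y \<in> W \<Longrightarrow> g y = f y"
  shows "hol_at x g"
  using assms(1)
proof (rule hol_atE)
  fix F W' assume F: "holomorphic_near k F (coords x)" "openin X W'" "x \<in> W'" "\<And>y. y \<in> W' \<Longrightarrow> f y = F (coords y)"
  show "hol_at x g"
    by (rule hol_atI[OF F(1) openin_Int[OF F(2) assms(2)]]) (use F assms in auto)
qed

lemma hol_at_mult: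
  assumes "hol_at x f" "hol_at x g"
  shows "hol_at x (\<lambda>y. f y * g y)"
  using assms(1)
proof (rule hol_atE)
  fix F W assume F: "holomorphic_near k F (coords x)" "openin X W" "x \<in> W" "\<And>y. y \<in> W \<Longrightarrow> f y = F (coords y)"
  show ?thesis using assms(2)
  proof (rule hol_atE)
    fix F' W' assume F': "holomorphic_near k F' (coords x)" "openin X W'" "x \<in> W'" "\<And>y. y \<in> W' \<Longrightarrow> g y = F' (coords y)"
    show ?thesis
      by (rule hol_atI[OF holomorphic_near_mult[OF F(1) F'(1)] openin_Int[OF F(2) F'(2)]]) (use F F' in auto)
  qed
qed

lemma hol_at_inverse:
  assumes "hol_at x f" "f x \<noteq> 0"
  shows "hol_at x (\<lambda>y. inverse (f y))"
  using assms(1)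
proof (rule hol_atE)
  fix F W assume F: "holomorphic_near k F (coords x)" "openin X W" "x \<in> W" "\<And>y. y \<in> W \<Longrightarrow> f y = F (coords y)"
  have "F (coords x) \<noteq> 0" using F(3,4) assms(2) by force
  from hol_atI[OF holomorphic_near_inverse[OF F(1) this] F(2,3)] F(4)
  show ?thesis by simp
qed

lemma hol_at_const: "x \<in> points \<Longrightarrow> hol_at x (\<lambda>_. c)"
  by (rule hol_atI[OF holomorphic_near_const openin_points]) auto

lemma hol_at_monomial_value:
  assumes "x \<in> points" "u \<in> S"
  shows "hol_at x (\<lambda>y. monomial_value y u)"
  by (rule hol_atI[where F = "\<lambda>z. monom_eval k z (rep u)", OF _ openin_points assms(1)])
    (use assms(2) in \<open>auto intro!: holomorphic_near_monom_eval holomorphic_near_coordinate monomial_value_eq\<close>)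

lemma hol_at_nearby:
  assumes x: "x \<in> points" and f: "hol_at x f"
  shows "\<exists>W. openin X W \<and> x \<in> W \<and> (\<forall>y\<in>W. hol_at y f)"
  using f
proof (rule hol_atE)
  fix F W assume F: "holomorphic_near k F (coords x)" "openin X W" "x \<in> W" "\<And>y. y \<in> W \<Longrightarrow> f y = F (coords y)"
  obtain \<delta> where \<delta>: "0 < \<delta>"
    "\<And>b. (\<And>i. i < k \<Longrightarrow> norm (b i - coords x i) < \<delta>) \<Longrightarrow> holomorphic_near k F b"
    using holomorphic_near_nearby[OF F(1)] by metis
  have "hol_at y f" if "y \<in> W \<inter> box x \<delta>" for y
    using that by (intro hol_atI[OF \<delta>(2) F(2) _ F(4)]) (auto simp: box_def)
  moreover have "openin X (W \<inter> box x \<delta>)" "x \<in> W \<inter> box x \<delta>"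
    using F x \<delta>(1) by (auto intro: openin_Int openin_box center_in_box)
  ultimately show ?thesis by blast
qed

lemma hol_at_continuous:
  assumes x: "x \<in> points" and f: "hol_at x f" and e: "0 < \<epsilon>"
  shows "\<exists>W. openin X W \<and> x \<in> W \<and> (\<forall>y\<in>W. norm (f y - f x) < \<epsilon>)"
  using f
proof (rule hol_atE)
  fix F W assume F: "holomorphic_near k F (coords x)" "openin X W" "x \<in> W" "\<And>y. y \<in> W \<Longrightarrow> f y = F (coords y)"
  obtain \<delta> where \<delta>: "0 < \<delta>"
    "\<And>z. (\<And>i. i < k \<Longrightarrow> norm (z i - coords x i) < \<delta>) \<Longrightarrow> norm (F z - F (coords x)) < \<epsilon>"
    using holomorphic_near_continuous[OF F(1) e] by metis
  have "norm (f y - f x) < \<epsilon>" if "y \<in> W \<inter> box x \<delta>" for y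
    using \<delta>(2)[of "coords y"] that F(3,4) by (auto simp: box_def)
  moreover have "openin X (W \<inter> box x \<delta>)" "x \<in> W \<inter> box x \<delta>"
    using F x \<delta>(1) by (auto intro: openin_Int openin_box center_in_box)
  ultimately show ?thesis by blast
qed

lemma hol_at_nonzero_nearby:
  assumes "x \<in> points" "hol_at x f" "f x \<noteq> 0"
  shows "\<exists>W. openin X W \<and> x \<in> W \<and> (\<forall>y\<in>W. f y \<noteq> 0)"
proof -
  have "0 < norm (f x)" using assms(3) by simp
  from hol_at_continuous[OF assms(1,2) this] obtain W
    where W: "openin X W" "x \<in> W" "\<forall>y\<in>W. norm (f y - f x) < norm (f x)" by blast
  then have "\<forall>y\<in>W. f y \<noteq> 0" by (auto simp: norm_minus_commute)
  then show ?thesis using W by blast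
qed

text \<open>
  Each generator of the other system is a monomial in the coordinates, so the claim is a
  composition of holomorphic functions.
\<close>

lemma hol_at_change_of_generators:
  assumes gen: "generates_monoid k' h' S" and x: "x \<in> points"
    and F: "holomorphic_near k' F (\<lambda>i. monomial_value x (h' i))"
    and W: "openin X W" "x \<in> W" "\<And>y. y \<in> W \<Longrightarrow> f y = F (\<lambda>i. monomial_value y (h' i))"
  shows "hol_at x f"
proof -
  define P where "P j z = monom_eval k z (rep (h' j))" for j and z :: "nat \<Rightarrow> complex"
  have h': "h' j \<in> S" if "j < k'" for j using generates_monoid_generator[OF gen that] .
  have P: "P j (coords y) = monomial_value y (h' j)" if "j < k'" "y \<in> points" for j y
    using monomial_value_eq[OF that(2) h'[OF that(1)]] by (simp add: P_def)
  have F': "holomorphic_near k' F (\<lambda>j. P j (coords x))"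
    using holomorphic_near_cong[THEN iffD1, OF _ F] P x by simp
  have comp: "holomorphic_near k (\<lambda>z. F (\<lambda>j. P j z)) (coords x)"
  proof (rule holomorphic_near_compose[where P = P and a = "coords x", OF F'])
    show "holomorphic_near k (P j) (coords x)" for j
      unfolding P_def[abs_def] by (intro holomorphic_near_monom_eval holomorphic_near_coordinate)
  qed
  obtain r where r: "0 < r" and loc: "\<And>z z'. (\<forall>i<k'. norm (z i - monomial_value x (h' i)) < r \<and> z' i = z i) \<Longrightarrow> F z = F z'"
    using holomorphic_near_local[OF F] by metis
  define V where "V = {y\<in>points. \<forall>i<k'. monomial_value y (h' i) \<in> ball (monomial_value x (h' i)) r}"
  have "openin X V" unfolding V_def by (intro openin_finite_all openin_monomial_value h') auto
  moreover have "x \<in> V" using x r by (simp add: V_def)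
  moreover have "f y = F (\<lambda>j. P j (coords y))" if "y \<in> W \<inter> V" for y
  proof -
    have "F (\<lambda>i. monomial_value y (h' i)) = F (\<lambda>j. P j (coords y))"
      by (rule loc) (use that P in \<open>auto simp: V_def dist_norm norm_minus_commute\<close>)
    then show ?thesis using W(3) that by simp
  qed
  ultimately show ?thesis using W by (intro hol_atI[OF comp, of "W \<inter> V"]) auto
qed

subsection \<open>Sections of the structure sheaf and of the log structure\<close>

lemma structure_sheaf_iff:
  assumes U: "openin X U"
  shows "f \<in> structure_sheaf U \<longleftrightarrow> f \<in> extensional U \<and> (\<forall>x\<in>U. hol_at x f)"
proof
  assume f: "f \<in> structure_sheaf U"
  have "hol_at x f" if x: "x \<in> U" for x
  proof -
    have "\<exists>k h F. generates_monoid k h S \<and>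
       holomorphic_near k F (\<lambda>i. monomial_value x (h i)) \<and>
       (\<exists>W. openin X W \<and> x \<in> W \<and> W \<subseteq> U \<and> (\<forall>y\<in>W. f y = F (\<lambda>i. monomial_value y (h i))))"
      using f x unfolding toric_sheaf_def monomial_value_def by simp
    then obtain k' h' F W where "generates_monoid k' h' S"
       "holomorphic_near k' F (\<lambda>i. monomial_value x (h' i))"
       "openin X W" "x \<in> W" "\<forall>y\<in>W. f y = F (\<lambda>i. monomial_value y (h' i))" by blast
    then show ?thesis
      using hol_at_change_of_generators[of k' h' x F W f] openin_subset_points by blast
  qed
  then show "f \<in> extensional U \<and> (\<forall>x\<in>U. hol_at x f)" using f by (auto simp: toric_sheaf_def)
next
  assume f: "f \<in> extensional U \<and> (\<forall>x\<in>U. hol_at x f)"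
  have "\<exists>k h F. generates_monoid k h S \<and>
       holomorphic_near k F (\<lambda>i. monomial_value x (h i)) \<and>
       (\<exists>W. openin X W \<and> x \<in> W \<and> W \<subseteq> U \<and> (\<forall>y\<in>W. f y = F (\<lambda>i. monomial_value y (h i))))"
    if x: "x \<in> U" for x
  proof -
    from f x have "hol_at x f" by blast
    then show ?thesis
    proof (rule hol_atE)
      fix F W assume "holomorphic_near k F (coords x)" "openin X W" "x \<in> W" "\<And>y. y \<in> W \<Longrightarrow> f y = F (coords y)"
      then show ?thesis using generators U x
        by (intro exI[of _ k] exI[of _ h] exI[of _ F] conjI exI[of _ "W \<inter> U"]) (auto simp: coords_def)
    qed
  qed
  then show "f \<in> structure_sheaf U" using f unfolding toric_sheaf_def monomial_value_def by simp
qed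

lemma unit_sections_iff:
  assumes U: "openin X U"
  shows "f \<in> unit_sections structure_sheaf U \<longleftrightarrow> f \<in> extensional U \<and> (\<forall>x\<in>U. hol_at x f \<and> f x \<noteq> 0)"
proof
  assume "f \<in> unit_sections structure_sheaf U"
  then show "f \<in> extensional U \<and> (\<forall>x\<in>U. hol_at x f \<and> f x \<noteq> 0)"
    by (auto simp: unit_sections_def structure_sheaf_iff[OF U])
next
  assume f: "f \<in> extensional U \<and> (\<forall>x\<in>U. hol_at x f \<and> f x \<noteq> 0)"
  define g where "g = restrict (\<lambda>y. inverse (f y)) U"
  have "hol_at x g" if "x \<in> U" for x
    by (rule hol_at_cong[OF hol_at_inverse[of x f] U that]) (use f that in \<open>auto simp: g_def\<close>)
  then have "g \<in> structure_sheaf U" using structure_sheaf_iff[OF U] by (simp add: g_def)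
  moreover have "f \<in> structure_sheaf U" using structure_sheaf_iff[OF U] f by blast
  moreover have "\<forall>x\<in>U. f x * g x = 1" using f by (simp add: g_def)
  ultimately show "f \<in> unit_sections structure_sheaf U" unfolding unit_sections_def by blast
qed

lemma openin_minus_boundary:
  assumes "openin X U"
  shows "openin X (U - D)"
proof -
  have "U - D = U \<inter> {y\<in>points. \<forall>i<k. monomial_value y (h i) \<in> - {0}}"
  proof (intro equalityI subsetI)
    fix y assume y: "y \<in> U - D"
    then have "y \<in> points" using openin_subset_points[OF assms] by blast
    then show "y \<in> U \<inter> {y\<in>points. \<forall>i<k. monomial_value y (h i) \<in> - {0}}"
      using y boundary_iff h_in_S by auto
  next
    fix y assume y: "y \<in> U \<inter> {y\<in>points. \<forall>i<k. monomial_value y (h i) \<in> - {0}}"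
    then have "\<forall>u\<in>S. monomial_value y u \<noteq> 0"
      by (auto simp: monomial_value_eq monom_eval_def coords_def)
    then show "y \<in> U - D" using y boundary_iff by auto
  qed
  moreover have "openin X {y\<in>points. \<forall>i<k. monomial_value y (h i) \<in> - {0}}"
    by (intro openin_finite_all openin_monomial_value h_in_S) auto
  ultimately show ?thesis using assms by (simp add: openin_Int)
qed

abbreviation log_sheaf :: "'n point fun_sheaf" where
  "log_sheaf \<equiv> divisorial_log structure_sheaf D"

lemma log_sheaf_iff:
  assumes U: "openin X U"
  shows "f \<in> log_sheaf U \<longleftrightarrow> f \<in> extensional U \<and> (\<forall>x\<in>U. hol_at x f) \<and> (\<forall>x\<in>U - D. f x \<noteq> 0)"
proof -
  note UD = openin_minus_boundary[OF U]
  have "hol_at x (restrict f (U - D))" if "hol_at x f" "x \<in> U - D" for x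
    by (rule hol_at_cong[OF that(1) UD that(2)]) simp
  then show ?thesis
    unfolding divisorial_log_def mem_Collect_eq structure_sheaf_iff[OF U] unit_sections_iff[OF UD]
    by auto
qed

subsection \<open>Approximating points by points of the torus\<close>

text \<open>
  A path of torus logarithms that converges to \<open>y\<close> in \<open>X\<close>: if \<open>exp c\<close> agrees with \<open>y\<close> on the
  monomials that do not vanish at \<open>y\<close>, then moving against the normal of this face keeps their
  values and sends all other monomials to \<open>0\<close>.
\<close>

definition degenerate :: "'n point \<Rightarrow> complex ^ 'n \<Rightarrow> nat \<Rightarrow> complex ^ 'n" where
  "degenerate y c n = c + (- of_nat n) *s complex_vec (face_normal (hom_face (monomial_value y)))"

lemma complex_pairing_degenerate:
  "complex_pairing (degenerate y c n) u =
    complex_pairing c u - of_nat n * of_int (pairing (face_normal (hom_face (monomial_value y))) u)"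
  unfolding degenerate_def complex_pairing_add_left complex_pairing_scale_left complex_pairing_complex_vec
  by simp

lemma complex_pairing_degenerate_face:
  assumes "y \<in> points" "u \<in> hom_face (monomial_value y)"
  shows "complex_pairing (degenerate y c n) u = complex_pairing c u"
proof -
  have f: "face (hom_face (monomial_value y))"
    using face_hom_face monoid_hom_monomial_value assms(1) by blast
  then have "pairing (face_normal (hom_face (monomial_value y))) u = 0"
    using face_normal_zero_iff[OF f face_subset[OF f assms(2)]] assms(2) by blast
  then show ?thesis by (simp add: complex_pairing_degenerate)
qed

lemma character_degenerate_tendsto:
  assumes y: "y \<in> points" and c: "\<And>u. u \<in> hom_face (monomial_value y) \<Longrightarrow> monomial_value y u = character c u"
    and u: "u \<in> S"
  shows "(\<lambda>n. character (degenerate y c n) u) \<longlonglongrightarrow> monomial_value y u"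
proof (cases "u \<in> hom_face (monomial_value y)")
  case True
  then show ?thesis using c[OF True] complex_pairing_degenerate_face[OF y True] by (simp add: character_def)
next
  case False
  let ?m = "pairing (face_normal (hom_face (monomial_value y))) u"
  have "face (hom_face (monomial_value y))"
    using face_hom_face monoid_hom_monomial_value y by blast
  then have "?m \<noteq> 0" using face_normal_zero_iff u False by blast
  then have m: "1 \<le> ?m" using face_normal_nonneg[OF u] by (smt (verit))
  have bound: "norm (character (degenerate y c n) u) \<le> exp (- real n) * norm (character c u)" for n
  proof -
    have "real n * 1 \<le> real n * real_of_int ?m" using m by (intro mult_left_mono) auto
    then have "exp (Re (complex_pairing c u) - real n * real_of_int ?m) \<le> exp (Re (complex_pairing c u) - real n)"
      by simp
    moreover have "norm (character (degenerate y c n) u) = exp (Re (complex_pairing c u) - real n * real_of_int ?m)"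
      by (simp add: character_def complex_pairing_degenerate norm_exp_eq_Re)
    moreover have "exp (- real n) * norm (character c u) = exp (Re (complex_pairing c u) - real n)"
      by (simp add: character_def norm_exp_eq_Re flip: exp_add)
    ultimately show ?thesis by simp
  qed
  have lim: "(\<lambda>n. exp (- real n) * norm (character c u)) \<longlonglongrightarrow> 0"
    by (rule exp_minus_nat_tendsto)
  have "(\<lambda>n. character (degenerate y c n) u) \<longlonglongrightarrow> 0"
    by (rule Lim_null_comparison[OF always_eventually lim]) (rule allI[OF bound])
  moreover have "monomial_value y u = 0" using False u by (simp add: hom_face_def)
  ultimately show ?thesis by simp
qed

lemma nbhd_finite_all:
  assumes "finite J" "x \<in> points" "\<And>j. j \<in> J \<Longrightarrow> \<exists>W. openin X W \<and> x \<in> W \<and> (\<forall>y\<in>W. Q j y)"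
  shows "\<exists>W. openin X W \<and> x \<in> W \<and> (\<forall>y\<in>W. \<forall>j\<in>J. Q j y)"
  using assms(1,3)
proof (induction J)
  case empty
  then show ?case using openin_points assms(2) by auto
next
  case (insert j J)
  obtain W where W: "openin X W" "x \<in> W" "\<forall>y\<in>W. \<forall>j\<in>J. Q j y" using insert by auto
  obtain W' where W': "openin X W'" "x \<in> W'" "\<forall>y\<in>W'. Q j y" using insert.prems[of j] by auto
  show ?case
    using W W' by (intro exI[of _ "W \<inter> W'"]) (auto intro: openin_Int)
qed

lemma face_span_lift:
  assumes T: "face T" and u: "\<forall>g\<in>annihilator T. pairing g u = 0"
  shows "\<exists>q\<in>T. u + q \<in> T"
proof -
  have "\<And>g. g \<in> annihilator T \<Longrightarrow> 0 \<le> pairing g u" using u by simp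
  from face_lift[OF T this] obtain q where q: "q \<in> T" "u + q \<in> S" by metis
  moreover have "\<forall>g\<in>annihilator T. pairing g (u + q) = 0"
    using u q(1) by (simp add: pairing_add_right annihilator_def)
  ultimately show ?thesis using face_iff[OF T] by blast
qed

lemma character_sum_exp:
  assumes "\<And>i. exp (b i) = exp (b' i)"
  shows "exp (\<Sum>i\<in>A. b i * of_int (m i)) = exp (\<Sum>i\<in>A. b' i * of_int (m i) :: complex)"
proof -
  have "exp (b i * of_int (m i)) = exp (b' i * of_int (m i))" for i
    using assms[of i] exp_power_int[of "b i" "m i"] exp_power_int[of "b' i" "m i"]
    by (simp add: mult.commute)
  then show ?thesis by (cases "finite A") (simp_all add: exp_sum)
qed

text \<open>
  If \<open>c0\<close> is a logarithm of \<open>x\<close> on the monomials that do not vanish at \<open>x\<close>, then points \<open>y\<close> near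
  \<open>x\<close> have logarithms close to \<open>c0\<close> there. An arbitrary logarithm of \<open>y\<close> is corrected, along a
  lattice basis of the span of the face, by integral multiples of \<open>2 \<pi> \<i>\<close>, so that the principal
  branch can be used for the quotients \<open>s i\<close>.
\<close>

lemma nearby_logarithm:
  assumes x: "x \<in> points" and e: "0 < \<epsilon>"
    and c0: "\<And>u. u \<in> hom_face (monomial_value x) \<Longrightarrow> monomial_value x u = character c0 u"
  shows "\<exists>W. openin X W \<and> x \<in> W \<and> (\<forall>y\<in>W. \<exists>c.
     (\<forall>u\<in>hom_face (monomial_value y). monomial_value y u = character c u) \<and>
     (\<forall>l<k. h l \<in> hom_face (monomial_value x) \<longrightarrow> norm (complex_pairing (c - c0) (h l)) < \<epsilon>))"
proof -
  define T where "T = hom_face (monomial_value x)"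
  have T: "face T" using face_hom_face[OF monoid_hom_monomial_value[OF x]] by (simp add: T_def)
  obtain e d :: "'n \<Rightarrow> int ^ 'n" and B where b: "lattice_basis e d"
    and B: "\<forall>p. (\<forall>g\<in>annihilator T. real_vec g \<bullet> p = 0) \<longleftrightarrow> (\<forall>i. i \<notin> B \<longrightarrow> real_vec (d i) \<bullet> p = 0)"
    using lattice_basis_adapted[OF finite_annihilator, of T] by (elim exE conjE)
  have K_iff: "(\<forall>g\<in>annihilator T. pairing g u = 0) \<longleftrightarrow> (\<forall>i. i \<notin> B \<longrightarrow> pairing (d i) u = 0)" for u
    using B[rule_format, of "real_vec u"] by (simp add: real_vec_inner)
  have eK: "\<forall>g\<in>annihilator T. pairing g (e i) = 0" if "i \<in> B" for i
    unfolding K_iff using b that by (auto simp: lattice_basis_def)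
  have "\<forall>i\<in>B. \<exists>q\<in>T. e i + q \<in> T" using face_span_lift[OF T eK] by blast
  then obtain q where q: "\<And>i. i \<in> B \<Longrightarrow> q i \<in> T" "\<And>i. i \<in> B \<Longrightarrow> e i + q i \<in> T" by metis
  have TS: "u \<in> S" and Tc: "monomial_value x u = character c0 u" if "u \<in> T" for u
    using face_subset[OF T that] c0 that by (auto simp: T_def)
  \<comment> \<open>The value at \<open>y\<close> of the Laurent monomial \<open>e i\<close> relative to its value at \<open>x\<close>; it tends to \<open>1\<close> as \<open>y\<close> tends to \<open>x\<close>.\<close>
  define s where "s i y = monomial_value y (e i + q i) * inverse (monomial_value y (q i)) *
    exp (- complex_pairing c0 (e i))" for i y
  have s_hol: "hol_at x (s i)" if "i \<in> B" for i
    unfolding s_def using x q[OF that] Tc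
    by (intro hol_at_mult hol_at_inverse hol_at_monomial_value hol_at_const TS) auto
  have s_x: "s i x = 1" if "i \<in> B" for i
    using Tc[OF q(1)[OF that]] Tc[OF q(2)[OF that]]
    by (simp add: s_def character_add) (simp add: character_def exp_minus field_simps)
  define N where "N = (\<Sum>i\<in>B. \<Sum>l<k. real_of_int \<bar>pairing (d i) (h l)\<bar>) + 1"
  have N: "0 < N" unfolding N_def by (intro add_nonneg_pos sum_nonneg) auto
  have eN: "0 < \<epsilon> / N" using e N by simp
  have "isCont Ln 1" by (rule continuous_at_Ln) auto
  then have "\<forall>\<^sub>F z in at 1. dist (Ln z) (Ln 1) < \<epsilon> / N"
    unfolding isCont_def using eN by (rule tendstoD)
  then obtain t where "0 < t" "\<And>z. z \<noteq> 1 \<Longrightarrow> dist z 1 < t \<Longrightarrow> dist (Ln z) (Ln 1) < \<epsilon> / N"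
    unfolding eventually_at by auto
  then have "\<exists>t>0. \<forall>z. dist z 1 < t \<longrightarrow> dist (Ln z) (Ln 1) < \<epsilon> / N"
    using eN by (metis dist_self)
  then obtain t where t: "0 < t" "\<And>z. norm (z - 1) < t \<Longrightarrow> norm (Ln z) < \<epsilon> / N"
    unfolding dist_norm Ln_1 diff_0_right by metis
  have "\<exists>W. openin X W \<and> x \<in> W \<and> (\<forall>y\<in>W. norm (s i y - s i x) < min t 1)" if "i \<in> B" for i
    using hol_at_continuous[OF x s_hol[OF that], of "min t 1"] t(1) by simp
  then have "\<exists>W. openin X W \<and> x \<in> W \<and> (\<forall>y\<in>W. \<forall>i\<in>B. norm (s i y - s i x) < min t 1)"
    by (intro nbhd_finite_all[OF _ x] finite)
  then obtain W where W: "openin X W" "x \<in> W"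
    "\<forall>y\<in>W. \<forall>i\<in>B. norm (s i y - s i x) < min t 1" by (elim exE conjE)
  have "\<exists>c. (\<forall>u\<in>hom_face (monomial_value y). monomial_value y u = character c u) \<and>
     (\<forall>l<k. h l \<in> T \<longrightarrow> norm (complex_pairing (c - c0) (h l)) < \<epsilon>)" if y: "y \<in> W" for y
  proof -
    have yp: "y \<in> points" using y openin_subset_points[OF W(1)] by blast
    obtain c' where c': "\<And>u. u \<in> hom_face (monomial_value y) \<Longrightarrow> monomial_value y u = character c' u"
      using hom_face_eq_character[OF monoid_hom_monomial_value[OF yp]] by metis
    have s1: "norm (s i y - 1) < min t 1" if "i \<in> B" for i using W(3) y that s_x by simp
    define L where "L i = Ln (s i y)" for i
    have L: "norm (L i) < \<epsilon> / N" if "i \<in> B" for i using t(2)[of "s i y"] s1[OF that] by (simp add: L_def)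
    have s0: "s i y \<noteq> 0" if "i \<in> B" for i using s1[OF that] by auto
    have s_eq: "s i y = exp (complex_pairing c' (e i) - complex_pairing c0 (e i))" if "i \<in> B" for i
    proof -
      have "e i + q i \<in> hom_face (monomial_value y)" "q i \<in> hom_face (monomial_value y)"
        using s0[OF that] TS q that by (auto simp: s_def hom_face_def)
      then show ?thesis
        using c' by (simp add: s_def character_add) (simp add: character_def exp_diff exp_minus field_simps)
    qed
    define \<beta> where "\<beta> i = (if i \<in> B then complex_pairing c0 (e i) + L i else complex_pairing c' (e i))" for i
    define c where "c = (\<Sum>i\<in>UNIV. \<beta> i *s complex_vec (d i))"
    have cu: "complex_pairing c u = (\<Sum>i\<in>UNIV. \<beta> i * of_int (pairing (d i) u))" for u
      by (simp add: c_def complex_pairing_sum_left complex_pairing_scale_left complex_pairing_complex_vec)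
    have expand: "complex_pairing c'' u = (\<Sum>i\<in>UNIV. complex_pairing c'' (e i) * of_int (pairing (d i) u))" for c'' u
    proof -
      have "complex_pairing c'' u = complex_pairing c'' (\<Sum>i\<in>UNIV. pairing (d i) u *s e i)"
        using b by (simp add: lattice_basis_def)
      then show ?thesis by (simp add: complex_pairing_sum_right complex_pairing_scale_right mult.commute)
    qed
    have "exp (\<beta> i) = exp (complex_pairing c' (e i))" for i
    proof (cases "i \<in> B")
      case True
      then have "exp (L i) = s i y" using s0 by (simp add: L_def)
      then show ?thesis using s_eq[OF True] True by (simp add: \<beta>_def exp_add exp_diff)
    qed (simp add: \<beta>_def)
    then have "character c u = character c' u" for u
      unfolding character_def cu expand[of c' u] by (rule character_sum_exp)
    then have "\<forall>u\<in>hom_face (monomial_value y). monomial_value y u = character c u" using c' by simp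
    moreover have "norm (complex_pairing (c - c0) (h l)) < \<epsilon>" if l: "l < k" "h l \<in> T" for l
    proof -
      have z: "pairing (d i) (h l) = 0" if "i \<notin> B" for i
        using K_iff[of "h l"] face_iff[OF T TS[OF l(2)]] l(2) that by blast
      have "complex_pairing (c - c0) (h l) = (\<Sum>i\<in>UNIV. (\<beta> i - complex_pairing c0 (e i)) * of_int (pairing (d i) (h l)))"
        unfolding complex_pairing_diff_left cu expand[of c0 "h l"] left_diff_distrib sum_subtractf ..
      also have "\<dots> = (\<Sum>i\<in>B. L i * of_int (pairing (d i) (h l)))"
        using z by (intro sum.mono_neutral_cong_right) (auto simp: \<beta>_def)
      finally have "norm (complex_pairing (c - c0) (h l)) \<le> (\<Sum>i\<in>B. norm (L i * of_int (pairing (d i) (h l))))"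
        by (simp only: norm_sum)
      also have "\<dots> \<le> (\<Sum>i\<in>B. (\<epsilon> / N) * real_of_int \<bar>pairing (d i) (h l)\<bar>)"
        unfolding norm_mult norm_of_int of_int_abs
        by (intro sum_mono mult_right_mono less_imp_le[OF L]) auto
      also have "\<dots> \<le> (\<Sum>i\<in>B. (\<epsilon> / N) * (\<Sum>l<k. real_of_int \<bar>pairing (d i) (h l)\<bar>))"
        using l(1) eN by (intro sum_mono mult_left_mono member_le_sum) auto
      also have "\<dots> = (\<epsilon> / N) * (N - 1)" by (simp add: N_def sum_distrib_left)
      also have "\<dots> < \<epsilon>" using e N by (simp add: field_simps)
      finally show ?thesis .
    qed
    ultimately show ?thesis by blast
  qed
  then show ?thesis using W unfolding T_def by blast
qed

end

section \<open>Local factorization into a monomial and a unit\<close>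

lemma infsum_finite_fibres:
  fixes f :: "'a \<Rightarrow> complex"
  assumes "finite B" "f summable_on A" "\<And>a. a \<in> A \<Longrightarrow> j a \<in> B"
  shows "infsum f A = (\<Sum>b\<in>B. infsum f {a\<in>A. j a = b})"
proof -
  have "infsum f {a\<in>A. j a \<in> B'} = (\<Sum>b\<in>B'. infsum f {a\<in>A. j a = b})" if "finite B'" for B'
    using that
  proof (induction B')
    case (insert b B')
    have "{a\<in>A. j a \<in> insert b B'} = {a\<in>A. j a = b} \<union> {a\<in>A. j a \<in> B'}" by auto
    moreover have "infsum f ({a\<in>A. j a = b} \<union> {a\<in>A. j a \<in> B'})
        = infsum f {a\<in>A. j a = b} + infsum f {a\<in>A. j a \<in> B'}"
      using insert.hyps
      by (intro infsum_Un_disjoint summable_on_subset_banach[OF assms(2)]) auto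
    ultimately show ?case using insert by simp
  qed simp
  from this[OF assms(1)] have "infsum f {a\<in>A. j a \<in> B} = (\<Sum>b\<in>B. infsum f {a\<in>A. j a = b})" .
  moreover have "{a\<in>A. j a \<in> B} = A" using assms(3) by auto
  ultimately show ?thesis by simp
qed

lemma convex_complex_pairing_vimage:
  assumes "convex C"
  shows "convex {c. complex_pairing c u - z \<in> C}"
proof -
  have "linear (\<lambda>c. complex_pairing c u)"
    by (rule linearI[OF complex_pairing_add_left]) (simp add: complex_pairing_def scaleR_sum_right)
  moreover have "{c. complex_pairing c u - z \<in> C} = (\<lambda>c. complex_pairing c u) -` ((\<lambda>w. z + w) ` C)"
  proof -
    have "w - z \<in> C \<longleftrightarrow> w \<in> (\<lambda>w. z + w) ` C" for w
      by (auto intro: image_eqI[of w _ "w - z"])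
    then show ?thesis by auto
  qed
  ultimately show ?thesis
    using convex_linear_vimage[of "\<lambda>c. complex_pairing c u" "(\<lambda>w. z + w) ` C"] convex_translation[OF assms, of z]
    by simp
qed

context affine_toric
begin

text \<open>
  Logarithms of torus points near \<open>x\<close>: close to the logarithm \<open>c0\<close> of \<open>x\<close> on the generators that
  do not vanish at \<open>x\<close>, and with small values of the other generators. The set is convex and
  invariant under moving against the normals that vanish on the face of \<open>x\<close>.
\<close>

definition tube :: "'n point \<Rightarrow> complex ^ 'n \<Rightarrow> real \<Rightarrow> real \<Rightarrow> (complex ^ 'n) set" where
  "tube x c0 \<epsilon> \<rho> = {c. \<forall>i<k. if h i \<in> hom_face (monomial_value x)
      then norm (complex_pairing (c - c0) (h i)) < \<epsilon> else Re (complex_pairing c (h i)) < ln \<rho>}"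

lemma convex_tube: "convex (tube x c0 \<epsilon> \<rho>)"
proof -
  define C where "C i = (if h i \<in> hom_face (monomial_value x)
      then {c. complex_pairing c (h i) - complex_pairing c0 (h i) \<in> ball 0 \<epsilon>}
      else {c. complex_pairing c (h i) - 0 \<in> {w. Re w < ln \<rho>}})" for i
  have "convex (C i)" for i
    unfolding C_def by (simp only: convex_complex_pairing_vimage convex_ball convex_halfspace_Re_lt split: if_split) simp
  then have "convex (\<Inter>i\<in>{..<k}. C i)" by (intro convex_INT) auto
  moreover have "tube x c0 \<epsilon> \<rho> = (\<Inter>i\<in>{..<k}. C i)"
    by (auto simp: tube_def C_def complex_pairing_diff_left)
  ultimately show ?thesis by simp
qed

lemma tube_degenerate:
  assumes y: "y \<in> points" and c: "\<And>u. u \<in> hom_face (monomial_value y) \<Longrightarrow> monomial_value y u = character c u"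
    and sub: "\<And>i. i < k \<Longrightarrow> h i \<in> hom_face (monomial_value x) \<Longrightarrow> h i \<in> hom_face (monomial_value y)"
    and near: "\<And>i. i < k \<Longrightarrow> h i \<in> hom_face (monomial_value x) \<Longrightarrow> norm (complex_pairing (c - c0) (h i)) < \<epsilon>"
    and small: "\<And>i. i < k \<Longrightarrow> h i \<notin> hom_face (monomial_value x) \<Longrightarrow> norm (monomial_value y (h i)) < \<rho>"
    and rho: "0 < \<rho>"
  shows "\<forall>\<^sub>F n in sequentially. degenerate y c n \<in> tube x c0 \<epsilon> \<rho>"
proof -
  have "\<forall>\<^sub>F n in sequentially. if h i \<in> hom_face (monomial_value x)
      then norm (complex_pairing (degenerate y c n - c0) (h i)) < \<epsilon>
      else Re (complex_pairing (degenerate y c n) (h i)) < ln \<rho>" if i: "i < k" for i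
  proof (cases "h i \<in> hom_face (monomial_value x)")
    case True
    have "complex_pairing (degenerate y c n - c0) (h i) = complex_pairing (c - c0) (h i)" for n
      using complex_pairing_degenerate_face[OF y sub[OF i True]] by (simp add: complex_pairing_diff_left)
    then show ?thesis using near[OF i True] True by simp
  next
    case False
    have "(\<lambda>n. norm (character (degenerate y c n) (h i))) \<longlonglongrightarrow> norm (monomial_value y (h i))"
      by (intro tendsto_norm character_degenerate_tendsto y c h_in_S i)
    from order_tendstoD(2)[OF this small[OF i False]]
    have "\<forall>\<^sub>F n in sequentially. Re (complex_pairing (degenerate y c n) (h i)) < ln \<rho>"
    proof eventually_elim
      case (elim n)
      then have "exp (Re (complex_pairing (degenerate y c n) (h i))) < exp (ln \<rho>)"
        using rho by (simp add: character_def norm_exp_eq_Re)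
      then show ?case by simp
    qed
    then show ?thesis using False by simp
  qed
  then have "\<forall>\<^sub>F n in sequentially. \<forall>i\<in>{..<k}. if h i \<in> hom_face (monomial_value x)
      then norm (complex_pairing (degenerate y c n - c0) (h i)) < \<epsilon>
      else Re (complex_pairing (degenerate y c n) (h i)) < ln \<rho>"
    by (intro eventually_ball_finite) auto
  then show ?thesis by (rule eventually_mono) (simp add: tube_def)
qed

lemma tube_subset_box:
  assumes x: "x \<in> points" and c0: "\<And>u. u \<in> hom_face (monomial_value x) \<Longrightarrow> monomial_value x u = character c0 u"
    and rho: "0 < \<rho>"
  shows "\<exists>\<epsilon>>0. \<forall>c\<in>tube x c0 \<epsilon> \<rho>. \<forall>i<k. norm (character c (h i) - coords x i) < \<rho>"
proof -
  define N where "N = (\<Sum>i<k. norm (coords x i)) + 1"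
  have N: "0 < N" unfolding N_def by (intro add_nonneg_pos sum_nonneg) auto
  have "((exp :: complex \<Rightarrow> complex) \<longlongrightarrow> exp 0) (at 0)" by (intro tendsto_intros)
  then have "\<forall>\<^sub>F \<zeta> in at 0. dist (exp \<zeta>) (1::complex) < \<rho> / N"
    using rho N tendstoD[of exp "exp 0 :: complex" "at 0" "\<rho> / N"] by simp
  then obtain \<epsilon> where \<epsilon>: "0 < \<epsilon>" "\<And>\<zeta>::complex. \<zeta> \<noteq> 0 \<Longrightarrow> dist \<zeta> 0 < \<epsilon> \<Longrightarrow> dist (exp \<zeta>) 1 < \<rho> / N"
    unfolding eventually_at by auto
  have ex: "norm (exp \<zeta> - 1) < \<rho> / N" if "norm \<zeta> < \<epsilon>" for \<zeta> :: complex
    using \<epsilon>(2)[of \<zeta>] that rho N by (cases "\<zeta> = 0") (simp_all add: dist_norm)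
  have "norm (character c (h i) - coords x i) < \<rho>" if c: "c \<in> tube x c0 \<epsilon> \<rho>" and i: "i < k" for c i
  proof (cases "h i \<in> hom_face (monomial_value x)")
    case True
    have e: "norm (exp (complex_pairing (c - c0) (h i)) - 1) < \<rho> / N"
      using c i True by (intro ex) (auto simp: tube_def)
    have a: "coords x i = exp (complex_pairing c0 (h i))" using c0[OF True] by (simp add: coords_def character_def)
    have "character c (h i) - coords x i = coords x i * (exp (complex_pairing (c - c0) (h i)) - 1)"
      unfolding a by (simp add: character_def complex_pairing_diff_left exp_diff field_simps)
    then have "norm (character c (h i) - coords x i) = norm (coords x i) * norm (exp (complex_pairing (c - c0) (h i)) - 1)"
      by (simp add: norm_mult)
    also have "\<dots> \<le> norm (coords x i) * (\<rho> / N)" using e by (intro mult_left_mono) auto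
    also have "\<dots> < N * (\<rho> / N)"
    proof (rule mult_strict_right_mono)
      have "norm (coords x i) \<le> (\<Sum>i<k. norm (coords x i))" using i by (intro member_le_sum) auto
      then show "norm (coords x i) < N" by (simp add: N_def)
    qed (use rho N in simp)
    finally show ?thesis using N by simp
  next
    case False
    then have "coords x i = 0" using h_in_S[OF i] by (simp add: hom_face_def coords_def)
    moreover have "exp (Re (complex_pairing c (h i))) < exp (ln \<rho>)"
      using c i False by (simp add: tube_def)
    ultimately show ?thesis using rho by (simp add: character_def norm_exp_eq_Re)
  qed
  then show ?thesis using \<epsilon>(1) by blast
qed

text \<open>
  Degenerate a logarithm of \<open>y\<close> that is close to \<open>c0\<close>. Therefore an identity between holomorphic
  functions near \<open>x\<close> may be checked on torus points with logarithm in the tube.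
\<close>

lemma tube_dense:
  assumes x: "x \<in> points" and c0: "\<And>u. u \<in> hom_face (monomial_value x) \<Longrightarrow> monomial_value x u = character c0 u"
    and rho: "0 < \<rho>" and eps: "0 < \<epsilon>"
  shows "\<exists>W. openin X W \<and> x \<in> W \<and> (\<forall>y\<in>W. \<exists>c. (\<forall>n. c n \<in> tube x c0 \<epsilon> \<rho>) \<and>
      (\<forall>u\<in>S. (\<lambda>n. character (c n) u) \<longlonglongrightarrow> monomial_value y u))"
proof -
  obtain W where W: "openin X W" "x \<in> W" "\<forall>y\<in>W. \<exists>c.
     (\<forall>u\<in>hom_face (monomial_value y). monomial_value y u = character c u) \<and>
     (\<forall>l<k. h l \<in> hom_face (monomial_value x) \<longrightarrow> norm (complex_pairing (c - c0) (h l)) < \<epsilon>)"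
    using nearby_logarithm[OF x eps c0] by auto
  have "\<exists>W. openin X W \<and> x \<in> W \<and> (\<forall>y\<in>W. monomial_value x (h i) \<noteq> 0 \<longrightarrow> monomial_value y (h i) \<noteq> 0)"
    if "i \<in> {..<k}" for i
    using hol_at_nonzero_nearby[OF x hol_at_monomial_value[OF x h_in_S, of i]] that openin_points x by blast
  then have "\<exists>W. openin X W \<and> x \<in> W \<and>
      (\<forall>y\<in>W. \<forall>i\<in>{..<k}. monomial_value x (h i) \<noteq> 0 \<longrightarrow> monomial_value y (h i) \<noteq> 0)"
    by (intro nbhd_finite_all[OF finite_lessThan x])
  then obtain W' where W': "openin X W'" "x \<in> W'"
    "\<forall>y\<in>W'. \<forall>i\<in>{..<k}. monomial_value x (h i) \<noteq> 0 \<longrightarrow> monomial_value y (h i) \<noteq> 0"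
    by (elim exE conjE)
  define V where "V = W \<inter> W' \<inter> box x \<rho>"
  have V: "openin X V" "x \<in> V"
    using W W' rho x by (auto simp: V_def intro!: openin_Int openin_box center_in_box)
  have "\<exists>c. (\<forall>n. c n \<in> tube x c0 \<epsilon> \<rho>) \<and> (\<forall>u\<in>S. (\<lambda>n. character (c n) u) \<longlonglongrightarrow> monomial_value y u)"
    if y: "y \<in> V" for y
  proof -
    have yp: "y \<in> points" using openin_subset_points[OF V(1)] y by blast
    obtain c where c: "\<And>u. u \<in> hom_face (monomial_value y) \<Longrightarrow> monomial_value y u = character c u"
      "\<And>l. l < k \<Longrightarrow> h l \<in> hom_face (monomial_value x) \<Longrightarrow> norm (complex_pairing (c - c0) (h l)) < \<epsilon>"
      using W(3) y unfolding V_def by blast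
    have "\<forall>\<^sub>F n in sequentially. degenerate y c n \<in> tube x c0 \<epsilon> \<rho>"
    proof (rule tube_degenerate[OF yp c(1)])
      show "h i \<in> hom_face (monomial_value y)" if "i < k" "h i \<in> hom_face (monomial_value x)" for i
        using W'(3) y that by (simp add: V_def hom_face_def)
      show "norm (monomial_value y (h i)) < \<rho>" if "i < k" "h i \<notin> hom_face (monomial_value x)" for i
      proof -
        have "monomial_value x (h i) = 0" using that h_in_S by (simp add: hom_face_def)
        moreover have "norm (coords y i - coords x i) < \<rho>" using y that(1) by (simp add: V_def box_def)
        ultimately show ?thesis by (simp add: coords_def)
      qed
    qed (use c(2) rho in auto)
    then obtain n0 where n0: "\<And>n. n \<ge> n0 \<Longrightarrow> degenerate y c n \<in> tube x c0 \<epsilon> \<rho>"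
      unfolding eventually_sequentially by blast
    have "(\<lambda>n. character (degenerate y c (n + n0)) u) \<longlonglongrightarrow> monomial_value y u" if "u \<in> S" for u
      using LIMSEQ_ignore_initial_segment[OF character_degenerate_tendsto[OF yp c(1) that]] .
    then show ?thesis using n0 by (intro exI[of _ "\<lambda>n. degenerate y c (n + n0)"]) simp
  qed
  then show ?thesis using V by blast
qed

text \<open>
  By Dickson's lemma the exponents in \<open>A\<close> lie above finitely many of them, the set \<open>B\<close>. It
  therefore suffices to divide a single term with exponent \<open>\<beta>\<close> by the monomial \<open>u\<close>. By \<open>face_lift\<close>
  this is possible up to a monomial \<open>q \<beta>\<close> that does not vanish at \<open>x\<close>, hence is invertible nearby.
\<close>

lemma divide_series:
  assumes x: "x \<in> points"
    and F: "\<And>z. (\<And>i. i < k \<Longrightarrow> norm (z i - coords x i) < r) \<Longrightarrow>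
      ((\<lambda>\<alpha>. c \<alpha> * monom_eval k (\<lambda>i. z i - coords x i) \<alpha>) has_sum F z) (multi_indices k)"
    and r: "0 < r" and u: "u \<in> S" and A: "A \<subseteq> multi_indices k"
    and A_div: "\<And>\<alpha> g. \<alpha> \<in> A \<Longrightarrow> g \<in> annihilator (hom_face (monomial_value x)) \<Longrightarrow>
      pairing g u \<le> (\<Sum>i<k. int (\<alpha> i) * pairing g (h i))"
  shows "\<exists>H W. holomorphic_near k H (coords x) \<and> openin X W \<and> x \<in> W \<and>
    (\<forall>y\<in>W. (\<Sum>\<^sub>\<infinity>\<alpha>\<in>A. c \<alpha> * monom_eval k (\<lambda>i. coords y i - coords x i) \<alpha>) = monomial_value y u * H (coords y))"
proof -
  define T where "T = hom_face (monomial_value x)"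
  let ?a = "coords x"
  have T: "face T" using face_hom_face[OF monoid_hom_monomial_value[OF x]] by (simp add: T_def)
  have TS: "v \<in> S" and Tnz: "monomial_value x v \<noteq> 0" if "v \<in> T" for v
    using that by (auto simp: T_def hom_face_def)
  obtain B where B: "finite B" "B \<subseteq> A" "\<forall>\<alpha>\<in>A. \<exists>\<beta>\<in>B. \<forall>i\<in>{..<k}. \<beta> i \<le> \<alpha> i"
    using Dickson[OF finite_lessThan[of k], where A = A and w = "\<lambda>\<alpha>. \<alpha>"] by (elim exE conjE)
  then obtain J where J: "\<And>\<alpha>. \<alpha> \<in> A \<Longrightarrow> J \<alpha> \<in> B" "\<And>\<alpha> i. \<alpha> \<in> A \<Longrightarrow> i < k \<Longrightarrow> J \<alpha> i \<le> \<alpha> i"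
    by (metis lessThan_iff)
  \<comment> \<open>Coordinates in \<open>T\<close> are nonzero at \<open>x\<close>, so their differences \<open>z i - ?a i\<close> are not monomials; they go into
    the factor \<open>E\<close>. The other coordinates vanish at \<open>x\<close> and contribute the monomial \<open>v \<beta>\<close>.\<close>
  define v where "v \<beta> = (\<Sum>i\<in>{i. i < k \<and> h i \<notin> T}. int (\<beta> i) *s h i)" for \<beta> :: "nat \<Rightarrow> nat"
  have vS: "v \<beta> \<in> S" for \<beta>
    unfolding v_def by (intro lattice_cone_sum lattice_cone_scale h_in_S) auto
  have "\<exists>q\<in>T. (v \<beta> - u) + q \<in> S" if \<beta>: "\<beta> \<in> B" for \<beta>
  proof -
    have "0 \<le> pairing g (v \<beta> - u)" if g: "g \<in> annihilator T" for g
    proof -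
      have "(\<Sum>i<k. int (\<beta> i) * pairing g (h i)) = (\<Sum>i\<in>{i. i < k \<and> h i \<notin> T}. int (\<beta> i) * pairing g (h i))"
        using g by (intro sum.mono_neutral_right) (auto simp: annihilator_def)
      also have "\<dots> = pairing g (v \<beta>)"
        by (simp add: v_def pairing_sum_right pairing_scale_right)
      finally show ?thesis
        using A_div[of \<beta> g] \<beta> B(2) g by (auto simp: T_def pairing_diff_right)
    qed
    from face_lift[OF T this] show ?thesis by metis
  qed
  then obtain q where q: "\<And>\<beta>. \<beta> \<in> B \<Longrightarrow> q \<beta> \<in> T" "\<And>\<beta>. \<beta> \<in> B \<Longrightarrow> (v \<beta> - u) + q \<beta> \<in> S" by metis
  define p where "p \<beta> = (v \<beta> - u) + q \<beta>" for \<beta>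
  define E where "E \<beta> z = (\<Prod>i\<in>{i. i < k \<and> h i \<in> T}. (z i - ?a i) ^ \<beta> i)" for \<beta> :: "nat \<Rightarrow> nat" and z :: "nat \<Rightarrow> complex"
  define Q where "Q \<beta> z = (\<Sum>\<^sub>\<infinity>\<alpha>\<in>{\<alpha>\<in>A. J \<alpha> = \<beta>}. c \<alpha> * monom_eval k (\<lambda>i. z i - ?a i) (\<lambda>i. \<alpha> i - \<beta> i))" for \<beta> z
  define H where "H z = (\<Sum>\<beta>\<in>B. E \<beta> z * monom_eval k z (rep (p \<beta>)) * inverse (monom_eval k z (rep (q \<beta>))) * Q \<beta> z)" for z
  have "holomorphic_near k H ?a"
    unfolding H_def
  proof (intro holomorphic_near_sum holomorphic_near_mult)
    fix \<beta> assume \<beta>: "\<beta> \<in> B"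
    have "holomorphic_near k (\<lambda>z. z i - ?a i) ?a" if "i < k" for i
      using holomorphic_near_add[OF holomorphic_near_coordinate[OF that] holomorphic_near_const[of k "- ?a i"]] by simp
    then show "holomorphic_near k (E \<beta>) ?a"
      unfolding E_def[abs_def] by (intro holomorphic_near_prod holomorphic_near_power) auto
    show "holomorphic_near k (\<lambda>z. monom_eval k z (rep (p \<beta>))) ?a"
      by (intro holomorphic_near_monom_eval holomorphic_near_coordinate)
    show "holomorphic_near k (\<lambda>z. inverse (monom_eval k z (rep (q \<beta>)))) ?a"
    proof (intro holomorphic_near_inverse holomorphic_near_monom_eval holomorphic_near_coordinate)
      show "monom_eval k ?a (rep (q \<beta>)) \<noteq> 0"
        using monomial_value_eq[OF x TS[OF q(1)[OF \<beta>]]] Tnz[OF q(1)[OF \<beta>]] by simp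
    qed
    show "holomorphic_near k (Q \<beta>) ?a"
      unfolding Q_def[abs_def] by (rule holomorphic_near_subseries[OF F r]) (use A J in auto)
  qed
  moreover define W where "W = box x r \<inter> {y\<in>points. monomial_value y (\<Sum>\<beta>\<in>B. q \<beta>) \<in> - {0}}"
  have qS: "(\<Sum>\<beta>\<in>B. q \<beta>) \<in> T" by (intro face_sum[OF T] q(1))
  have "openin X W" unfolding W_def by (intro openin_Int openin_box openin_monomial_value TS qS) auto
  moreover have "x \<in> W" using x r Tnz[OF qS] by (simp add: W_def center_in_box)
  moreover have "(\<Sum>\<^sub>\<infinity>\<alpha>\<in>A. c \<alpha> * monom_eval k (\<lambda>i. coords y i - ?a i) \<alpha>) = monomial_value y u * H (coords y)"
    if y: "y \<in> W" for y
  proof -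
    have yp: "y \<in> points" and yr: "\<And>i. i < k \<Longrightarrow> norm (coords y i - ?a i) < r"
      using y by (auto simp: W_def box_def)
    let ?m = "monom_eval k (\<lambda>i. coords y i - ?a i)"
    have sm: "(\<lambda>\<alpha>. c \<alpha> * ?m \<alpha>) summable_on A"
      by (rule summable_on_subset_banach[OF has_sum_imp_summable[OF F[OF yr]] A])
    have "(\<Sum>\<^sub>\<infinity>\<alpha>\<in>A. c \<alpha> * ?m \<alpha>) = (\<Sum>\<beta>\<in>B. \<Sum>\<^sub>\<infinity>\<alpha>\<in>{\<alpha>\<in>A. J \<alpha> = \<beta>}. c \<alpha> * ?m \<alpha>)"
      by (rule infsum_finite_fibres[OF B(1) sm J(1)])
    also have "\<dots> = (\<Sum>\<beta>\<in>B. ?m \<beta> * Q \<beta> (coords y))"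
    proof (rule sum.cong[OF refl])
      fix \<beta> assume \<beta>: "\<beta> \<in> B"
      have "?m \<alpha> = ?m \<beta> * ?m (\<lambda>i. \<alpha> i - \<beta> i)" if "\<alpha> \<in> A" "J \<alpha> = \<beta>" for \<alpha>
        unfolding monom_eval_def prod.distrib[symmetric] power_add[symmetric]
        using J(2)[OF that(1)] that(2) by (intro prod.cong) auto
      then have "(\<Sum>\<^sub>\<infinity>\<alpha>\<in>{\<alpha>\<in>A. J \<alpha> = \<beta>}. c \<alpha> * ?m \<alpha>)
          = (\<Sum>\<^sub>\<infinity>\<alpha>\<in>{\<alpha>\<in>A. J \<alpha> = \<beta>}. ?m \<beta> * (c \<alpha> * ?m (\<lambda>i. \<alpha> i - \<beta> i)))"
        by (intro infsum_cong) auto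
      then show "(\<Sum>\<^sub>\<infinity>\<alpha>\<in>{\<alpha>\<in>A. J \<alpha> = \<beta>}. c \<alpha> * ?m \<alpha>) = ?m \<beta> * Q \<beta> (coords y)"
        by (simp add: Q_def infsum_cmult_right')
    qed
    also have "\<dots> = (\<Sum>\<beta>\<in>B. monomial_value y u *
        (E \<beta> (coords y) * monom_eval k (coords y) (rep (p \<beta>)) * inverse (monom_eval k (coords y) (rep (q \<beta>))) * Q \<beta> (coords y)))"
    proof (rule sum.cong[OF refl])
      fix \<beta> assume \<beta>: "\<beta> \<in> B"
      have "{..<k} = {i. i < k \<and> h i \<in> T} \<union> {i. i < k \<and> h i \<notin> T}" by auto
      then have "?m \<beta> = E \<beta> (coords y) * (\<Prod>i\<in>{i. i < k \<and> h i \<notin> T}. (coords y i - ?a i) ^ \<beta> i)"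
        unfolding monom_eval_def E_def by (simp add: prod.union_disjoint disjoint_iff)
      also have "(\<Prod>i\<in>{i. i < k \<and> h i \<notin> T}. (coords y i - ?a i) ^ \<beta> i) = monomial_value y (v \<beta>)"
      proof -
        have "monomial_value y (v \<beta>) = (\<Prod>i\<in>{i. i < k \<and> h i \<notin> T}. monomial_value y (int (\<beta> i) *s h i))"
          unfolding v_def
          by (rule monoid_hom_sum[OF monoid_hom_monomial_value[OF yp]]) (auto intro: lattice_cone_scale h_in_S)
        also have "\<dots> = (\<Prod>i\<in>{i. i < k \<and> h i \<notin> T}. (coords y i - ?a i) ^ \<beta> i)"
        proof (rule prod.cong[OF refl])
          fix i assume "i \<in> {i. i < k \<and> h i \<notin> T}"
          then have i: "i < k" "h i \<notin> T" by auto
          then have "?a i = 0" using h_in_S by (simp add: T_def hom_face_def coords_def)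
          then show "monomial_value y (int (\<beta> i) *s h i) = (coords y i - ?a i) ^ \<beta> i"
            using monoid_hom_scale[OF monoid_hom_monomial_value[OF yp] h_in_S[OF i(1)]] by (simp add: coords_def)
        qed
        finally show ?thesis by simp
      qed
      finally have m: "?m \<beta> = E \<beta> (coords y) * monomial_value y (v \<beta>)" .
      have "(\<Sum>\<beta>\<in>B. q \<beta>) = q \<beta> + (\<Sum>\<beta>\<in>B - {\<beta>}. q \<beta>)" using \<beta> B(1) by (simp add: sum.remove)
      then have "monomial_value y (q \<beta>) * monomial_value y (\<Sum>\<beta>\<in>B - {\<beta>}. q \<beta>) = monomial_value y (\<Sum>\<beta>\<in>B. q \<beta>)"
        using monomial_value_mult[OF yp, of "q \<beta>" "\<Sum>\<beta>\<in>B - {\<beta>}. q \<beta>"] TS[OF q(1)[OF \<beta>]]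
          lattice_cone_sum[of "B - {\<beta>}" q G] TS q(1) by auto
      then have nz: "monomial_value y (q \<beta>) \<noteq> 0" using y by (auto simp: W_def)
      have "v \<beta> + q \<beta> = u + p \<beta>" by (simp add: p_def)
      moreover have pS: "p \<beta> \<in> S" using q(2)[OF \<beta>] by (simp add: p_def)
      ultimately have "monomial_value y (v \<beta>) * monomial_value y (q \<beta>) = monomial_value y u * monomial_value y (p \<beta>)"
        using monomial_value_mult[OF yp vS TS[OF q(1)[OF \<beta>]], of \<beta>] monomial_value_mult[OF yp u pS] by simp
      then have "monomial_value y (v \<beta>) = monomial_value y u * monomial_value y (p \<beta>) * inverse (monomial_value y (q \<beta>))"
        using nz by (simp add: field_simps)
      then show "?m \<beta> * Q \<beta> (coords y) = monomial_value y u *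
        (E \<beta> (coords y) * monom_eval k (coords y) (rep (p \<beta>)) * inverse (monom_eval k (coords y) (rep (q \<beta>))) * Q \<beta> (coords y))"
        unfolding m monomial_value_eq[OF yp pS] monomial_value_eq[OF yp TS[OF q(1)[OF \<beta>]]] by (simp add: mult_ac)
    qed
    finally show ?thesis by (simp add: H_def sum_distrib_left)
  qed
  ultimately show ?thesis by blast
qed

text \<open>
  In logarithmic coordinates on the tube, the expansion of \<open>f\<close> is a weighted series without zeros,
  since torus points lie off the boundary. Its leading weight is the weight of an exponent \<open>u\<close>,
  and the terms of at least this weight are divisible by \<open>u\<close>. The cofactor is nonzero at \<open>x\<close>
  because \<open>f\<close> decays exactly as fast as the monomial \<open>u\<close> when the torus degenerates to \<open>x\<close>.
\<close>

theorem local_factorization: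
  assumes x: "x \<in> points" and W0: "openin X W0" "x \<in> W0" and f: "hol_at x f"
    and nz: "\<And>y. y \<in> W0 - D \<Longrightarrow> f y \<noteq> 0"
  shows "\<exists>u\<in>S. \<exists>g. hol_at x g \<and> g x \<noteq> 0 \<and>
    (\<exists>W. openin X W \<and> x \<in> W \<and> (\<forall>y\<in>W. f y = monomial_value y u * g y))"
  using f
proof (rule hol_atE)
  fix F W1 assume F: "holomorphic_near k F (coords x)" and W1: "openin X W1" "x \<in> W1" "\<And>y. y \<in> W1 \<Longrightarrow> f y = F (coords y)"
  define T where "T = hom_face (monomial_value x)"
  let ?a = "coords x" and ?M = "multi_indices k"
  have T: "face T" using face_hom_face[OF monoid_hom_monomial_value[OF x]] by (simp add: T_def)
  obtain c0 where c0: "\<And>u. u \<in> hom_face (monomial_value x) \<Longrightarrow> monomial_value x u = character c0 u"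
    using hom_face_eq_character[OF monoid_hom_monomial_value[OF x]] by metis
  obtain r c where r: "0 < r" and ser: "\<And>z. (\<And>i. i < k \<Longrightarrow> norm (z i - ?a i) < r) \<Longrightarrow>
      ((\<lambda>\<alpha>. c \<alpha> * monom_eval k (\<lambda>i. z i - ?a i) \<alpha>) has_sum F z) ?M"
    using F unfolding holomorphic_near_iff_series by metis
  obtain \<delta> where \<delta>: "0 < \<delta>" "box x \<delta> \<subseteq> W0 \<inter> W1"
    using openin_contains_box[of "W0 \<inter> W1" x] W0 W1 openin_Int by (metis IntI)
  define \<rho> where "\<rho> = min \<delta> (r / 2)"
  have \<rho>: "0 < \<rho>" "\<rho> < r" "box x \<rho> \<subseteq> W0 \<inter> W1"
    using \<delta> r box_mono[of \<rho> \<delta> x] by (auto simp: \<rho>_def)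
  obtain \<epsilon> where \<epsilon>: "0 < \<epsilon>" and box: "\<forall>c\<in>tube x c0 \<epsilon> \<rho>. \<forall>i<k. norm (character c (h i) - ?a i) < \<rho>"
    using tube_subset_box[OF x c0 \<rho>(1)] by auto
  define \<Omega> where "\<Omega> = tube x c0 \<epsilon> \<rho>"
  define t where "t \<alpha> c' = c \<alpha> * monom_eval k (\<lambda>i. character c' (h i) - ?a i) \<alpha>" for \<alpha> and c' :: "complex ^ 'n"
  define w where "w \<alpha> g = (\<Sum>i<k. \<alpha> i * nat (pairing g (h i)))" for \<alpha> :: "nat \<Rightarrow> nat" and g
  have coords_torus: "coords (torus_point c') i = character c' (h i)" if "i < k" for c' i
    using monomial_value_point_of[OF h_in_S[OF that]] by (simp add: coords_def)
  have near: "norm (character c' (h i) - ?a i) < \<rho>" if "c' \<in> \<Omega>" "i < k" for c' i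
    using box that by (simp add: \<Omega>_def)
  have torus_box: "torus_point c' \<in> box x \<rho>" if "c' \<in> \<Omega>" for c'
    using near[OF that] coords_torus by (simp add: box_def torus_point_in_points)
  have a0: "?a i = 0" if "i < k" "h i \<notin> T" for i
    using that h_in_S by (simp add: T_def hom_face_def coords_def)
  have gen: "g \<in> G" "h i \<in> T \<Longrightarrow> pairing g (h i) = 0" "i < k \<Longrightarrow> 0 \<le> pairing g (h i)"
    if "g \<in> annihilator T" for g i
    using that h_in_S by (auto simp: annihilator_def lattice_cone_def)
  have F_sum: "((\<lambda>\<alpha>. t \<alpha> c') has_sum f (torus_point c')) ?M" if "c' \<in> \<Omega>" for c'
  proof -
    have "((\<lambda>\<alpha>. c \<alpha> * monom_eval k (\<lambda>i. coords (torus_point c') i - ?a i) \<alpha>) has_sum F (coords (torus_point c'))) ?M"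
      by (rule ser) (use torus_box[OF that] \<rho>(2) in \<open>auto simp: box_def intro: less_trans\<close>)
    moreover have "monom_eval k (\<lambda>i. coords (torus_point c') i - ?a i) = monom_eval k (\<lambda>i. character c' (h i) - ?a i)"
      by (intro ext monom_eval_cong) (simp add: coords_torus)
    moreover have "F (coords (torus_point c')) = f (torus_point c')"
      using W1(3) torus_box[OF that] \<rho>(3) by auto
    ultimately show ?thesis by (simp add: t_def)
  qed
  interpret weighted_series \<Omega> "annihilator T" complex_vec ?M t w "\<lambda>\<alpha>. norm (c \<alpha>) * monom_eval k (\<lambda>_. \<rho>) \<alpha>"
  proof
    show "finite (annihilator T)" by (rule finite_annihilator)
    show "connected \<Omega>" unfolding \<Omega>_def by (rule convex_connected[OF convex_tube])
    have "\<forall>\<^sub>F n in sequentially. degenerate x c0 n \<in> tube x c0 \<epsilon> \<rho>"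
      using \<epsilon> \<rho>(1) h_in_S by (intro tube_degenerate x c0) (auto simp: hom_face_def)
    then show "\<Omega> \<noteq> {}" unfolding \<Omega>_def eventually_sequentially by blast
  next
    fix g c' \<zeta> assume g: "g \<in> annihilator T" and c': "c' \<in> \<Omega>" and \<zeta>: "Re \<zeta> \<le> 0"
    have cp: "complex_pairing (c' + \<zeta> *s complex_vec g) (h i) = complex_pairing c' (h i) + \<zeta> * of_int (pairing g (h i))" for i
      by (simp add: complex_pairing_add_left complex_pairing_scale_left complex_pairing_complex_vec)
    show "c' + \<zeta> *s complex_vec g \<in> \<Omega>"
      unfolding \<Omega>_def tube_def
    proof (intro CollectI allI impI)
      fix i assume i: "i < k"
      show "if h i \<in> hom_face (monomial_value x)
        then norm (complex_pairing (c' + \<zeta> *s complex_vec g - c0) (h i)) < \<epsilon>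
        else Re (complex_pairing (c' + \<zeta> *s complex_vec g) (h i)) < ln \<rho>"
      proof (cases "h i \<in> hom_face (monomial_value x)")
        case True
        then have "complex_pairing (c' + \<zeta> *s complex_vec g - c0) (h i) = complex_pairing (c' - c0) (h i)"
          using gen(2)[OF g, of i] unfolding complex_pairing_diff_left cp by (simp add: T_def)
        then show ?thesis using True c' i by (simp add: \<Omega>_def tube_def)
      next
        case False
        have "Re \<zeta> * real_of_int (pairing g (h i)) \<le> 0"
          using \<zeta> gen(3)[OF g i] by (intro mult_nonpos_nonneg) auto
        moreover have "Re (complex_pairing c' (h i)) < ln \<rho>" using c' i False by (simp add: \<Omega>_def tube_def)
        ultimately show ?thesis using False unfolding cp by simp
      qed
    qed
    fix \<alpha> assume "\<alpha> \<in> ?M"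
    have "(character (c' + \<zeta> *s complex_vec g) (h i) - ?a i) ^ \<alpha> i
        = exp (\<zeta> * of_nat (\<alpha> i * nat (pairing g (h i)))) * (character c' (h i) - ?a i) ^ \<alpha> i" if i: "i < k" for i
    proof (cases "h i \<in> T")
      case True
      then show ?thesis using gen(2)[OF g True] by (simp add: character_def cp)
    next
      case False
      have "of_int (pairing g (h i)) = (of_nat (nat (pairing g (h i))) :: complex)"
        using gen(3)[OF g i] by simp
      then have "character (c' + \<zeta> *s complex_vec g) (h i) = exp (\<zeta> * of_nat (nat (pairing g (h i)))) * character c' (h i)"
        unfolding character_def cp by (simp add: exp_add)
      moreover have "exp (\<zeta> * of_nat (nat (pairing g (h i)))) ^ \<alpha> i = exp (\<zeta> * of_nat (\<alpha> i * nat (pairing g (h i))))"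
        by (simp add: mult_ac flip: exp_of_nat_mult)
      ultimately show ?thesis using a0[OF i False] by (simp only: diff_0_right power_mult_distrib)
    qed
    then have "monom_eval k (\<lambda>i. character (c' + \<zeta> *s complex_vec g) (h i) - ?a i) \<alpha>
        = (\<Prod>i<k. exp (\<zeta> * of_nat (\<alpha> i * nat (pairing g (h i))))) * monom_eval k (\<lambda>i. character c' (h i) - ?a i) \<alpha>"
      unfolding monom_eval_def prod.distrib[symmetric] by (intro prod.cong) auto
    also have "(\<Prod>i<k. exp (\<zeta> * of_nat (\<alpha> i * nat (pairing g (h i))))) = exp (\<zeta> * of_nat (w \<alpha> g))"
      unfolding w_def of_nat_sum sum_distrib_left by (rule exp_sum[symmetric]) simp
    finally show "t \<alpha> (c' + \<zeta> *s complex_vec g) = exp (\<zeta> * of_nat (w \<alpha> g)) * t \<alpha> c'"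
      by (simp add: t_def mult_ac)
  next
    fix \<alpha>
    show "continuous_on \<Omega> (t \<alpha>)"
      unfolding t_def[abs_def] monom_eval_def character_def
      by (intro continuous_intros continuous_on_prod complex_pairing_cont)
    show "norm (t \<alpha> c') \<le> norm (c \<alpha>) * monom_eval k (\<lambda>_. \<rho>) \<alpha>" if "c' \<in> \<Omega>" for c'
      unfolding t_def norm_mult using near[OF that] by (intro mult_left_mono norm_monom_eval_le) (auto intro: less_imp_le)
  next
    show "(\<lambda>\<alpha>. norm (c \<alpha>) * monom_eval k (\<lambda>_. \<rho>) \<alpha>) summable_on ?M"
      by (rule has_sum_polydisc_abs[OF ser]) (use \<rho> in auto)
    show "(\<Sum>\<^sub>\<infinity>\<alpha>\<in>?M. t \<alpha> c') \<noteq> 0" if c': "c' \<in> \<Omega>" for c'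
    proof -
      have "torus_point c' \<notin> D"
        using boundary_iff[OF torus_point_in_points] by (simp add: monomial_value_point_of)
      then show ?thesis using infsumI[OF F_sum[OF c']] nz[of "torus_point c'"] torus_box[OF c'] \<rho>(3) by auto
    qed
  qed
  obtain \<kappa> where \<kappa>: "\<forall>c'\<in>\<Omega>. (\<Sum>\<^sub>\<infinity>\<alpha>\<in>?M. t \<alpha> c') = (\<Sum>\<^sub>\<infinity>\<alpha>\<in>{\<alpha>\<in>?M. \<forall>g\<in>annihilator T. \<kappa> g \<le> w \<alpha> g}. t \<alpha> c')"
    and ex: "\<exists>\<alpha>\<in>?M. \<forall>g\<in>annihilator T. w \<alpha> g = \<kappa> g"
    and lim: "\<forall>c'\<in>\<Omega>. \<exists>L. L \<noteq> 0 \<and> (\<lambda>n. exp (of_nat n * of_nat (\<Sum>g\<in>annihilator T. \<kappa> g)) *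
        (\<Sum>\<^sub>\<infinity>\<alpha>\<in>?M. t \<alpha> (c' + (- of_nat n) *s (\<Sum>g\<in>annihilator T. complex_vec g)))) \<longlonglongrightarrow> L"
    using leading_weight by (elim exE conjE)
  define A where "A = {\<alpha>\<in>?M. \<forall>g\<in>annihilator T. \<kappa> g \<le> w \<alpha> g}"
  obtain \<alpha>0 where \<alpha>0: "\<alpha>0 \<in> ?M" "\<And>g. g \<in> annihilator T \<Longrightarrow> w \<alpha>0 g = \<kappa> g" using ex by blast
  define u where "u = (\<Sum>i<k. int (\<alpha>0 i) *s h i)"
  have u: "u \<in> S" unfolding u_def by (rule generates_monoid_mem[OF generators])
  have w_int: "(\<Sum>i<k. int (\<alpha> i) * pairing g (h i)) = int (w \<alpha> g)" if "g \<in> annihilator T" for g \<alpha>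
    unfolding w_def of_nat_sum using gen(3)[OF that] by (intro sum.cong) auto
  have pu: "pairing g u = int (\<kappa> g)" if "g \<in> annihilator T" for g
    using w_int[OF that, of \<alpha>0] \<alpha>0(2)[OF that] by (simp add: u_def pairing_sum_right pairing_scale_right)
  have "\<exists>H W. holomorphic_near k H ?a \<and> openin X W \<and> x \<in> W \<and>
    (\<forall>y\<in>W. (\<Sum>\<^sub>\<infinity>\<alpha>\<in>A. c \<alpha> * monom_eval k (\<lambda>i. coords y i - ?a i) \<alpha>) = monomial_value y u * H (coords y))"
  proof (rule divide_series[OF x ser r u])
    show "pairing g u \<le> (\<Sum>i<k. int (\<alpha> i) * pairing g (h i))"
      if "\<alpha> \<in> A" "g \<in> annihilator (hom_face (monomial_value x))" for \<alpha> g
      using that w_int[of g \<alpha>] pu[of g] by (simp add: A_def T_def)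
  qed (auto simp: A_def)
  then obtain H W2 where H: "holomorphic_near k H ?a" and W2: "openin X W2" "x \<in> W2"
    "\<And>y. y \<in> W2 \<Longrightarrow> (\<Sum>\<^sub>\<infinity>\<alpha>\<in>A. c \<alpha> * monom_eval k (\<lambda>i. coords y i - ?a i) \<alpha>) = monomial_value y u * H (coords y)"
    by metis
  \<comment> \<open>The terms outside \<open>A\<close> cancel on the tube, hence near \<open>x\<close>.\<close>
  define E where "E z = (\<Sum>\<^sub>\<infinity>\<alpha>\<in>?M - A. c \<alpha> * monom_eval k (\<lambda>i. z i - ?a i) \<alpha>)" for z
  have E_add: "F z = (\<Sum>\<^sub>\<infinity>\<alpha>\<in>A. c \<alpha> * monom_eval k (\<lambda>i. z i - ?a i) \<alpha>) + E z"
    if z: "\<And>i. i < k \<Longrightarrow> norm (z i - ?a i) < r" for z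
  proof -
    let ?f = "\<lambda>\<alpha>. c \<alpha> * monom_eval k (\<lambda>i. z i - ?a i) \<alpha>"
    have sm: "?f summable_on ?M" using ser[OF z] by (rule has_sum_imp_summable)
    have "F z = infsum ?f (A \<union> (?M - A))"
    proof -
      have "A \<union> (?M - A) = ?M" by (auto simp: A_def)
      then show ?thesis using infsumI[OF ser[OF z]] by simp
    qed
    also have "\<dots> = infsum ?f A + infsum ?f (?M - A)"
      by (intro infsum_Un_disjoint summable_on_subset_banach[OF sm]) (auto simp: A_def)
    finally show ?thesis by (simp add: E_def)
  qed
  have "holomorphic_near k (\<lambda>z. \<Sum>\<^sub>\<infinity>\<alpha>\<in>?M - A. c \<alpha> * monom_eval k (\<lambda>i. z i - ?a i) (\<lambda>i. \<alpha> i - 0)) ?a"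
    by (rule holomorphic_near_subseries[OF ser r]) auto
  then have E_hol: "holomorphic_near k E ?a" by (simp add: E_def[abs_def])
  have E_torus: "E (coords (torus_point c')) = 0" if c': "c' \<in> \<Omega>" for c'
  proof -
    have m: "monom_eval k (\<lambda>i. coords (torus_point c') i - ?a i) = monom_eval k (\<lambda>i. character c' (h i) - ?a i)"
      by (intro ext monom_eval_cong) (simp add: coords_torus)
    have "F (coords (torus_point c')) = (\<Sum>\<^sub>\<infinity>\<alpha>\<in>A. t \<alpha> c') + E (coords (torus_point c'))"
      using E_add[of "coords (torus_point c')"] torus_box[OF c'] \<rho>(2) unfolding m t_def
      by (auto simp: box_def intro: less_trans)
    moreover have "F (coords (torus_point c')) = (\<Sum>\<^sub>\<infinity>\<alpha>\<in>?M. t \<alpha> c')"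
      using infsumI[OF F_sum[OF c']] W1(3)[of "torus_point c'"] torus_box[OF c'] \<rho>(3) by auto
    ultimately show ?thesis using \<kappa> c' by (simp add: A_def)
  qed
  obtain W3 where W3: "openin X W3" "x \<in> W3" "\<forall>y\<in>W3. \<exists>c. (\<forall>n. c n \<in> \<Omega>) \<and>
      (\<forall>u\<in>S. (\<lambda>n. character (c n) u) \<longlonglongrightarrow> monomial_value y u)"
    using tube_dense[OF x c0 \<rho>(1) \<epsilon>] unfolding \<Omega>_def by auto
  have "hol_at x (\<lambda>y. E (coords y))" by (rule hol_atI[OF E_hol openin_points x]) simp
  then obtain W4 where W4: "openin X W4" "x \<in> W4" "\<forall>y\<in>W4. hol_at y (\<lambda>y. E (coords y))"
    using hol_at_nearby[OF x] by metis
  have E_zero: "E (coords y) = 0" if y: "y \<in> W3 \<inter> W4" for y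
  proof (rule ccontr)
    assume neq: "E (coords y) \<noteq> 0"
    have yp: "y \<in> points" using y openin_subset_points[OF W3(1)] by blast
    obtain V where V: "openin X V" "y \<in> V" "\<forall>z\<in>V. E (coords z) \<noteq> 0"
      using hol_at_nonzero_nearby[of y "\<lambda>y. E (coords y)"] yp neq W4(3) y by auto
    obtain c' where c': "\<And>n. c' n \<in> \<Omega>" "\<And>u. u \<in> S \<Longrightarrow> (\<lambda>n. character (c' n) u) \<longlonglongrightarrow> monomial_value y u"
      using W3(3) y by blast
    obtain \<delta>' where \<delta>': "0 < \<delta>'" "box y \<delta>' \<subseteq> V" using openin_contains_box[OF V(1,2)] by metis
    have "\<forall>\<^sub>F n in sequentially. norm (character (c' n) (h i) - coords y i) < \<delta>'" if "i < k" for i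
      using tendstoD[OF c'(2)[OF h_in_S[OF that]] \<delta>'(1)] by (simp add: coords_def dist_norm)
    then have "\<forall>\<^sub>F n in sequentially. \<forall>i\<in>{..<k}. norm (character (c' n) (h i) - coords y i) < \<delta>'"
      by (intro eventually_ball_finite) auto
    then obtain n where "\<forall>i\<in>{..<k}. norm (character (c' n) (h i) - coords y i) < \<delta>'"
      unfolding eventually_sequentially by blast
    then have "torus_point (c' n) \<in> box y \<delta>'"
      using coords_torus by (simp add: box_def torus_point_in_points)
    then show False using E_torus[OF c'(1)[of n]] \<delta>'(2) V(3) by blast
  qed
  define W where "W = W2 \<inter> W3 \<inter> W4 \<inter> box x \<rho>"
  have W: "openin X W" "x \<in> W"
    using W2 W3 W4 x \<rho>(1) by (auto simp: W_def intro!: openin_Int openin_box center_in_box)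
  have fH: "f y = monomial_value y u * H (coords y)" if y: "y \<in> W" for y
  proof -
    have "F (coords y) = (\<Sum>\<^sub>\<infinity>\<alpha>\<in>A. c \<alpha> * monom_eval k (\<lambda>i. coords y i - ?a i) \<alpha>) + E (coords y)"
      using y \<rho>(2) by (intro E_add) (auto simp: W_def box_def intro: less_trans)
    moreover have "f y = F (coords y)" using W1(3) \<rho>(3) y by (auto simp: W_def)
    ultimately show ?thesis using W2(3)[of y] E_zero[of y] y by (simp add: W_def)
  qed
  have H_hol: "hol_at x (\<lambda>y. H (coords y))" by (rule hol_atI[OF H openin_points x]) simp
  \<comment> \<open>Along the degeneration of the torus to \<open>x\<close>, the quotient by the monomial has a nonzero limit.\<close>
  have "H (coords x) \<noteq> 0"
  proof
    assume H0: "H (coords x) = 0"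
    have "\<forall>\<^sub>F n in sequentially. degenerate x c0 n \<in> tube x c0 \<epsilon> \<rho>"
      using \<epsilon> \<rho>(1) h_in_S by (intro tube_degenerate x c0) (auto simp: hom_face_def)
    then obtain n0 where n0: "degenerate x c0 n0 \<in> \<Omega>" unfolding eventually_sequentially \<Omega>_def by blast
    define c1 where "c1 = degenerate x c0 n0"
    define m where "m = (\<Sum>g\<in>annihilator T. \<kappa> g)"
    have c1: "c1 \<in> \<Omega>" using n0 by (simp add: c1_def)
    have c1x: "monomial_value x v = character c1 v" if "v \<in> hom_face (monomial_value x)" for v
      using c0[OF that] complex_pairing_degenerate_face[OF x that] by (simp add: c1_def character_def)
    have deg: "degenerate x c1 n = c1 + (- of_nat n) *s (\<Sum>g\<in>annihilator T. complex_vec g)" for n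
      by (simp add: degenerate_def T_def face_normal_def complex_vec_sum)
    obtain L where L: "L \<noteq> 0" "(\<lambda>n. exp (of_nat n * of_nat m) * (\<Sum>\<^sub>\<infinity>\<alpha>\<in>?M. t \<alpha> (degenerate x c1 n))) \<longlonglongrightarrow> L"
      using lim[rule_format, OF c1] unfolding deg m_def by blast
    have degO: "degenerate x c1 n \<in> \<Omega>" for n
      using shift(1)[OF order_refl c1, of n] unfolding shift_def deg .
    have pm: "pairing (face_normal T) u = int m"
      unfolding face_normal_def pairing_sum_left m_def of_nat_sum using pu by (intro sum.cong) auto
    have ch: "character (degenerate x c1 n) u = exp (- (of_nat n * of_nat m)) * character c1 u" for n
      unfolding character_def complex_pairing_degenerate T_def[symmetric] pm
      by (simp add: exp_diff exp_minus field_simps)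
    have conv: "(\<lambda>n. character (degenerate x c1 n) v) \<longlonglongrightarrow> monomial_value x v" if "v \<in> S" for v
      by (rule character_degenerate_tendsto[OF x c1x that])
    have ev_box: "\<forall>\<^sub>F n in sequentially. torus_point (degenerate x c1 n) \<in> box x \<eta>" if "0 < \<eta>" for \<eta>
    proof -
      have "\<forall>\<^sub>F n in sequentially. norm (character (degenerate x c1 n) (h i) - coords x i) < \<eta>" if "i < k" for i
        using tendstoD[OF conv[OF h_in_S[OF that]] \<open>0 < \<eta>\<close>] by (simp add: coords_def dist_norm)
      then have "\<forall>\<^sub>F n in sequentially. \<forall>i\<in>{..<k}. norm (character (degenerate x c1 n) (h i) - coords x i) < \<eta>"
        by (intro eventually_ball_finite) auto
      then show ?thesis
        by (rule eventually_mono) (use coords_torus in \<open>simp add: box_def torus_point_in_points\<close>)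
    qed
    obtain \<eta> where \<eta>: "0 < \<eta>" "box x \<eta> \<subseteq> W" using openin_contains_box[OF W] by metis
    have "(\<lambda>n. H (coords (torus_point (degenerate x c1 n)))) \<longlonglongrightarrow> 0"
    proof (rule tendstoI)
      fix e :: real assume "0 < e"
      then obtain V where V: "openin X V" "x \<in> V" "\<forall>y\<in>V. norm (H (coords y) - H (coords x)) < e"
        using hol_at_continuous[OF x H_hol] by metis
      obtain \<eta>' where \<eta>': "0 < \<eta>'" "box x \<eta>' \<subseteq> V" using openin_contains_box[OF V(1,2)] by metis
      from ev_box[OF \<eta>'(1)]
      show "\<forall>\<^sub>F n in sequentially. dist (H (coords (torus_point (degenerate x c1 n)))) 0 < e"
        by (rule eventually_mono) (use \<eta>'(2) V(3) H0 in auto)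
    qed
    then have "(\<lambda>n. character c1 u * H (coords (torus_point (degenerate x c1 n)))) \<longlonglongrightarrow> 0"
      by (rule tendsto_mult_right_zero)
    moreover have "\<forall>\<^sub>F n in sequentially. character c1 u * H (coords (torus_point (degenerate x c1 n)))
        = exp (of_nat n * of_nat m) * (\<Sum>\<^sub>\<infinity>\<alpha>\<in>?M. t \<alpha> (degenerate x c1 n))"
      using ev_box[OF \<eta>(1)]
    proof eventually_elim
      case (elim n)
      then have "f (torus_point (degenerate x c1 n)) =
          character (degenerate x c1 n) u * H (coords (torus_point (degenerate x c1 n)))"
        using fH \<eta>(2) monomial_value_point_of[OF u] by auto
      then have "(\<Sum>\<^sub>\<infinity>\<alpha>\<in>?M. t \<alpha> (degenerate x c1 n)) =
          exp (- (of_nat n * of_nat m)) * character c1 u * H (coords (torus_point (degenerate x c1 n)))"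
        using infsumI[OF F_sum[OF degO]] ch by simp
      then show ?case by (simp add: exp_minus field_simps)
    qed
    ultimately have "(\<lambda>n. exp (of_nat n * of_nat m) * (\<Sum>\<^sub>\<infinity>\<alpha>\<in>?M. t \<alpha> (degenerate x c1 n))) \<longlonglongrightarrow> 0"
      by (rule Lim_transform_eventually)
    then show False using L LIMSEQ_unique by blast
  qed
  then show ?thesis using u H_hol W fH by (intro bexI[of _ u] exI[of _ "\<lambda>y. H (coords y)"]) auto
qed

end

section \<open>The moment map\<close>

lemma convergent_subsequence_finite:
  fixes f :: "nat \<Rightarrow> nat \<Rightarrow> real"
  assumes "\<And>n i. i < k \<Longrightarrow> \<bar>f n i\<bar> \<le> B"
  shows "\<exists>r l. strict_mono (r :: nat \<Rightarrow> nat) \<and> (\<forall>i<k. (\<lambda>n. f (r n) i) \<longlonglongrightarrow> l i)"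
  using assms
proof (induction k)
  case 0
  show ?case using strict_mono_id by blast
next
  case (Suc k)
  then obtain r l where r: "strict_mono (r :: nat \<Rightarrow> nat)" "\<forall>i<k. (\<lambda>n. f (r n) i) \<longlonglongrightarrow> l i"
    by (metis less_SucI)
  have "bounded (range (\<lambda>n. f (r n) k))"
    using Suc.prems[of k] by (auto simp: bounded_iff intro!: exI[of _ B])
  then obtain m q where q: "strict_mono (q :: nat \<Rightarrow> nat)" "((\<lambda>n. f (r n) k) \<circ> q) \<longlonglongrightarrow> m"
    using bounded_imp_convergent_subsequence by metis
  have "(\<lambda>n. f (r (q n)) i) \<longlonglongrightarrow> (l(k := m)) i" if "i < Suc k" for i
  proof (cases "i = k")
    case True
    then show ?thesis using q(2) by (simp add: o_def)
  next
    case False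
    then have "(\<lambda>n. f (r n) i) \<longlonglongrightarrow> l i" using r(2) that by simp
    from LIMSEQ_subseq_LIMSEQ[OF this q(1)] show ?thesis using False by (simp add: o_def)
  qed
  then show ?case using strict_mono_o[OF r(1) q(1)] by (intro exI[of _ "r \<circ> q"] exI[of _ "l(k := m)"]) (simp add: o_def)
qed

lemma ln_monotone_product_nonneg: "0 < x \<Longrightarrow> 0 < y \<Longrightarrow> 0 \<le> (x - y) * (ln x - ln (y::real))"
  by (cases "x \<le> y") (auto intro: mult_nonneg_nonneg mult_nonpos_nonpos)

lemma ln_monotone_product_zero:
  assumes "0 < x" "0 < y" "(x - y) * (ln x - ln (y::real)) = 0"
  shows "x = y"
  using assms by auto

lemma exp_ge_linear:
  assumes "1 \<le> (M::real)"
  shows "M * max 0 x - M * ln M \<le> exp x"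
proof (cases "0 \<le> x")
  case True
  have "M * (1 + (x - ln M)) \<le> M * exp (x - ln M)"
    using assms exp_ge_add_one_self[of "x - ln M"] by (intro mult_left_mono) auto
  also have "\<dots> = exp x" using assms by (simp add: exp_diff)
  finally show ?thesis using True assms by (simp add: algebra_simps)
next
  case False
  then show ?thesis using assms by (simp add: order_trans[of _ 0])
qed

context affine_toric
begin

definition positive_hom :: "(int ^ 'n \<Rightarrow> real) \<Rightarrow> bool" where
  "positive_hom \<eta> \<longleftrightarrow> monoid_hom (\<lambda>u. of_real (\<eta> u)) \<and> (\<forall>u\<in>S. 0 \<le> \<eta> u)"

text \<open>
  For positive \<open>\<eta> = exp (a \<bullet> _)\<close> this is the gradient of \<open>\<Sum>\<^sub>i exp (a \<bullet> h i)\<close> with respect to \<open>a\<close>.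
  It is not normalized by the sum of the weights, so that it maps onto a cone instead of a
  polytope.
\<close>

definition moment :: "(int ^ 'n \<Rightarrow> real) \<Rightarrow> real ^ 'n" where
  "moment \<eta> = (\<Sum>i<k. \<eta> (h i) *\<^sub>R real_vec (h i))"

definition positive_face :: "(int ^ 'n \<Rightarrow> real) \<Rightarrow> (int ^ 'n) set" where
  "positive_face \<eta> = {u\<in>S. 0 < \<eta> u}"

lemma dual_cone_eq: "dual_cone \<sigma> = {p. \<forall>g\<in>G. 0 \<le> real_vec g \<bullet> p}"
  by (simp add: \<sigma>_eq dual_cone_hull)

lemma positive_hom_mult: "positive_hom \<eta> \<Longrightarrow> u \<in> S \<Longrightarrow> v \<in> S \<Longrightarrow> \<eta> (u + v) = \<eta> u * \<eta> v"
  using monoid_hom_mult[of "\<lambda>u. of_real (\<eta> u)" u v] by (simp add: positive_hom_def flip: of_real_mult)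

lemma positive_hom_zero: "positive_hom \<eta> \<Longrightarrow> \<eta> 0 = 1"
  by (simp add: positive_hom_def monoid_hom_def)

lemma positive_hom_nonneg: "positive_hom \<eta> \<Longrightarrow> u \<in> S \<Longrightarrow> 0 \<le> \<eta> u"
  by (simp add: positive_hom_def)

lemma positive_hom_generators:
  assumes \<eta>: "positive_hom \<eta>" and u: "u \<in> S"
  shows "\<eta> u = monom_eval k (\<lambda>i. \<eta> (h i)) (rep u)"
proof -
  have "complex_of_real (\<eta> u) = monom_eval k (\<lambda>i. of_real (\<eta> (h i))) (rep u)"
    using hom_generators[of "\<lambda>u. of_real (\<eta> u)" "rep u"] \<eta> rep[OF u] by (simp add: positive_hom_def)
  also have "\<dots> = of_real (monom_eval k (\<lambda>i. \<eta> (h i)) (rep u))"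
    by (simp add: monom_eval_def)
  finally show ?thesis by (simp only: of_real_eq_iff)
qed

lemma positive_face_eq: "positive_hom \<eta> \<Longrightarrow> positive_face \<eta> = hom_face (\<lambda>u. of_real (\<eta> u))"
  by (auto simp: positive_face_def hom_face_def positive_hom_def less_le)

lemma face_positive_face: "positive_hom \<eta> \<Longrightarrow> face (positive_face \<eta>)"
  using positive_face_eq face_hom_face by (simp add: positive_hom_def)

lemma positive_hom_log_linear:
  assumes \<eta>: "positive_hom \<eta>"
  shows "\<exists>a. \<forall>u\<in>positive_face \<eta>. ln (\<eta> u) = a \<bullet> real_vec u"
proof -
  have "monoid_hom (\<lambda>u. of_real (\<eta> u))" using \<eta> by (simp add: positive_hom_def)
  from hom_face_eq_character[OF this] obtain c
    where c: "\<And>u. u \<in> hom_face (\<lambda>u. of_real (\<eta> u)) \<Longrightarrow> complex_of_real (\<eta> u) = character c u" by metis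
  have "ln (\<eta> u) = (\<chi> j. Re (c $ j)) \<bullet> real_vec u" if u: "u \<in> positive_face \<eta>" for u
  proof -
    have "norm (complex_of_real (\<eta> u)) = exp (Re (complex_pairing c u))"
      using c u positive_face_eq[OF \<eta>] by (simp add: character_def norm_exp_eq_Re)
    moreover have "0 < \<eta> u" using u by (simp add: positive_face_def)
    ultimately have "ln (\<eta> u) = Re (complex_pairing c u)" by simp
    then show ?thesis by (simp add: complex_pairing_def inner_vec_def real_vec_def)
  qed
  then show ?thesis by blast
qed

lemma inner_moment: "a \<bullet> moment \<eta> = (\<Sum>i<k. \<eta> (h i) * (a \<bullet> real_vec (h i)))"
  by (simp add: moment_def inner_sum_right)

lemma moment_in_dual_cone:
  assumes "positive_hom \<eta>"
  shows "moment \<eta> \<in> dual_cone \<sigma>"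
proof -
  have "0 \<le> \<eta> (h i) * real_of_int (pairing g (h i))" if "g \<in> G" "i < k" for g i
    using positive_hom_nonneg[OF assms h_in_S[OF that(2)]] h_in_S[OF that(2)] that(1)
    by (intro mult_nonneg_nonneg) (auto simp: lattice_cone_def)
  then show ?thesis
    unfolding dual_cone_eq mem_Collect_eq inner_moment real_vec_inner by (auto intro!: sum_nonneg)
qed

text \<open>
  The lattice points in the smallest face of the dual cone that contains \<open>p\<close>.
\<close>

definition support_face :: "real ^ 'n \<Rightarrow> (int ^ 'n) set" where
  "support_face p = {u\<in>S. \<forall>g\<in>G. real_vec g \<bullet> p = 0 \<longrightarrow> pairing g u = 0}"

lemma face_support_face: "face (support_face p)"
proof -
  have "pairing g u + pairing g v = 0 \<longleftrightarrow> pairing g u = 0 \<and> pairing g v = 0"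
    if "u \<in> S" "v \<in> S" "g \<in> G" for g u v
    using that by (auto simp: lattice_cone_def add_nonneg_eq_0_iff)
  then show ?thesis unfolding face_def
    by (auto simp: support_face_def pairing_add_right lattice_cone_add)
qed

text \<open>
  The zeros of \<open>\<eta>\<close> can be read off its moment: a normal vanishes at the moment exactly if it
  vanishes on every generator at which \<open>\<eta>\<close> is positive.
\<close>

lemma generator_positive_iff:
  assumes \<eta>: "positive_hom \<eta>" and i: "i < k"
  shows "0 < \<eta> (h i) \<longleftrightarrow> h i \<in> support_face (moment \<eta>)"
proof
  have z: "real_vec g \<bullet> moment \<eta> = 0 \<longleftrightarrow> (\<forall>j<k. \<eta> (h j) * of_int (pairing g (h j)) = 0)" if "g \<in> G" for g
    unfolding inner_moment real_vec_inner
    using positive_hom_nonneg[OF \<eta>] h_in_S that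
    by (subst sum_nonneg_eq_0_iff) (auto simp: lattice_cone_def intro!: mult_nonneg_nonneg)
  {
    assume "0 < \<eta> (h i)"
    then show "h i \<in> support_face (moment \<eta>)"
      unfolding support_face_def using z i h_in_S[OF i] by fastforce
  next
    assume hi: "h i \<in> support_face (moment \<eta>)"
    have "pairing g (h i) = 0" if g: "g \<in> annihilator (positive_face \<eta>)" for g
    proof -
      have "g \<in> G" using g by (simp add: annihilator_def)
      moreover have "\<eta> (h j) * of_int (pairing g (h j)) = 0" if "j < k" for j
      proof (cases "0 < \<eta> (h j)")
        case True
        then have "h j \<in> positive_face \<eta>" using h_in_S[OF that] by (simp add: positive_face_def)
        then show ?thesis using g by (simp add: annihilator_def)
      next
        case False
        then show ?thesis using positive_hom_nonneg[OF \<eta> h_in_S[OF that]] by simp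
      qed
      ultimately show ?thesis using z hi by (simp add: support_face_def)
    qed
    then have "h i \<in> positive_face \<eta>" using face_iff[OF face_positive_face[OF \<eta>] h_in_S[OF i]] by blast
    then show "0 < \<eta> (h i)" by (simp add: positive_face_def)
  }
qed

text \<open>
  Both homomorphisms are positive on the same generators and, there, are exponentials of linear
  forms \<open>a\<close> and \<open>a'\<close>. Pairing the difference of the moments with \<open>a - a'\<close> gives a sum of terms
  \<open>(x - y) * (ln x - ln y)\<close>, which are nonnegative and zero only for \<open>x = y\<close>.
\<close>

lemma moment_inj:
  assumes \<eta>: "positive_hom \<eta>" and \<eta>': "positive_hom \<eta>'" and eq: "moment \<eta> = moment \<eta>'" and u: "u \<in> S"
  shows "\<eta> u = \<eta>' u"
proof -
  obtain a where a: "\<forall>u\<in>positive_face \<eta>. ln (\<eta> u) = a \<bullet> real_vec u"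
    using positive_hom_log_linear[OF \<eta>] by blast
  obtain a' where a': "\<forall>u\<in>positive_face \<eta>'. ln (\<eta>' u) = a' \<bullet> real_vec u"
    using positive_hom_log_linear[OF \<eta>'] by blast
  have pos: "0 < \<eta> (h i) \<longleftrightarrow> 0 < \<eta>' (h i)" if "i < k" for i
    using generator_positive_iff[OF \<eta> that] generator_positive_iff[OF \<eta>' that] eq by simp
  define f where "f i = (\<eta> (h i) - \<eta>' (h i)) * (ln (\<eta> (h i)) - ln (\<eta>' (h i)))" for i
  have nz: "\<eta> (h i) = 0 \<and> \<eta>' (h i) = 0" if "i < k" "\<not> 0 < \<eta> (h i)" for i
    using positive_hom_nonneg[OF \<eta> h_in_S[OF that(1)]] positive_hom_nonneg[OF \<eta>' h_in_S[OF that(1)]] pos[OF that(1)] that(2)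
    by simp
  have f: "f i = (\<eta> (h i) - \<eta>' (h i)) * ((a - a') \<bullet> real_vec (h i))" if i: "i < k" for i
  proof (cases "0 < \<eta> (h i)")
    case True
    then have "h i \<in> positive_face \<eta>" "h i \<in> positive_face \<eta>'"
      using pos[OF i] h_in_S[OF i] by (auto simp: positive_face_def)
    then show ?thesis using a a' by (simp add: f_def inner_diff_left)
  next
    case False
    then show ?thesis using nz[OF i] by (simp add: f_def)
  qed
  have "(\<Sum>i<k. f i) = (\<Sum>i<k. \<eta> (h i) * ((a - a') \<bullet> real_vec (h i))) - (\<Sum>i<k. \<eta>' (h i) * ((a - a') \<bullet> real_vec (h i)))"
    by (simp add: f left_diff_distrib sum_subtractf)
  also have "\<dots> = 0" unfolding inner_moment[symmetric] eq by simp
  finally have "(\<Sum>i<k. f i) = 0" .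
  moreover have "0 \<le> f i" if "i \<in> {..<k}" for i
  proof (cases "0 < \<eta> (h i)")
    case True
    then show ?thesis using pos[of i] that ln_monotone_product_nonneg by (simp add: f_def)
  next
    case False
    then show ?thesis using nz[of i] that by (simp add: f_def)
  qed
  ultimately have f0: "f i = 0" if "i < k" for i using sum_nonneg_eq_0_iff[of "{..<k}" f] that by simp
  have "\<eta> (h i) = \<eta>' (h i)" if i: "i < k" for i
  proof (cases "0 < \<eta> (h i)")
    case True
    show ?thesis
      by (rule ln_monotone_product_zero[OF True pos[OF i, THEN iffD1, OF True] f0[OF i, unfolded f_def]])
  next
    case False
    then show ?thesis using nz[OF i] by simp
  qed
  then have "monom_eval k (\<lambda>i. \<eta> (h i)) (rep u) = monom_eval k (\<lambda>i. \<eta>' (h i)) (rep u)"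
    by (intro monom_eval_cong)
  then show ?thesis using positive_hom_generators[OF \<eta> u] positive_hom_generators[OF \<eta>' u] by simp
qed

text \<open>
  Since \<open>p\<close> is in the relative interior of its face, \<open>q = p + \<epsilon> a\<close> lies in it as well. Near every
  large multiple of \<open>q\<close> there is, at bounded distance, a lattice point of the face, and such
  points are sums of generators of the face, on which \<open>a\<close> is nonpositive. Thus \<open>a \<bullet> q \<le> 0\<close>.
\<close>

lemma face_direction:
  assumes p: "p \<in> dual_cone \<sigma>" and a: "a \<noteq> 0" "\<forall>g\<in>G. real_vec g \<bullet> p = 0 \<longrightarrow> real_vec g \<bullet> a = 0"
    and le: "\<And>i. i < k \<Longrightarrow> h i \<in> support_face p \<Longrightarrow> a \<bullet> real_vec (h i) \<le> 0"
  shows "a \<bullet> p < 0"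
proof -
  define F where "F = {g\<in>G. real_vec g \<bullet> p = 0}"
  have fin: "finite F" "finite G" using finite_G by (auto simp: F_def)
  obtain e d :: "'n \<Rightarrow> int ^ 'n" and B where b: "lattice_basis e d"
    and B: "\<forall>q. (\<forall>g\<in>F. real_vec g \<bullet> q = 0) \<longleftrightarrow> (\<forall>i. i \<notin> B \<longrightarrow> real_vec (d i) \<bullet> q = 0)"
    using lattice_basis_adapted[OF fin(1)] by (elim exE conjE)
  have "\<forall>\<^sub>F \<epsilon> in at_right 0. \<forall>g\<in>G - F. 0 < real_vec g \<bullet> (p + \<epsilon> *\<^sub>R a)"
  proof (rule eventually_ball_finite)
    show "\<forall>g\<in>G - F. \<forall>\<^sub>F \<epsilon> in at_right 0. 0 < real_vec g \<bullet> (p + \<epsilon> *\<^sub>R a)"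
    proof
      fix g assume g: "g \<in> G - F"
      have "((\<lambda>\<epsilon>. real_vec g \<bullet> (p + \<epsilon> *\<^sub>R a)) \<longlongrightarrow> real_vec g \<bullet> (p + 0 *\<^sub>R a)) (at_right 0)"
        by (intro tendsto_intros)
      moreover have "0 < real_vec g \<bullet> (p + 0 *\<^sub>R a)"
        using g p by (auto simp: F_def dual_cone_eq less_le)
      ultimately show "\<forall>\<^sub>F \<epsilon> in at_right 0. 0 < real_vec g \<bullet> (p + \<epsilon> *\<^sub>R a)"
        by (rule order_tendstoD(1))
    qed
  qed (use fin in auto)
  then obtain \<epsilon> where \<epsilon>: "0 < \<epsilon>" "\<forall>g\<in>G - F. 0 < real_vec g \<bullet> (p + \<epsilon> *\<^sub>R a)"
    by (rule eventually_at_right_0_witness)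
  define q where "q = p + \<epsilon> *\<^sub>R a"
  have qF: "\<forall>g\<in>F. real_vec g \<bullet> q = 0" using a(2) by (auto simp: q_def F_def inner_add_right)
  then have qB: "\<And>i. i \<notin> B \<Longrightarrow> real_vec (d i) \<bullet> q = 0" using B by blast
  define R where "R = (\<Sum>i\<in>B. norm (real_vec (e i)))"
  \<comment> \<open>Rounding the coordinates of \<open>N q\<close> in a lattice basis adapted to the span of the face stays in that span.\<close>
  define v where "v N = (\<Sum>i\<in>B. \<lfloor>real N * (real_vec (d i) \<bullet> q)\<rfloor> *s e i)" for N :: nat
  have q_exp: "q = (\<Sum>i\<in>B. (real_vec (d i) \<bullet> q) *\<^sub>R real_vec (e i))"
  proof -
    have "q = (\<Sum>i\<in>UNIV. (real_vec (d i) \<bullet> q) *\<^sub>R real_vec (e i))" using lattice_basis_expand[OF b] by simp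
    also have "\<dots> = (\<Sum>i\<in>B. (real_vec (d i) \<bullet> q) *\<^sub>R real_vec (e i))"
      using qB by (intro sum.mono_neutral_right) auto
    finally show ?thesis .
  qed
  have v_near: "norm (real_vec (v N) - real N *\<^sub>R q) \<le> R" for N
  proof -
    have "real_vec (v N) - real N *\<^sub>R q
        = (\<Sum>i\<in>B. (of_int \<lfloor>real N * (real_vec (d i) \<bullet> q)\<rfloor> - real N * (real_vec (d i) \<bullet> q)) *\<^sub>R real_vec (e i))"
      unfolding v_def real_vec_sum real_vec_scale
      by (subst arg_cong[OF q_exp, of "\<lambda>q'. real N *\<^sub>R q'"])
        (simp only: scaleR_sum_right sum_subtractf scaleR_diff_left scaleR_scaleR)
    also have "norm \<dots> \<le> (\<Sum>i\<in>B. norm (real_vec (e i)))"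
    proof (rule sum_norm_le)
      fix i
      have "\<bar>of_int \<lfloor>real N * (real_vec (d i) \<bullet> q)\<rfloor> - real N * (real_vec (d i) \<bullet> q)\<bar> \<le> 1" by linarith
      then have "\<bar>of_int \<lfloor>real N * (real_vec (d i) \<bullet> q)\<rfloor> - real N * (real_vec (d i) \<bullet> q)\<bar> * norm (real_vec (e i))
          \<le> 1 * norm (real_vec (e i))" by (rule mult_right_mono) simp
      then show "norm ((of_int \<lfloor>real N * (real_vec (d i) \<bullet> q)\<rfloor> - real N * (real_vec (d i) \<bullet> q)) *\<^sub>R real_vec (e i))
          \<le> norm (real_vec (e i))" by simp
    qed
    finally show ?thesis by (simp add: R_def)
  qed
  have inner_near: "\<bar>y \<bullet> real_vec (v N) - real N * (y \<bullet> q)\<bar> \<le> norm y * R" for y N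
  proof -
    have "y \<bullet> real_vec (v N) - real N * (y \<bullet> q) = y \<bullet> (real_vec (v N) - real N *\<^sub>R q)"
      by (simp add: inner_diff_right)
    also have "\<bar>\<dots>\<bar> \<le> norm y * norm (real_vec (v N) - real N *\<^sub>R q)" by (rule Cauchy_Schwarz_ineq2)
    also have "\<dots> \<le> norm y * R" using v_near by (intro mult_left_mono) auto
    finally show ?thesis .
  qed
  have vF: "pairing g (v N) = 0" if g: "g \<in> F" for g N
  proof -
    have "pairing g (e i) = 0" if "i \<in> B" for i
    proof -
      have "\<forall>j. j \<notin> B \<longrightarrow> real_vec (d j) \<bullet> real_vec (e i) = 0"
        using b that by (auto simp: lattice_basis_def real_vec_inner)
      then have "real_vec g \<bullet> real_vec (e i) = 0" using B g by blast
      then show ?thesis by (simp add: real_vec_inner)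
    qed
    then show ?thesis by (simp add: v_def pairing_sum_right pairing_scale_right)
  qed
  have "\<forall>\<^sub>F N in sequentially. \<forall>g\<in>G - F. norm (real_vec g) * R < real N * (real_vec g \<bullet> q)"
  proof (rule eventually_ball_finite)
    show "\<forall>g\<in>G - F. \<forall>\<^sub>F N in sequentially. norm (real_vec g) * R < real N * (real_vec g \<bullet> q)"
    proof
      fix g assume "g \<in> G - F"
      then have g: "0 < real_vec g \<bullet> q" using \<epsilon>(2) by (simp add: q_def)
      obtain n0 :: nat where n0: "norm (real_vec g) * R < real n0 * (real_vec g \<bullet> q)"
        using reals_Archimedean3[OF g] by blast
      have "norm (real_vec g) * R < real n * (real_vec g \<bullet> q)" if "n0 \<le> n" for n
        by (rule less_le_trans[OF n0 mult_right_mono]) (use that g in auto)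
      then show "\<forall>\<^sub>F N in sequentially. norm (real_vec g) * R < real N * (real_vec g \<bullet> q)"
        unfolding eventually_sequentially by blast
    qed
  qed (use fin in auto)
  then obtain N0 where N0: "\<And>N g. N0 \<le> N \<Longrightarrow> g \<in> G - F \<Longrightarrow> norm (real_vec g) * R < real N * (real_vec g \<bullet> q)"
    unfolding eventually_sequentially by blast
  have vS: "v N \<in> support_face p" if "N0 \<le> N" for N
  proof -
    have "0 \<le> pairing g (v N)" if g: "g \<in> G" for g
    proof (cases "g \<in> F")
      case True
      then show ?thesis using vF by simp
    next
      case False
      have "0 \<le> real_vec g \<bullet> real_vec (v N)"
        using N0[OF \<open>N0 \<le> N\<close>, of g] g False inner_near[of "real_vec g" N] by auto
      then show ?thesis by (simp add: real_vec_inner)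
    qed
    then show ?thesis using vF by (auto simp: support_face_def lattice_cone_def F_def)
  qed
  have av: "a \<bullet> real_vec (v N) \<le> 0" if N: "N0 \<le> N" for N
  proof -
    have vv: "v N \<in> S" using vS[OF N] by (simp add: support_face_def)
    let ?r = "rep (v N)"
    have "a \<bullet> real_vec (\<Sum>i<k. int (?r i) *s h i) = (\<Sum>i<k. real (?r i) * (a \<bullet> real_vec (h i)))"
      by (simp add: real_vec_sum real_vec_scale inner_sum_right)
    also have "\<dots> \<le> 0"
    proof (rule sum_nonpos)
      fix i assume "i \<in> {..<k}"
      then have i: "i < k" by simp
      show "real (?r i) * (a \<bullet> real_vec (h i)) \<le> 0"
      proof (cases "?r i = 0")
        case False
        let ?w = "(int (?r i) - 1) *s h i + (\<Sum>j\<in>{..<k} - {i}. int (?r j) *s h j)"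
        have "v N = (\<Sum>j<k. int (?r j) *s h j)" by (rule rep[OF vv])
        also have "\<dots> = int (?r i) *s h i + (\<Sum>j\<in>{..<k} - {i}. int (?r j) *s h j)"
          using i by (intro sum.remove) auto
        also have "\<dots> = h i + ?w" by (simp add: vec_eq_iff algebra_simps)
        finally have eq: "v N = h i + ?w" .
        have "int (?r i) - 1 = int (?r i - 1)" using False by simp
        then have "(int (?r i) - 1) *s h i \<in> S" by (simp only: lattice_cone_scale[OF h_in_S[OF i]])
        moreover have "(\<Sum>j\<in>{..<k} - {i}. int (?r j) *s h j) \<in> S"
          by (intro lattice_cone_sum lattice_cone_scale h_in_S) auto
        ultimately have wS: "?w \<in> S" by (rule lattice_cone_add)
        have "h i + ?w \<in> support_face p"
          by (rule subst[OF eq, of "\<lambda>z. z \<in> support_face p"]) (rule vS[OF N])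
        then have "h i \<in> support_face p" by (rule face_addD[OF face_support_face h_in_S[OF i] wS])
        then show ?thesis using le[OF i] by (simp add: mult_nonneg_nonpos)
      qed simp
    qed
    finally show ?thesis using rep[OF vv] by simp
  qed
  have "a \<bullet> q \<le> 0"
  proof (rule ccontr)
    assume "\<not> a \<bullet> q \<le> 0"
    then have pos: "0 < a \<bullet> q" by simp
    obtain n :: nat where n: "norm a * R < real n * (a \<bullet> q)" using reals_Archimedean3[OF pos] by blast
    have "real n * (a \<bullet> q) \<le> real (max n N0) * (a \<bullet> q)" using pos by (intro mult_right_mono) auto
    then show False using av[of "max n N0"] inner_near[of a "max n N0"] n by auto
  qed
  then have "a \<bullet> p \<le> - \<epsilon> * (a \<bullet> a)" by (simp add: q_def inner_add_right)
  also have "\<dots> < 0" using \<epsilon>(1) a(1) by simp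
  finally show ?thesis .
qed

text \<open>
  Let \<open>V\<close> be the span of the face of \<open>p\<close>. At a minimum over \<open>V\<close> of the function
  \<open>\<Sum>\<^sub>i exp (a \<bullet> h i) - a \<bullet> p\<close>, with \<open>i\<close> ranging over the generators in this face, the gradient is
  zero, which says that \<open>exp (a \<bullet> _)\<close>, extended by zero outside the face, has moment \<open>p\<close>. The
  minimum exists because the function grows at least linearly: by \<open>face_direction\<close>, in every
  direction some generator grows or \<open>p\<close> decreases.
\<close>

lemma moment_surj:
  assumes p: "p \<in> dual_cone \<sigma>"
  shows "\<exists>\<eta>. positive_hom \<eta> \<and> moment \<eta> = p"
proof -
  define V where "V = {a. \<forall>g\<in>G. real_vec g \<bullet> p = 0 \<longrightarrow> real_vec g \<bullet> a = 0}"
  define J where "J = {i. i < k \<and> h i \<in> support_face p}"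
  have finJ: "finite J" by (simp add: J_def)
  have subV: "subspace V" by (auto simp: subspace_def V_def inner_add_right)
  have hV: "real_vec (h i) \<in> V" if "i \<in> J" for i
    using that by (auto simp: V_def J_def support_face_def real_vec_inner)
  have pV: "p \<in> V" by (simp add: V_def)
  define \<psi> where "\<psi> a = (\<Sum>i\<in>J. max 0 (a \<bullet> real_vec (h i))) + max 0 (- (a \<bullet> p))" for a
  define \<phi> where "\<phi> a = (\<Sum>i\<in>J. exp (a \<bullet> real_vec (h i))) - a \<bullet> p" for a
  have \<psi>_cont: "continuous_on UNIV \<psi>" unfolding \<psi>_def by (intro continuous_intros)
  have \<phi>_cont: "continuous_on UNIV \<phi>" unfolding \<phi>_def by (intro continuous_intros)
  have \<psi>_pos: "0 < \<psi> a" if "a \<in> V" "a \<noteq> 0" for a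
  proof (rule ccontr)
    assume "\<not> 0 < \<psi> a"
    moreover have "0 \<le> (\<Sum>i\<in>J. max 0 (a \<bullet> real_vec (h i)))" by (intro sum_nonneg) auto
    ultimately have "(\<Sum>i\<in>J. max 0 (a \<bullet> real_vec (h i))) = 0" "max 0 (- (a \<bullet> p)) = 0"
      unfolding \<psi>_def by linarith+
    then have "\<forall>i\<in>J. max 0 (a \<bullet> real_vec (h i)) = 0" "0 \<le> a \<bullet> p"
      using finJ by (auto simp: sum_nonneg_eq_0_iff)
    then have "\<forall>i\<in>J. a \<bullet> real_vec (h i) \<le> 0" "0 \<le> a \<bullet> p" by (auto simp: max_def split: if_splits)
    then show False using face_direction[OF p that(2)] that(1) by (force simp: V_def J_def)
  qed
  have "\<exists>\<delta>>0. \<forall>a\<in>V. \<delta> * norm a \<le> \<psi> a"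
  proof (cases "V \<inter> sphere 0 1 = {}")
    case True
    have "a = 0" if "a \<in> V" for a
    proof (rule ccontr)
      assume "a \<noteq> 0"
      then have "a /\<^sub>R norm a \<in> V \<inter> sphere 0 1" using subspace_scale[OF subV that] by simp
      then show False using True by blast
    qed
    note zero = this
    have "1 * norm a \<le> \<psi> a" if "a \<in> V" for a
      unfolding zero[OF that] by (simp add: \<psi>_def)
    then show ?thesis using zero_less_one by blast
  next
    case False
    have "compact (V \<inter> sphere 0 1)" by (intro closed_Int_compact closed_subspace subV) auto
    then obtain b where b: "b \<in> V \<inter> sphere 0 1" "\<And>a. a \<in> V \<inter> sphere 0 1 \<Longrightarrow> \<psi> b \<le> \<psi> a"
      using continuous_attains_inf[OF _ False, of \<psi>] continuous_on_subset[OF \<psi>_cont] by (metis subset_UNIV)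
    have "\<psi> b * norm a \<le> \<psi> a" if a: "a \<in> V" for a
    proof (cases "a = 0")
      case True
      then show ?thesis by (simp add: \<psi>_def)
    next
      case False
      then have "a /\<^sub>R norm a \<in> V \<inter> sphere 0 1" using subspace_scale[OF subV a] by simp
      from b(2)[OF this] have "\<psi> b * norm a \<le> \<psi> (a /\<^sub>R norm a) * norm a" by (intro mult_right_mono) auto
      also have "\<psi> (a /\<^sub>R norm a) * norm a = \<psi> a"
      proof -
        have m: "max 0 (x / norm a) * norm a = max 0 x" for x :: real
          using False by (auto simp: max_def field_simps)
        have m': "max 0 (- (x / norm a)) * norm a = max 0 (- x)" for x :: real
          using m[of "- x"] by simp
        show ?thesis
          by (simp add: \<psi>_def distrib_right sum_distrib_right divide_inverse_commute[symmetric] m m'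
            flip: divide_inverse)
      qed
      finally show ?thesis .
    qed
    moreover have "0 < \<psi> b" using b(1) by (intro \<psi>_pos) auto
    ultimately show ?thesis by blast
  qed
  then obtain \<delta> where \<delta>: "0 < \<delta>" "\<And>a. a \<in> V \<Longrightarrow> \<delta> * norm a \<le> \<psi> a" by blast
  \<comment> \<open>The slope \<open>M\<close> of the linear minorant of \<open>exp\<close> is chosen so large that it outweighs the term \<open>a \<bullet> p\<close>.\<close>
  define M where "M = 1 + norm p / \<delta>"
  have M: "1 \<le> M" using \<delta>(1) by (simp add: M_def)
  define C where "C = real (card J) * (M * ln M)"
  have coercive: "\<delta> * norm a - C \<le> \<phi> a" if a: "a \<in> V" for a
  proof -
    let ?s = "\<Sum>i\<in>J. max 0 (a \<bullet> real_vec (h i))"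
    have s0: "0 \<le> ?s" by (intro sum_nonneg) auto
    have "(\<Sum>i\<in>J. M * max 0 (a \<bullet> real_vec (h i)) - M * ln M) \<le> (\<Sum>i\<in>J. exp (a \<bullet> real_vec (h i)))"
      by (intro sum_mono exp_ge_linear M)
    then have "M * ?s - C \<le> (\<Sum>i\<in>J. exp (a \<bullet> real_vec (h i)))"
      by (simp add: sum_subtractf sum_distrib_left C_def)
    then have phi: "M * ?s - C - a \<bullet> p \<le> \<phi> a" by (simp add: \<phi>_def)
    show ?thesis
    proof (cases "a \<bullet> p \<le> 0")
      case True
      have "1 * ?s \<le> M * ?s" using M s0 by (intro mult_right_mono) auto
      then show ?thesis using \<delta>(2)[OF a] phi True by (simp add: \<psi>_def)
    next
      case False
      then have "\<delta> * norm a \<le> ?s" using \<delta>(2)[OF a] by (simp add: \<psi>_def)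
      then have "M * (\<delta> * norm a) \<le> M * ?s" using M by (intro mult_left_mono) auto
      moreover have "M * (\<delta> * norm a) = \<delta> * norm a + norm p * norm a"
        using \<delta>(1) by (simp add: M_def field_simps)
      moreover have "a \<bullet> p \<le> norm p * norm a" using norm_cauchy_schwarz[of a p] by (simp add: mult.commute)
      ultimately show ?thesis using phi by linarith
    qed
  qed
  define R where "R = (\<bar>\<phi> 0\<bar> + \<bar>C\<bar>) / \<delta> + 1"
  have R: "0 < R" using \<delta>(1) by (simp add: R_def add_nonneg_pos)
  have "compact (V \<inter> cball 0 R)" by (intro closed_Int_compact closed_subspace subV) auto
  moreover have "0 \<in> V \<inter> cball 0 R" using subspace_0[OF subV] R by simp
  ultimately obtain b where b: "b \<in> V \<inter> cball 0 R" "\<And>a. a \<in> V \<inter> cball 0 R \<Longrightarrow> \<phi> b \<le> \<phi> a"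
    using continuous_attains_inf[of "V \<inter> cball 0 R" \<phi>] continuous_on_subset[OF \<phi>_cont]
    by (metis empty_iff subset_UNIV)
  have min: "\<phi> b \<le> \<phi> a" if a: "a \<in> V" for a
  proof (cases "norm a \<le> R")
    case True
    then show ?thesis using b(2) a by simp
  next
    case False
    have "\<phi> b \<le> \<phi> 0" using b(2) \<open>0 \<in> V \<inter> cball 0 R\<close> by blast
    also have "\<dots> \<le> \<delta> * R - C"
    proof -
      have "\<delta> * R = \<bar>\<phi> 0\<bar> + \<bar>C\<bar> + \<delta>" using \<delta>(1) by (simp add: R_def field_simps)
      then show ?thesis using \<delta>(1) by linarith
    qed
    also have "\<dots> \<le> \<delta> * norm a - C" using False \<delta>(1) by simp
    also have "\<dots> \<le> \<phi> a" by (rule coercive[OF a])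
    finally show ?thesis .
  qed
  \<comment> \<open>The gradient at the minimum \<open>b\<close> lies in \<open>V\<close>; the derivative in its own direction is its squared norm.\<close>
  define w where "w = (\<Sum>i\<in>J. exp (b \<bullet> real_vec (h i)) *\<^sub>R real_vec (h i)) - p"
  have wV: "w \<in> V" unfolding w_def
    by (intro subspace_diff subspace_sum subspace_scale subV hV pV)
  have "((\<lambda>t. \<phi> (b + t *\<^sub>R w)) has_real_derivative
      (\<Sum>i\<in>J. exp ((b + 0 *\<^sub>R w) \<bullet> real_vec (h i)) * (w \<bullet> real_vec (h i))) - w \<bullet> p) (at 0)"
    unfolding \<phi>_def inner_add_left inner_scaleR_left
    by (auto intro!: derivative_eq_intros sum.cong)
  moreover have "\<phi> (b + 0 *\<^sub>R w) \<le> \<phi> (b + t *\<^sub>R w)" for t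
    using min[of "b + t *\<^sub>R w"] b(1) wV subspace_add[OF subV] subspace_scale[OF subV] by simp
  ultimately have "(\<Sum>i\<in>J. exp ((b + 0 *\<^sub>R w) \<bullet> real_vec (h i)) * (w \<bullet> real_vec (h i))) - w \<bullet> p = 0"
    by (intro DERIV_local_min[where d = 1]) auto
  then have "w \<bullet> w = 0" unfolding w_def by (simp add: inner_diff_right inner_sum_right)
  then have w0: "(\<Sum>i\<in>J. exp (b \<bullet> real_vec (h i)) *\<^sub>R real_vec (h i)) = p" by (simp add: w_def)
  define \<eta> where "\<eta> u = (if u \<in> support_face p then exp (b \<bullet> real_vec u) else 0)" for u
  have "positive_hom \<eta>"
    using face_support_face[of p] unfolding positive_hom_def monoid_hom_def face_def
    by (auto simp: \<eta>_def real_vec_add inner_add_right exp_add)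
  moreover have "moment \<eta> = (\<Sum>i\<in>J. exp (b \<bullet> real_vec (h i)) *\<^sub>R real_vec (h i))"
    unfolding moment_def by (rule sum.mono_neutral_cong_right) (auto simp: J_def \<eta>_def)
  ultimately show ?thesis using w0 by metis
qed

text \<open>
  Along a sequence that escapes to infinity with bounded moments, the normalized values on the
  generators would converge to coefficients \<open>l i \<ge> 0\<close> of a nontrivial relation \<open>\<Sum>\<^sub>i l i h i = 0\<close>.
  As \<open>ln \<eta>\<close> is linear where \<open>\<eta>\<close> is positive, \<open>\<Sum>\<^sub>i l i ln (\<eta> (h i)) = 0\<close> then holds far along the
  sequence, although all terms with \<open>l i > 0\<close> are positive there.
\<close>

lemma moment_proper: "\<exists>R. \<forall>\<eta>. positive_hom \<eta> \<and> norm (moment \<eta>) \<le> B \<longrightarrow> (\<forall>i<k. \<eta> (h i) \<le> R)"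
proof (rule ccontr)
  assume "\<not> ?thesis"
  then have "\<forall>n::nat. \<exists>\<eta>. positive_hom \<eta> \<and> norm (moment \<eta>) \<le> B \<and> (\<exists>i<k. real n < \<eta> (h i))"
    by (metis linorder_not_le)
  then obtain \<eta> where \<eta>: "\<And>n. positive_hom (\<eta> n)" "\<And>n. norm (moment (\<eta> n)) \<le> B"
      "\<And>n. \<exists>i<k. real n < \<eta> n (h i)" by metis
  have nonneg: "0 \<le> \<eta> n (h i)" if "i < k" for n i using positive_hom_nonneg[OF \<eta>(1) h_in_S[OF that]] .
  define M where "M n = (\<Sum>i<k. \<eta> n (h i))" for n
  have M: "real n < M n" for n
  proof -
    obtain i where i: "i < k" "real n < \<eta> n (h i)" using \<eta>(3) by blast
    have "\<eta> n (h i) \<le> M n" unfolding M_def using i(1) nonneg by (intro member_le_sum) auto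
    then show ?thesis using i(2) by linarith
  qed
  have M0: "0 < M n" for n using M[of n] by (meson le_less_trans of_nat_0_le_iff)
  define \<nu> where "\<nu> n i = \<eta> n (h i) / M n" for n i
  have \<nu>0: "0 \<le> \<nu> n i" if "i < k" for n i using nonneg[OF that] M0[of n] by (simp add: \<nu>_def)
  have \<nu>sum: "(\<Sum>i<k. \<nu> n i) = 1" for n
    using M0[of n] by (simp add: \<nu>_def M_def flip: sum_divide_distrib)
  have "\<bar>\<nu> n i\<bar> \<le> 1" if "i < k" for n i
  proof -
    have "\<nu> n i \<le> (\<Sum>i<k. \<nu> n i)" using that \<nu>0 by (intro member_le_sum) auto
    then show ?thesis using \<nu>sum \<nu>0[OF that] by simp
  qed
  then obtain r l where r: "strict_mono (r :: nat \<Rightarrow> nat)" and l: "\<And>i. i < k \<Longrightarrow> (\<lambda>n. \<nu> (r n) i) \<longlonglongrightarrow> l i"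
    using convergent_subsequence_finite[of k \<nu> 1] by blast
  have l0: "0 \<le> l i" if "i < k" for i
    by (rule LIMSEQ_le_const[OF l[OF that]]) (use \<nu>0[OF that] in blast)
  have "(\<lambda>n. \<Sum>i<k. \<nu> (r n) i) \<longlonglongrightarrow> (\<Sum>i<k. l i)" using l by (intro tendsto_sum) auto
  then have lsum: "(\<Sum>i<k. l i) = 1" unfolding \<nu>sum using LIMSEQ_unique tendsto_const by blast
  have "(\<lambda>n. \<Sum>i<k. \<nu> (r n) i *\<^sub>R real_vec (h i)) \<longlonglongrightarrow> (\<Sum>i<k. l i *\<^sub>R real_vec (h i))"
    using l by (intro tendsto_sum tendsto_scaleR tendsto_const) auto
  moreover have "(\<lambda>n. \<Sum>i<k. \<nu> (r n) i *\<^sub>R real_vec (h i)) \<longlonglongrightarrow> 0"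
  proof (rule Lim_null_comparison)
    show "(\<lambda>n. \<bar>B\<bar> / real n) \<longlonglongrightarrow> 0" by (rule lim_const_over_n)
    show "\<forall>\<^sub>F n in sequentially. norm (\<Sum>i<k. \<nu> (r n) i *\<^sub>R real_vec (h i)) \<le> \<bar>B\<bar> / real n"
      using eventually_gt_at_top[of 0]
    proof eventually_elim
      case (elim n)
      have "(\<Sum>i<k. \<nu> (r n) i *\<^sub>R real_vec (h i)) = moment (\<eta> (r n)) /\<^sub>R M (r n)"
        by (simp add: \<nu>_def moment_def scaleR_sum_right divide_inverse mult.commute)
      then have "norm (\<Sum>i<k. \<nu> (r n) i *\<^sub>R real_vec (h i)) = norm (moment (\<eta> (r n))) / M (r n)"
        using M0[of "r n"] by (simp add: divide_inverse mult.commute)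
      also have "\<dots> \<le> \<bar>B\<bar> / real n"
      proof (rule frac_le)
        show "norm (moment (\<eta> (r n))) \<le> \<bar>B\<bar>" using \<eta>(2)[of "r n"] by linarith
        show "real n \<le> M (r n)" using M[of "r n"] seq_suble[OF r, of n] by linarith
      qed (use elim in auto)
      finally show ?case .
    qed
  qed
  ultimately have rel: "(\<Sum>i<k. l i *\<^sub>R real_vec (h i)) = 0" using LIMSEQ_unique by blast
  have unit: "pairing g (h i) = 0" if g: "g \<in> G" and i: "i < k" "0 < l i" for g i
  proof -
    have "(\<Sum>i<k. l i * of_int (pairing g (h i))) = real_vec g \<bullet> (\<Sum>i<k. l i *\<^sub>R real_vec (h i))"
      by (simp add: inner_sum_right real_vec_inner)
    then have "(\<Sum>i<k. l i * of_int (pairing g (h i))) = 0" using rel by simp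
    moreover have "0 \<le> l i * of_int (pairing g (h i))" if "i \<in> {..<k}" for i
      using that l0 h_in_S g by (intro mult_nonneg_nonneg) (auto simp: lattice_cone_def)
    ultimately have "\<forall>i\<in>{..<k}. l i * of_int (pairing g (h i)) = 0"
      by (subst (asm) sum_nonneg_eq_0_iff) auto
    then have "l i * of_int (pairing g (h i)) = 0" using i(1) by blast
    then show ?thesis using i(2) by simp
  qed
  have "\<forall>\<^sub>F n in sequentially. \<forall>i\<in>{i. i < k \<and> 0 < l i}. 1 < \<eta> (r n) (h i)"
  proof (rule eventually_ball_finite)
    show "\<forall>i\<in>{i. i < k \<and> 0 < l i}. \<forall>\<^sub>F n in sequentially. 1 < \<eta> (r n) (h i)"
    proof
      fix i assume "i \<in> {i. i < k \<and> 0 < l i}"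
      then have i: "i < k" "0 < l i" by auto
      have "0 < l i / 2" using i(2) by simp
      then obtain n0 :: nat where n0: "1 < real n0 * (l i / 2)" using reals_Archimedean3 by blast
      have "\<forall>\<^sub>F n in sequentially. l i / 2 < \<nu> (r n) i" using order_tendstoD(1)[OF l[OF i(1)], of "l i / 2"] i(2) by simp
      with eventually_ge_at_top[of n0] show "\<forall>\<^sub>F n in sequentially. 1 < \<eta> (r n) (h i)"
      proof eventually_elim
        case (elim n)
        have "real n0 \<le> M (r n)" using M[of "r n"] seq_suble[OF r, of n] elim(1) by linarith
        then have "real n0 * (l i / 2) \<le> M (r n) * \<nu> (r n) i"
          using elim(2) i(2) M0[of "r n"] by (intro mult_mono) auto
        then show ?case using n0 M0[of "r n"] by (simp add: \<nu>_def)
      qed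
    qed
  qed auto
  then obtain n where n: "\<And>i. i < k \<Longrightarrow> 0 < l i \<Longrightarrow> 1 < \<eta> (r n) (h i)"
    unfolding eventually_sequentially by blast
  obtain a where a: "\<forall>u\<in>positive_face (\<eta> (r n)). ln (\<eta> (r n) u) = a \<bullet> real_vec u"
    using positive_hom_log_linear[OF \<eta>(1)] by blast
  have term_eq: "l i * (a \<bullet> real_vec (h i)) = l i * ln (\<eta> (r n) (h i))" if i: "i < k" for i
  proof (cases "0 < l i")
    case True
    then have "h i \<in> positive_face (\<eta> (r n))" using n[OF i True] h_in_S[OF i] by (simp add: positive_face_def)
    then show ?thesis using a by simp
  next
    case False
    then show ?thesis using l0[OF i] by simp
  qed
  have "\<exists>i<k. 0 < l i"
  proof (rule ccontr)
    assume "\<not> (\<exists>i<k. 0 < l i)"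
    then have "\<forall>i\<in>{..<k}. l i = 0" using l0 by force
    then show False using lsum by simp
  qed
  then obtain i where i: "i < k" "0 < l i" by blast
  have "0 < (\<Sum>i<k. l i * ln (\<eta> (r n) (h i)))"
  proof (rule sum_pos2[of _ i])
    show "0 < l i * ln (\<eta> (r n) (h i))" using n[OF i] i by simp
    show "0 \<le> l j * ln (\<eta> (r n) (h j))" if "j \<in> {..<k}" for j
      using l0[of j] n[of j] that by (cases "0 < l j") auto
  qed (use i in auto)
  also have "(\<Sum>i<k. l i * ln (\<eta> (r n) (h i))) = (\<Sum>i<k. l i * (a \<bullet> real_vec (h i)))"
    by (rule sum.cong[OF refl], subst term_eq) auto
  also have "\<dots> = a \<bullet> (\<Sum>i<k. l i *\<^sub>R real_vec (h i))" by (simp add: inner_sum_right)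
  finally show False using rel by simp
qed

text \<open>
  The inverse \<open>\<xi>\<close> of the moment map is sequentially continuous: by properness every subsequence of
  values has an accumulation point, which has the right moment and is therefore the expected
  limit.
\<close>

theorem moment_homeomorphism:
  "\<exists>\<xi>. (\<forall>p\<in>dual_cone \<sigma>. positive_hom (\<xi> p) \<and> moment (\<xi> p) = p) \<and>
     (\<forall>\<eta>. positive_hom \<eta> \<longrightarrow> (\<forall>u\<in>S. \<xi> (moment \<eta>) u = \<eta> u)) \<and>
     (\<forall>u\<in>S. continuous_on (dual_cone \<sigma>) (\<lambda>p. \<xi> p u))"
proof -
  obtain \<xi> where \<xi>: "\<And>p. p \<in> dual_cone \<sigma> \<Longrightarrow> positive_hom (\<xi> p)" "\<And>p. p \<in> dual_cone \<sigma> \<Longrightarrow> moment (\<xi> p) = p"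
    using moment_surj by metis
  have inv: "\<xi> (moment \<eta>) u = \<eta> u" if "positive_hom \<eta>" "u \<in> S" for \<eta> u
    using moment_inj[OF \<xi>(1) that(1) \<xi>(2) that(2)] moment_in_dual_cone[OF that(1)] by blast
  have gen: "continuous_on (dual_cone \<sigma>) (\<lambda>p. \<xi> p (h i))" if i: "i < k" for i
    unfolding continuous_on_sequentially
  proof (intro allI ballI impI, elim conjE)
    fix x p assume p: "p \<in> dual_cone \<sigma>" and x: "\<forall>n::nat. x n \<in> dual_cone \<sigma>" "x \<longlonglongrightarrow> p"
    have "(\<lambda>n. \<xi> (x n) (h i)) \<longlonglongrightarrow> \<xi> p (h i)"
    proof (rule ccontr)
      assume "\<not> (\<lambda>n. \<xi> (x n) (h i)) \<longlonglongrightarrow> \<xi> p (h i)"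
      then obtain e where e: "0 < e" "\<forall>N. \<exists>n\<ge>N. e \<le> dist (\<xi> (x n) (h i)) (\<xi> p (h i))"
        unfolding lim_sequentially by (meson linorder_not_le)
      then have "infinite {n. e \<le> dist (\<xi> (x n) (h i)) (\<xi> p (h i))}"
        by (simp add: infinite_nat_iff_unbounded_le)
      from infinite_enumerate[OF this] obtain s where s: "strict_mono (s :: nat \<Rightarrow> nat)"
        "\<And>n. e \<le> dist (\<xi> (x (s n)) (h i)) (\<xi> p (h i))" by auto
      obtain B where B: "\<And>n. norm (x n) \<le> B"
        using convergent_imp_bounded[OF x(2)] unfolding bounded_iff by auto
      obtain R where R: "\<forall>\<eta>. positive_hom \<eta> \<and> norm (moment \<eta>) \<le> B \<longrightarrow> (\<forall>i<k. \<eta> (h i) \<le> R)"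
        using moment_proper[of B] by blast
      have "\<bar>\<xi> (x (s n)) (h j)\<bar> \<le> R" if j: "j < k" for n j
      proof -
        have "positive_hom (\<xi> (x (s n)))" "moment (\<xi> (x (s n))) = x (s n)" using \<xi> x(1) by auto
        then show ?thesis using R B[of "s n"] j positive_hom_nonneg[OF _ h_in_S[OF j]] by auto
      qed
      then obtain r l where r: "strict_mono (r :: nat \<Rightarrow> nat)"
        and l: "\<And>j. j < k \<Longrightarrow> (\<lambda>n. \<xi> (x (s (r n))) (h j)) \<longlonglongrightarrow> l j"
        using convergent_subsequence_finite[of k "\<lambda>n j. \<xi> (x (s n)) (h j)" R] by blast
      define \<eta> where "\<eta> u = monom_eval k l (rep u)" for u
      let ?x = "\<lambda>n. \<xi> (x (s (r n)))"
      have ph: "positive_hom (?x n)" for n using \<xi> x(1) by blast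
      have lim: "(\<lambda>n. ?x n u) \<longlonglongrightarrow> \<eta> u" if u: "u \<in> S" for u
        unfolding positive_hom_generators[OF ph u] \<eta>_def monom_eval_def
        using l by (intro tendsto_prod tendsto_power) auto
      have l_eq: "\<eta> (h j) = l j" if "j < k" for j
        using LIMSEQ_unique[OF lim[OF h_in_S[OF that]] l[OF that]] .
      have "\<eta> 0 = 1" using LIMSEQ_unique[OF lim[OF lattice_cone_zero]] positive_hom_zero[OF ph] by simp
      moreover have "\<eta> (u + v) = \<eta> u * \<eta> v" if "u \<in> S" "v \<in> S" for u v
      proof (rule LIMSEQ_unique[OF lim[OF lattice_cone_add[OF that]]])
        show "(\<lambda>n. ?x n (u + v)) \<longlonglongrightarrow> \<eta> u * \<eta> v"
          unfolding positive_hom_mult[OF ph that] by (intro tendsto_mult lim that)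
      qed
      moreover have "0 \<le> \<eta> u" if "u \<in> S" for u
        by (rule LIMSEQ_le_const[OF lim[OF that]]) (use positive_hom_nonneg[OF ph that] in blast)
      ultimately have \<eta>: "positive_hom \<eta>" by (simp add: positive_hom_def monoid_hom_def)
      have "(\<lambda>n. moment (?x n)) \<longlonglongrightarrow> moment \<eta>"
        unfolding moment_def using lim h_in_S by (intro tendsto_sum tendsto_scaleR tendsto_const) auto
      moreover have "moment (?x n) = x (s (r n))" for n using \<xi> x(1) by blast
      moreover have "(\<lambda>n. x (s (r n))) \<longlonglongrightarrow> p"
        using LIMSEQ_subseq_LIMSEQ[OF x(2) strict_mono_o[OF s(1) r]] by (simp add: o_def)
      ultimately have "moment \<eta> = p" using LIMSEQ_unique by force
      then have "\<eta> (h i) = \<xi> p (h i)" using inv[OF \<eta> h_in_S[OF i]] by simp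
      then have "(\<lambda>n. ?x n (h i)) \<longlonglongrightarrow> \<xi> p (h i)" using lim[OF h_in_S[OF i]] by simp
      from tendstoD[OF this e(1)] obtain n where "dist (?x n (h i)) (\<xi> p (h i)) < e"
        unfolding eventually_sequentially by blast
      then show False using s(2)[of "r n"] by simp
    qed
    then show "((\<lambda>p. \<xi> p (h i)) \<circ> x) \<longlonglongrightarrow> \<xi> p (h i)" by (simp add: o_def)
  qed
  have "continuous_on (dual_cone \<sigma>) (\<lambda>p. \<xi> p u)" if u: "u \<in> S" for u
  proof -
    have "continuous_on (dual_cone \<sigma>) (\<lambda>p. monom_eval k (\<lambda>i. \<xi> p (h i)) (rep u))"
      unfolding monom_eval_def by (intro continuous_on_prod continuous_on_power gen) auto
    then show ?thesis
      by (rule continuous_on_cong[THEN iffD1, OF refl, rotated]) (use positive_hom_generators \<xi>(1) u in auto)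
  qed
  then show ?thesis using \<xi> inv by (intro exI[of _ \<xi>]) blast
qed

end

section \<open>Homomorphisms from a Grothendieck group to the circle\<close>

abbreviation groth_class :: "('m, 'r) monoid_scheme \<Rightarrow> 'm \<Rightarrow> 'm \<Rightarrow> ('m \<times> 'm) set" where
  "groth_class M a b \<equiv> groth_rel M `` {(a, b)}"

context comm_monoid
begin

lemma groth_rel_mult:
  assumes "((a, b), (a', b')) \<in> groth_rel G" "((c, d), (c', d')) \<in> groth_rel G"
  shows "((a \<otimes> c, b \<otimes> d), (a' \<otimes> c', b' \<otimes> d')) \<in> groth_rel G"
proof -
  from assms obtain k l where *: "a \<in> carrier G" "b \<in> carrier G" "a' \<in> carrier G" "b' \<in> carrier G"
    "c \<in> carrier G" "d \<in> carrier G" "c' \<in> carrier G" "d' \<in> carrier G" "k \<in> carrier G" "l \<in> carrier G"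
    "a \<otimes> b' \<otimes> k = a' \<otimes> b \<otimes> k" "c \<otimes> d' \<otimes> l = c' \<otimes> d \<otimes> l"
    unfolding groth_rel_def by blast
  have "(a \<otimes> c) \<otimes> (b' \<otimes> d') \<otimes> (k \<otimes> l) = (a \<otimes> b' \<otimes> k) \<otimes> (c \<otimes> d' \<otimes> l)"
    using *(1-10) by (simp add: m_ac)
  also have "\<dots> = (a' \<otimes> b \<otimes> k) \<otimes> (c' \<otimes> d \<otimes> l)" using *(11,12) by simp
  also have "\<dots> = (a' \<otimes> c') \<otimes> (b \<otimes> d) \<otimes> (k \<otimes> l)"
    using *(1-10) by (simp add: m_ac)
  finally show ?thesis using *(1-10) unfolding groth_rel_def by blast
qed

lemma equiv_groth_rel: "equiv (carrier G \<times> carrier G) (groth_rel G)"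
proof (rule equivI)
  show "groth_rel G \<subseteq> (carrier G \<times> carrier G) \<times> (carrier G \<times> carrier G)"
    unfolding groth_rel_def by auto
  show "refl_on (carrier G \<times> carrier G) (groth_rel G)"
    unfolding groth_rel_def refl_on_def using one_closed by auto
  show "sym (groth_rel G)"
    unfolding groth_rel_def sym_def by auto metis
  show "trans (groth_rel G)"
  proof (rule transI)
    fix x y z assume "(x, y) \<in> groth_rel G" "(y, z) \<in> groth_rel G"
    moreover obtain a b c d e f where xyz: "x = (a, b)" "y = (c, d)" "z = (e, f)" by (metis surj_pair)
    ultimately obtain k l where *: "a \<in> carrier G" "b \<in> carrier G" "c \<in> carrier G" "d \<in> carrier G"
      "e \<in> carrier G" "f \<in> carrier G" "k \<in> carrier G" "l \<in> carrier G"
      "a \<otimes> d \<otimes> k = c \<otimes> b \<otimes> k" "c \<otimes> f \<otimes> l = e \<otimes> d \<otimes> l"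
      unfolding groth_rel_def by blast
    have "a \<otimes> f \<otimes> (k \<otimes> l \<otimes> d) = (a \<otimes> d \<otimes> k) \<otimes> (f \<otimes> l)" using *(1-8) by (simp add: m_ac)
    also have "\<dots> = (c \<otimes> b \<otimes> k) \<otimes> (f \<otimes> l)" using *(9) by simp
    also have "\<dots> = (c \<otimes> f \<otimes> l) \<otimes> (b \<otimes> k)" using *(1-8) by (simp add: m_ac)
    also have "\<dots> = (e \<otimes> d \<otimes> l) \<otimes> (b \<otimes> k)" using *(10) by simp
    also have "\<dots> = e \<otimes> b \<otimes> (k \<otimes> l \<otimes> d)" using *(1-8) by (simp add: m_ac)
    finally have "a \<otimes> f \<otimes> (k \<otimes> l \<otimes> d) = e \<otimes> b \<otimes> (k \<otimes> l \<otimes> d)" .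
    moreover have "k \<otimes> l \<otimes> d \<in> carrier G" using *(1-8) by simp
    ultimately show "(x, z) \<in> groth_rel G" using *(1-8) unfolding groth_rel_def xyz by blast
  qed
qed

lemma carrier_grothendieck_group:
  "A \<in> carrier (grothendieck_group G) \<longleftrightarrow> (\<exists>a\<in>carrier G. \<exists>b\<in>carrier G. A = groth_class G a b)"
  unfolding grothendieck_group_def quotient_def by auto

lemma groth_class_eqI: "((a, b), (c, d)) \<in> groth_rel G \<Longrightarrow> groth_class G a b = groth_class G c d"
  by (rule equiv_class_eq[OF equiv_groth_rel])

lemma groth_class_self: "a \<in> carrier G \<Longrightarrow> b \<in> carrier G \<Longrightarrow> (a, b) \<in> groth_class G a b"
  by (rule equiv_class_self[OF equiv_groth_rel]) simp

lemma groth_class_mult: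
  assumes "a \<in> carrier G" "b \<in> carrier G" "c \<in> carrier G" "d \<in> carrier G"
  shows "groth_class G a b \<otimes>\<^bsub>grothendieck_group G\<^esub> groth_class G c d = groth_class G (a \<otimes> c) (b \<otimes> d)"
proof -
  have eq: "groth_class G (a' \<otimes> c') (b' \<otimes> d') = groth_class G (a \<otimes> c) (b \<otimes> d)"
    if "(a', b') \<in> groth_class G a b" "(c', d') \<in> groth_class G c d" for a' b' c' d'
    using groth_rel_mult[of a b a' b' c d c' d'] that groth_class_eqI by simp
  have "groth_class G a b \<otimes>\<^bsub>grothendieck_group G\<^esub> groth_class G c d
      = (\<Union>p\<in>groth_class G a b. \<Union>q\<in>groth_class G c d. groth_class G (fst p \<otimes> fst q) (snd p \<otimes> snd q))"
    unfolding grothendieck_group_def by (simp add: case_prod_beta)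
  also have "\<dots> = (\<Union>p\<in>groth_class G a b. \<Union>q\<in>groth_class G c d. groth_class G (a \<otimes> c) (b \<otimes> d))"
  proof (intro SUP_cong refl)
    fix p q assume "p \<in> groth_class G a b" "q \<in> groth_class G c d"
    then show "groth_class G (fst p \<otimes> fst q) (snd p \<otimes> snd q) = groth_class G (a \<otimes> c) (b \<otimes> d)"
      using eq[of "fst p" "snd p" "fst q" "snd q"] by simp
  qed
  also have "\<dots> = groth_class G (a \<otimes> c) (b \<otimes> d)"
  proof -
    have "groth_class G a b \<noteq> {}" "groth_class G c d \<noteq> {}"
      using groth_class_self assms by blast+
    then show ?thesis by (simp add: UN_constant)
  qed
  finally show ?thesis .
qed

text \<open>
  Homomorphisms from a monoid to the circle, without passing to its Grothendieck group; on the
  carrier they correspond to homomorphisms from the group by \<open>groth_extension_hom\<close> and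
  \<open>hom_eq_groth_extension\<close>.
\<close>

definition circle_hom :: "('a \<Rightarrow> complex) \<Rightarrow> bool" where
  "circle_hom f \<longleftrightarrow> (\<forall>a\<in>carrier G. norm (f a) = 1) \<and>
    (\<forall>a\<in>carrier G. \<forall>b\<in>carrier G. f (a \<otimes> b) = f a * f b)"

definition groth_extension :: "('a \<Rightarrow> complex) \<Rightarrow> ('a \<times> 'a) set \<Rightarrow> complex" where
  "groth_extension f = restrict (\<lambda>A. let p = SOME p. p \<in> A in f (fst p) / f (snd p)) (carrier (grothendieck_group G))"

lemma groth_extension_class:
  assumes f: "circle_hom f" and ab: "a \<in> carrier G" "b \<in> carrier G"
  shows "groth_extension f (groth_class G a b) = f a / f b"
proof -
  define p where "p = (SOME p. p \<in> groth_class G a b)"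
  have "p \<in> groth_class G a b" unfolding p_def
    by (rule someI[where P = "\<lambda>p. p \<in> groth_class G a b", OF groth_class_self[OF ab]])
  then have "((a, b), (fst p, snd p)) \<in> groth_rel G" by simp
  then obtain k where *: "fst p \<in> carrier G" "snd p \<in> carrier G" "k \<in> carrier G"
    "a \<otimes> snd p \<otimes> k = fst p \<otimes> b \<otimes> k"
    unfolding groth_rel_def by blast
  have nz: "f c \<noteq> 0" if "c \<in> carrier G" for c using f that by (force simp: circle_hom_def)
  have "f a * f (snd p) * f k = f (fst p) * f b * f k"
    using f ab * unfolding circle_hom_def by (metis m_closed)
  then have "f a / f b = f (fst p) / f (snd p)"
    using nz[OF *(3)] nz[OF *(2)] nz[OF ab(2)] by (simp add: frac_eq_eq)
  moreover have "groth_class G a b \<in> carrier (grothendieck_group G)"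
    using ab carrier_grothendieck_group by blast
  ultimately show ?thesis by (simp add: groth_extension_def Let_def p_def)
qed

lemma circle_hom_one: "circle_hom f \<Longrightarrow> f \<one> = 1"
proof -
  assume f: "circle_hom f"
  then have "f (\<one> \<otimes> \<one>) = f \<one> * f \<one>" unfolding circle_hom_def by blast
  moreover have "f \<one> \<noteq> 0" using f unfolding circle_hom_def by force
  ultimately show "f \<one> = 1" by simp
qed

lemma groth_extension_groth_of: "circle_hom f \<Longrightarrow> a \<in> carrier G \<Longrightarrow> groth_extension f (groth_of G a) = f a"
  by (simp add: groth_of_def groth_extension_class circle_hom_one)

lemma groth_extension_hom:
  assumes f: "circle_hom f"
  shows "groth_extension f \<in> hom (grothendieck_group G) circle_group"
proof (rule homI)
  fix A assume "A \<in> carrier (grothendieck_group G)"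
  then obtain a b where ab: "a \<in> carrier G" "b \<in> carrier G" "A = groth_class G a b"
    using carrier_grothendieck_group by blast
  have "norm (f a / f b) = 1" using f ab(1,2) by (simp add: circle_hom_def norm_divide)
  then show "groth_extension f A \<in> carrier circle_group"
    using groth_extension_class[OF f ab(1,2)] ab(3) by (simp add: circle_group_def)
next
  fix A B assume "A \<in> carrier (grothendieck_group G)" "B \<in> carrier (grothendieck_group G)"
  then obtain a b c d where ab: "a \<in> carrier G" "b \<in> carrier G" "A = groth_class G a b"
    and cd: "c \<in> carrier G" "d \<in> carrier G" "B = groth_class G c d"
    using carrier_grothendieck_group by metis
  have "groth_extension f (A \<otimes>\<^bsub>grothendieck_group G\<^esub> B) = f (a \<otimes> c) / f (b \<otimes> d)"
    unfolding ab(3) cd(3) groth_class_mult[OF ab(1,2) cd(1,2)]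
    by (rule groth_extension_class[OF f]) (use ab cd in auto)
  also have "\<dots> = (f a / f b) * (f c / f d)"
    using f ab(1,2) cd(1,2) by (simp add: circle_hom_def)
  finally show "groth_extension f (A \<otimes>\<^bsub>grothendieck_group G\<^esub> B) =
      groth_extension f A \<otimes>\<^bsub>circle_group\<^esub> groth_extension f B"
    using groth_extension_class[OF f ab(1,2)] groth_extension_class[OF f cd(1,2)] ab(3) cd(3)
    by (simp add: circle_group_def)
qed

lemma hom_groth_of:
  assumes \<phi>: "\<phi> \<in> hom (grothendieck_group G) circle_group"
  shows "circle_hom (\<lambda>a. \<phi> (groth_of G a))"
    and "a \<in> carrier G \<Longrightarrow> b \<in> carrier G \<Longrightarrow> \<phi> (groth_class G a b) = \<phi> (groth_of G a) / \<phi> (groth_of G b)"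
proof -
  have car: "groth_class G a b \<in> carrier (grothendieck_group G)" if "a \<in> carrier G" "b \<in> carrier G" for a b
    using that carrier_grothendieck_group by blast
  have norm: "norm (\<phi> (groth_class G a b)) = 1" if "a \<in> carrier G" "b \<in> carrier G" for a b
    using hom_in_carrier[OF \<phi> car[OF that]] by (simp add: circle_group_def)
  have mult: "\<phi> (groth_class G (a \<otimes> c) (b \<otimes> d)) = \<phi> (groth_class G a b) * \<phi> (groth_class G c d)"
    if "a \<in> carrier G" "b \<in> carrier G" "c \<in> carrier G" "d \<in> carrier G" for a b c d
    using hom_mult[OF \<phi> car[OF that(1,2)] car[OF that(3,4)]] groth_class_mult[OF that]
    by (simp add: circle_group_def)
  show "circle_hom (\<lambda>a. \<phi> (groth_of G a))"
    unfolding circle_hom_def groth_of_def using norm mult[of _ \<one> _ \<one>] by simp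
  assume ab: "a \<in> carrier G" "b \<in> carrier G"
  have "((a \<otimes> b, b), (a, \<one>)) \<in> groth_rel G"
    unfolding groth_rel_def using ab by (auto intro!: bexI[of _ \<one>])
  then have "groth_class G (a \<otimes> b) b = groth_of G a" unfolding groth_of_def by (rule groth_class_eqI)
  then have "\<phi> (groth_of G a) = \<phi> (groth_class G a b) * \<phi> (groth_of G b)"
    using mult[OF ab ab(2) one_closed] ab by (simp add: groth_of_def)
  moreover have "\<phi> (groth_of G b) \<noteq> 0" using norm[OF ab(2) one_closed] by (force simp: groth_of_def)
  ultimately show "\<phi> (groth_class G a b) = \<phi> (groth_of G a) / \<phi> (groth_of G b)" by simp
qed

lemma hom_eq_groth_extension:
  assumes \<phi>: "\<phi> \<in> hom (grothendieck_group G) circle_group" "\<phi> \<in> extensional (carrier (grothendieck_group G))"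
    and f: "circle_hom f" and eq: "\<And>a. a \<in> carrier G \<Longrightarrow> \<phi> (groth_of G a) = f a"
  shows "\<phi> = groth_extension f"
proof (rule extensionalityI[OF \<phi>(2)])
  show "groth_extension f \<in> extensional (carrier (grothendieck_group G))"
    by (simp add: groth_extension_def)
  fix A assume "A \<in> carrier (grothendieck_group G)"
  then obtain a b where "a \<in> carrier G" "b \<in> carrier G" "A = groth_class G a b"
    using carrier_grothendieck_group by blast
  then show "\<phi> A = groth_extension f A"
    using hom_groth_of(2)[OF \<phi>(1)] eq groth_extension_class[OF f] by simp
qed

end

section \<open>Points of the Kato--Nakayama space\<close>

lemma germ_eq_iff: "germ X x f = germ X x g \<longleftrightarrow> (\<forall>\<^sub>F y in nhdsin X x. f y = g y)"
proof
  assume "germ X x f = germ X x g"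
  moreover have "f \<in> germ X x f" by (simp add: germ_def)
  ultimately have "f \<in> germ X x g" by simp
  then show "\<forall>\<^sub>F y in nhdsin X x. f y = g y" by (simp add: germ_def)
next
  assume *: "\<forall>\<^sub>F y in nhdsin X x. f y = g y"
  have "(\<forall>\<^sub>F y in nhdsin X x. e y = f y) \<longleftrightarrow> (\<forall>\<^sub>F y in nhdsin X x. e y = g y)" for e
    by (rule eventually_cong[OF *]) simp
  then show "germ X x f = germ X x g" by (simp add: germ_def)
qed

lemma germ_mult:
  "{e. \<exists>f'\<in>germ X x f. \<exists>g'\<in>germ X x g. \<forall>\<^sub>F y in nhdsin X x. e y = f' y * g' y} = germ X x (\<lambda>y. f y * g y)"
proof (intro equalityI subsetI)
  fix e assume "e \<in> {e. \<exists>f'\<in>germ X x f. \<exists>g'\<in>germ X x g. \<forall>\<^sub>F y in nhdsin X x. e y = f' y * g' y}"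
  then obtain f' g' where "\<forall>\<^sub>F y in nhdsin X x. f' y = f y" "\<forall>\<^sub>F y in nhdsin X x. g' y = g y"
    "\<forall>\<^sub>F y in nhdsin X x. e y = f' y * g' y" by (auto simp: germ_def)
  then have "\<forall>\<^sub>F y in nhdsin X x. e y = f y * g y" by eventually_elim simp
  then show "e \<in> germ X x (\<lambda>y. f y * g y)" by (simp add: germ_def)
next
  fix e assume "e \<in> germ X x (\<lambda>y. f y * g y)"
  then have "\<forall>\<^sub>F y in nhdsin X x. e y = f y * g y" by (simp add: germ_def)
  moreover have "f \<in> germ X x f" "g \<in> germ X x g" by (simp_all add: germ_def)
  ultimately show "e \<in> {e. \<exists>f'\<in>germ X x f. \<exists>g'\<in>germ X x g. \<forall>\<^sub>F y in nhdsin X x. e y = f' y * g' y}"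
    by blast
qed

context affine_toric
begin

abbreviation log_stalk :: "'n point \<Rightarrow> ('n point \<Rightarrow> complex) set monoid" where
  "log_stalk x \<equiv> stalk X log_sheaf x"

text \<open>
  The germs of sections of the log sheaf, as a condition on functions that are defined on all of
  \<open>X\<close>.
\<close>

definition log_at :: "'n point \<Rightarrow> ('n point \<Rightarrow> complex) \<Rightarrow> bool" where
  "log_at x f \<longleftrightarrow> hol_at x f \<and> (\<exists>W. openin X W \<and> x \<in> W \<and> (\<forall>y\<in>W - D. f y \<noteq> 0))"

lemma eventually_nhdsin_points:
  "x \<in> points \<Longrightarrow> (\<forall>\<^sub>F y in nhdsin X x. P y) \<longleftrightarrow> (\<exists>W. openin X W \<and> x \<in> W \<and> (\<forall>y\<in>W. P y))"
  by (auto simp: eventually_nhdsin)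

lemma carrier_log_stalk:
  assumes x: "x \<in> points"
  shows "carrier (log_stalk x) = {germ X x f | f. log_at x f}"
proof (intro equalityI subsetI)
  fix A assume "A \<in> carrier (log_stalk x)"
  then obtain f U where f: "A = germ X x f" "openin X U" "x \<in> U" "f \<in> log_sheaf U"
    by (auto simp: stalk_def)
  then have "log_at x f" unfolding log_at_def log_sheaf_iff[OF f(2)] by blast
  then show "A \<in> {germ X x f | f. log_at x f}" using f(1) by blast
next
  fix A assume "A \<in> {germ X x f | f. log_at x f}"
  then obtain f where A: "A = germ X x f" and f: "log_at x f" by blast
  obtain W where W: "openin X W" "x \<in> W" "\<forall>y\<in>W - D. f y \<noteq> 0" using f unfolding log_at_def by blast
  obtain W' where W': "openin X W'" "x \<in> W'" "\<forall>y\<in>W'. hol_at y f"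
    using hol_at_nearby[OF x, of f] f unfolding log_at_def by blast
  define U where "U = W \<inter> W'"
  have U: "openin X U" "x \<in> U" using W W' by (auto simp: U_def intro: openin_Int)
  have "hol_at y (restrict f U)" if "y \<in> U" for y
    by (rule hol_at_cong[of y f U]) (use W' U that in \<open>auto simp: U_def\<close>)
  then have "restrict f U \<in> log_sheaf U" unfolding log_sheaf_iff[OF U(1)] using W(3) by (auto simp: U_def)
  moreover have "A = germ X x (restrict f U)"
    unfolding A germ_eq_iff eventually_nhdsin_points[OF x] using U by auto
  ultimately show "A \<in> carrier (log_stalk x)" using U unfolding stalk_def by auto
qed

lemma log_at_mult: "log_at x f \<Longrightarrow> log_at x g \<Longrightarrow> log_at x (\<lambda>y. f y * g y)"
proof -
  assume fg: "log_at x f" "log_at x g"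
  obtain W where W: "openin X W" "x \<in> W" "\<forall>y\<in>W - D. f y \<noteq> 0" using fg(1) unfolding log_at_def by blast
  obtain W' where W': "openin X W'" "x \<in> W'" "\<forall>y\<in>W' - D. g y \<noteq> 0" using fg(2) unfolding log_at_def by blast
  have "\<forall>y\<in>W \<inter> W' - D. f y * g y \<noteq> 0" using W(3) W'(3) by auto
  moreover have "openin X (W \<inter> W')" "x \<in> W \<inter> W'" using W W' by (auto intro: openin_Int)
  ultimately show ?thesis using fg hol_at_mult unfolding log_at_def by blast
qed

lemma log_at_unit:
  assumes "x \<in> points" "hol_at x g" "g x \<noteq> 0"
  shows "log_at x g"
proof -
  obtain W where "openin X W" "x \<in> W" "\<forall>y\<in>W. g y \<noteq> 0"
    using hol_at_nonzero_nearby[OF assms] by (elim exE conjE)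
  then have "openin X W \<and> x \<in> W \<and> (\<forall>y\<in>W - D. g y \<noteq> 0)" by simp
  then show ?thesis unfolding log_at_def using assms(2) by blast
qed

lemma log_at_monomial_value:
  assumes "x \<in> points" "u \<in> S"
  shows "log_at x (\<lambda>y. monomial_value y u)"
proof -
  have "\<forall>y\<in>points - D. monomial_value y u \<noteq> 0"
  proof
    fix y assume "y \<in> points - D"
    then show "monomial_value y u \<noteq> 0" using boundary_iff[of y] assms(2) by blast
  qed
  then show ?thesis
    unfolding log_at_def using hol_at_monomial_value[OF assms] openin_points assms(1) by (intro conjI exI[of _ points])
qed

lemma mult_log_stalk: "germ X x f \<otimes>\<^bsub>log_stalk x\<^esub> germ X x g = germ X x (\<lambda>y. f y * g y)"
  by (simp add: stalk_def germ_mult)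

lemma one_log_stalk: "\<one>\<^bsub>log_stalk x\<^esub> = germ X x (\<lambda>_. 1)"
  by (simp add: stalk_def)

lemma comm_monoid_log_stalk:
  assumes x: "x \<in> points"
  shows "comm_monoid (log_stalk x)"
proof (rule comm_monoidI)
  note car = carrier_log_stalk[OF x]
  fix A B assume "A \<in> carrier (log_stalk x)" "B \<in> carrier (log_stalk x)"
  then obtain f g where fg: "A = germ X x f" "log_at x f" "B = germ X x g" "log_at x g" unfolding car by blast
  show "A \<otimes>\<^bsub>log_stalk x\<^esub> B \<in> carrier (log_stalk x)"
    unfolding fg mult_log_stalk car using log_at_mult[OF fg(2,4)] by blast
  show "A \<otimes>\<^bsub>log_stalk x\<^esub> B = B \<otimes>\<^bsub>log_stalk x\<^esub> A"
    unfolding fg mult_log_stalk by (simp add: mult.commute)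
next
  have "log_at x (\<lambda>_. 1)" by (rule log_at_unit[OF x hol_at_const[OF x]]) simp
  then show "\<one>\<^bsub>log_stalk x\<^esub> \<in> carrier (log_stalk x)"
    unfolding one_log_stalk carrier_log_stalk[OF x] by blast
next
  fix A assume "A \<in> carrier (log_stalk x)"
  then obtain f where "A = germ X x f" unfolding carrier_log_stalk[OF x] by blast
  then show "\<one>\<^bsub>log_stalk x\<^esub> \<otimes>\<^bsub>log_stalk x\<^esub> A = A" unfolding one_log_stalk by (simp add: mult_log_stalk)
next
  fix A B C assume "A \<in> carrier (log_stalk x)" "B \<in> carrier (log_stalk x)" "C \<in> carrier (log_stalk x)"
  then obtain f g e where "A = germ X x f" "B = germ X x g" "C = germ X x e" unfolding carrier_log_stalk[OF x] by blast
  then show "A \<otimes>\<^bsub>log_stalk x\<^esub> B \<otimes>\<^bsub>log_stalk x\<^esub> C = A \<otimes>\<^bsub>log_stalk x\<^esub> (B \<otimes>\<^bsub>log_stalk x\<^esub> C)"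
    by (simp add: mult_log_stalk mult.assoc)
qed

end

section \<open>Phases\<close>

text \<open>
  The character of the compact torus with exponent \<open>u\<close>, evaluated at \<open>\<theta>\<close>.
\<close>

definition phase :: "('n::finite \<Rightarrow> complex) \<Rightarrow> int ^ 'n \<Rightarrow> complex" where
  "phase \<theta> u = (\<Prod>j\<in>UNIV. \<theta> j powi (u $ j))"

lemma phase_zero [simp]: "phase \<theta> 0 = 1"
  by (simp add: phase_def)

lemma phase_add: "(\<And>j. \<theta> j \<noteq> 0) \<Longrightarrow> phase \<theta> (u + v) = phase \<theta> u * phase \<theta> v"
  by (simp add: phase_def power_int_add prod.distrib)

lemma norm_phase: "(\<And>j. norm (\<theta> j) = 1) \<Longrightarrow> norm (phase \<theta> u) = 1"
  unfolding phase_def by (simp add: norm_power_int flip: prod_norm)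

lemma phase_axis: "phase \<theta> (axis j 1) = \<theta> j"
proof -
  have "phase \<theta> (axis j 1) = (\<Prod>i\<in>UNIV. if i = j then \<theta> i else 1)"
    unfolding phase_def by (intro prod.cong) (auto simp: axis_def)
  then show ?thesis by simp
qed

lemma phase_exp: "phase (\<lambda>j. exp (c $ j)) u = character c u"
proof -
  have "exp (c $ j) powi (u $ j) = exp (c $ j * of_int (u $ j))" for j
    using exp_power_int[of "c $ j" "u $ j"] by (simp add: mult.commute)
  then show ?thesis unfolding phase_def character_def complex_pairing_def by (simp add: exp_sum)
qed

lemma continuous_map_phase:
  assumes "\<And>j. continuous_map Z euclidean (\<lambda>z. \<theta> z j)" "\<And>z j. z \<in> topspace Z \<Longrightarrow> \<theta> z j \<noteq> 0"
  shows "continuous_map Z euclidean (\<lambda>z. phase (\<theta> z) u)"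
  using assms unfolding continuous_map_atin phase_def limitin_canonical_iff
  by (auto intro!: tendsto_prod tendsto_power_int)

definition circle_valued :: "('n \<Rightarrow> complex) \<Rightarrow> bool" where
  "circle_valued \<theta> \<longleftrightarrow> (\<forall>j. norm (\<theta> j) = 1)"

lemma circle_valued_nonzero: "circle_valued \<theta> \<Longrightarrow> \<theta> j \<noteq> 0"
  by (auto simp: circle_valued_def intro: norm_eq_zero[THEN iffD2] dest: spec[of _ j])

context affine_toric
begin

text \<open>
  The phases of the monomials that do not vanish at \<open>x\<close> are prescribed, those of the others are
  free.
\<close>

definition compatible :: "'n point \<Rightarrow> ('n \<Rightarrow> complex) \<Rightarrow> bool" where
  "compatible x \<theta> \<longleftrightarrow> x \<in> points \<and> circle_valued \<theta> \<and>
     (\<forall>u\<in>S. monomial_value x u = of_real (norm (monomial_value x u)) * phase \<theta> u)"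

text \<open>
  The real part of an arbitrary logarithm of \<open>x\<close> is combined with a purely imaginary logarithm of
  \<open>\<theta>\<close>. By compatibility the result is again a logarithm of \<open>x\<close>, and degenerating it changes only
  absolute values, as face normals are real.
\<close>

lemma approach_exists:
  assumes "compatible x \<theta>"
  shows "\<exists>c. (\<forall>u\<in>hom_face (monomial_value x). monomial_value x u = character c u) \<and>
     (\<forall>n u. sgn (character (degenerate x c n) u) = phase \<theta> u)"
proof -
  have x: "x \<in> points" and \<theta>: "circle_valued \<theta>" using assms by (auto simp: compatible_def)
  obtain c' where c': "\<And>u. u \<in> hom_face (monomial_value x) \<Longrightarrow> monomial_value x u = character c' u"
    using hom_face_eq_character[OF monoid_hom_monomial_value[OF x]] by metis
  define b where "b = (\<chi> j. \<i> * of_real (Arg (\<theta> j)))"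
  define c where "c = (\<chi> j. of_real (Re (c' $ j))) + b"
  have "exp (b $ j) = \<theta> j" for j
  proof -
    have "norm (\<theta> j) = 1" using \<theta> by (simp add: circle_valued_def)
    then show ?thesis using Arg_eq[of "\<theta> j"] circle_valued_nonzero[OF \<theta>, of j] by (simp add: b_def)
  qed
  then have b: "character b u = phase \<theta> u" for u using phase_exp[of b u] by simp
  have real: "complex_pairing (\<chi> j. of_real (Re (c' $ j))) u = of_real (Re (complex_pairing c' u))" for u
    by (simp add: complex_pairing_def)
  have cc: "complex_pairing c u = of_real (Re (complex_pairing c' u)) + complex_pairing b u" for u
    by (simp add: c_def complex_pairing_add_left real)
  have sgn_real: "sgn (exp (of_real r) * w) = w" if "norm w = 1" for r and w :: complex
    using that by (simp add: sgn_eq norm_mult exp_of_real)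
  have pn: "norm (phase \<theta> u) = 1" for u using \<theta> norm_phase unfolding circle_valued_def by blast
  have "monomial_value x u = character c u" if u: "u \<in> hom_face (monomial_value x)" for u
  proof -
    have "monomial_value x u = of_real (norm (monomial_value x u)) * phase \<theta> u"
      using assms u by (simp add: compatible_def hom_face_def)
    also have "norm (monomial_value x u) = exp (Re (complex_pairing c' u))"
      using c'[OF u] by (simp add: character_def norm_exp_eq_Re)
    also have "of_real (exp (Re (complex_pairing c' u))) * phase \<theta> u = character c u"
      unfolding b[symmetric] character_def cc exp_add by (simp add: exp_of_real)
    finally show ?thesis .
  qed
  moreover have "sgn (character (degenerate x c n) u) = phase \<theta> u" for n u
  proof -
    have "complex_pairing (degenerate x c n) u = of_real (Re (complex_pairing c' u)
        - real n * real_of_int (pairing (face_normal (hom_face (monomial_value x))) u)) + complex_pairing b u"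
      by (simp add: complex_pairing_degenerate cc)
    then have "character (degenerate x c n) u = exp (of_real (Re (complex_pairing c' u)
        - real n * real_of_int (pairing (face_normal (hom_face (monomial_value x))) u))) * phase \<theta> u"
      unfolding b[symmetric] character_def by (simp add: exp_add)
    then show ?thesis by (simp only: sgn_real[OF pn])
  qed
  ultimately show ?thesis by blast
qed

definition approach :: "'n point \<Rightarrow> ('n \<Rightarrow> complex) \<Rightarrow> nat \<Rightarrow> 'n point" where
  "approach x \<theta> n = torus_point (degenerate x (SOME c.
     (\<forall>u\<in>hom_face (monomial_value x). monomial_value x u = character c u) \<and>
     (\<forall>n u. sgn (character (degenerate x c n) u) = phase \<theta> u)) n)"

lemma approach:
  assumes "compatible x \<theta>"
  shows "approach x \<theta> n \<in> points"
    and "u \<in> S \<Longrightarrow> sgn (monomial_value (approach x \<theta> n) u) = phase \<theta> u"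
    and "openin X W \<Longrightarrow> x \<in> W \<Longrightarrow> \<forall>\<^sub>F n in sequentially. approach x \<theta> n \<in> W"
proof -
  have x: "x \<in> points" using assms by (simp add: compatible_def)
  define c where "c = (SOME c.
     (\<forall>u\<in>hom_face (monomial_value x). monomial_value x u = character c u) \<and>
     (\<forall>n u. sgn (character (degenerate x c n) u) = phase \<theta> u))"
  have c: "\<forall>u\<in>hom_face (monomial_value x). monomial_value x u = character c u"
     "\<forall>n u. sgn (character (degenerate x c n) u) = phase \<theta> u"
    using someI_ex[OF approach_exists[OF assms]] unfolding c_def by (rule conjunct1, rule conjunct2)
  have eq: "approach x \<theta> n = torus_point (degenerate x c n)" for n
    by (simp only: approach_def c_def)
  show "approach x \<theta> n \<in> points" unfolding eq by (rule torus_point_in_points)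
  show "u \<in> S \<Longrightarrow> sgn (monomial_value (approach x \<theta> n) u) = phase \<theta> u"
    unfolding eq using c(2) by (simp add: monomial_value_point_of)
  assume W: "openin X W" "x \<in> W"
  obtain \<delta> where \<delta>: "0 < \<delta>" "box x \<delta> \<subseteq> W" using openin_contains_box[OF W] by metis
  have "\<forall>\<^sub>F n in sequentially. norm (coords (approach x \<theta> n) i - coords x i) < \<delta>" if i: "i < k" for i
  proof -
    have "(\<lambda>n. character (degenerate x c n) (h i)) \<longlonglongrightarrow> monomial_value x (h i)"
      by (rule character_degenerate_tendsto[OF x _ h_in_S[OF i]]) (use c(1) in blast)
    from tendstoD[OF this \<delta>(1)] show ?thesis
      unfolding eq coords_def monomial_value_point_of[OF h_in_S[OF i]] dist_norm .
  qed
  then have "\<forall>\<^sub>F n in sequentially. \<forall>i\<in>{..<k}. norm (coords (approach x \<theta> n) i - coords x i) < \<delta>"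
    by (intro eventually_ball_finite) auto
  then show "\<forall>\<^sub>F n in sequentially. approach x \<theta> n \<in> W"
    by (rule eventually_mono) (use \<delta>(2) torus_point_in_points in \<open>auto simp: box_def eq\<close>)
qed

text \<open>
  The limit of the phases along the path towards \<open>x\<close>. Any representative of a germ gives the same
  limit; taking limits makes multiplicativity immediate, whereas a definition through the
  factorization would have to deal with its non-uniqueness.
\<close>

definition phase_hom :: "'n point \<Rightarrow> ('n \<Rightarrow> complex) \<Rightarrow> ('n point \<Rightarrow> complex) set \<Rightarrow> complex" where
  "phase_hom x \<theta> A = lim (\<lambda>n. sgn ((SOME f. f \<in> A) (approach x \<theta> n)))"

lemma sgn_tendsto_along_approach:
  assumes c: "compatible x \<theta>" and u: "u \<in> S" and g: "hol_at x g" "g x \<noteq> 0"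
    and W: "openin X W" "x \<in> W" "\<forall>y\<in>W. f y = monomial_value y u * g y"
  shows "(\<lambda>n. sgn (f (approach x \<theta> n))) \<longlonglongrightarrow> phase \<theta> u * sgn (g x)"
proof -
  have x: "x \<in> points" using c by (simp add: compatible_def)
  have "(\<lambda>n. g (approach x \<theta> n)) \<longlonglongrightarrow> g x"
  proof (rule tendstoI)
    fix e :: real assume "0 < e"
    then obtain V where V: "openin X V" "x \<in> V" "\<forall>y\<in>V. norm (g y - g x) < e"
      using hol_at_continuous[OF x g(1)] by metis
    from approach(3)[OF c V(1,2)] show "\<forall>\<^sub>F n in sequentially. dist (g (approach x \<theta> n)) (g x) < e"
      by (rule eventually_mono) (use V(3) in \<open>simp add: dist_norm\<close>)
  qed
  then have "(\<lambda>n. phase \<theta> u * sgn (g (approach x \<theta> n))) \<longlonglongrightarrow> phase \<theta> u * sgn (g x)"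
    using g(2) by (intro tendsto_intros)
  moreover have "\<forall>\<^sub>F n in sequentially. phase \<theta> u * sgn (g (approach x \<theta> n)) = sgn (f (approach x \<theta> n))"
    using approach(3)[OF c W(1,2)]
    by (rule eventually_mono) (use W(3) approach(2)[OF c u] in \<open>simp add: sgn_mult\<close>)
  ultimately show ?thesis by (rule Lim_transform_eventually)
qed

lemma phase_hom_germ_tendsto:
  assumes c: "compatible x \<theta>" and l: "(\<lambda>n. sgn (f (approach x \<theta> n))) \<longlonglongrightarrow> L"
  shows "phase_hom x \<theta> (germ X x f) = L"
proof -
  have x: "x \<in> points" using c by (simp add: compatible_def)
  define f' where "f' = (SOME f'. f' \<in> germ X x f)"
  have "f \<in> germ X x f" by (simp add: germ_def)
  then have "f' \<in> germ X x f" unfolding f'_def by (rule someI[where P = "\<lambda>f'. f' \<in> germ X x f"])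
  then have "\<forall>\<^sub>F y in nhdsin X x. f' y = f y" by (simp add: germ_def)
  then obtain W where W: "openin X W" "x \<in> W" "\<forall>y\<in>W. f' y = f y"
    unfolding eventually_nhdsin_points[OF x] by blast
  have "\<forall>\<^sub>F n in sequentially. sgn (f (approach x \<theta> n)) = sgn (f' (approach x \<theta> n))"
    using approach(3)[OF c W(1,2)] by (rule eventually_mono) (use W(3) in simp)
  with l have "(\<lambda>n. sgn (f' (approach x \<theta> n))) \<longlonglongrightarrow> L" by (rule Lim_transform_eventually)
  then show ?thesis unfolding phase_hom_def f'_def[symmetric] by (rule limI)
qed

lemma phase_hom_germ:
  assumes "compatible x \<theta>" "u \<in> S" "hol_at x g" "g x \<noteq> 0"
    and "openin X W" "x \<in> W" "\<forall>y\<in>W. f y = monomial_value y u * g y"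
  shows "phase_hom x \<theta> (germ X x f) = phase \<theta> u * sgn (g x)"
  by (rule phase_hom_germ_tendsto[OF assms(1) sgn_tendsto_along_approach[OF assms]])

lemma log_at_factorization:
  assumes x: "x \<in> points" and f: "log_at x f"
  obtains u g W where "u \<in> S" "hol_at x g" "g x \<noteq> 0" "openin X W" "x \<in> W"
    "\<forall>y\<in>W. f y = monomial_value y u * g y"
proof -
  obtain W0 where W0: "openin X W0" "x \<in> W0" "\<And>y. y \<in> W0 - D \<Longrightarrow> f y \<noteq> 0" and h: "hol_at x f"
    using f unfolding log_at_def by blast
  have "\<exists>u\<in>S. \<exists>g. hol_at x g \<and> g x \<noteq> 0 \<and> (\<exists>W. openin X W \<and> x \<in> W \<and> (\<forall>y\<in>W. f y = monomial_value y u * g y))"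
    by (rule local_factorization[OF x W0(1,2) h]) (rule W0(3))
  then show ?thesis by (elim bexE exE conjE) (rule that)
qed

lemma circle_hom_phase_hom:
  assumes c: "compatible x \<theta>"
  shows "comm_monoid.circle_hom (log_stalk x) (phase_hom x \<theta>)"
proof -
  have x: "x \<in> points" and \<theta>: "circle_valued \<theta>" using c by (auto simp: compatible_def)
  interpret comm_monoid "log_stalk x" by (rule comm_monoid_log_stalk[OF x])
  have lim: "\<exists>L. norm L = 1 \<and> (\<lambda>n. sgn (f (approach x \<theta> n))) \<longlonglongrightarrow> L" if f: "log_at x f" for f
  proof -
    obtain u g W where *: "u \<in> S" "hol_at x g" "g x \<noteq> 0" "openin X W" "x \<in> W"
      "\<forall>y\<in>W. f y = monomial_value y u * g y"
      by (rule log_at_factorization[OF x f])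
    have "norm (phase \<theta> u * sgn (g x)) = 1"
      using \<theta> norm_phase[of \<theta> u] *(3) by (simp add: norm_mult norm_sgn circle_valued_def)
    then show ?thesis using sgn_tendsto_along_approach[OF c *] by blast
  qed
  show ?thesis
    unfolding circle_hom_def
  proof (intro conjI ballI)
    fix A assume "A \<in> carrier (log_stalk x)"
    then obtain f where f: "A = germ X x f" "log_at x f" unfolding carrier_log_stalk[OF x] by blast
    then show "norm (phase_hom x \<theta> A) = 1" using lim[OF f(2)] phase_hom_germ_tendsto[OF c] by metis
    fix B assume "B \<in> carrier (log_stalk x)"
    then obtain g where g: "B = germ X x g" "log_at x g" unfolding carrier_log_stalk[OF x] by blast
    obtain L where L: "(\<lambda>n. sgn (f (approach x \<theta> n))) \<longlonglongrightarrow> L" using lim[OF f(2)] by blast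
    obtain L' where L': "(\<lambda>n. sgn (g (approach x \<theta> n))) \<longlonglongrightarrow> L'" using lim[OF g(2)] by blast
    have "(\<lambda>n. sgn (f (approach x \<theta> n) * g (approach x \<theta> n))) \<longlonglongrightarrow> L * L'"
      unfolding sgn_mult by (rule tendsto_mult[OF L L'])
    then have "phase_hom x \<theta> (germ X x (\<lambda>y. f y * g y)) = L * L'" by (rule phase_hom_germ_tendsto[OF c])
    then show "phase_hom x \<theta> (A \<otimes>\<^bsub>log_stalk x\<^esub> B) = phase_hom x \<theta> A * phase_hom x \<theta> B"
      unfolding f(1) g(1) mult_log_stalk
      using phase_hom_germ_tendsto[OF c L] phase_hom_germ_tendsto[OF c L'] by simp
  qed
qed

definition kn_hom :: "'n point \<Rightarrow> ('n \<Rightarrow> complex) \<Rightarrow>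
    (('n point \<Rightarrow> complex) set \<times> ('n point \<Rightarrow> complex) set) set \<Rightarrow> complex" where
  "kn_hom x \<theta> = comm_monoid.groth_extension (log_stalk x) (phase_hom x \<theta>)"

abbreviation kn :: "'n point kn_point set" where
  "kn \<equiv> kn_points X structure_sheaf log_sheaf"

abbreviation arg_of :: "'n point kn_point \<Rightarrow> ('n point \<Rightarrow> complex) \<Rightarrow> complex" where
  "arg_of z f \<equiv> snd z (groth_of (log_stalk (fst z)) (germ X (fst z) f))"

lemma kn_hom_germ:
  assumes c: "compatible x \<theta>" and f: "log_at x f"
  shows "kn_hom x \<theta> (groth_of (log_stalk x) (germ X x f)) = phase_hom x \<theta> (germ X x f)"
proof -
  have x: "x \<in> points" using c by (auto simp: compatible_def)
  interpret comm_monoid "log_stalk x" by (rule comm_monoid_log_stalk[OF x])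
  have "germ X x f \<in> carrier (log_stalk x)" unfolding carrier_log_stalk[OF x] using f by blast
  then show ?thesis unfolding kn_hom_def by (rule groth_extension_groth_of[OF circle_hom_phase_hom[OF c]])
qed

lemma kn_hom_in_kn:
  assumes c: "compatible x \<theta>"
  shows "(x, kn_hom x \<theta>) \<in> kn"
proof -
  have x: "x \<in> points" using c by (auto simp: compatible_def)
  interpret comm_monoid "log_stalk x" by (rule comm_monoid_log_stalk[OF x])
  have "kn_hom x \<theta> (groth_of (log_stalk x) (germ X x e)) = e x / norm (e x)"
    if U: "openin X U" "x \<in> U" and e: "e \<in> unit_sections structure_sheaf U" for U e
  proof -
    have h: "hol_at x e" "e x \<noteq> 0" using e U unfolding unit_sections_iff[OF U(1)] by blast+
    have "phase_hom x \<theta> (germ X x e) = phase \<theta> 0 * sgn (e x)"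
      by (rule phase_hom_germ[OF c lattice_cone_zero h openin_points x]) simp
    then show ?thesis
      using kn_hom_germ[OF c log_at_unit[OF x h]] by (simp add: sgn_eq)
  qed
  moreover have "kn_hom x \<theta> \<in> hom (grothendieck_group (log_stalk x)) circle_group"
    unfolding kn_hom_def by (rule groth_extension_hom[OF circle_hom_phase_hom[OF c]])
  moreover have "kn_hom x \<theta> \<in> extensional (carrier (grothendieck_group (log_stalk x)))"
    unfolding kn_hom_def groth_extension_def by simp
  ultimately show ?thesis unfolding kn_points_def using x by simp metis
qed

text \<open>
  The values at monomials have absolute value one, so they form a homomorphism without zeros on
  \<open>S\<close>.
\<close>

lemma kn_monomials:
  assumes z: "z \<in> kn"
  obtains c where "\<And>u. u \<in> S \<Longrightarrow> arg_of z (\<lambda>y. monomial_value y u) = character c u"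
proof -
  obtain x \<phi> where z_eq: "z = (x, \<phi>)" by (cases z)
  have x: "x \<in> points" and \<phi>: "\<phi> \<in> hom (grothendieck_group (log_stalk x)) circle_group"
    and unit: "\<And>U e. openin X U \<Longrightarrow> x \<in> U \<Longrightarrow> e \<in> unit_sections structure_sheaf U \<Longrightarrow>
      \<phi> (groth_of (log_stalk x) (germ X x e)) = e x / norm (e x)"
    using z unfolding z_eq kn_points_def by auto
  interpret comm_monoid "log_stalk x" by (rule comm_monoid_log_stalk[OF x])
  define \<eta> where "\<eta> u = \<phi> (groth_of (log_stalk x) (germ X x (\<lambda>y. monomial_value y u)))" for u
  have car: "germ X x (\<lambda>y. monomial_value y u) \<in> carrier (log_stalk x)" if "u \<in> S" for u
    unfolding carrier_log_stalk[OF x] using log_at_monomial_value[OF x that] by blast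
  have ch: "circle_hom (\<lambda>a. \<phi> (groth_of (log_stalk x) a))" by (rule hom_groth_of(1)[OF \<phi>])
  have germ_add: "germ X x (\<lambda>y. monomial_value y (u + v)) = germ X x (\<lambda>y. monomial_value y u) \<otimes>\<^bsub>log_stalk x\<^esub> germ X x (\<lambda>y. monomial_value y v)"
    if "u \<in> S" "v \<in> S" for u v
    unfolding mult_log_stalk germ_eq_iff eventually_nhdsin_points[OF x]
    using openin_points x monomial_value_mult that by (intro exI[of _ points]) simp
  have mult: "\<eta> (u + v) = \<eta> u * \<eta> v" if "u \<in> S" "v \<in> S" for u v
    unfolding \<eta>_def germ_add[OF that] using ch car[OF that(1)] car[OF that(2)] unfolding circle_hom_def by blast
  have norm: "norm (\<eta> u) = 1" if "u \<in> S" for u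
    unfolding \<eta>_def using ch car[OF that] unfolding circle_hom_def by blast
  have "\<eta> 0 * \<eta> 0 = \<eta> 0" using mult[of 0 0] by simp
  moreover have "\<eta> 0 \<noteq> 0" using norm[of 0] by auto
  ultimately have "\<eta> 0 = 1" by simp
  then have mh: "monoid_hom \<eta>" unfolding monoid_hom_def using mult by blast
  have face: "u \<in> hom_face \<eta>" if "u \<in> S" for u using norm[OF that] that by (auto simp: hom_face_def)
  obtain c where "\<And>u. u \<in> hom_face \<eta> \<Longrightarrow> \<eta> u = character c u"
    using hom_face_eq_character[OF mh] by metis
  then have "arg_of z (\<lambda>y. monomial_value y u) = character c u" if "u \<in> S" for u
    using face[OF that] by (simp add: z_eq \<eta>_def)
  then show ?thesis by (rule that)
qed

text \<open>
  A monomial that remains a monomial after multiplication with any coordinate of the torus; a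
  large multiple of the interior point \<open>u0\<close> has this property. It recovers the phases of the
  coordinates as quotients of phases of monomials.
\<close>

definition base_exponent :: "int ^ 'n" where
  "base_exponent = (SOME v. v \<in> S \<and> (\<forall>j. v + axis j 1 \<in> S))"

lemma base_exponent: "base_exponent \<in> S" "base_exponent + axis j 1 \<in> S"
proof -
  define N where "N = nat (\<Sum>g\<in>G. \<Sum>j\<in>UNIV. \<bar>g $ j\<bar>)"
  have "int N *s u0 + axis j 1 \<in> S" for j
    unfolding lattice_cone_def
  proof (intro CollectI ballI)
    fix g assume g: "g \<in> G"
    show "0 \<le> pairing g (int N *s u0 + axis j 1)"
    proof (cases "g = 0")
      case False
      have "\<bar>g $ j\<bar> \<le> (\<Sum>j\<in>UNIV. \<bar>g $ j\<bar>)" by (rule member_le_sum) auto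
      also have "\<dots> \<le> (\<Sum>g\<in>G. \<Sum>j\<in>UNIV. \<bar>g $ j\<bar>)"
        using g finite_G by (intro member_le_sum sum_nonneg) auto
      finally have "\<bar>g $ j\<bar> \<le> (\<Sum>g\<in>G. \<Sum>j\<in>UNIV. \<bar>g $ j\<bar>)" .
      moreover have "0 \<le> (\<Sum>g\<in>G. \<Sum>j\<in>UNIV. \<bar>g $ j\<bar>)" by (intro sum_nonneg) auto
      ultimately have "\<bar>g $ j\<bar> \<le> int N * 1" by (simp add: N_def)
      also have "\<dots> \<le> int N * pairing g u0" using interior[OF g False] by (intro mult_left_mono) auto
      finally show ?thesis by (simp add: pairing_add_right pairing_scale_right)
    qed simp
  qed
  then have "\<exists>v. v \<in> S \<and> (\<forall>j. v + axis j 1 \<in> S)"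
    using lattice_cone_scale[OF u0_in_S, of N] by blast
  from someI_ex[OF this] show "base_exponent \<in> S" "base_exponent + axis j 1 \<in> S"
    unfolding base_exponent_def by blast+
qed

definition kn_phase :: "'n point kn_point \<Rightarrow> 'n \<Rightarrow> complex" where
  "kn_phase z j = arg_of z (\<lambda>y. monomial_value y (base_exponent + axis j 1)) /
     arg_of z (\<lambda>y. monomial_value y base_exponent)"

lemma arg_of_monomial:
  assumes z: "z \<in> kn" and u: "u \<in> S"
  shows "arg_of z (\<lambda>y. monomial_value y u) = phase (kn_phase z) u"
proof -
  obtain c where c: "\<And>u. u \<in> S \<Longrightarrow> arg_of z (\<lambda>y. monomial_value y u) = character c u"
    using kn_monomials[OF z] by metis
  have "kn_phase z = (\<lambda>j. exp (c $ j))"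
  proof
    fix j
    have "complex_pairing c (axis j 1) = c $ j"
      by (simp add: complex_pairing_def axis_def if_distrib cong: if_cong)
    then show "kn_phase z j = exp (c $ j)"
      unfolding kn_phase_def c[OF base_exponent(1)] c[OF base_exponent(2)] character_add
      by (simp add: character_def)
  qed
  then show ?thesis using c[OF u] phase_exp[of c u] by simp
qed

lemma kn_circle_valued:
  assumes z: "z \<in> kn"
  shows "circle_valued (kn_phase z)"
proof -
  obtain x \<phi> where z_eq: "z = (x, \<phi>)" by (cases z)
  have x: "x \<in> points" and \<phi>: "\<phi> \<in> hom (grothendieck_group (log_stalk x)) circle_group"
    using z unfolding z_eq kn_points_def by auto
  interpret comm_monoid "log_stalk x" by (rule comm_monoid_log_stalk[OF x])
  have "norm (arg_of z (\<lambda>y. monomial_value y u)) = 1" if "u \<in> S" for u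
  proof -
    have "germ X x (\<lambda>y. monomial_value y u) \<in> carrier (log_stalk x)"
      unfolding carrier_log_stalk[OF x] using log_at_monomial_value[OF x that] by blast
    then show ?thesis using hom_groth_of(1)[OF \<phi>] unfolding circle_hom_def z_eq by simp
  qed
  then show ?thesis
    using base_exponent unfolding circle_valued_def kn_phase_def by (simp add: norm_divide)
qed

text \<open>
  Near \<open>x\<close>, a monomial that does not vanish at \<open>x\<close> is a unit, on which the homomorphism is
  prescribed.
\<close>

lemma kn_compatible:
  assumes z: "z \<in> kn"
  shows "compatible (fst z) (kn_phase z)"
proof -
  obtain x \<phi> where z_eq: "z = (x, \<phi>)" by (cases z)
  have x: "x \<in> points"
    and unit: "\<And>U e. openin X U \<Longrightarrow> x \<in> U \<Longrightarrow> e \<in> unit_sections structure_sheaf U \<Longrightarrow>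
      \<phi> (groth_of (log_stalk x) (germ X x e)) = e x / norm (e x)"
    using z unfolding z_eq kn_points_def by auto
  have "monomial_value x u = of_real (norm (monomial_value x u)) * phase (kn_phase z) u" if u: "u \<in> S" for u
  proof (cases "monomial_value x u = 0")
    case False
    define U where "U = {y\<in>points. monomial_value y u \<in> - {0}}"
    have U: "openin X U" "x \<in> U" using openin_monomial_value[OF u, of "- {0}"] x False by (auto simp: U_def)
    define e where "e = restrict (\<lambda>y. monomial_value y u) U"
    have "hol_at y e \<and> e y \<noteq> 0" if y: "y \<in> U" for y
    proof
      have yp: "y \<in> points" using y by (simp add: U_def)
      show "hol_at y e" by (rule hol_at_cong[OF hol_at_monomial_value[OF yp u] U(1) y]) (simp add: e_def)
      show "e y \<noteq> 0" using y by (simp add: e_def U_def)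
    qed
    then have "e \<in> unit_sections structure_sheaf U" unfolding unit_sections_iff[OF U(1)] by (simp add: e_def)
    from unit[OF U this] have "\<phi> (groth_of (log_stalk x) (germ X x e)) = monomial_value x u / norm (monomial_value x u)"
      using U(2) by (simp add: e_def)
    moreover have "germ X x e = germ X x (\<lambda>y. monomial_value y u)"
      unfolding germ_eq_iff eventually_nhdsin_points[OF x] using U by (intro exI[of _ U]) (simp add: e_def)
    ultimately have "phase (kn_phase z) u = monomial_value x u / norm (monomial_value x u)"
      using arg_of_monomial[OF z u] by (simp add: z_eq)
    then show ?thesis using False by simp
  qed simp
  then show ?thesis using x kn_circle_valued[OF z] by (simp add: compatible_def z_eq)
qed

text \<open>
  Both homomorphisms agree on monomials and on units, and every germ is a product of those.
\<close>

lemma kn_eq_kn_hom: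
  assumes z: "z \<in> kn"
  shows "snd z = kn_hom (fst z) (kn_phase z)"
proof -
  obtain x \<phi> where z_eq: "z = (x, \<phi>)" by (cases z)
  have x: "x \<in> points" and \<phi>: "\<phi> \<in> hom (grothendieck_group (log_stalk x)) circle_group"
      "\<phi> \<in> extensional (carrier (grothendieck_group (log_stalk x)))"
    and unit: "\<And>U e. openin X U \<Longrightarrow> x \<in> U \<Longrightarrow> e \<in> unit_sections structure_sheaf U \<Longrightarrow>
      \<phi> (groth_of (log_stalk x) (germ X x e)) = e x / norm (e x)"
    using z unfolding z_eq kn_points_def by auto
  have c: "compatible x (kn_phase z)" using kn_compatible[OF z] by (simp add: z_eq)
  interpret comm_monoid "log_stalk x" by (rule comm_monoid_log_stalk[OF x])
  have "\<phi> (groth_of (log_stalk x) A) = phase_hom x (kn_phase z) A" if A: "A \<in> carrier (log_stalk x)" for A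
  proof -
    obtain f where f: "A = germ X x f" "log_at x f" using A unfolding carrier_log_stalk[OF x] by blast
    obtain u g W where *: "u \<in> S" "hol_at x g" "g x \<noteq> 0" "openin X W" "x \<in> W"
      "\<forall>y\<in>W. f y = monomial_value y u * g y"
      by (rule log_at_factorization[OF x f(2)])
    obtain W' where W': "openin X W'" "x \<in> W'" "\<forall>y\<in>W'. g y \<noteq> 0"
      using hol_at_nonzero_nearby[OF x *(2,3)] by (elim exE conjE)
    obtain V where V: "openin X V" "x \<in> V" "\<forall>y\<in>V. hol_at y g"
      using hol_at_nearby[OF x *(2)] by (elim exE conjE)
    define U where "U = W' \<inter> V"
    have U: "openin X U" "x \<in> U" using W' V by (auto simp: U_def intro: openin_Int)
    define e where "e = restrict g U"
    have "hol_at y e \<and> e y \<noteq> 0" if y: "y \<in> U" for y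
    proof
      have "hol_at y g" using y V(3) by (simp add: U_def)
      then show "hol_at y e" by (rule hol_at_cong[OF _ U(1) y]) (simp add: e_def)
      show "e y \<noteq> 0" using y W'(3) by (simp add: e_def U_def)
    qed
    then have "e \<in> unit_sections structure_sheaf U" unfolding unit_sections_iff[OF U(1)] by (simp add: e_def)
    from unit[OF U this] have "\<phi> (groth_of (log_stalk x) (germ X x e)) = sgn (g x)"
      using U(2) by (simp add: e_def sgn_eq)
    moreover have "germ X x e = germ X x g"
      unfolding germ_eq_iff eventually_nhdsin_points[OF x] using U by (intro exI[of _ U]) (simp add: e_def)
    ultimately have \<phi>g: "\<phi> (groth_of (log_stalk x) (germ X x g)) = sgn (g x)" by simp
    have "A = germ X x (\<lambda>y. monomial_value y u * g y)"
      unfolding f(1) germ_eq_iff eventually_nhdsin_points[OF x] using * by blast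
    then have "A = germ X x (\<lambda>y. monomial_value y u) \<otimes>\<^bsub>log_stalk x\<^esub> germ X x g" by (simp add: mult_log_stalk)
    moreover have "germ X x (\<lambda>y. monomial_value y u) \<in> carrier (log_stalk x)" "germ X x g \<in> carrier (log_stalk x)"
      unfolding carrier_log_stalk[OF x]
      using log_at_monomial_value[OF x *(1)] log_at_unit[OF x *(2,3)] by blast+
    ultimately have "\<phi> (groth_of (log_stalk x) A) =
        \<phi> (groth_of (log_stalk x) (germ X x (\<lambda>y. monomial_value y u))) * \<phi> (groth_of (log_stalk x) (germ X x g))"
      using hom_groth_of(1)[OF \<phi>(1)] unfolding circle_hom_def by simp
    also have "\<dots> = phase (kn_phase z) u * sgn (g x)"
      using arg_of_monomial[OF z *(1)] \<phi>g by (simp add: z_eq)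
    also have "\<dots> = phase_hom x (kn_phase z) A"
      using phase_hom_germ[OF c *] f(1) by simp
    finally show ?thesis .
  qed
  then have "\<phi> = groth_extension (phase_hom x (kn_phase z))"
    by (rule hom_eq_groth_extension[OF \<phi> circle_hom_phase_hom[OF c]])
  then show ?thesis by (simp add: z_eq kn_hom_def)
qed

end

section \<open>The homeomorphism\<close>

context affine_toric
begin

abbreviation kn_space :: "'n point kn_point topology" where
  "kn_space \<equiv> kato_nakayama X structure_sheaf log_sheaf"

abbreviation model_space :: "((real ^ 'n) \<times> ('n \<Rightarrow> complex)) topology" where
  "model_space \<equiv> prod_topology (top_of_set (dual_cone \<sigma>)) compact_torus"

lemma topspace_model_space: "topspace model_space = dual_cone \<sigma> \<times> {\<theta>. circle_valued \<theta>}"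
  by (auto simp: compact_torus_def circle_valued_def PiE_def Pi_def)

lemma kn_fst: "z \<in> kn \<Longrightarrow> fst z \<in> points"
  by (auto simp: kn_points_def)

lemma openin_kn_fst:
  assumes "openin X U"
  shows "openin kn_space {z\<in>kn. fst z \<in> U}"
proof -
  have "{z\<in>kn. fst z \<in> U} = {(x, \<phi>) \<in> kn. x \<in> U}" by auto
  then show ?thesis
    unfolding kato_nakayama_def using assms by (intro topology_generated_by_Basis) blast
qed

lemma openin_kn_arg:
  assumes "openin X U" "m \<in> log_sheaf U" "openin (top_of_set (sphere 0 1)) V"
  shows "openin kn_space {z\<in>kn. fst z \<in> U \<and> arg_of z m \<in> V}"
proof -
  have "{z\<in>kn. fst z \<in> U \<and> arg_of z m \<in> V} =
    {(x, \<phi>) \<in> kn. x \<in> U \<and> \<phi> (groth_of (log_stalk x) (germ X x m)) \<in> V}" by auto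
  then show ?thesis
    unfolding kato_nakayama_def using assms by (intro topology_generated_by_Basis) blast
qed

lemma topspace_kn_space: "topspace kn_space = kn"
proof
  show "topspace kn_space \<subseteq> kn" unfolding kato_nakayama_def topology_generated_by_topspace by auto
  have "{z\<in>kn. fst z \<in> points} = kn" using kn_fst by blast
  then show "kn \<subseteq> topspace kn_space" using openin_subset[OF openin_kn_fst[OF openin_points]] by simp
qed

lemma continuous_map_into_kn_space:
  assumes f: "\<And>w. w \<in> topspace Z \<Longrightarrow> f w \<in> kn"
    and U: "\<And>U. openin X U \<Longrightarrow> openin Z {w\<in>topspace Z. fst (f w) \<in> U}"
    and V: "\<And>U m V. openin X U \<Longrightarrow> m \<in> log_sheaf U \<Longrightarrow> openin (top_of_set (sphere 0 1)) V \<Longrightarrow>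
      openin Z {w\<in>topspace Z. fst (f w) \<in> U \<and> arg_of (f w) m \<in> V}"
  shows "continuous_map Z kn_space f"
  unfolding kato_nakayama_def
proof (rule continuous_on_generated_topo)
  fix W assume "W \<in> {{(x, \<phi>) \<in> kn. x \<in> U} | U. openin X U} \<union>
    {{(x, \<phi>) \<in> kn. x \<in> U \<and> \<phi> (groth_of (log_stalk x) (germ X x m)) \<in> V} | U m V.
       openin X U \<and> m \<in> log_sheaf U \<and> openin (top_of_set (sphere 0 1)) V}"
  then show "openin Z (f -` W \<inter> topspace Z)"
  proof
    assume "W \<in> {{(x, \<phi>) \<in> kn. x \<in> U} | U. openin X U}"
    then obtain U' where U': "W = {(x, \<phi>) \<in> kn. x \<in> U'}" "openin X U'" by blast
    have "f -` W \<inter> topspace Z = {w\<in>topspace Z. fst (f w) \<in> U'}" using f by (auto simp: U'(1) case_prod_beta)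
    then show ?thesis using U[OF U'(2)] by simp
  next
    assume "W \<in> {{(x, \<phi>) \<in> kn. x \<in> U \<and> \<phi> (groth_of (log_stalk x) (germ X x m)) \<in> V} | U m V.
       openin X U \<and> m \<in> log_sheaf U \<and> openin (top_of_set (sphere 0 1)) V}"
    then obtain U' m V' where U': "W = {(x, \<phi>) \<in> kn. x \<in> U' \<and> \<phi> (groth_of (log_stalk x) (germ X x m)) \<in> V'}"
      "openin X U'" "m \<in> log_sheaf U'" "openin (top_of_set (sphere 0 1)) V'" by blast
    have "f -` W \<inter> topspace Z = {w\<in>topspace Z. fst (f w) \<in> U' \<and> arg_of (f w) m \<in> V'}"
      using f by (auto simp: U'(1) case_prod_beta)
    then show ?thesis using V[OF U'(2-4)] by simp
  qed
next
  have "{z\<in>kn. fst z \<in> points} = {(x, \<phi>) \<in> kn. x \<in> points}" by auto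
  moreover have "{z\<in>kn. fst z \<in> points} = kn" using kn_fst by blast
  ultimately have "kn \<in> {{(x, \<phi>) \<in> kn. x \<in> U} | U. openin X U}" using openin_points by blast
  then show "f ` topspace Z \<subseteq> \<Union> ({{(x, \<phi>) \<in> kn. x \<in> U} | U. openin X U} \<union>
    {{(x, \<phi>) \<in> kn. x \<in> U \<and> \<phi> (groth_of (log_stalk x) (germ X x m)) \<in> V} | U m V.
       openin X U \<and> m \<in> log_sheaf U \<and> openin (top_of_set (sphere 0 1)) V})"
    using f by blast
qed

subsection \<open>Moment and phase are continuous\<close>

lemma continuous_map_kn_fst: "continuous_map kn_space X fst"
  unfolding continuous_map_def topspace_kn_space topspace_X using kn_fst openin_kn_fst by blast

lemma continuous_map_kn_monomial_value:
  assumes "u \<in> S"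
  shows "continuous_map kn_space euclidean (\<lambda>z. monomial_value (fst z) u)"
  using continuous_map_compose[OF continuous_map_kn_fst continuous_map_monomial_value[OF assms]]
  by (simp add: o_def)

lemma norm_arg_of_monomial:
  assumes "z \<in> kn" "u \<in> S"
  shows "norm (arg_of z (\<lambda>y. monomial_value y u)) = 1"
  unfolding arg_of_monomial[OF assms] using kn_circle_valued[OF assms(1)] norm_phase
  unfolding circle_valued_def by blast

lemma continuous_map_arg_of_monomial:
  assumes u: "u \<in> S"
  shows "continuous_map kn_space euclidean (\<lambda>z. arg_of z (\<lambda>y. monomial_value y u))"
proof (rule continuous_map_into_fulltopology)
  let ?m = "restrict (\<lambda>y. monomial_value y u) points"
  have hol: "hol_at y ?m" if "y \<in> points" for y
    by (rule hol_at_cong[OF hol_at_monomial_value[OF that u] openin_points that]) simp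
  have nz: "?m y \<noteq> 0" if "y \<in> points - D" for y
    using that boundary_iff[of y] u by (metis DiffD1 DiffD2 restrict_apply')
  have m: "?m \<in> log_sheaf points"
    unfolding log_sheaf_iff[OF openin_points] using hol nz by (intro conjI ballI) simp_all
  have germ: "germ X x ?m = germ X x (\<lambda>y. monomial_value y u)" if "x \<in> points" for x
    unfolding germ_eq_iff eventually_nhdsin_points[OF that]
    using openin_points that by (intro exI[of _ points]) simp
  show "continuous_map kn_space (top_of_set (sphere 0 1)) (\<lambda>z. arg_of z (\<lambda>y. monomial_value y u))"
    unfolding continuous_map_def topspace_kn_space
  proof (intro conjI allI impI)
    show "(\<lambda>z. arg_of z (\<lambda>y. monomial_value y u)) \<in> kn \<rightarrow> topspace (top_of_set (sphere 0 1))"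
      using norm_arg_of_monomial[OF _ u] by (simp add: Pi_iff)
  next
    fix V :: "complex set" assume V: "openin (top_of_set (sphere 0 1)) V"
    have "{z\<in>kn. arg_of z (\<lambda>y. monomial_value y u) \<in> V} = {z\<in>kn. fst z \<in> points \<and> arg_of z ?m \<in> V}"
      using kn_fst germ by (intro Collect_cong) (metis (no_types, lifting))
    then show "openin kn_space {z\<in>kn. arg_of z (\<lambda>y. monomial_value y u) \<in> V}"
      using openin_kn_arg[OF openin_points m V] by simp
  qed
qed

lemma continuous_map_kn_phase: "continuous_map kn_space compact_torus kn_phase"
  unfolding compact_torus_def continuous_map_componentwise_UNIV
proof
  fix j
  have "arg_of z (\<lambda>y. monomial_value y base_exponent) \<noteq> 0" if "z \<in> kn" for z
    using norm_arg_of_monomial[OF that base_exponent(1)] by (metis norm_zero zero_neq_one)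
  then have "continuous_map kn_space euclidean (\<lambda>z. kn_phase z j)"
    unfolding kn_phase_def using base_exponent
    by (intro continuous_map_euclidean_divide continuous_map_arg_of_monomial) (simp_all add: topspace_kn_space)
  moreover have "kn_phase z j \<in> sphere 0 1" if "z \<in> kn" for z
    using kn_circle_valued[OF that] by (simp add: circle_valued_def)
  ultimately show "continuous_map kn_space (top_of_set (sphere 0 1)) (\<lambda>z. kn_phase z j)"
    by (auto simp: continuous_map_in_subtopology topspace_kn_space)
qed

definition kn_moment :: "'n point kn_point \<Rightarrow> real ^ 'n" where
  "kn_moment z = moment (\<lambda>u. norm (monomial_value (fst z) u))"

lemma positive_hom_norm:
  assumes "x \<in> points"
  shows "positive_hom (\<lambda>u. norm (monomial_value x u))"
  using monoid_hom_monomial_value[OF assms]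
  by (simp add: positive_hom_def monoid_hom_def norm_mult)

lemma continuous_map_kn_moment: "continuous_map kn_space (top_of_set (dual_cone \<sigma>)) kn_moment"
proof -
  have "continuous_map kn_space euclidean kn_moment"
    unfolding kn_moment_def moment_def
    by (intro continuous_map_euclidean_sum continuous_map_euclidean_scaleR continuous_map_euclidean_norm
        continuous_map_kn_monomial_value h_in_S) simp
  moreover have "kn_moment z \<in> dual_cone \<sigma>" if "z \<in> kn" for z
    unfolding kn_moment_def by (rule moment_in_dual_cone[OF positive_hom_norm[OF kn_fst[OF that]]])
  ultimately show ?thesis by (auto simp: continuous_map_in_subtopology topspace_kn_space)
qed

lemma arg_of_kn_hom_monomial:
  assumes c: "compatible x \<theta>" and u: "u \<in> S"
  shows "arg_of (x, kn_hom x \<theta>) (\<lambda>y. monomial_value y u) = phase \<theta> u"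
proof -
  have x: "x \<in> points" using c by (simp add: compatible_def)
  have "phase_hom x \<theta> (germ X x (\<lambda>y. monomial_value y u)) = phase \<theta> u * sgn 1"
    by (rule phase_hom_germ[OF c u hol_at_const[OF x] _ openin_points x]) simp_all
  then show ?thesis using kn_hom_germ[OF c log_at_monomial_value[OF x u]] by simp
qed

lemma kn_phase_kn_hom:
  assumes c: "compatible x \<theta>"
  shows "kn_phase (x, kn_hom x \<theta>) = \<theta>"
proof
  fix j
  have \<theta>: "circle_valued \<theta>" using c by (simp add: compatible_def)
  have "phase \<theta> base_exponent \<noteq> 0"
    using norm_phase[of \<theta> base_exponent] \<theta> unfolding circle_valued_def by (metis norm_zero zero_neq_one)
  then show "kn_phase (x, kn_hom x \<theta>) j = \<theta> j"
    unfolding kn_phase_def arg_of_kn_hom_monomial[OF c base_exponent(1)] arg_of_kn_hom_monomial[OF c base_exponent(2)]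
      phase_add[of \<theta>, OF circle_valued_nonzero[OF \<theta>]] phase_axis by simp
qed

lemma continuous_map_hol:
  assumes W: "openin X W" and g: "\<And>y. y \<in> W \<Longrightarrow> hol_at y g"
  shows "continuous_map (subtopology X W) euclidean g"
  unfolding continuous_map_def
proof (intro conjI allI impI)
  fix V :: "complex set" assume "openin euclidean V"
  then have V: "open V" by simp
  have "\<exists>T. openin X T \<and> y \<in> T \<and> T \<subseteq> {y\<in>W. g y \<in> V}" if y: "y \<in> {y\<in>W. g y \<in> V}" for y
  proof -
    have yW: "y \<in> W" and "g y \<in> V" using y by auto
    then obtain e where e: "0 < e" "ball (g y) e \<subseteq> V" using V open_contains_ball by blast
    have "y \<in> points" using yW openin_subset_points[OF W] by blast
    from hol_at_continuous[OF this g[OF yW] e(1)] obtain T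
      where T: "openin X T" "y \<in> T" "\<forall>w\<in>T. norm (g w - g y) < e" by (elim exE conjE)
    have "g w \<in> V" if "w \<in> T" for w
    proof -
      have "g w \<in> ball (g y) e" using T(3) that by (simp add: dist_norm norm_minus_commute)
      then show ?thesis using e(2) by blast
    qed
    then have "T \<inter> W \<subseteq> {y\<in>W. g y \<in> V}" by auto
    then show ?thesis using openin_Int[OF T(1) W] T(2) yW by (intro exI[of _ "T \<inter> W"]) simp
  qed
  then have "openin X {y\<in>W. g y \<in> V}" by (subst openin_subopen) simp
  then have "openin (subtopology X W) {y\<in>W. g y \<in> V}" using openin_open_subtopology[OF W] by auto
  moreover have "topspace (subtopology X W) = W" using openin_subset[OF W] by auto
  ultimately show "openin (subtopology X W) {y \<in> topspace (subtopology X W). g y \<in> V}" by simp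
qed simp

subsection \<open>The inverse map\<close>

text \<open>
  The point with absolute value \<open>\<eta>\<close> and phase \<open>\<theta>\<close>.
\<close>

definition lift :: "(int ^ 'n \<Rightarrow> real) \<Rightarrow> ('n \<Rightarrow> complex) \<Rightarrow> 'n point" where
  "lift \<eta> \<theta> = point_of (\<lambda>u. of_real (\<eta> u) * phase \<theta> u)"

lemma monomial_value_lift: "u \<in> S \<Longrightarrow> monomial_value (lift \<eta> \<theta>) u = of_real (\<eta> u) * phase \<theta> u"
  by (simp add: lift_def monomial_value_point_of)

lemma
  assumes \<eta>: "positive_hom \<eta>" and \<theta>: "circle_valued \<theta>"
  shows norm_monomial_value_lift: "u \<in> S \<Longrightarrow> norm (monomial_value (lift \<eta> \<theta>) u) = \<eta> u"
    and compatible_lift: "compatible (lift \<eta> \<theta>) \<theta>"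
proof -
  have n: "norm (monomial_value (lift \<eta> \<theta>) u) = \<eta> u" if "u \<in> S" for u
    using norm_phase[of \<theta> u] \<theta> positive_hom_nonneg[OF \<eta> that]
    by (simp add: monomial_value_lift[OF that] norm_mult circle_valued_def)
  then show "u \<in> S \<Longrightarrow> norm (monomial_value (lift \<eta> \<theta>) u) = \<eta> u" .
  have "monoid_hom (\<lambda>u. of_real (\<eta> u) * phase \<theta> u)"
    using \<eta> phase_add[of \<theta>, OF circle_valued_nonzero[OF \<theta>]] by (simp add: positive_hom_def monoid_hom_def)
  then have "lift \<eta> \<theta> \<in> points" unfolding lift_def by (rule point_of_in_points)
  then show "compatible (lift \<eta> \<theta>) \<theta>"
    unfolding compatible_def using \<theta> n monomial_value_lift by simp
qed

theorem kn_space_homeomorphic: "kn_space homeomorphic_space model_space"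
proof -
  obtain \<xi> where \<xi>': "\<forall>p\<in>dual_cone \<sigma>. positive_hom (\<xi> p) \<and> moment (\<xi> p) = p"
      "\<forall>\<eta>. positive_hom \<eta> \<longrightarrow> (\<forall>u\<in>S. \<xi> (moment \<eta>) u = \<eta> u)"
      "\<forall>u\<in>S. continuous_on (dual_cone \<sigma>) (\<lambda>p. \<xi> p u)"
    using moment_homeomorphism by (elim exE conjE) (rule that)
  have \<xi>: "positive_hom (\<xi> p)" "moment (\<xi> p) = p" if "p \<in> dual_cone \<sigma>" for p
    using bspec[OF \<xi>'(1) that] by (rule conjunct1, rule conjunct2)
  note \<xi>_moment = bspec[OF mp[OF spec[OF \<xi>'(2)]]] and \<xi>_cont = bspec[OF \<xi>'(3)]
  define pt where "pt w = lift (\<xi> (fst w)) (snd w)" for w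
  define kn_of where "kn_of w = (pt w, kn_hom (pt w) (snd w))" for w
  have w: "positive_hom (\<xi> (fst w))" "circle_valued (snd w)" if "w \<in> topspace model_space" for w
    using that \<xi>(1) unfolding topspace_model_space by auto
  have c: "compatible (pt w) (snd w)" if "w \<in> topspace model_space" for w
    unfolding pt_def by (rule compatible_lift[OF w[OF that]])
  have in_kn: "kn_of w \<in> kn" if "w \<in> topspace model_space" for w
    unfolding kn_of_def by (rule kn_hom_in_kn[OF c[OF that]])
  have phase: "continuous_map model_space euclidean (\<lambda>w. phase (snd w) u)" for u
  proof (rule continuous_map_phase)
    fix j
    have "continuous_map compact_torus (top_of_set (sphere 0 1)) (\<lambda>\<theta> :: 'n \<Rightarrow> complex. \<theta> j)"
      unfolding compact_torus_def by (rule continuous_map_product_projection) simp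
    from continuous_map_compose[OF continuous_map_snd this]
    show "continuous_map model_space euclidean (\<lambda>w. snd w j)"
      unfolding o_def by (rule continuous_map_into_fulltopology)
  next
    show "snd w j \<noteq> 0" if "w \<in> topspace model_space" for w j
      by (rule circle_valued_nonzero[OF w(2)[OF that]])
  qed
  have pt: "continuous_map model_space X pt"
  proof (rule continuous_map_into_X)
    show "pt w \<in> points" if "w \<in> topspace model_space" for w using c[OF that] by (simp add: compatible_def)
  next
    fix u assume u: "u \<in> S"
    have "continuous_map (top_of_set (dual_cone \<sigma>)) euclidean (\<lambda>p. \<xi> p u)" using \<xi>_cont[OF u] by simp
    from continuous_map_compose[OF continuous_map_fst this]
    have "continuous_map model_space euclidean (\<lambda>w. \<xi> (fst w) u)" by (simp add: o_def)
    then show "continuous_map model_space euclidean (\<lambda>w. monomial_value (pt w) u)"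
      unfolding pt_def monomial_value_lift[OF u]
      by (intro continuous_map_euclidean_mult continuous_map_euclidean_of_real phase)
  qed
  have kn_of: "continuous_map model_space kn_space kn_of"
  proof (rule continuous_map_into_kn_space[OF in_kn])
    fix U assume "openin X U"
    then show "openin model_space {w\<in>topspace model_space. fst (kn_of w) \<in> U}"
      unfolding kn_of_def fst_conv by (rule openin_continuous_map_preimage[OF pt])
  next
    fix U m and V :: "complex set" assume U: "openin X U" and m: "m \<in> log_sheaf U" and V: "openin (top_of_set (sphere 0 1)) V"
    obtain V' where V': "open V'" "V = sphere 0 1 \<inter> V'" using V unfolding openin_open by (elim exE conjE)
    show "openin model_space {w\<in>topspace model_space. fst (kn_of w) \<in> U \<and> arg_of (kn_of w) m \<in> V}"
      (is "openin _ ?A")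
    proof (subst openin_subopen, intro ballI)
      fix w0 assume w0: "w0 \<in> ?A"
      then have w0t: "w0 \<in> topspace model_space" and x0U: "pt w0 \<in> U" and w0V: "arg_of (kn_of w0) m \<in> V"
        by (auto simp: kn_of_def)
      have x0: "pt w0 \<in> points" using x0U openin_subset_points[OF U] by blast
      have log: "log_at y m" if "y \<in> U" for y
        using m that U unfolding log_sheaf_iff[OF U] log_at_def by blast
      obtain u g W0 where g: "u \<in> S" "hol_at (pt w0) g" "g (pt w0) \<noteq> 0" "openin X W0" "pt w0 \<in> W0"
          "\<forall>y\<in>W0. m y = monomial_value y u * g y"
        by (rule log_at_factorization[OF x0 log[OF x0U]])
      obtain W1 where W1: "openin X W1" "pt w0 \<in> W1" "\<forall>y\<in>W1. g y \<noteq> 0"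
        using hol_at_nonzero_nearby[OF x0 g(2,3)] by (elim exE conjE)
      obtain W2 where W2: "openin X W2" "pt w0 \<in> W2" "\<forall>y\<in>W2. hol_at y g"
        using hol_at_nearby[OF x0 g(2)] by (elim exE conjE)
      define W where "W = W0 \<inter> W1 \<inter> W2 \<inter> U"
      have W: "openin X W" "pt w0 \<in> W" using g(4,5) W1 W2 U x0U by (auto simp: W_def intro!: openin_Int)
      have WW: "\<And>y. y \<in> W \<Longrightarrow> g y \<noteq> 0" "\<And>y. y \<in> W \<Longrightarrow> hol_at y g" "W \<subseteq> U" "\<And>y. y \<in> W \<Longrightarrow> m y = monomial_value y u * g y"
        using g(6) W1(3) W2(3) by (auto simp: W_def)
      define B where "B = {w\<in>topspace model_space. pt w \<in> W}"
      have B: "openin model_space B" unfolding B_def by (rule openin_continuous_map_preimage[OF pt W(1)])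
      have topB: "topspace (subtopology model_space B) = B" using openin_subset[OF B] by auto
      define q where "q w = phase (snd w) u * sgn (g (pt w))" for w
      \<comment> \<open>The factorization of \<open>m\<close> at one point serves for all nearby points, so the argument of \<open>m\<close> is
        locally the continuous function \<open>q\<close>.\<close>
      have arg: "arg_of (kn_of w) m = q w" if "w \<in> B" for w
      proof -
        have wt: "w \<in> topspace model_space" and xW: "pt w \<in> W" using that by (auto simp: B_def)
        have "arg_of (kn_of w) m = phase_hom (pt w) (snd w) (germ X (pt w) m)"
          unfolding kn_of_def fst_conv snd_conv using kn_hom_germ[OF c[OF wt] log] WW(3) xW by blast
        also have "\<dots> = q w"
          unfolding q_def
          by (rule phase_hom_germ[OF c[OF wt] g(1) WW(2)[OF xW] WW(1)[OF xW] W(1) xW]) (use WW(4) in blast)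
        finally show ?thesis .
      qed
      have "continuous_map (subtopology model_space B) (subtopology X W) pt"
        unfolding continuous_map_in_subtopology
        using continuous_map_from_subtopology[OF pt] by (auto simp: topB B_def)
      from continuous_map_compose[OF this continuous_map_hol[OF W(1) WW(2)]]
      have "continuous_map (subtopology model_space B) euclidean (\<lambda>w. g (pt w))" by (simp add: o_def)
      then have q: "continuous_map (subtopology model_space B) euclidean q"
        unfolding q_def
        by (intro continuous_map_euclidean_mult continuous_map_euclidean_sgn continuous_map_from_subtopology[OF phase])
          (use WW(1) in \<open>simp_all add: topB, simp add: B_def\<close>)
      have "openin (subtopology model_space B) {w\<in>topspace (subtopology model_space B). q w \<in> V'}"
        by (rule openin_continuous_map_preimage[OF q]) (use V'(1) in simp)
      then have T: "openin model_space {w\<in>B. q w \<in> V'}"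
        unfolding topB using B openin_trans_full by blast
      have nq: "norm (q w) = 1" if "w \<in> B" for w
      proof -
        have "circle_valued (snd w)" "pt w \<in> W" using that w(2) by (auto simp: B_def)
        then show ?thesis
          using norm_phase[of "snd w" u] WW(1) by (simp add: q_def norm_mult norm_sgn circle_valued_def)
      qed
      have "{w\<in>B. q w \<in> V'} \<subseteq> ?A"
      proof
        fix w assume "w \<in> {w\<in>B. q w \<in> V'}"
        then have wB: "w \<in> B" and "q w \<in> V'" by auto
        then have "arg_of (kn_of w) m \<in> V" using arg[OF wB] nq[OF wB] V'(2) by simp
        moreover have "w \<in> topspace model_space" "fst (kn_of w) \<in> U" using wB WW(3) by (auto simp: B_def kn_of_def)
        ultimately show "w \<in> ?A" by blast
      qed
      moreover have w0B: "w0 \<in> B" using w0t W(2) by (simp add: B_def)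
      then have "w0 \<in> {w\<in>B. q w \<in> V'}" using arg[OF w0B] w0V V'(2) by simp
      ultimately show "\<exists>T. openin model_space T \<and> w0 \<in> T \<and> T \<subseteq> ?A" using T by blast
    qed
  qed
  have left: "kn_of (kn_moment z, kn_phase z) = z" if z: "z \<in> kn" for z
  proof -
    have x: "fst z \<in> points" by (rule kn_fst[OF z])
    have zc: "compatible (fst z) (kn_phase z)" by (rule kn_compatible[OF z])
    have p: "kn_moment z \<in> dual_cone \<sigma>"
      unfolding kn_moment_def by (rule moment_in_dual_cone[OF positive_hom_norm[OF x]])
    have "pt (kn_moment z, kn_phase z) = fst z"
    proof (rule points_eqI)
      show "pt (kn_moment z, kn_phase z) \<in> points"
        using c[unfolded topspace_model_space, of "(kn_moment z, kn_phase z)"] p kn_circle_valued[OF z]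
        by (simp add: compatible_def)
    next
      fix u assume u: "u \<in> S"
      have "monomial_value (pt (kn_moment z, kn_phase z)) u =
          of_real (norm (monomial_value (fst z) u)) * phase (kn_phase z) u"
        unfolding pt_def kn_moment_def fst_conv snd_conv monomial_value_lift[OF u]
          \<xi>_moment[OF positive_hom_norm[OF x] u] ..
      also have "\<dots> = monomial_value (fst z) u" using zc u unfolding compatible_def by metis
      finally show "monomial_value (pt (kn_moment z, kn_phase z)) u = monomial_value (fst z) u" .
    qed (rule x)
    then show ?thesis unfolding kn_of_def using kn_eq_kn_hom[OF z] by (simp add: prod_eq_iff)
  qed
  have right: "(kn_moment (kn_of w), kn_phase (kn_of w)) = w" if wt: "w \<in> topspace model_space" for w
  proof -
    have "kn_moment (kn_of w) = moment (\<xi> (fst w))"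
      unfolding kn_moment_def kn_of_def fst_conv moment_def pt_def
      using norm_monomial_value_lift[OF w[OF wt] h_in_S] by simp
    also have "\<dots> = fst w" using \<xi>(2) wt unfolding topspace_model_space by auto
    finally show ?thesis
      using kn_phase_kn_hom[OF c[OF wt]] by (simp add: kn_of_def prod_eq_iff)
  qed
  have "continuous_map kn_space model_space (\<lambda>z. (kn_moment z, kn_phase z))"
    by (rule continuous_map_pairedI[OF continuous_map_kn_moment continuous_map_kn_phase])
  then have "homeomorphic_maps kn_space model_space (\<lambda>z. (kn_moment z, kn_phase z)) kn_of"
    unfolding homeomorphic_maps_def using kn_of left right by (simp add: topspace_kn_space)
  then show ?thesis unfolding homeomorphic_space_def by blast
qed

end

theorem lemma5p4:
  fixes \<sigma> :: "(real ^ 'n::finite) set"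
  assumes "rational_polyhedral_cone \<sigma>" and "strictly_convex \<sigma>"
  shows "kato_nakayama (toric_space \<sigma>) (toric_sheaf \<sigma>)
           (divisorial_log (toric_sheaf \<sigma>) (toric_boundary \<sigma>))
         homeomorphic_space
         prod_topology (top_of_set (dual_cone \<sigma>)) (compact_torus :: ('n \<Rightarrow> complex) topology)"
proof -
  obtain G :: "(int ^ 'n) set" where G: "finite G" "\<sigma> = convex_cone hull (real_vec ` G)"
    using assms(1) unfolding rational_polyhedral_cone_def by blast
  obtain k h where kh: "generates_monoid k h (lattice_cone G)"
    by (rule lattice_cone_generators[OF G(1)])
  obtain u0 where u0: "\<And>g. g \<in> G \<Longrightarrow> g \<noteq> 0 \<Longrightarrow> 0 < pairing g u0"
    using strictly_convex_interior_lattice_point[OF G(1) assms(2)[unfolded G(2)]] by metis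
  interpret affine_toric G \<sigma> k h u0
    by unfold_locales (use G kh u0 in auto)
  show ?thesis by (rule kn_space_homeomorphic)
qed

end
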